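(* For $k$ a positive integer, let $p=tq^{2k}$. Then for each $\sigma\in\{0,1\}$, $$\sum_{\substack{\lambda\\ \lambda_1\leq 2k}} q^{(\sigma+1)|\lambda|/2}\Biggl(\prod_{i=1}^{2k-1}\bigl(-t^{1/2};t^{1/2}\bigr)_{m_i(\lambda)}\Biggr)P_{\lambda}\bigl(1,q,q^2,\dots;t\bigr)$$ $$=\frac{\bigl(p^{1/2};p^{1/2}\bigr)_{\infty}(p;p)_{\infty}^{k-1}}{(\sigma+1)(q;q)_{\infty}^k}\prod_{i=1}^k\theta\bigl(-q^{i-(\sigma+1)/2};p^{1/2}\bigr)\prod_{1\leq i<j\leq k}\theta\bigl(q^{j-i};p\bigr)\,\theta\bigl(q^{i+j-\sigma-1};p\bigr),$$ where the sum is over all partitions $\lambda$ with largest part at most $2k$.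
   Context: $(a;q)_m=\prod_{i=0}^{m-1}(1-aq^i)$, $(a;q)_\infty=\prod_{i\ge0}(1-aq^i)$ and $\theta(a;p)=(a;p)_\infty(p/a;p)_\infty$. The identity is understood for complex $q,t$ with $|q|,|t|<1$ (with fixed choices of $q^{1/2},t^{1/2}$ and $p^{1/2}=t^{1/2}q^{k}$), or as an identity of formal power series in $q^{1/2}$ with coefficients polynomial in $t^{1/2}$. For a partition $\lambda$: $|\lambda|=\sum_i\lambda_i$, $l(\lambda)$ is the number of parts and $m_i(\lambda)$ the multiplicity of parts equal to $i$. The Hall–Littlewood polynomial in $x=(x_1,\dots,x_n)$, $l(\lambda)\le n$, is $$P_{\lambda}(x;t)=\frac{1}{v_{\lambda}(t)}\sum_{w\in S_n} w\biggl(x_1^{\lambda_1}\cdots x_n^{\lambda_n}\prod_{1\leq i<j\leq n}\frac{x_i-tx_j}{x_i-x_j}\biggr),\qquad v_{\lambda}(t)=\frac{(t;t)_{n-l(\lambda)}}{(1-t)^{n-l(\lambda)}}\prod_{i\geq 1}\frac{(t;t)_{m_i(\lambda)}}{(1-t)^{m_i(\lambda)}},$$ and $P_\lambda(x;t)=0$ if $l(\lambda)>n$. Since $P_\lambda(x_1,\dots,x_n,0;t)=P_\lambda(x_1,\dots,x_n;t)$, it extends to infinitely many variables; $P_\lambda(1,q,q^2,\dots;t)=\lim_{n\to\infty}P_\lambda(1,q,\dots,q^{n-1};t)$. *)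

theory Defs
  imports "HOL-Analysis.Analysis" "HOL-Combinatorics.Permutations"
begin

section \<open>q-shifted factorials and the modified theta function\<close>

definition qpoch :: "complex \<Rightarrow> complex \<Rightarrow> nat \<Rightarrow> complex" where
  "qpoch a q m = (\<Prod>i<m. 1 - a * q ^ i)"

definition qpoch_inf :: "complex \<Rightarrow> complex \<Rightarrow> complex" where
  "qpoch_inf a q = (\<Prod>i. 1 - a * q ^ i)"

text \<open>For \<open>a = 0\<close> the factor \<open>p / a\<close> is 0. In the identity \<open>a = 0\<close> arises only if \<open>q = 0\<close>, and there
  \<open>p / a\<close> stands for a power of \<open>t\<close> times a positive power of \<open>q\<close>, hence indeed for 0.\<close>

definition theta :: "complex \<Rightarrow> complex \<Rightarrow> complex" where
  "theta a p = qpoch_inf a p * qpoch_inf (p / a) p"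

section \<open>Partitions\<close>

text \<open>A partition is the weakly decreasing list of its (positive) parts, so that its weight is
  \<^const>\<open>sum_list\<close>, its length is \<^const>\<open>length\<close> and the multiplicity of \<open>i\<close> is
  \<^term>\<open>count_list lam i\<close>.\<close>

definition is_partition :: "nat list \<Rightarrow> bool" where
  "is_partition lam \<longleftrightarrow> sorted_wrt (\<ge>) lam \<and> 0 \<notin> set lam"

text \<open>Parts are indexed from 0 (as are the variables below): \<open>part_at lam i\<close> is the usual
  $\lambda_{i+1}$, which is 0 beyond the length.\<close>

definition part_at :: "nat list \<Rightarrow> nat \<Rightarrow> nat" where
  "part_at lam i = (if i < length lam then lam ! i else 0)"

section \<open>Hall--Littlewood polynomials\<close>

text \<open>Complex polynomials in \<open>x 0, \<dots>, x (n - 1)\<close>, as functions.\<close>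

inductive poly_fun :: "nat \<Rightarrow> ((nat \<Rightarrow> complex) \<Rightarrow> complex) \<Rightarrow> bool" for n where
  const: "poly_fun n (\<lambda>x. c)"
| var: "i < n \<Longrightarrow> poly_fun n (\<lambda>x. x i)"
| add: "poly_fun n f \<Longrightarrow> poly_fun n g \<Longrightarrow> poly_fun n (\<lambda>x. f x + g x)"
| mult: "poly_fun n f \<Longrightarrow> poly_fun n g \<Longrightarrow> poly_fun n (\<lambda>x. f x * g x)"

text \<open>In \<open>hl_v\<close> the factors for \<open>i \<notin> set lam\<close> are equal to 1 and are omitted.\<close>

definition hl_v :: "nat \<Rightarrow> nat list \<Rightarrow> complex \<Rightarrow> complex" where
  "hl_v n lam t =
     qpoch t t (n - length lam) / (1 - t) ^ (n - length lam) *
     (\<Prod>i\<in>set lam. qpoch t t (count_list lam i) / (1 - t) ^ count_list lam i)"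

definition hl_sym :: "nat \<Rightarrow> nat list \<Rightarrow> complex \<Rightarrow> (nat \<Rightarrow> complex) \<Rightarrow> complex" where
  "hl_sym n lam t x =
     1 / hl_v n lam t *
     (\<Sum>w | w permutes {..<n}.
        (\<Prod>i<n. x (w i) ^ part_at lam i) *
        (\<Prod>(i, j)\<in>{(i, j). i < j \<and> j < n}.
           (x (w i) - t * x (w j)) / (x (w i) - x (w j))))"

text \<open>The symmetrization is an identity of rational functions whose value is a polynomial. As a
  function, \<open>hl_sym\<close> gives the values of that polynomial only where no denominator vanishes, i.e.
  at points with pairwise distinct coordinates; these points are dense, so they determine it.\<close>

definition hall_littlewood ::
    "nat \<Rightarrow> nat list \<Rightarrow> complex \<Rightarrow> (nat \<Rightarrow> complex) \<Rightarrow> complex" where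
  "hall_littlewood n lam t =
     (if length lam \<le> n
      then (THE P. poly_fun n P \<and> (\<forall>x. inj_on x {..<n} \<longrightarrow> P x = hl_sym n lam t x))
      else (\<lambda>x. 0))"

definition hall_littlewood_principal :: "nat list \<Rightarrow> complex \<Rightarrow> complex \<Rightarrow> complex" where
  "hall_littlewood_principal lam q t = lim (\<lambda>n. hall_littlewood n lam t (\<lambda>i. q ^ i))"

end

theory Submission
  imports Defs "HOL-Computational_Algebra.Polynomial"
begin

text \<open>For finitely many variables \<open>x\<close>, a bounded Littlewood identity, proved by partial fractions and
  induction on the set of variables, turns the sum over partitions into a sum over the
  hyperoctahedral group (\<open>bc_sum\<close>). Its recursion in \<open>x\<close> is also satisfied by the integral of the kernel
  \<open>\<Prod>\<^sub>i \<Prod>\<^sub>l (x\<^sub>i + 1 / x\<^sub>i + y\<^sub>l + 1 / y\<^sub>l)\<close> over \<open>k\<close> torus variables \<open>y\<close> against a theta-function density of type BC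
  with base \<open>t\<close>: the surplus terms are exact for the shift \<open>y\<^sub>l \<mapsto> t y\<^sub>l\<close> and integrate to 0. A Macdonald
  identity writes the density as a determinant, so by Andreief's formula the integral is a \<open>k \<times> k\<close>
  determinant of constant terms. At \<open>x\<^sub>i = q^(i + (\<sigma> + 1) / 2)\<close>, as the number of variables grows, the
  product of the kernel tends to a theta function, the Jacobi triple product evaluates the constant
  terms, and the limiting determinant is again of Macdonald type, now with base \<open>t\<^sup>1\<^sup>/\<^sup>2 q\<^sup>k\<close>. The
  countably many exceptional \<open>t\<close> follow by continuity, and \<open>q = 0\<close> by inspection.\<close>

section \<open>Hall--Littlewood convolutions\<close>

text \<open>The weight \<open>(-s; s)_m\<close> with \<open>s = t^(1/2)\<close> is the value at
  \<open>s\<close> of the Rogers-Szego polynomial of degree \<open>m\<close>, that is, a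
  Hall-Littlewood convolution of a constant with \<open>s^card\<close>. This splitting lets one more
  level be added on top without changing the form of the answer. The sum over sign changes has ever
  more terms as variables are added, whereas the integral keeps \<open>k\<close> torus variables and
  a \<open>k\<close> by \<open>k\<close> matrix, so the passage to infinitely many variables happens
  entry by entry. The radii of the torus are distinct and larger than 1 so that all poles of the
  partial fraction expansion are simple and separate; the integral does not depend on them, since
  only constant terms of Laurent series enter. The base \<open>t^(1/2) q^k\<close> appears because
  the limiting kernel has Gaussian coefficients in \<open>q^(1/2)\<close>: along a residue class
  modulo \<open>2k\<close> their exponents are \<open>2k\<close> times those of the basis functions
  \<open>psi\<close>, up to terms linear in the index. The factor \<open>\<sigma> + 1\<close> is the
  leading coefficient 2 that distinguishes type D from type B.\<close>

definition hl_cross :: "(nat => complex) => complex => nat set => nat set => complex" where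
 "hl_cross x t B A = (\<Prod>b\<in>B. \<Prod>a\<in>A. (x b - t*x a)/(x b - x a))"

text \<open>Under this product the set functions form an algebra. Its iterated products are sums
  over ordered set partitions, the form that a Hall-Littlewood symmetrization takes once equal
  exponents are grouped into blocks.\<close>

definition hl_conv :: "(nat => complex) => complex => (nat set => complex) => (nat set => complex) =>
  nat set => complex" where
 "hl_conv x t f g S = (\<Sum>B\<in>Pow S. hl_cross x t B (S - B)*f (S - B)*g B)"

lemma hl_cross_empty [simp]: "hl_cross x t {} A = 1" "hl_cross x t B {} = 1"
 by (simp_all add: hl_cross_def)

lemma hl_cross_Un_left:
 "finite B ==> finite C ==> B \<inter> C = {} ==> hl_cross x t (B \<union> C) A = hl_cross x t B A*hl_cross x t C A"
 by (simp add: hl_cross_def prod.union_disjoint)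

lemma hl_cross_Un_right:
 "finite A ==> finite C ==> A \<inter> C = {} ==> hl_cross x t B (A \<union> C) = hl_cross x t B A*hl_cross x t B C"
 by (simp add: hl_cross_def prod.union_disjoint prod.distrib)

lemma hl_cross_insert_left:
 "finite B ==> i \<notin> B ==> hl_cross x t (insert i B) A = (\<Prod>a\<in>A. (x i - t*x a)/(x i - x a))*hl_cross x t B A"
 by (simp add: hl_cross_def)

lemma hl_cross_insert_right:
 "finite A ==> i \<notin> A ==> hl_cross x t B (insert i A) = (\<Prod>b\<in>B. (x b - t*x i)/(x b - x i))*hl_cross x t B A"
 by (simp add: hl_cross_def flip: prod.distrib)

lemma hl_conv_cong:
 assumes "!!A. A \<subseteq> S ==> f A = f' A" "!!A. A \<subseteq> S ==> g A = g' A"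
 shows "hl_conv x t f g S = hl_conv x t f' g' S"
 unfolding hl_conv_def by (intro sum.cong) (auto simp: assms)

text \<open>Both sides are sums over ordered partitions of \<open>S\<close> into three blocks, with
  one factor for each pair from different blocks and the variable of the later block in front. The
  bijection trades the nested pair (\<open>C\<close>, \<open>B\<close>) for the chain
  \<open>C \<subseteq> B \<union> C\<close>.\<close>

lemma hl_conv_assoc:
 assumes "finite S"
 shows "hl_conv x t (hl_conv x t f g) h S = hl_conv x t f (hl_conv x t g h) S"
proof -
 let ?V = "hl_cross x t"
 have "hl_conv x t (hl_conv x t f g) h S =
   (\<Sum>(C, B)\<in>(SIGMA C:Pow S. Pow (S - C)). ?V C (S - C)*(?V B (S - C - B)*f (S - C - B)*g B)*h C)"
  unfolding hl_conv_def using assms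
  by (subst sum.Sigma[symmetric]) (auto simp: sum_distrib_left sum_distrib_right mult_ac intro!: sum.cong)
 also have "... = (\<Sum>(D, C)\<in>(SIGMA D:Pow S. Pow D). ?V D (S - D)*f (S - D)*(?V C (D - C)*g (D - C)*h C))"
 proof (rule sum.reindex_bij_witness[of _ "%(D, C). (C, D - C)" "%(C, B). (B \<union> C, C)"]; clarify?)
  fix C B assume CB: "C \<subseteq> S" "B \<subseteq> S - C"
  have fin: "finite C" "finite B" "finite (S - C - B)"
   using CB assms by (auto intro: finite_subset)
  have e: "S - C = B \<union> (S - C - B)" "S - (B \<union> C) = S - C - B" "B \<union> C - C = B" using CB by auto
  have "?V C (S - C) = ?V C B*?V C (S - C - B)"
   by (subst e, subst hl_cross_Un_right) (use fin in auto)
  moreover have "?V (B \<union> C) (S - C - B) = ?V B (S - C - B)*?V C (S - C - B)"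
   by (rule hl_cross_Un_left) (use fin CB in auto)
  ultimately show "?V (B \<union> C) (S - (B \<union> C))*f (S - (B \<union> C))*(?V C (B \<union> C - C)*g (B \<union> C - C)*h C) =
    ?V C (S - C)*(?V B (S - C - B)*f (S - C - B)*g B)*h C"
   unfolding e(2,3) by (simp add: mult_ac)
 qed auto
 also have "... = hl_conv x t f (hl_conv x t g h) S"
  unfolding hl_conv_def using assms
  by (subst sum.Sigma[symmetric]) (auto simp: sum_distrib_left sum_distrib_right mult_ac finite_subset intro!: sum.cong)
 finally show ?thesis .
qed

lemma hl_conv_unit_right: "finite S ==> hl_conv x t f (%B. of_bool (B = {})) S = f S"
 unfolding hl_conv_def by (subst sum.remove[of _ "{}"]) auto

lemma sum_Pow_insert:
 fixes F :: "nat set => complex"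
 assumes "finite S" "j \<notin> S"
 shows "(\<Sum>B\<in>Pow (insert j S). F B) = (\<Sum>B\<in>Pow S. F B + F (insert j B))"
proof -
 have "(\<Sum>B\<in>Pow (insert j S). F B) = (\<Sum>B\<in>Pow S. F B) + (\<Sum>B\<in>insert j ` Pow S. F B)"
  unfolding Pow_insert by (rule sum.union_disjoint) (use assms in auto)
 also have "(\<Sum>B\<in>insert j ` Pow S. F B) = (\<Sum>B\<in>Pow S. F (insert j B))"
  using assms by (subst sum.reindex) (auto simp: inj_on_def)
 finally show ?thesis by (simp add: sum.distrib)
qed

text \<open>Singles out one variable. With \<open>x j\<close> replaced by a free \<open>z\<close>
  the right-hand side is a rational function of \<open>z\<close>, and the inductions on
  \<open>S\<close> below compare two expressions as functions of \<open>z\<close>.\<close>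

lemma hl_conv_insert:
 assumes "finite S" "j \<notin> S"
 shows "hl_conv x t f g (insert j S) =
  (\<Sum>B\<in>Pow S. hl_cross x t B (S - B) *
    ((\<Prod>b\<in>B. (x b - t*x j)/(x b - x j))*f (insert j (S - B))*g B +
    (\<Prod>a\<in>S - B. (x j - t*x a)/(x j - x a))*f (S - B)*g (insert j B)))"
 unfolding hl_conv_def
proof (subst sum_Pow_insert[OF assms], intro sum.cong refl)
 fix B assume "B \<in> Pow S"
 then have B: "B \<subseteq> S" "finite B" "j \<notin> B" using assms by (auto intro: finite_subset)
 have e: "insert j S - B = insert j (S - B)" "insert j S - insert j B = S - B" using B assms by auto
 show "hl_cross x t B (insert j S - B)*f (insert j S - B)*g B +
    hl_cross x t (insert j B) (insert j S - insert j B)*f (insert j S - insert j B)*g (insert j B) =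
    hl_cross x t B (S - B) *
    ((\<Prod>b\<in>B. (x b - t*x j)/(x b - x j))*f (insert j (S - B))*g B +
    (\<Prod>a\<in>S - B. (x j - t*x a)/(x j - x a))*f (S - B)*g (insert j B))"
  unfolding e using B assms
  by (simp add: hl_cross_insert_left hl_cross_insert_right distrib_left mult_ac)
qed

text \<open>The set function \<open>hl_levels x t c M S\<close> is the sum over all \<open>f: S \<rightarrow> {0..M}\<close> of
  \<open>x^f\<close> times the Hall--Littlewood factors \<open>(x\<^sub>i - t x\<^sub>j) / (x\<^sub>i - x\<^sub>j)\<close> for \<open>f i > f j\<close>, where
  a fibre of size \<open>m\<close> over \<open>r\<close> carries the weight \<open>c r m\<close>.\<close>

primrec hl_levels :: "(nat => complex) => complex => (nat => nat => complex) => nat => nat set => complex" where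
 "hl_levels x t c 0 = (%S. c 0 (card S))"
| "hl_levels x t c (Suc M) =
   hl_conv x t (hl_levels x t c M) (%B. (\<Prod>i\<in>B. x i^Suc M) * c (Suc M) (card B))"

definition hl_weight :: "(nat => complex) => complex => nat set => (nat => nat) => complex" where
 "hl_weight x t S f = (\<Prod>i\<in>S. x i^f i*(\<Prod>j\<in>{j\<in>S. f j < f i}. (x i - t*x j)/(x i - x j)))"

lemma hl_weight_extend:
 assumes "finite S" "B \<subseteq> S" "!!i. i \<in> S - B ==> f i \<le> M"
 shows "hl_weight x t S (%i. if i \<in> B then Suc M else f i) =
  hl_cross x t B (S - B)*hl_weight x t (S - B) f*(\<Prod>i\<in>B. x i^Suc M)"
proof -
 let ?f = "%i. if i \<in> B then Suc M else f i"
 let ?h = "%i. x i^?f i*(\<Prod>j\<in>{j\<in>S. ?f j < ?f i}. (x i - t*x j)/(x i - x j))"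
 have "hl_weight x t S ?f = (\<Prod>i\<in>S - B. ?h i)*(\<Prod>i\<in>B. ?h i)"
  unfolding hl_weight_def by (rule prod.subset_diff) (use assms in auto)
 also have "(\<Prod>i\<in>S - B. ?h i) = hl_weight x t (S - B) f"
  unfolding hl_weight_def
 proof (intro prod.cong refl)
  fix i assume i: "i \<in> S - B"
  then have "{j\<in>S. ?f j < ?f i} = {j \<in> S - B. f j < f i}" using assms(3)[OF i] by auto
  then show "?h i = x i^f i*(\<Prod>j\<in>{j \<in> S - B. f j < f i}. (x i - t*x j)/(x i - x j))"
   using i by simp
 qed
 also have "(\<Prod>i\<in>B. ?h i) = (\<Prod>i\<in>B. x i^Suc M*(\<Prod>j\<in>S - B. (x i - t*x j)/(x i - x j)))"
 proof (intro prod.cong refl)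
  fix i assume i: "i \<in> B"
  then have "{j\<in>S. ?f j < ?f i} = S - B" using assms(3) by fastforce
  with i show "?h i = x i^Suc M*(\<Prod>j\<in>S - B. (x i - t*x j)/(x i - x j))" by simp
 qed
 finally show ?thesis by (simp add: hl_cross_def prod.distrib mult_ac)
qed

lemma hl_levels_eq_sum:
 assumes "finite S"
 shows "hl_levels x t c M S =
  (\<Sum>f\<in>PiE S (%_. {..M}). (\<Prod>r\<le>M. c r (card {i\<in>S. f i = r}))*hl_weight x t S f)"
 using assms
proof (induction M arbitrary: S)
 case 0
 have "PiE S (%_. {..0::nat}) = {\<lambda>i\<in>S. 0}" by (auto simp: PiE_def extensional_def Pi_def)
 moreover have "{i \<in> S. (\<lambda>i\<in>S. 0) i = (0::nat)} = S" by auto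
 ultimately show ?case by (simp add: hl_weight_def)
next
 case (Suc M)
 let ?G = "%M S f. (\<Prod>r\<le>M. c r (card {i\<in>S. f i = r}))*hl_weight x t S f"
 have fp: "finite (PiE (S - B) (%_. {..M}))" for B using Suc.prems by (intro finite_PiE) auto
 have "hl_levels x t c (Suc M) S = (\<Sum>(B, f)\<in>(SIGMA B:Pow S. PiE (S - B) (%_. {..M})).
   hl_cross x t B (S - B)*?G M (S - B) f*((\<Prod>i\<in>B. x i^Suc M) * c (Suc M) (card B)))"
  using Suc.prems fp
  by (subst sum.Sigma[symmetric])
    (auto simp: hl_conv_def Suc.IH sum_distrib_left sum_distrib_right mult_ac intro!: sum.cong)
 \<comment> \<open>An exponent function is cut into its top fibre \<open>B\<close> and the rest. The
   rest is restricted to \<open>S - B\<close> because members of \<open>PiE\<close> are undefined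
   outside their domain.\<close>
 also have "... = (\<Sum>f\<in>PiE S (%_. {..Suc M}). ?G (Suc M) S f)"
 proof (rule sum.reindex_bij_witness[of _ "%f. ({i\<in>S. f i = Suc M}, restrict f (S - {i\<in>S. f i = Suc M}))"
     "%(B, f) i. if i \<in> B then Suc M else f i"])
  fix p assume "p \<in> (SIGMA B:Pow S. PiE (S - B) (%_. {..M}))"
  then obtain B f where p: "p = (B, f)" and B: "B \<subseteq> S" and f: "f \<in> PiE (S - B) (%_. {..M})"
   by (elim SigmaE) simp
  let ?f = "%i. if i \<in> B then Suc M else f i"
  have le: "f i \<le> M" if "i \<in> S - B" for i using PiE_mem[OF f that] by simp
  have "f i ~= Suc M" if "i \<in> S - B" for i using le[OF that] by simp
  then have eq: "{i \<in> S. ?f i = Suc M} = B" using B by (auto split: if_splits)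
  show "(case p of (B, f) => %i. if i \<in> B then Suc M else f i) \<in> PiE S (%_. {..Suc M})"
   using B le PiE_arb[OF f] by (auto simp: p PiE_def extensional_def Pi_def le_Suc_eq)
  show "({i \<in> S. (case p of (B, f) => %i. if i \<in> B then Suc M else f i) i = Suc M},
    restrict (case p of (B, f) => %i. if i \<in> B then Suc M else f i)
     (S - {i \<in> S. (case p of (B, f) => %i. if i \<in> B then Suc M else f i) i = Suc M})) = p"
   unfolding p prod.case eq using PiE_arb[OF f] by (auto simp: fun_eq_iff)
  have "card {i \<in> S. ?f i = r} = card {i \<in> S - B. f i = r}" if "r \<le> M" for r
   by (rule arg_cong[where f = card]) (use that in auto)
  then show "?G (Suc M) S (case p of (B, f) => %i. if i \<in> B then Suc M else f i) =
    (case p of (B, f) =>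
     hl_cross x t B (S - B)*?G M (S - B) f*((\<Prod>i\<in>B. x i^Suc M) * c (Suc M) (card B)))"
   using hl_weight_extend[OF Suc.prems B, of f M x t] le eq by (simp add: p mult_ac)
 next
  fix f assume f: "f \<in> PiE S (%_. {..Suc M})"
  show "(case ({i \<in> S. f i = Suc M}, restrict f (S - {i \<in> S. f i = Suc M})) of (B, f) =>
    %i. if i \<in> B then Suc M else f i) = f"
   using PiE_arb[OF f] by (auto simp: fun_eq_iff)
  have "f i \<le> Suc M" if "i \<in> S" for i using PiE_mem[OF f that] by simp
  then show "({i \<in> S. f i = Suc M}, restrict f (S - {i \<in> S. f i = Suc M})) \<in>
    (SIGMA B:Pow S. PiE (S - B) (%_. {..M}))"
   by (auto simp: le_Suc_eq)
 qed
 finally show ?case .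
qed

section \<open>Partial fractions\<close>

text \<open>Off the finite set \<open>Z\<close>, \<open>f\<close> is a rational function whose poles
  are simple and lie in \<open>Z\<close>; the degree bound keeps it finite at infinity. Values at
  points of \<open>Z\<close> are left free, so the conventional value of a division by 0 does no
  harm.\<close>

definition ratf :: "complex set => (complex => complex) => bool" where
 "ratf Z f \<longleftrightarrow> finite Z \<and>
   (\<exists>p. degree p \<le> card Z \<and> (\<forall>z. z \<notin> Z \<longrightarrow> f z = poly p z/(\<Prod>a\<in>Z. z - a)))"

lemma poly_prod_linear: "poly (\<Prod>a\<in>Z. [:- a, 1:]) z = (\<Prod>a\<in>Z. z - (a::complex))"
 by (simp add: poly_prod)

lemma degree_prod_linear: "degree (\<Prod>a\<in>Z. [:- a, 1:]) = card (Z :: complex set)"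
 by (subst degree_prod_eq_sum_degree) auto

lemma roots_prod_dvd:
 assumes "finite Z" "!!a::complex. a \<in> Z ==> poly p a = 0"
 shows "(\<Prod>a\<in>Z. [:- a, 1:]) dvd p"
 using assms
proof (induction Z rule: finite_induct)
 case (insert a Z)
 then obtain h where h: "p = (\<Prod>a\<in>Z. [:- a, 1:])*h" by (auto elim: dvdE)
 have "poly p a = 0" using insert by blast
 then have "poly h a = 0"
  using insert.hyps by (auto simp: h poly_prod_linear)
 then have "[:- a, 1:] dvd h" by (simp add: poly_eq_0_iff_dvd)
 then have "[:- a, 1:]*(\<Prod>a\<in>Z. [:- a, 1:]) dvd h*(\<Prod>a\<in>Z. [:- a, 1:])"
  by (rule mult_dvd_mono) simp
 then show ?case by (simp only: h prod.insert[OF insert.hyps] mult.commute[of h])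
qed simp

lemma ratf_finite: "ratf Z f ==> finite Z"
 by (simp add: ratf_def)

lemma ratf_const: "finite Z ==> ratf Z (%_. c)"
 unfolding ratf_def
 by (auto intro!: exI[of _ "smult c (\<Prod>a\<in>Z. [:- a, 1:])"]
   simp: degree_prod_linear poly_prod_linear order.trans[OF degree_smult_le])

lemma ratf_cong: "ratf Z f ==> (!!z. z \<notin> Z ==> f z = g z) ==> ratf Z g"
 unfolding ratf_def by auto

lemma ratf_add: "ratf Z f ==> ratf Z g ==> ratf Z (%z. f z + g z)"
 unfolding ratf_def
proof safe
 fix p r assume "degree p \<le> card Z" "degree r \<le> card Z"
  and "\<forall>z. z \<notin> Z \<longrightarrow> f z = poly p z/(\<Prod>a\<in>Z. z - a)" "\<forall>z. z \<notin> Z \<longrightarrow> g z = poly r z/(\<Prod>a\<in>Z. z - a)"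
 then show "\<exists>q. degree q \<le> card Z \<and> (\<forall>z. z \<notin> Z \<longrightarrow> f z + g z = poly q z/(\<Prod>a\<in>Z. z - a))"
  by (intro exI[of _ "p + r"]) (auto simp: degree_add_le add_divide_distrib)
qed

lemma ratf_mult_disjoint:
 assumes "ratf Z f" "ratf Z' g" "Z \<inter> Z' = {}"
 shows "ratf (Z \<union> Z') (%z. f z*g z)"
proof -
 obtain p r where p: "degree p \<le> card Z" "!!z. z \<notin> Z ==> f z = poly p z/(\<Prod>a\<in>Z. z - a)"
  and r: "degree r \<le> card Z'" "!!z. z \<notin> Z' ==> g z = poly r z/(\<Prod>a\<in>Z'. z - a)"
  and fin: "finite Z" "finite Z'"
  using assms(1,2) unfolding ratf_def by blast
 have "degree (p*r) \<le> card (Z \<union> Z')"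
  using degree_mult_le[of p r] p(1) r(1) card_Un_disjoint[OF fin assms(3)] by linarith
 with p r fin assms(3) show ?thesis
  unfolding ratf_def by (intro conjI exI[of _ "p*r"]) (auto simp: prod.union_disjoint)
qed

lemma ratf_mono:
 assumes "ratf Z f" "Z \<subseteq> Z'" "finite Z'"
 shows "ratf Z' f"
proof -
 have "ratf (Z \<union> (Z' - Z)) (%z. f z*1)"
  by (intro ratf_mult_disjoint ratf_const assms) (use assms in auto)
 moreover have "Z \<union> (Z' - Z) = Z'" using assms by auto
 ultimately show ?thesis by simp
qed

lemma ratf_mult:
 assumes "ratf Z f" "ratf Z' g" "Z \<inter> Z' = {}" "Z \<union> Z' \<subseteq> Y" "finite Y"
 shows "ratf Y (%z. f z*g z)"
 using ratf_mono[OF ratf_mult_disjoint] assms by blast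

lemma ratf_cmult: "ratf Z f ==> ratf Z (%z. c*f z)"
 using ratf_mult_disjoint[OF ratf_const[of "{}" c], of Z f] by simp

lemma ratf_diff: "ratf Z f ==> ratf Z g ==> ratf Z (%z. f z - g z)"
 using ratf_add[of Z f "%z. (-1)*g z"] ratf_cmult[of Z g "-1"] by simp

lemma ratf_sum:
 "finite Z ==> (!!i. i \<in> I ==> ratf Z (f i)) ==> ratf Z (%z. \<Sum>i\<in>I. f i z)"
 by (induction I rule: infinite_finite_induct) (auto intro: ratf_add ratf_const)

lemma ratf_mobius:
 assumes "!!z. f z = (alp*z + bt)/(gm*z + dl)" "gm*a + dl = 0" "gm ~= 0"
 shows "ratf {a} f"
proof -
 have "gm*z + dl = gm*(z - a)" for z using assms(2) by (simp add: algebra_simps eq_neg_iff_add_eq_0)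
 then have "f z = poly [:bt/gm, alp/gm:] z/(z - a)" if "z ~= a" for z
  using assms(1)[of z] assms(3) that by (simp add: field_simps)
 then show ?thesis unfolding ratf_def
  by (auto intro!: exI[of _ "[:bt/gm, alp/gm:]"])
qed

lemma ratf_prod:
 assumes "finite I" "!!i. i \<in> I ==> ratf {p i} (f i)" "inj_on p I"
 shows "ratf (p ` I) (%z. \<Prod>i\<in>I. f i z)"
 using assms
proof (induction I rule: finite_induct)
 case (insert i I)
 have "ratf ({p i} \<union> p ` I) (%z. f i z*(\<Prod>i\<in>I. f i z))"
  using insert by (intro ratf_mult_disjoint) auto
 then show ?case using insert by simp
qed (simp add: ratf_const)

text \<open>Vanishing residues make every point of \<open>Z\<close> a root of the numerator, so the
  denominator divides it, and the degree bound leaves a constant quotient. This takes the place of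
  Liouville's theorem.\<close>

lemma ratf_no_poles:
 assumes "ratf Z f" and "!!a. a \<in> Z ==> ((%z. (z - a)*f z) \<longlongrightarrow> 0) (at a)"
 shows "\<exists>c. \<forall>z. z \<notin> Z \<longrightarrow> f z = c"
proof -
 obtain p where fin: "finite Z" and p: "degree p \<le> card Z"
  "!!z. z \<notin> Z ==> f z = poly p z/(\<Prod>a\<in>Z. z - a)"
  using assms unfolding ratf_def by blast
 have root: "poly p a = 0" if "a \<in> Z" for a
 proof -
  let ?Q = "%z. \<Prod>b\<in>Z - {a}. z - b"
  have Q: "?Q a ~= 0" using fin by auto
  have "\<forall>\<^sub>F z in at a. z \<notin> Z"
   using eventually_ball_finite[OF fin, of "%z b. z ~= b" "at a"] eventually_neq_at_within[of _ a]
   by (auto elim: eventually_mono)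
  then have "\<forall>\<^sub>F z in at a. (z - a)*f z = poly p z/?Q z"
  proof eventually_elim
   case (elim z)
   then have "z - a ~= 0" using that by auto
   then show ?case using p(2)[OF elim] prod.remove[OF fin that, of "%b. z - b"] by simp
  qed
  moreover have "((%z. poly p z/?Q z) \<longlongrightarrow> poly p a/?Q a) (at a)"
   by (intro tendsto_intros Q)
  ultimately have "((%z. (z - a)*f z) \<longlongrightarrow> poly p a/?Q a) (at a)"
   by (simp add: filterlim_cong)
  from tendsto_unique[OF _ this assms(2)[OF that]] Q show ?thesis by simp
 qed
 obtain h where h: "p = (\<Prod>a\<in>Z. [:- a, 1:])*h"
  using roots_prod_dvd[OF fin root] by blast
 have "degree h = 0"
 proof (cases "h = 0")
  case False
  then have "degree p = card Z + degree h"
   unfolding h by (subst degree_mult_eq) (auto simp: degree_prod_linear fin)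
  with p(1) show ?thesis by simp
 qed simp
 then obtain c where "h = [:c:]" by (auto elim: degree_eq_zeroE)
 then have "f z = c" if "z \<notin> Z" for z
  using p(2)[OF that] that fin by (simp add: h poly_prod_linear)
 then show ?thesis by blast
qed

lemma mobius_at_infinity:
 assumes "(gm::complex) ~= 0"
 shows "((%z. (alp*z + bt)/(gm*z + dl)) \<longlongrightarrow> alp/gm) at_infinity"
proof -
 have f: "filterlim (%z. gm*z + dl) at_infinity at_infinity"
  by (rule tendsto_add_filterlim_at_infinity'[OF
     tendsto_mult_filterlim_at_infinity[OF tendsto_const assms filterlim_ident] tendsto_const])
 have "((%z. alp/gm + (bt - alp*dl/gm)/(gm*z + dl)) \<longlongrightarrow> alp/gm + 0) at_infinity"
  by (intro tendsto_add tendsto_const tendsto_divide_0[OF tendsto_const f])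
 moreover have "\<forall>\<^sub>F z in at_infinity. alp/gm + (bt - alp*dl/gm)/(gm*z + dl) =
   (alp*z + bt)/(gm*z + dl)"
  using eventually_not_equal_at_infinity[of "- dl/gm"]
 proof eventually_elim
  case (elim z)
  then have "gm*z + dl ~= 0" using assms by (auto simp: field_simps eq_neg_iff_add_eq_0)
  then show ?case using assms by (simp add: divide_simps) (simp add: algebra_simps)
 qed
 ultimately show ?thesis by (simp add: filterlim_cong)
qed

text \<open>Subtracting the principal parts leaves a function without poles, hence a constant, which
  is read off at infinity.\<close>

theorem partial_fractions:
 assumes "ratf Z f" "!!a. a \<in> Z ==> ((%z. (z - a)*f z) \<longlongrightarrow> rh a) (at a)"
  and "(f \<longlongrightarrow> L) at_infinity" "z \<notin> Z"
 shows "f z = L + (\<Sum>a\<in>Z. rh a/(z - a))"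
proof -
 have fin: "finite Z" using assms ratf_finite by blast
 define g where "g = (%z. f z - (\<Sum>a\<in>Z. rh a/(z - a)))"
 have "ratf Z (%z. rh a/(z - a))" if "a \<in> Z" for a
  by (rule ratf_mono[OF ratf_mobius[of _ 0 "rh a" 1 "-a"]]) (use that fin in auto)
 then have r: "ratf Z g"
  unfolding g_def by (intro ratf_diff ratf_sum assms fin)
 have "((%z. (z - a)*g z) \<longlongrightarrow> 0) (at a)" if a: "a \<in> Z" for a
 proof -
  have "((%z. (z - a)*f z - (rh a + (\<Sum>b\<in>Z-{a}. (z - a)*(rh b/(z - b))))) \<longlongrightarrow>
    rh a - (rh a + (\<Sum>b\<in>Z-{a}. (a - a)*(rh b/(a - b))))) (at a)"
   by (intro tendsto_intros assms a) auto
  moreover have "\<forall>\<^sub>F z in at a. (z - a)*f z - (rh a + (\<Sum>b\<in>Z-{a}. (z - a)*(rh b/(z - b)))) = (z - a)*g z"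
   unfolding eventually_at_filter
   by (auto simp: g_def right_diff_distrib sum.remove[OF fin a] sum_distrib_left distrib_left)
  ultimately show ?thesis by (simp add: filterlim_cong)
 qed
 from ratf_no_poles[OF r this] obtain c where c: "!!z. z \<notin> Z ==> g z = c" by blast
 have "(g \<longlongrightarrow> L - (\<Sum>a\<in>Z. 0)) at_infinity"
  unfolding g_def
 proof (intro tendsto_intros assms)
  fix a
  have "filterlim (%z. z + (- a)) at_infinity (at_infinity :: complex filter)"
   by (rule tendsto_add_filterlim_at_infinity'[OF filterlim_ident tendsto_const])
  then show "((%z. rh a/(z - a)) \<longlongrightarrow> 0) at_infinity"
   by (intro tendsto_divide_0[OF tendsto_const]) simp
 qed
 moreover have "\<forall>\<^sub>F z in at_infinity. g z = c"
 proof -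
  have "\<forall>\<^sub>F z in at_infinity. \<forall>b\<in>Z. z ~= b"
   by (intro eventually_ball_finite[OF fin] ballI eventually_not_equal_at_infinity)
  then have "\<forall>\<^sub>F z in at_infinity. z \<notin> Z" by eventually_elim auto
  then show ?thesis by eventually_elim (rule c)
 qed
 ultimately have "((%z::complex. c) \<longlongrightarrow> L) at_infinity"
  by (simp add: filterlim_cong)
 then have "c = L" using tendsto_unique[OF trivial_limit_at_infinity tendsto_const] by blast
 with c[OF assms(4)] show ?thesis by (simp add: g_def algebra_simps)
qed

section \<open>Bounded Littlewood identities\<close>

text \<open>\<open>z\<close> stands for the variable of a new index, with weight
  \<open>alp z\<close> and interaction \<open>bt z\<close>. A pole at \<open>x c\<close> arises only
  when \<open>z\<close> and \<open>x c\<close> lie on opposite sides of the cut. Exchanging the two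
  matches a term of \<open>B\<close> with one of \<open>insert c B\<close>, and the multiplicativity
  of \<open>om\<close> makes the two residues opposite.\<close>

lemma hl_sum_no_pole:
 fixes om :: "nat set => complex"
 assumes S: "finite S" "c \<in> S" "inj_on x S"
  and alp: "isCont alp (x c)" and bt: "!!b. b \<in> S ==> isCont (%z. bt z (x b)) (x c)"
  and om: "!!B. B \<subseteq> S - {c} ==> om (insert c B) = om B*alp (x c)*(\<Prod>b\<in>B. bt (x c) (x b))"
 shows "((%z. (z - x c)*(\<Sum>B\<in>Pow S. hl_cross x t B (S - B) *
   ((\<Prod>b\<in>B. (x b - t*z)/(x b - z)) * om B +
    (\<Prod>a\<in>S - B. (z - t*x a)/(z - x a))*(om B*alp z*(\<Prod>b\<in>B. bt z (x b)))))) \<longlongrightarrow> 0) (at (x c))"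
proof -
 define S0 where "S0 = S - {c}"
 have S0: "finite S0" "c \<notin> S0" "S = insert c S0" using S by (auto simp: S0_def)
 let ?P = "%B z. \<Prod>b\<in>B. (x b - t*z)/(x b - z)"
 let ?Q = "%A z. \<Prod>a\<in>A. (z - t*x a)/(z - x a)"
 let ?R = "%B z. \<Prod>b\<in>B. bt z (x b)"
 let ?T = "%B z. hl_cross x t B (S - B)*(?P B z * om B + ?Q (S - B) z*(om B*alp z*?R B z))"
 have ne: "x b ~= x c" if "b \<in> S0" for b
  using that S(3) S0 by (auto simp: inj_on_def)
 have "((%z. (z - x c)*(?T B z + ?T (insert c B) z)) \<longlongrightarrow> 0) (at (x c))" if B: "B \<in> Pow S0" for B
 proof -
  define A where "A = S0 - B"
  have B': "B \<subseteq> S0" "finite B" "finite A" "c \<notin> A" "c \<notin> B" using B S0 by (auto simp: A_def intro: finite_subset)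
  have e: "S - B = insert c A" "S - insert c B = A" using B' S0 by (auto simp: A_def)
  define V where "V = hl_cross x t B A"
  \<comment> \<open>The two matched terms times \<open>z - x c\<close>, with the vanishing
    denominators already cancelled, so that \<open>g\<close> is continuous at
    \<open>x c\<close>.\<close>
  define g where "g = (%z. V*?P B (x c)*((z - x c)*?P B z * om B + (z - t*x c)*?Q A z*(om B*alp z*?R B z))
    + V*?Q A (x c)*((t*z - x c)*?P B z * om (insert c B) + (z - x c)*?Q A z*(om (insert c B)*alp z*(bt z (x c)*?R B z))))"
  have Pc: "(?P B \<longlongrightarrow> ?P B (x c)) (at (x c))"
   by (intro tendsto_intros) (use ne B' in fastforce)+
  have Qc: "(?Q A \<longlongrightarrow> ?Q A (x c)) (at (x c))"
   by (intro tendsto_intros) (use ne A_def in fastforce)+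
  have Rc: "(?R B \<longlongrightarrow> ?R B (x c)) (at (x c))"
   by (intro tendsto_prod isContD bt) (use B' S0 in auto)
  have "(g \<longlongrightarrow> V*?P B (x c)*((x c - x c)*?P B (x c) * om B + (x c - t*x c)*?Q A (x c)*(om B*alp (x c)*?R B (x c)))
    + V*?Q A (x c)*((t*x c - x c)*?P B (x c) * om (insert c B) + (x c - x c)*?Q A (x c)*(om (insert c B)*alp (x c)*(bt (x c) (x c)*?R B (x c))))) (at (x c))"
   unfolding g_def
   by (intro tendsto_add tendsto_mult tendsto_diff tendsto_const tendsto_ident_at Pc Qc Rc isContD[OF alp]
     isContD[OF bt[OF S(2)]])
  moreover have "om (insert c B) = om B*alp (x c)*?R B (x c)" using om B' by (simp add: S0_def)
  ultimately have "(g \<longlongrightarrow> 0) (at (x c))" by (simp add: algebra_simps)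
  moreover have "\<forall>\<^sub>F z in at (x c). g z = (z - x c)*(?T B z + ?T (insert c B) z)"
   unfolding eventually_at_filter
  proof (intro always_eventually allI impI)
   fix z assume z: "z ~= x c"
   have V1: "hl_cross x t B (insert c A) = ?P B (x c)*V"
    unfolding V_def by (rule hl_cross_insert_right) (use B' in auto)
   have V2: "hl_cross x t (insert c B) A = ?Q A (x c)*V"
    unfolding V_def by (rule hl_cross_insert_left) (use B' in auto)
   have P2: "(z - x c)*?P (insert c B) z = (t*z - x c)*?P B z"
    using B' z by (simp add: divide_simps) (simp add: algebra_simps)
   have Q2: "(z - x c)*?Q (insert c A) z = (z - t*x c)*?Q A z"
    using B' z by (simp add: divide_simps)
   have "(z - x c)*(?T B z + ?T (insert c B) z) =
    ?P B (x c)*V*((z - x c)*?P B z * om B + ((z - x c)*?Q (insert c A) z)*(om B*alp z*?R B z)) +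
    ?Q A (x c)*V*(((z - x c)*?P (insert c B) z) * om (insert c B) +
     (z - x c)*?Q A z*(om (insert c B)*alp z*?R (insert c B) z))"
    unfolding e V1 V2 by (simp only: ring_distribs mult_ac)
   also have "... = g z"
    unfolding P2 Q2 g_def using B' by (simp add: mult_ac)
   finally show "g z = (z - x c)*(?T B z + ?T (insert c B) z)" by simp
  qed
  ultimately show ?thesis by (simp add: filterlim_cong)
 qed
 then have "((%z. \<Sum>B\<in>Pow S0. (z - x c)*(?T B z + ?T (insert c B) z)) \<longlongrightarrow> (\<Sum>B\<in>Pow S0. 0)) (at (x c))"
  by (intro tendsto_sum)
 moreover have "(\<Sum>B\<in>Pow S0. (z - x c)*(?T B z + ?T (insert c B) z)) = (z - x c)*(\<Sum>B\<in>Pow S. ?T B z)" for z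
  using sum_Pow_insert[OF S0(1,2), of "%B. ?T B z"] S0(3) by (simp only: sum_distrib_left)
 ultimately show ?thesis by simp
qed

section \<open>Closed forms of simple convolutions\<close>

lemma ratf_cross_left:
 assumes "finite B" "inj_on x B"
 shows "ratf (x ` B) (%z. \<Prod>b\<in>B. (x b - t*z)/(x b - z))"
proof (rule ratf_prod[OF assms(1) _ assms(2)])
 show "ratf {x b} (%z. (x b - t*z)/(x b - z))" for b
  by (rule ratf_mobius[of _ "-t" "x b" "-1" "x b"]) auto
qed

lemma ratf_cross_right:
 assumes "finite A" "inj_on x A"
 shows "ratf (x ` A) (%z. \<Prod>a\<in>A. (z - t*x a)/(z - x a))"
proof (rule ratf_prod[OF assms(1) _ assms(2)])
 show "ratf {x a} (%z. (z - t*x a)/(z - x a))" for a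
  by (rule ratf_mobius[of _ 1 "- t*x a" 1 "- x a"]) auto
qed

lemma cross_left_at_infinity:
 "((%z::complex. \<Prod>b\<in>B. (x b - t*z)/(x b - z)) \<longlongrightarrow> t^card B) at_infinity"
proof -
 have "((%z. \<Prod>b\<in>B. (- t*z + x b)/(- 1*z + x b)) \<longlongrightarrow> (\<Prod>b\<in>B. - t/- 1)) at_infinity"
  by (intro tendsto_prod mobius_at_infinity) simp
 then show ?thesis by simp
qed

lemma cross_right_at_infinity:
 "((%z::complex. \<Prod>a\<in>A. (z - t*x a)/(z - x a)) \<longlongrightarrow> 1) at_infinity"
proof -
 have "((%z. \<Prod>a\<in>A. (1*z + (- t*x a))/(1*z + (- x a))) \<longlongrightarrow> (\<Prod>b\<in>A. 1/1)) at_infinity"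
  by (intro tendsto_prod mobius_at_infinity) simp
 then show ?thesis by simp
qed

lemma eventually_at_infinity_notin:
 assumes "finite (Z :: complex set)" shows "\<forall>\<^sub>F z in at_infinity. z \<notin> Z"
proof -
 have "\<forall>\<^sub>F z in at_infinity. \<forall>b\<in>Z. z ~= b"
  by (intro eventually_ball_finite[OF assms] ballI eventually_not_equal_at_infinity)
 then show ?thesis by eventually_elim auto
qed

lemma const_at_infinity:
 assumes "finite (Z :: complex set)" "!!z. z \<notin> Z ==> f z = (c :: complex)" "(f \<longlongrightarrow> L) at_infinity"
 shows "c = L"
proof -
 have "\<forall>\<^sub>F z in at_infinity. f z = c"
  using eventually_at_infinity_notin[OF assms(1)]
 proof eventually_elim
  case (elim z) then show ?case by (rule assms(2))
 qed
 from tendsto_cong[THEN iffD1, OF this assms(3)] have "((%z::complex. c) \<longlongrightarrow> L) at_infinity" .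
 then show ?thesis using tendsto_unique[OF trivial_limit_at_infinity tendsto_const] by blast
qed

text \<open>The Rogers-Szego polynomial, whose coefficients are the \<open>t\<close>-binomial
  coefficients of \<open>n\<close>, generated by one of the two \<open>t\<close>-Pascal
  rules.\<close>

primrec rogers_szego :: "complex => nat => complex => complex" where
 "rogers_szego t 0 c = 1"
| "rogers_szego t (Suc n) c = rogers_szego t n (t * c) + c*rogers_szego t n c"

text \<open>As a function of one variable \<open>z\<close> the sum has no poles, hence is constant.
  At infinity each cross factor of \<open>z\<close> tends to \<open>t\<close> if \<open>z\<close>
  lies below the cut and to 1 if it lies above, which is the recursion of
  \<open>rogers_szego\<close>.\<close>

lemma hl_conv_const:
 assumes "finite S" "inj_on x S"
 shows "hl_conv x t (%_. 1) (%B. c^card B) S = rogers_szego t (card S) c"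
 using assms
proof (induction S arbitrary: c rule: finite_induct)
 case empty
 then show ?case by (simp add: hl_conv_def)
next
 case (insert j S c)
 have inj: "inj_on x S" using insert.prems by simp
 define H where "H = (%z. \<Sum>B\<in>Pow S. hl_cross x t B (S - B) *
   ((\<Prod>b\<in>B. (x b - t*z)/(x b - z)) * c^card B +
    (\<Prod>a\<in>S - B. (z - t*x a)/(z - x a))*(c^card B * c*(\<Prod>b\<in>B. 1))))"
 have sub: "finite B" "inj_on x B" if "B \<subseteq> S" for B
  using that insert.hyps inj by (auto intro: finite_subset inj_on_subset)
 have r: "ratf (x ` S) H"
  unfolding H_def using insert.hyps sub
  by (intro ratf_sum ratf_cmult ratf_add)
    (auto simp: mult.commute[of _ "c ^ _"] mult.commute[of _ "c ^ _ * c"]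
     intro!: ratf_cmult ratf_mono[OF ratf_cross_left] ratf_mono[OF ratf_cross_right])
 have "((%z. (z - a)*H z) \<longlongrightarrow> 0) (at a)" if a: "a \<in> x ` S" for a
 proof -
  obtain d where d: "d \<in> S" "a = x d" using a by auto
  show ?thesis unfolding d(2) H_def
   by (rule hl_sum_no_pole[OF insert.hyps(1) d(1) inj])
     (use sub in "auto simp: card_insert_if subset_Diff_insert")
 qed
 from ratf_no_poles[OF r this] obtain C where C: "!!z. z \<notin> x ` S ==> H z = C" by blast
 have "(H \<longlongrightarrow> (\<Sum>B\<in>Pow S. hl_cross x t B (S - B)*(t^card B * c^card B + 1*(c^card B * c*(\<Prod>b\<in>B. 1))))) at_infinity"
  unfolding H_def by (intro tendsto_intros cross_left_at_infinity cross_right_at_infinity)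
 from const_at_infinity[OF finite_imageI[OF insert.hyps(1)] C this]
 have "C = (\<Sum>B\<in>Pow S. hl_cross x t B (S - B)*(t^card B * c^card B + (c^card B * c)))" by simp
 also have "... = hl_conv x t (%_. 1) (%B. (t * c)^card B) S + c*hl_conv x t (%_. 1) (%B. c^card B) S"
  by (simp add: hl_conv_def sum.distrib sum_distrib_left power_mult_distrib distrib_left mult_ac)
 also have "... = rogers_szego t (card (insert j S)) c"
  using insert by simp
 also have "C = H (x j)" using C[of "x j"] insert.prems insert.hyps by auto
 also have "H (x j) = hl_conv x t (%_. 1) (%B. c^card B) (insert j S)"
  unfolding hl_conv_insert[OF insert.hyps(1,2)] H_def
  by (intro sum.cong refl) (use insert.hyps in "auto simp: card_insert_if finite_subset mult_ac")
 finally show ?case by simp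
qed

text \<open>The other \<open>t\<close>-Pascal rule, at the argument \<open>t * c\<close>. Together
  with the defining one it yields the three-term recurrence \<open>rogers_szego_rec\<close>.\<close>

lemma rogers_szego_shift:
 "rogers_szego t (Suc n) (t * c) = rogers_szego t n (t * c) + c*t^Suc n*rogers_szego t n c"
proof (induction n arbitrary: c)
 case (Suc n)
 have "rogers_szego t (Suc (Suc n)) (t * c) =
   rogers_szego t (Suc n) (t*(t * c)) + t * c*rogers_szego t (Suc n) (t * c)" by simp
 also have "rogers_szego t (Suc n) (t*(t * c)) =
   rogers_szego t n (t*(t * c)) + t * c*t^Suc n*rogers_szego t n (t * c)" by (rule Suc.IH)
 also have "rogers_szego t n (t*(t * c)) = rogers_szego t (Suc n) (t * c) - t * c*rogers_szego t n (t * c)" by simp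
 finally have "rogers_szego t (Suc (Suc n)) (t * c) - (rogers_szego t (Suc n) (t * c) + c*t^Suc (Suc n)*rogers_szego t (Suc n) c)
  = t * c*(rogers_szego t (Suc n) (t * c) - rogers_szego t n (t * c) - c*t^Suc n*rogers_szego t n c)"
  by (simp add: algebra_simps)
 then show ?case using Suc.IH[of c] by (simp del: rogers_szego.simps)
qed simp

lemma rogers_szego_rec:
 "rogers_szego t (Suc (Suc n)) c = (1 + c)*rogers_szego t (Suc n) c - c*(1 - t^Suc n)*rogers_szego t n c"
proof -
 have "rogers_szego t (Suc (Suc n)) c = rogers_szego t (Suc n) (t * c) + c*rogers_szego t (Suc n) c" by simp
 also have "rogers_szego t (Suc n) (t * c) = rogers_szego t n (t * c) + c*t^Suc n*rogers_szego t n c"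
  by (rule rogers_szego_shift)
 also have "rogers_szego t n (t * c) = rogers_szego t (Suc n) c - c*rogers_szego t n c" by simp
 finally show ?thesis by (simp only: ring_distribs) (simp add: mult_ac)
qed

lemma qpoch_Suc: "qpoch a q (Suc n) = qpoch a q n*(1 - a*q^n)"
 by (simp add: qpoch_def)

text \<open>At \<open>c = s\<close> the three-term recurrence has a product solution, because
  \<open>(1 + s)(1 + a) - s(1 - a^2) = (1 + a)(1 + s a)\<close> for \<open>a = s^(l + 1)\<close>.
  This is where the weight of the theorem comes from.\<close>

lemma rogers_szego_sqrt: "rogers_szego (s^2) n s = qpoch (- s) s n"
proof (induction n rule: less_induct)
 case (less n)
 show ?case
 proof (cases n)
  case 0
  then show ?thesis by (simp add: qpoch_def)
 next
  case (Suc m)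
  show ?thesis
  proof (cases m)
   case 0
   with Suc show ?thesis by (simp add: qpoch_def)
  next
   case (Suc l)
   have "rogers_szego (s^2) n s = (1 + s)*qpoch (- s) s (Suc l) - s*(1 - (s^2)^Suc l)*qpoch (- s) s l"
    unfolding \<open>n = Suc m\<close> Suc rogers_szego_rec
    using less[of "Suc l"] less[of l] \<open>n = Suc m\<close> Suc by (simp del: rogers_szego.simps)
   also have "... = qpoch (- s) s n"
   proof -
    have "(s^2)^Suc l = (s^Suc l)\<^sup>2" by (metis power_mult mult.commute)
    then show ?thesis
     unfolding \<open>n = Suc m\<close> Suc qpoch_Suc by (simp add: algebra_simps power2_eq_square)
   qed
   finally show ?thesis .
  qed
 qed
qed

text \<open>Partial fractions of the product of the \<open>(x b - t*z)/(x b - z)\<close>, evaluated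
  at \<open>z = 0\<close>; the value at infinity is \<open>t^card S\<close>. It yields both the
  normalisation of Hall-Littlewood polynomials and the recursion of \<open>bc_sum\<close>.\<close>

lemma sum_cross_single:
 fixes x :: "nat => complex"
 assumes "finite S" "inj_on x S" "!!i. i \<in> S ==> x i ~= 0" "t ~= 1"
 shows "(\<Sum>i\<in>S. \<Prod>j\<in>S - {i}. (x j - t*x i)/(x j - x i)) = (1 - t^card S)/(1 - t)"
proof -
 let ?f = "%z. \<Prod>b\<in>S. (x b - t*z)/(x b - z)"
 let ?V = "%i. \<Prod>j\<in>S - {i}. (x j - t*x i)/(x j - x i)"
 define rh where "rh a = (let i = inv_into S x a in - ((1 - t)*x i*?V i))" for a
 have rh: "rh (x i) = - ((1 - t)*x i*?V i)" if "i \<in> S" for i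
  using that assms(2) by (simp add: rh_def)
 have "?f 0 = t^card S + (\<Sum>a\<in>x ` S. rh a/(0 - a))"
 proof (rule partial_fractions[OF ratf_cross_left[OF assms(1,2)] _ cross_left_at_infinity])
  fix a assume "a \<in> x ` S"
  then obtain i where i: "i \<in> S" "a = x i" by auto
  have "((%z. (t*z - x i)*(\<Prod>b\<in>S - {i}. (x b - t*z)/(x b - z))) \<longlongrightarrow> (t*x i - x i)*?V i) (at (x i))"
   by (intro tendsto_intros) (use i assms(2) in "auto simp: inj_on_def")
  moreover have "\<forall>\<^sub>F z in at (x i). (t*z - x i)*(\<Prod>b\<in>S - {i}. (x b - t*z)/(x b - z)) = (z - x i)*?f z"
   unfolding eventually_at_filter
  proof (intro always_eventually allI impI)
   fix z assume z: "z ~= x i"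
   then show "(t*z - x i)*(\<Prod>b\<in>S - {i}. (x b - t*z)/(x b - z)) = (z - x i)*?f z"
    unfolding prod.remove[OF assms(1) i(1)] by (simp add: divide_simps) (simp add: algebra_simps)
  qed
  ultimately have "((%z. (z - x i)*?f z) \<longlongrightarrow> (t*x i - x i)*?V i) (at (x i))"
   by (rule Lim_transform_eventually)
  moreover have "(t*x i - x i)*?V i = rh a"
   unfolding i(2) rh[OF i(1)] by (simp only: ring_distribs) simp
  ultimately show "((%z. (z - a)*?f z) \<longlongrightarrow> rh a) (at a)"
   by (simp add: i(2))
 qed (use assms(3) in auto)
 also have "(\<Sum>a\<in>x ` S. rh a/(0 - a)) = (\<Sum>i\<in>S. (1 - t)*?V i)"
  by (subst sum.reindex[OF assms(2)], intro sum.cong refl) (simp add: rh assms(3))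
 also have "?f 0 = 1" using assms(3) by simp
 finally show ?thesis using assms(4) unfolding sum_distrib_left[symmetric]
  by (simp add: eq_divide_eq) (simp add: mult.commute eq_diff_eq add.commute)
qed

text \<open>With one variable \<open>z\<close> set free the sum grows linearly in \<open>z\<close>,
  so it is divided by \<open>z\<close>. The price is a pole at 0, whose residue is known by
  induction; the poles at the other variables cancel.\<close>

lemma hl_conv_elementary:
 assumes "finite S" "inj_on x S" "!!i. i \<in> S ==> x i ~= 0"
 shows "hl_conv x t (%_. 1) (%B. \<Prod>i\<in>B. c*x i) S = (\<Prod>i\<in>S. 1 + c*x i)"
 using assms
proof (induction S rule: finite_induct)
 case empty
 then show ?case by (simp add: hl_conv_def)
next
 case (insert j S)
 have inj: "inj_on x S" using insert.prems by simp
 have nz: "x i ~= 0" if "i \<in> S" for i using that insert.prems by simp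
 define D where "D = (\<Prod>i\<in>S. 1 + c*x i)"
 have IH: "(\<Sum>B\<in>Pow S. hl_cross x t B (S - B)*(\<Prod>i\<in>B. c*x i)) = D"
  using insert.IH[OF inj nz] by (simp add: hl_conv_def D_def)
 define H where "H = (%z. \<Sum>B\<in>Pow S. hl_cross x t B (S - B) *
   ((\<Prod>b\<in>B. (x b - t*z)/(x b - z))*(\<Prod>i\<in>B. c*x i) +
    (\<Prod>a\<in>S - B. (z - t*x a)/(z - x a))*((\<Prod>i\<in>B. c*x i)*(c*z)*(\<Prod>b\<in>B. 1))))"
 define G where "G = (%z. (1/z)*H z)"
 define Z where "Z = insert 0 (x ` S)"
 have sub: "finite B" "inj_on x B" if "B \<subseteq> S" for B
  using that insert.hyps inj by (auto intro: finite_subset inj_on_subset)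
 have Z: "finite Z" "x ` B \<subseteq> Z" if "B \<subseteq> S" for B using insert.hyps that by (auto simp: Z_def)
 have inv: "ratf {0} (%z. 1/z)" by (rule ratf_mobius[of _ 0 1 1 0]) auto
 have "ratf Z (%z. \<Sum>B\<in>Pow S. hl_cross x t B (S - B) *
   ((\<Prod>i\<in>B. c*x i)*((1/z)*(\<Prod>b\<in>B. (x b - t*z)/(x b - z))) +
    (\<Prod>i\<in>B. c*x i) * c*(\<Prod>a\<in>S - B. (z - t*x a)/(z - x a))))"
 proof (intro ratf_sum ratf_cmult ratf_add Z[OF order_refl])
  fix B assume B: "B \<in> Pow S"
  show "ratf Z (%z. (1/z)*(\<Prod>b\<in>B. (x b - t*z)/(x b - z)))"
   by (rule ratf_mult[OF inv ratf_cross_left]) (use B sub nz Z in "auto simp: Z_def")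
  show "ratf Z (%z. \<Prod>a\<in>S - B. (z - t*x a)/(z - x a))"
   by (rule ratf_mono[OF ratf_cross_right]) (use B sub Z in auto)
 qed
 then have r: "ratf Z G"
 proof (rule ratf_cong)
  fix z assume "z \<notin> Z"
  then have "z ~= 0" by (auto simp: Z_def)
  then show "(\<Sum>B\<in>Pow S. hl_cross x t B (S - B) *
   ((\<Prod>i\<in>B. c*x i)*((1/z)*(\<Prod>b\<in>B. (x b - t*z)/(x b - z))) +
    (\<Prod>i\<in>B. c*x i) * c*(\<Prod>a\<in>S - B. (z - t*x a)/(z - x a)))) = G z"
   unfolding G_def H_def sum_distrib_left by (intro sum.cong refl) (simp add: field_simps)
 qed
 \<comment> \<open>The expected value \<open>(1 + c*z)*D\<close>, divided by \<open>z\<close>, is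
   subtracted. What is left has no poles and tends to 0 at infinity.\<close>
 have r': "ratf Z (%z. G z - (c + 1/z)*D)"
 proof (rule ratf_diff[OF r])
  have "ratf Z (%z. c*D + D*(1/z))"
   by (intro ratf_add ratf_const ratf_cmult ratf_mono[OF inv]) (use Z in "auto simp: Z_def")
  then show "ratf Z (%z. (c + 1/z)*D)" by (simp add: algebra_simps)
 qed
 have "((%z. (z - a)*(G z - (c + 1/z)*D)) \<longlongrightarrow> 0) (at a)" if a: "a \<in> Z" for a
 proof (cases "a = 0")
  case True
  have "(H \<longlongrightarrow> (\<Sum>B\<in>Pow S. hl_cross x t B (S - B) *
   ((\<Prod>b\<in>B. (x b - t*0)/(x b - 0))*(\<Prod>i\<in>B. c*x i) +
    (\<Prod>a\<in>S - B. (0 - t*x a)/(0 - x a))*((\<Prod>i\<in>B. c*x i)*(c*0)*(\<Prod>b\<in>B. 1))))) (at 0)"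
   unfolding H_def by (intro tendsto_intros) (use nz in auto)
  also have "(\<Sum>B\<in>Pow S. hl_cross x t B (S - B) *
   ((\<Prod>b\<in>B. (x b - t*0)/(x b - 0))*(\<Prod>i\<in>B. c*x i) +
    (\<Prod>a\<in>S - B. (0 - t*x a)/(0 - x a))*((\<Prod>i\<in>B. c*x i)*(c*0)*(\<Prod>b\<in>B. 1)))) =
    (\<Sum>B\<in>Pow S. hl_cross x t B (S - B)*(\<Prod>i\<in>B. c*x i))"
  proof (intro sum.cong refl)
   fix B assume "B \<in> Pow S"
   then have "(\<Prod>b\<in>B. (x b - t*0)/(x b - 0)) = 1" using nz by (intro prod.neutral) auto
   then show "hl_cross x t B (S - B) *
   ((\<Prod>b\<in>B. (x b - t*0)/(x b - 0))*(\<Prod>i\<in>B. c*x i) +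
    (\<Prod>a\<in>S - B. (0 - t*x a)/(0 - x a))*((\<Prod>i\<in>B. c*x i)*(c*0)*(\<Prod>b\<in>B. 1))) =
     hl_cross x t B (S - B)*(\<Prod>i\<in>B. c*x i)" by simp
  qed
  finally have "(H \<longlongrightarrow> D) (at 0)" unfolding IH .
  then have "((%z. H z - (c*z + 1)*D) \<longlongrightarrow> D - (c*0 + 1)*D) (at 0)" by (intro tendsto_intros)
  then have "((%z. H z - (c*z + 1)*D) \<longlongrightarrow> 0) (at 0)" by simp
  then show ?thesis unfolding True
  proof (rule Lim_transform_eventually)
   show "\<forall>\<^sub>F z in at 0. H z - (c*z + 1)*D = (z - 0)*(G z - (c + 1/z)*D)"
    unfolding eventually_at_filter by (auto simp: G_def field_simps)
  qed
 next
  case False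
  with a obtain d where d: "d \<in> S" "a = x d" by (auto simp: Z_def)
  have "((%z. (z - x d)*H z) \<longlongrightarrow> 0) (at (x d))" unfolding H_def
   by (rule hl_sum_no_pole[OF insert.hyps(1) d(1) inj])
     (use sub in "auto simp: subset_Diff_insert")
  then have "((%z. (1/z)*((z - x d)*H z) - (z - x d)*((c + 1/z)*D)) \<longlongrightarrow>
    (1/x d)*0 - (x d - x d)*((c + 1/x d)*D)) (at (x d))"
   by (intro tendsto_intros) (use nz d in auto)
  moreover have "(1/z)*((z - x d)*H z) - (z - x d)*((c + 1/z)*D) =
    (z - x d)*(G z - (c + 1/z)*D)" for z
   unfolding G_def right_diff_distrib by (simp only: mult_ac)
  ultimately show ?thesis unfolding d(2) by simp
 qed
 from ratf_no_poles[OF r' this] obtain C where C: "!!z. z \<notin> Z ==> G z - (c + 1/z)*D = C" by blast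
 have inv0: "((%z::complex. 1/z) \<longlongrightarrow> 0) at_infinity"
  by (rule tendsto_divide_0[OF tendsto_const filterlim_ident])
 have "((%z. (\<Sum>B\<in>Pow S. hl_cross x t B (S - B) *
   ((\<Prod>i\<in>B. c*x i)*((1/z)*(\<Prod>b\<in>B. (x b - t*z)/(x b - z))) +
    (\<Prod>i\<in>B. c*x i) * c*(\<Prod>a\<in>S - B. (z - t*x a)/(z - x a)))) - (c + 1/z)*D) \<longlongrightarrow>
    (\<Sum>B\<in>Pow S. hl_cross x t B (S - B)*((\<Prod>i\<in>B. c*x i)*(0*t^card B) +
    (\<Prod>i\<in>B. c*x i) * c*1)) - (c + 0)*D) at_infinity"
  by (intro tendsto_intros cross_left_at_infinity cross_right_at_infinity inv0)
 moreover have "(\<Sum>B\<in>Pow S. hl_cross x t B (S - B)*((\<Prod>i\<in>B. c*x i)*(0*t^card B) +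
    (\<Prod>i\<in>B. c*x i) * c*1)) = c*D"
  unfolding IH[symmetric] by (simp add: sum_distrib_left mult_ac)
 ultimately have lim: "((%z. (\<Sum>B\<in>Pow S. hl_cross x t B (S - B) *
   ((\<Prod>i\<in>B. c*x i)*((1/z)*(\<Prod>b\<in>B. (x b - t*z)/(x b - z))) +
    (\<Prod>i\<in>B. c*x i) * c*(\<Prod>a\<in>S - B. (z - t*x a)/(z - x a)))) - (c + 1/z)*D) \<longlongrightarrow> 0) at_infinity"
  by simp
 have "C = 0"
 proof (rule const_at_infinity[OF Z(1)[OF order_refl] _ lim])
  fix z assume z: "z \<notin> Z"
  then have "z ~= 0" by (auto simp: Z_def)
  then have "(\<Sum>B\<in>Pow S. hl_cross x t B (S - B) *
   ((\<Prod>i\<in>B. c*x i)*((1/z)*(\<Prod>b\<in>B. (x b - t*z)/(x b - z))) +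
    (\<Prod>i\<in>B. c*x i) * c*(\<Prod>a\<in>S - B. (z - t*x a)/(z - x a)))) = G z"
   unfolding G_def H_def sum_distrib_left by (intro sum.cong refl) (simp add: field_simps)
  then show "(\<Sum>B\<in>Pow S. hl_cross x t B (S - B) *
   ((\<Prod>i\<in>B. c*x i)*((1/z)*(\<Prod>b\<in>B. (x b - t*z)/(x b - z))) +
    (\<Prod>i\<in>B. c*x i) * c*(\<Prod>a\<in>S - B. (z - t*x a)/(z - x a)))) - (c + 1/z)*D = C"
   using C[OF z] by simp
 qed
 have xj: "x j ~= 0" "x j \<notin> Z" using insert.prems insert.hyps by (auto simp: Z_def)
 have "H (x j) = (1 + c*x j)*D"
  using C[OF xj(2)] \<open>C = 0\<close> xj(1) by (simp add: G_def field_simps)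
 also have "H (x j) = hl_conv x t (%_. 1) (%B. \<Prod>i\<in>B. c*x i) (insert j S)"
  unfolding hl_conv_insert[OF insert.hyps(1,2)] H_def
 proof (intro sum.cong refl)
  fix B assume "B \<in> Pow S"
  then have "finite B" "j \<notin> B" using sub insert.hyps by auto
  then show "hl_cross x t B (S - B) *
   ((\<Prod>b\<in>B. (x b - t*x j)/(x b - x j))*(\<Prod>i\<in>B. c*x i) +
    (\<Prod>a\<in>S - B. (x j - t*x a)/(x j - x a))*((\<Prod>i\<in>B. c*x i)*(c*x j)*(\<Prod>b\<in>B. 1))) =
   hl_cross x t B (S - B) *
   ((\<Prod>b\<in>B. (x b - t*x j)/(x b - x j))*1*(\<Prod>i\<in>B. c*x i) +
    (\<Prod>a\<in>S - B. (x j - t*x a)/(x j - x a))*1*(\<Prod>i\<in>insert j B. c*x i))"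
   by (simp add: mult_ac)
 qed
 finally show ?case using insert.hyps by (simp add: D_def)
qed

section \<open>Products over pairs and the unbounded sum\<close>

definition pair_prod :: "(nat => nat => complex) => nat set => complex" where
 "pair_prod h S = (\<Prod>(i, j)\<in>{(i, j). i \<in> S \<and> j \<in> S \<and> i < j}. h i j)"

lemma finite_pairs: "finite S ==> finite {(i, j). i \<in> S \<and> j \<in> S \<and> i < (j::nat)}"
 by (rule finite_subset[of _ "S \<times> S"]) auto

text \<open>The new index may stand anywhere among the old ones, so its pairs are sorted by
  \<open>min\<close> and \<open>max\<close>; the symmetry of \<open>h\<close> then forgets the
  sorting.\<close>

lemma pair_prod_insert:
 assumes "finite S" "k \<notin> S" and sym: "!!i j. h i j = h j i"
 shows "pair_prod h (insert k S) = pair_prod h S*(\<Prod>i\<in>S. h k i)"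
proof -
 let ?f = "%i. (min i k, max i k)"
 have inj: "inj_on ?f S"
  using assms(2) by (auto simp: inj_on_def min_def max_def split: if_splits)
 have "{(i, j). i \<in> insert k S \<and> j \<in> insert k S \<and> i < j} =
   {(i, j). i \<in> S \<and> j \<in> S \<and> i < j} \<union> ?f ` S"
 proof (intro equalityI subsetI)
  fix p assume p: "p \<in> {(i, j). i \<in> insert k S \<and> j \<in> insert k S \<and> i < j}"
  then obtain i j where ij: "p = (i, j)" "i \<in> insert k S" "j \<in> insert k S" "i < j" by auto
  consider "i \<in> S" "j \<in> S" | "i = k" "j \<in> S" | "j = k" "i \<in> S" using ij by auto
  then show "p \<in> {(i, j). i \<in> S \<and> j \<in> S \<and> i < j} \<union> ?f ` S"
  proof cases
   case 2
   then have "p = ?f j" using ij by (simp add: min_def max_def)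
   with 2 show ?thesis by blast
  next
   case 3
   then have "p = ?f i" using ij by (simp add: min_def max_def)
   with 3 show ?thesis by blast
  qed (use ij in auto)
 next
  fix p assume "p \<in> {(i, j). i \<in> S \<and> j \<in> S \<and> i < j} \<union> ?f ` S"
  then consider "p \<in> {(i, j). i \<in> S \<and> j \<in> S \<and> i < j}" | i where "i \<in> S" "p = ?f i" by auto
  then show "p \<in> {(i, j). i \<in> insert k S \<and> j \<in> insert k S \<and> i < j}"
  proof cases
   case (2 i)
   then have "i ~= k" using assms(2) by auto
   then show ?thesis using 2 by (cases i k rule: linorder_cases) (auto simp: min_def max_def)
  qed auto
 qed
 moreover have "{(i, j). i \<in> S \<and> j \<in> S \<and> i < j} \<inter> ?f ` S = {}"
 proof -
  have "\<not> (min i k \<in> S \<and> max i k \<in> S)" for i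
   using assms(2) by (cases "i \<le> k") (simp_all add: min_def max_def)
  then show ?thesis by blast
 qed
 ultimately have "pair_prod h (insert k S) = pair_prod h S*(\<Prod>(i, j)\<in>?f ` S. h i j)"
  unfolding pair_prod_def
  by (simp only: prod.union_disjoint[OF finite_pairs[OF assms(1)] finite_imageI[OF assms(1)]])
 also have "(\<Prod>(i, j)\<in>?f ` S. h i j) = (\<Prod>i\<in>S. h k i)"
  by (subst prod.reindex[OF inj]) (auto simp: min_def max_def sym intro!: prod.cong)
 finally show ?thesis .
qed

lemma pair_prod_empty [simp]: "pair_prod h {} = 1"
 by (simp add: pair_prod_def)

lemma pair_prod_Un:
 assumes "finite A" "finite B" "A \<inter> B = {}" and sym: "!!i j. h i j = h j i"
 shows "pair_prod h (A \<union> B) = pair_prod h A*pair_prod h B*(\<Prod>b\<in>B. \<Prod>a\<in>A. h b a)"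
 using assms(2,3)
proof (induction B rule: finite_induct)
 case (insert b B)
 have "pair_prod h (A \<union> insert b B) = pair_prod h (A \<union> B)*(\<Prod>i\<in>A \<union> B. h b i)"
  using insert assms(1) pair_prod_insert[of "A \<union> B" b h] sym by simp
 also have "(\<Prod>i\<in>A \<union> B. h b i) = (\<Prod>i\<in>A. h b i)*(\<Prod>i\<in>B. h b i)"
  using insert assms(1) by (intro prod.union_disjoint) auto
 finally show ?case
  using insert pair_prod_insert[of B b h] sym by simp
qed simp

lemma pair_prod_cong:
 "(!!i j. i \<in> S ==> j \<in> S ==> i < j ==> h i j = h' i j) ==> pair_prod h S = pair_prod h' S"
 unfolding pair_prod_def by (intro prod.cong) auto

definition hl_total :: "(nat => complex) => complex => nat set => complex" where
 "hl_total x t S = (\<Prod>i\<in>S. 1/(1 - x i))*pair_prod (%i j. (1 - t*x i*x j)/(1 - x i*x j)) S"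

lemma hl_total_insert:
 assumes "finite S" "k \<notin> S"
 shows "hl_total x t (insert k S) =
  hl_total x t S*(1/(1 - x k))*(\<Prod>i\<in>S. (1 - t*x k*x i)/(1 - x k*x i))"
 unfolding hl_total_def
 by (subst pair_prod_insert[OF assms]) (use assms in "auto simp: mult_ac")

lemma hl_total_cong: "(!!i. i \<in> S ==> x i = y i) ==> hl_total x t S = hl_total y t S"
 unfolding hl_total_def by (intro arg_cong2[of _ _ _ _ "(*)"] prod.cong pair_prod_cong) auto

text \<open>Removing the first column of \<open>\<lambda>\<close> gives this recursive form of \<open>\<Sum>\<lambda>. P\<^sub>\<lambda>(x; t) = hl_total\<close>. Both sides
  are compared as rational functions of one of the variables.\<close>

lemma hl_conv_total:
 assumes "finite S" "inj_on x S" "!!i. i \<in> S ==> x i ~= 0" "!!i. i \<in> S ==> x i ~= 1"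
  "!!i j. i \<in> S ==> j \<in> S ==> x i*x j ~= 1"
 shows "hl_conv x t (%_. 1) (%B. (\<Prod>i\<in>B. x i)*hl_total x t B) S = hl_total x t S"
 using assms
proof (induction S rule: finite_psubset_induct)
 case (psubset S')
 show ?case
 proof (cases "S' = {}")
  case True
  then show ?thesis by (simp add: hl_conv_def hl_total_def)
 next
  case False
  then obtain j where j: "j \<in> S'" by blast
  define S where "S = S' - {j}"
  have S': "S' = insert j S" "j \<notin> S" "finite S" using j psubset.hyps by (auto simp: S_def)
  have inj: "inj_on x S" using psubset.prems S' by simp
  have nz: "x i ~= 0" "x i ~= 1" if "i \<in> S" for i using that psubset.prems S' by auto
  have nn: "x i*x k ~= 1" if "i \<in> S" "k \<in> S" for i k using that psubset.prems S' by auto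
  have neq: "x i ~= x k" if "i \<in> S" "k \<in> S" "i ~= k" for i k using that inj by (auto simp: inj_on_def)
  have jv: "x j ~= 0" "x j ~= 1" "!!i. i \<in> S ==> x j ~= x i" "!!i. i \<in> S ==> x j*x i ~= 1"
   using psubset.prems S' by (auto simp: inj_on_def)
  define om where "om B = (\<Prod>i\<in>B. x i)*hl_total x t B" for B
  \<comment> \<open>The residues below need the identity for \<open>S\<close> and also for
    \<open>S\<close> without one more index, hence the induction over all proper subsets.\<close>
  have IH: "(\<Sum>B\<in>Pow T. hl_cross x t B (T - B) * om B) = hl_total x t T" if "T \<subseteq> S" for T
  proof -
   have "T \<subset> S'" using that S' by auto
   moreover have "inj_on x T" using inj that by (auto intro: inj_on_subset)
   ultimately show ?thesis
    using psubset.IH[of T] that nz nn by (simp add: hl_conv_def om_def subset_eq)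
  qed
  define alp where "alp z = z/(1 - z)" for z :: complex
  define bt where "bt z u = (1 - t*z*u)/(1 - z*u)" for z u :: complex
  define P where "P B z = (\<Prod>b\<in>B. (x b - t*z)/(x b - z))" for B z
  define Q where "Q A z = (\<Prod>a\<in>A. (z - t*x a)/(z - x a))" for A z
  define R where "R B z = (\<Prod>b\<in>B. bt z (x b))" for B z
  define T where "T B z = hl_cross x t B (S - B)*(P B z * om B + Q (S - B) z*(om B*alp z * R B z))" for B z
  \<comment> \<open>\<open>H\<close> is the left-hand side and \<open>K\<close> the right-hand side,
    with the variable \<open>x j\<close> set free as \<open>z\<close>.\<close>
  define H where "H z = (\<Sum>B\<in>Pow S. T B z)" for z
  define K where "K z = hl_total x t S*(1/(1 - z)) * R S z" for z
  have om_insert: "om (insert c B) = om B*alp (x c) * R B (x c)" if "finite B" "c \<notin> B" for c B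
   using that by (simp add: om_def hl_total_insert alp_def R_def bt_def)
  have sub: "finite B" "inj_on x B" if "B \<subseteq> S" for B
   using that S'(3) inj by (auto intro: finite_subset inj_on_subset)
  \<comment> \<open>The candidates for poles: 1 from the weight of \<open>z\<close>,
    \<open>x i\<close> from the cross factors, \<open>1/x i\<close> from the interaction. Those at
    \<open>x i\<close> cancel within \<open>H\<close>.\<close>
  define Z where "Z = insert 1 (x ` S \<union> (%i. 1/x i) ` S)"
  have finZ: "finite Z" using S' by (simp add: Z_def)
  have rR: "ratf ((%i. 1/x i) ` B) (R B)" if "B \<subseteq> S" for B
   unfolding R_def bt_def
  proof (rule ratf_prod)
   show "inj_on (%i. 1/x i) B" using sub(2)[OF that] by (auto simp: inj_on_def)
   show "ratf {1/x i} (%z. (1 - t*z*x i)/(1 - z*x i))" if "i \<in> B" for i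
    by (rule ratf_mobius[of _ "- t*x i" 1 "- x i" 1]) (use that \<open>B \<subseteq> S\<close> nz in "auto simp: mult_ac")
  qed (use sub that in auto)
  have ralp: "ratf {1} alp" "ratf {1} (%z. 1/(1 - z))"
   by (rule ratf_mobius[of _ 1 0 "-1" 1], auto simp: alp_def)
     (rule ratf_mobius[of _ 0 1 "-1" 1], auto)
  have one: "1 \<notin> (%i. 1/x i) ` B" "1 \<notin> x ` B" if "B \<subseteq> S" for B
   using that nz by force+
  have disj: "x ` A \<inter> ({1} \<union> (%i. 1/x i) ` B) = {}" if "A \<subseteq> S" "B \<subseteq> S" for A B
   using that nz nn by (fastforce simp: field_simps)
  have rHK: "ratf Z (%z. H z - K z)"
   unfolding H_def T_def K_def mult.assoc
  proof (intro ratf_diff ratf_sum ratf_cmult ratf_add finZ)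
   fix B assume B: "B \<in> Pow S"
   have "ratf Z (%z. om B*P B z)" unfolding P_def
    by (intro ratf_cmult ratf_mono[OF ratf_cross_left]) (use B sub finZ in "auto simp: Z_def")
   then show "ratf Z (%z. P B z * om B)" by (simp add: mult.commute)
   have "ratf Z (%z. om B*(Q (S - B) z*(alp z * R B z)))"
    unfolding Q_def
    by (intro ratf_cmult ratf_mult[OF ratf_cross_right ratf_mult_disjoint[OF ralp(1) rR]])
      (use B sub finZ one disj in "auto simp: Z_def")
   then show "ratf Z (%z. Q (S - B) z*(om B*(alp z * R B z)))" by (simp add: mult_ac)
  next
   show "ratf Z (%z. 1/(1 - z) * R S z)"
    by (rule ratf_mult[OF ralp(2) rR]) (use one finZ in "auto simp: Z_def")
  qed
  have limR: "(R B \<longlongrightarrow> R B u) (at u)" if "!!b. b \<in> B ==> 1 - u*x b ~= 0" for B u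
   unfolding R_def bt_def by (intro tendsto_intros that)
  have limP: "(P B \<longlongrightarrow> P B u) (at u)" if "!!b. b \<in> B ==> x b - u ~= 0" for B u
   unfolding P_def by (intro tendsto_intros that)
  have limQ: "(Q B \<longlongrightarrow> Q B u) (at u)" if "!!b. b \<in> B ==> u - x b ~= 0" for B u
   unfolding Q_def by (intro tendsto_intros that)
  have limalp: "(alp \<longlongrightarrow> alp u) (at u)" if "u ~= 1" for u
   unfolding alp_def by (intro tendsto_intros) (use that in auto)
  have "((%z. (z - a)*(H z - K z)) \<longlongrightarrow> 0) (at a)" if a: "a \<in> Z" for a
  proof -
   consider "a = 1" | d where "d \<in> S" "a = x d" | c where "c \<in> S" "a = 1/x c"
    using a by (auto simp: Z_def)
   then show ?thesis
   proof cases
    \<comment> \<open>At \<open>z = 1\<close> the cross factors of \<open>z\<close> coincide with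
      its interaction factors, so they combine to the product \<open>R S 1\<close> for every
      \<open>B\<close>, and the residue of \<open>H\<close> is a multiple of the sum known for
      \<open>S\<close>.\<close>
    case 1
    define g where "g z = (\<Sum>B\<in>Pow S. hl_cross x t B (S - B)*((z - 1)*P B z * om B + Q (S - B) z*(om B*(- z) * R B z)))
      - hl_total x t S*(- 1) * R S z" for z
    have "(g \<longlongrightarrow> (\<Sum>B\<in>Pow S. hl_cross x t B (S - B)*((1 - 1)*P B 1 * om B + Q (S - B) 1*(om B*(- 1) * R B 1)))
      - hl_total x t S*(- 1) * R S 1) (at 1)"
     unfolding g_def
     by (intro tendsto_intros limP limQ limR) (use nz in auto)
    moreover have "(\<Sum>B\<in>Pow S. hl_cross x t B (S - B)*((1 - 1)*P B 1 * om B + Q (S - B) 1*(om B*(- 1) * R B 1)))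
      = (\<Sum>B\<in>Pow S. hl_cross x t B (S - B) * om B)*(- R S 1)"
     unfolding sum_distrib_right
    proof (intro sum.cong refl)
     fix B assume "B \<in> Pow S"
     then have "R S 1 = R (S - B) 1 * R B 1" unfolding R_def by (intro prod.subset_diff) (use S' in auto)
     moreover have "Q (S - B) 1 = R (S - B) 1" by (simp add: Q_def R_def bt_def)
     ultimately show "hl_cross x t B (S - B)*((1 - 1)*P B 1 * om B + Q (S - B) 1*(om B*(- 1) * R B 1)) =
       hl_cross x t B (S - B) * om B*(- R S 1)" by simp
    qed
    ultimately have "(g \<longlongrightarrow> 0) (at 1)" using IH[OF order_refl] by simp
    moreover have "\<forall>\<^sub>F z in at 1. g z = (z - 1)*(H z - K z)"
     unfolding eventually_at_filter
    proof (intro always_eventually allI impI)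
     fix z :: complex assume z: "z ~= 1"
     have alpz: "(z - 1)*alp z = - z" "(z - 1)*(1/(1 - z)) = - 1"
      using z by (simp_all add: alp_def divide_simps) (simp_all add: algebra_simps)
     have "(z - 1)*T B z = hl_cross x t B (S - B)*((z - 1)*P B z * om B + Q (S - B) z*(om B*(- z) * R B z))" for B
      unfolding T_def alpz(1)[symmetric] by (simp add: algebra_simps)
     moreover have "(z - 1)*K z = hl_total x t S*(- 1) * R S z"
      unfolding K_def alpz(2)[symmetric] by simp
     ultimately show "g z = (z - 1)*(H z - K z)"
      by (simp add: g_def H_def right_diff_distrib sum_distrib_left)
    qed
    ultimately show ?thesis unfolding 1 by (rule Lim_transform_eventually)
   next
    case 2
    have "((%z. (z - x d)*H z) \<longlongrightarrow> 0) (at (x d))"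
     unfolding H_def T_def P_def Q_def R_def
    proof (rule hl_sum_no_pole[OF S'(3) 2(1) inj])
     show "isCont alp (x d)" unfolding alp_def by (intro continuous_intros) (use nz 2 in auto)
     show "isCont (%z. bt z (x b)) (x d)" if "b \<in> S" for b
      unfolding bt_def by (intro continuous_intros) (use nn 2 that in auto)
     show "om (insert d B) = om B*alp (x d)*(\<Prod>b\<in>B. bt (x d) (x b))" if "B \<subseteq> S - {d}" for B
      using om_insert[of B d] that sub by (auto simp: R_def subset_Diff_insert)
    qed
    moreover have "((%z. (z - x d)*K z) \<longlongrightarrow> (x d - x d)*K (x d)) (at (x d))"
     unfolding K_def by (intro tendsto_intros limR) (use nn nz 2 in auto)
    ultimately have "((%z. (z - x d)*H z - (z - x d)*K z) \<longlongrightarrow> 0 - (x d - x d)*K (x d)) (at (x d))"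
     by (rule tendsto_diff)
    then show ?thesis by (simp add: 2 right_diff_distrib)
   next
    \<comment> \<open>At \<open>z = 1/x c\<close> only the terms with \<open>c\<close> and
      \<open>z\<close> both above the cut have a pole. There the cross factors of \<open>z\<close>
      turn into interactions of \<open>c\<close> and the interactions of \<open>z\<close> into cross
      factors of \<open>c\<close>, which leaves the sum known for \<open>S0\<close>.\<close>
    case 3
    define u where "u = 1/x c"
    define S0 where "S0 = S - {c}"
    have S0: "finite S0" "c \<notin> S0" "S = insert c S0" using S' 3 by (auto simp: S0_def)
    have c: "x c ~= 0" "x c ~= 1" using nz 3 by auto
    have u: "u ~= 1" "u*x c = 1" "x c*u = 1" using c by (auto simp: u_def)
    have u1: "1 - u*x b ~= 0" if "b \<in> S0" for b
    proof -
     have "b ~= c" "b \<in> S" using that S0 by auto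
     from neq[OF this(2) 3(1) this(1)] show ?thesis using c(1) by (auto simp: u_def field_simps)
    qed
    have u2: "x b - u ~= 0" if "b \<in> S" for b
     using nn[OF that 3(1)] c(1) by (auto simp: u_def field_simps)
    define W where "W A = (\<Prod>a\<in>A. (x c - t*x a)/(x c - x a))" for A
    define g where "g z = (\<Sum>B\<in>Pow S0. (z - u)*T B z + hl_cross x t (insert c B) (S0 - B) *
      ((z - u)*P (insert c B) z * om (insert c B) +
       Q (S0 - B) z*(om (insert c B)*alp z*(- u*(1 - t*z*x c) * R B z))))
      - hl_total x t S*(1/(1 - z))*(- u*(1 - t*z*x c) * R S0 z)" for z
    have "(g \<longlongrightarrow> (\<Sum>B\<in>Pow S0. (u - u)*T B u + hl_cross x t (insert c B) (S0 - B) *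
      ((u - u)*P (insert c B) u * om (insert c B) +
       Q (S0 - B) u*(om (insert c B)*alp u*(- u*(1 - t*u*x c) * R B u))))
      - hl_total x t S*(1/(1 - u))*(- u*(1 - t*u*x c) * R S0 u)) (at u)"
     unfolding g_def T_def
     by (intro tendsto_intros limP limQ limR limalp) (use u u1 u2 S0 in auto)
    moreover have "(\<Sum>B\<in>Pow S0. (u - u)*T B u + hl_cross x t (insert c B) (S0 - B) *
      ((u - u)*P (insert c B) u * om (insert c B) +
       Q (S0 - B) u*(om (insert c B)*alp u*(- u*(1 - t*u*x c) * R B u)))) =
      (\<Sum>B\<in>Pow S0. hl_cross x t B (S0 - B) * om B) *
       (alp (x c)*alp u*(- u*(1 - t))*W S0 * R S0 (x c))"
     unfolding sum_distrib_right
    proof (intro sum.cong refl)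
     fix B assume B: "B \<in> Pow S0"
     then have fB: "finite B" "c \<notin> B" using S0 by (auto intro: finite_subset)
     have w: "W S0 = W (S0 - B)*W B" "R S0 (x c) = R (S0 - B) (x c) * R B (x c)"
      unfolding W_def R_def by (intro prod.subset_diff; use B S0 in auto)+
     have 1: "hl_cross x t (insert c B) (S0 - B) = W (S0 - B)*hl_cross x t B (S0 - B)"
      unfolding W_def by (rule hl_cross_insert_left) (use fB in auto)
     have q: "(u - t * v)/(u - v) = bt (x c) v" for v
     proof -
      have "u - t * v = (1 - t*x c * v)/x c" "u - v = (1 - x c * v)/x c"
       using c(1) by (simp_all add: u_def diff_divide_distrib)
      then show ?thesis using c(1) by (simp add: bt_def)
     qed
     have r: "bt u v = (x c - t * v)/(x c - v)" for v
     proof -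
      have "1 - t*u * v = (x c - t * v)/x c" "1 - u * v = (x c - v)/x c"
       using c(1) by (simp_all add: u_def diff_divide_distrib)
      then show ?thesis using c(1) by (simp add: bt_def)
     qed
     have 2: "Q (S0 - B) u = R (S0 - B) (x c)" by (simp add: Q_def R_def q)
     have 3: "R B u = W B" by (simp add: W_def R_def r)
     show "(u - u)*T B u + hl_cross x t (insert c B) (S0 - B) *
      ((u - u)*P (insert c B) u * om (insert c B) +
       Q (S0 - B) u*(om (insert c B)*alp u*(- u*(1 - t*u*x c) * R B u))) =
      hl_cross x t B (S0 - B) * om B*(alp (x c)*alp u*(- u*(1 - t))*W S0 * R S0 (x c))"
      unfolding w 1 2 3 om_insert[OF fB] using u by (simp add: mult.assoc mult_ac)
    qed
    moreover have "hl_total x t S*(1/(1 - u))*(- u*(1 - t*u*x c) * R S0 u) =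
      hl_total x t S0*(alp (x c)*alp u*(- u*(1 - t))*W S0 * R S0 (x c))"
    proof -
     have a: "R S0 u = W S0" unfolding R_def W_def
     proof (intro prod.cong refl)
      fix v
      have "1 - t*u*x v = (x c - t*x v)/x c" "1 - u*x v = (x c - x v)/x c"
       using c(1) by (simp_all add: u_def diff_divide_distrib)
      then show "bt u (x v) = (x c - t*x v)/(x c - x v)" using c(1) by (simp add: bt_def)
     qed
     have b: "hl_total x t S = hl_total x t S0*(1/(1 - x c)) * R S0 (x c)"
      unfolding S0(3) hl_total_insert[OF S0(1,2)] by (simp add: R_def bt_def)
     have c': "(1/(1 - x c))*(1/(1 - u)) = alp (x c)*alp u"
      using u by (simp add: alp_def)
     have d: "1 - t*u*x c = 1 - t" using u by simp
     have "hl_total x t S*(1/(1 - u))*(- u*(1 - t*u*x c) * R S0 u) =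
       hl_total x t S0*((1/(1 - x c))*(1/(1 - u)))*(- u*(1 - t)*W S0 * R S0 (x c))"
      unfolding a b d by (simp only: mult_ac)
     then show ?thesis unfolding c' by (simp only: mult_ac)
    qed
    ultimately have "(g \<longlongrightarrow> 0) (at u)"
     using IH[of S0] S0(3) by (simp add: subset_insertI)
    moreover have "\<forall>\<^sub>F z in at u. g z = (z - u)*(H z - K z)"
     unfolding eventually_at_filter
    proof (intro always_eventually allI impI)
     fix z :: complex assume z: "z ~= u"
     have "1 - z*x c = - x c*(z - u)" using u by (simp add: algebra_simps)
     then have b: "(z - u)*bt z (x c) = - u*(1 - t*z*x c)"
      using z c(1) by (simp add: bt_def u_def)
     have Ri: "(z - u) * R (insert c B) z = - u*(1 - t*z*x c) * R B z" if "finite B" "c \<notin> B" for B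
      using that b by (simp add: R_def mult.assoc[symmetric])
     have "(z - u)*T (insert c B) z = hl_cross x t (insert c B) (S0 - B) *
      ((z - u)*P (insert c B) z * om (insert c B) +
       Q (S0 - B) z*(om (insert c B)*alp z*(- u*(1 - t*z*x c) * R B z)))"
      if "B \<in> Pow S0" for B
     proof -
      have fB: "finite B" "c \<notin> B" using S0 that by (auto intro: finite_subset)
      have e: "S - insert c B = S0 - B" using S0 by auto
      show ?thesis unfolding T_def e Ri[OF fB, symmetric] by (simp add: algebra_simps)
     qed
     moreover have "(z - u)*K z = hl_total x t S*(1/(1 - z))*(- u*(1 - t*z*x c) * R S0 z)"
      unfolding K_def Ri[OF S0(1,2), symmetric] S0(3)[symmetric] by (simp add: mult_ac)
     moreover have "H z = (\<Sum>B\<in>Pow S0. T B z + T (insert c B) z)"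
      unfolding H_def by (subst S0(3), rule sum_Pow_insert[OF S0(1,2)])
     ultimately show "g z = (z - u)*(H z - K z)"
      by (simp add: g_def right_diff_distrib sum_distrib_left distrib_left)
    qed
    ultimately show ?thesis unfolding 3(2) u_def[symmetric] by (rule Lim_transform_eventually)
   qed
  qed
  from ratf_no_poles[OF rHK this] obtain C where C: "!!z. z \<notin> Z ==> H z - K z = C" by blast
  \<comment> \<open>The constant is determined at \<open>z = 0\<close>, where \<open>H\<close> is
    the sum known for \<open>S\<close> and \<open>K\<close> is
    \<open>hl_total x t S\<close>.\<close>
  have "0 \<notin> Z" using nz by (auto simp: Z_def)
  moreover have "H 0 = hl_total x t S"
  proof -
   have "P B 0 = 1" if "B \<in> Pow S" for B
    unfolding P_def using that nz by (intro prod.neutral) auto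
   then have "H 0 = (\<Sum>B\<in>Pow S. hl_cross x t B (S - B) * om B)"
    unfolding H_def T_def by (intro sum.cong) (auto simp: alp_def)
   then show ?thesis using IH by simp
  qed
  moreover have "K 0 = hl_total x t S" by (simp add: K_def R_def bt_def)
  ultimately have "C = 0" using C[of 0] by simp
  moreover have "x j ~= 1/x i" if "i \<in> S" for i
   using jv(4)[OF that] nz(1)[OF that] by auto
  then have "x j \<notin> Z" using jv(2,3) by (auto simp: Z_def)
  ultimately have "H (x j) = K (x j)" using C[of "x j"] by simp
  also have "H (x j) = hl_conv x t (%_. 1) (%B. (\<Prod>i\<in>B. x i)*hl_total x t B) S'"
   unfolding S'(1) hl_conv_insert[OF S'(3,2)] H_def T_def
  proof (intro sum.cong refl)
   fix B assume "B \<in> Pow S"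
   then have "finite B" "j \<notin> B" using sub S' by auto
   from om_insert[OF this]
   show "hl_cross x t B (S - B)*(P B (x j) * om B + Q (S - B) (x j)*(om B*alp (x j) * R B (x j))) =
    hl_cross x t B (S - B) *
    ((\<Prod>b\<in>B. (x b - t*x j)/(x b - x j))*1*((\<Prod>i\<in>B. x i)*hl_total x t B) +
     (\<Prod>a\<in>S - B. (x j - t*x a)/(x j - x a))*1*((\<Prod>i\<in>insert j B. x i)*hl_total x t (insert j B)))"
    by (simp add: P_def Q_def om_def)
  qed
  also have "K (x j) = hl_total x t S'"
   unfolding S'(1) hl_total_insert[OF S'(3,2)] by (simp add: K_def R_def bt_def)
  finally show ?thesis .
 qed
qed

theorem partial_fractions_indexed:
 assumes "inj_on p I" "ratf (p ` I) f"
  and "!!i. i \<in> I ==> ((%z. (z - p i)*f z) \<longlongrightarrow> r i) (at (p i))"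
  and "(f \<longlongrightarrow> L) at_infinity" "z \<notin> p ` I"
 shows "f z = L + (\<Sum>i\<in>I. r i/(z - p i))"
proof -
 have "f z = L + (\<Sum>a\<in>p ` I. r (inv_into I p a)/(z - a))"
  by (rule partial_fractions[OF assms(2) _ assms(4,5)]) (use assms(1,3) in auto)
 also have "(\<Sum>a\<in>p ` I. r (inv_into I p a)/(z - a)) = (\<Sum>i\<in>I. r i/(z - p i))"
  by (subst sum.reindex[OF assms(1)]) (use assms(1) in auto)
 finally show ?thesis .
qed

section \<open>Sums over sign changes\<close>

definition flip_inverse :: "(nat => complex) => nat set => nat => complex" where
 "flip_inverse x B i = (if i \<in> B then 1/x i else x i)"

definition hl_phi :: "(nat => complex) => complex => complex => nat set => complex" where
 "hl_phi y t s S = (\<Prod>i\<in>S. 1 + s*y i)*hl_total y t S"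

text \<open>The summand is symmetric in the variables, so of the hyperoctahedral group only the sign
  changes remain, indexed by the set \<open>B\<close> of inverted variables.\<close>

definition bc_sum :: "(nat => complex) => complex => complex => nat => nat set => complex" where
 "bc_sum x t s m S = (\<Sum>B\<in>Pow S. (\<Prod>i\<in>B. x i^m)*hl_phi (flip_inverse x B) t s S)"

text \<open>The coefficient with which a variable of value \<open>u\<close> is attached to the
  variables of \<open>T\<close> in \<open>bc_sum_rec\<close>. It does not change when variables of
  \<open>T\<close> are inverted.\<close>

definition bc_coeff :: "(nat => complex) => complex => complex => nat set => complex => complex" where
 "bc_coeff x t s T u = (1 + s*u)/(1 - u) *
   (\<Prod>j\<in>T. ((1 - t*u*x j)*(1 - t*u/x j))/((1 - u*x j)*(1 - u/x j)))"

lemma hl_phi_insert: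
 assumes "finite S" "k \<notin> S"
 shows "hl_phi y t s (insert k S) =
  hl_phi y t s S*((1 + s*y k)/(1 - y k))*(\<Prod>i\<in>S. (1 - t*y k*y i)/(1 - y k*y i))"
 using assms by (simp add: hl_phi_def hl_total_insert)

lemma hl_phi_cong: "(!!i. i \<in> S ==> x i = y i) ==> hl_phi x t s S = hl_phi y t s S"
 unfolding hl_phi_def by (intro arg_cong2[of _ _ _ _ "(*)"] prod.cong hl_total_cong) auto

text \<open>Between an inverted \<open>1/x b\<close> and an unchanged \<open>x a\<close> the pair
  factor \<open>(1 - t*x a/x b)/(1 - x a/x b)\<close> is the Hall-Littlewood factor of
  \<open>x b\<close> and \<open>x a\<close>. Hence \<open>bc_sum\<close> is a convolution.\<close>

lemma hl_phi_flip:
 assumes "finite S" "B \<subseteq> S" "!!i. i \<in> S ==> x i ~= 0"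
 shows "hl_phi (flip_inverse x B) t s S =
  hl_phi x t s (S - B)*hl_phi (%i. 1/x i) t s B*hl_cross x t B (S - B)"
proof -
 let ?y = "flip_inverse x B"
 let ?A = "S - B"
 have fin: "finite ?A" "finite B" using assms by (auto intro: finite_subset)
 have S: "S = ?A \<union> B" "?A \<inter> B = {}" using assms by auto
 let ?h = "%i j. (1 - t*?y i*?y j)/(1 - ?y i*?y j)"
 have c: "(\<Prod>b\<in>B. \<Prod>a\<in>?A. ?h b a) = hl_cross x t B ?A"
  unfolding hl_cross_def
 proof (intro prod.cong refl)
  fix b a assume ba: "b \<in> B" "a \<in> ?A"
  then have b: "x b ~= 0" using assms by auto
  have "?h b a = (1 - t*(1/x b)*x a)/(1 - (1/x b)*x a)"
   using ba by (simp add: flip_inverse_def)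
  also have "1 - t*(1/x b)*x a = (x b - t*x a)/x b" using b by (simp add: diff_divide_distrib)
  also have "1 - (1/x b)*x a = (x b - x a)/x b" using b by (simp add: diff_divide_distrib)
  finally show "?h b a = (x b - t*x a)/(x b - x a)" using b by simp
 qed
 have p: "pair_prod ?h S = pair_prod ?h ?A*pair_prod ?h B*hl_cross x t B ?A"
  by (subst S(1), subst pair_prod_Un[OF fin S(2)]) (auto simp: mult_ac c[symmetric])
 have sp: "(\<Prod>i\<in>S. f i) = (\<Prod>i\<in>?A. f i)*(\<Prod>i\<in>B. f i)" for f :: "nat => complex"
  using assms by (intro prod.subset_diff) auto
 have "hl_phi ?y t s S = hl_phi ?y t s ?A*hl_phi ?y t s B*hl_cross x t B ?A"
  unfolding hl_phi_def hl_total_def p by (simp only: sp mult_ac)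
 also have "hl_phi ?y t s ?A = hl_phi x t s ?A"
  by (rule hl_phi_cong) (auto simp: flip_inverse_def)
 also have "hl_phi ?y t s B = hl_phi (%i. 1/x i) t s B"
  by (rule hl_phi_cong) (auto simp: flip_inverse_def)
 finally show ?thesis .
qed

lemma bc_sum_conv:
 assumes "finite S" "!!i. i \<in> S ==> x i ~= 0"
 shows "bc_sum x t s m S =
  hl_conv x t (hl_phi x t s) (%B. (\<Prod>i\<in>B. x i^m)*hl_phi (%i. 1/x i) t s B) S"
 unfolding bc_sum_def hl_conv_def
 by (intro sum.cong refl) (use hl_phi_flip[OF assms(1) _ assms(2)] in "auto simp: mult_ac")

lemma flip_inverse_distinct:
 assumes "inj_on x S" "!!i j. i \<in> S ==> j \<in> S ==> x i*x j ~= 1" "!!i. i \<in> S ==> x i ~= 0"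
 shows "inj_on (flip_inverse x B) S"
proof (rule inj_onI)
 fix i j assume ij: "i \<in> S" "j \<in> S" "flip_inverse x B i = flip_inverse x B j"
 have "x i = x j"
  using ij assms(2)[OF ij(1,2)] assms(3)[OF ij(1)] assms(3)[OF ij(2)]
  by (auto simp: flip_inverse_def field_simps split: if_splits)
 then show "i = j" using assms(1) ij by (auto dest: inj_onD)
qed

text \<open>The factor \<open>(1 - t^card S)/(1 - t)\<close> is expanded by
  \<open>sum_cross_single\<close>, applied to the variables after inversion, and the sums are
  exchanged. The cross factors of index \<open>i\<close> complete its pair factors to an expression
  that does not depend on which other variables are inverted, so the sum over those is again a
  \<open>bc_sum\<close>.\<close>

lemma bc_sum_rec:
 assumes "finite S" "inj_on x S" "!!i. i \<in> S ==> x i ~= 0"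
  "!!i j. i \<in> S ==> j \<in> S ==> x i*x j ~= 1" "t ~= 1"
 shows "(1 - t^card S)/(1 - t)*bc_sum x t s m S =
  (\<Sum>i\<in>S. (bc_coeff x t s (S - {i}) (x i) + x i^m*bc_coeff x t s (S - {i}) (1/x i)) *
    bc_sum x t s m (S - {i}))"
proof -
 let ?y = "flip_inverse x"
 let ?V = "%B i. \<Prod>j\<in>S - {i}. (?y B j - t*?y B i)/(?y B j - ?y B i)"
 let ?G = "%B i. (\<Prod>i\<in>B. x i^m)*hl_phi (?y B) t s S*?V B i"
 have "(\<Sum>i\<in>S. ?V B i) = (1 - t^card S)/(1 - t)" for B
  by (rule sum_cross_single[OF assms(1) flip_inverse_distinct]) (use assms in "auto simp: flip_inverse_def")
 moreover have "(\<Sum>i\<in>S. ?G B i) = (\<Prod>i\<in>B. x i^m)*hl_phi (?y B) t s S*(\<Sum>i\<in>S. ?V B i)" for B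
  by (rule sum_distrib_left[symmetric])
 ultimately have "(\<Sum>i\<in>S. ?G B i) =
   (1 - t^card S)/(1 - t)*((\<Prod>i\<in>B. x i^m)*hl_phi (?y B) t s S)" for B
  by (simp only: mult.commute)
 then have "(1 - t^card S)/(1 - t)*bc_sum x t s m S = (\<Sum>B\<in>Pow S. \<Sum>i\<in>S. ?G B i)"
  unfolding bc_sum_def by (simp only: sum_distrib_left)
 also have "... = (\<Sum>i\<in>S. \<Sum>B\<in>Pow S. ?G B i)" by (rule sum.swap)
 also have "... = (\<Sum>i\<in>S. (bc_coeff x t s (S - {i}) (x i) + x i^m*bc_coeff x t s (S - {i}) (1/x i)) *
    bc_sum x t s m (S - {i}))"
 proof (intro sum.cong refl)
  fix i assume i: "i \<in> S"
  define T where "T = S - {i}"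
  have T: "finite T" "i \<notin> T" "S = insert i T" using i assms by (auto simp: T_def)
  have key: "hl_phi (?y B) t s S*?V B i = hl_phi (?y B) t s T*bc_coeff x t s T (?y B i)" for B
  proof -
   have "(\<Prod>j\<in>T. (1 - t*?y B i*?y B j)/(1 - ?y B i*?y B j))*?V B i =
     (\<Prod>j\<in>T. ((1 - t*?y B i*x j)*(1 - t*?y B i/x j))/((1 - ?y B i*x j)*(1 - ?y B i/x j)))"
    unfolding T_def[symmetric] prod.distrib[symmetric]
   proof (intro prod.cong refl)
    fix j assume j: "j \<in> T"
    then have nz: "x j ~= 0" using assms(3) T by auto
    define u where "u = ?y B i"
    have "(?y B j - t*u)/(?y B j - u) = (1 - t*u/?y B j)/(1 - u/?y B j)"
    proof -
     have "?y B j ~= 0" using nz by (simp add: flip_inverse_def)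
     then have "1 - t*u/?y B j = (?y B j - t*u)/?y B j" "1 - u/?y B j = (?y B j - u)/?y B j"
      by (simp_all add: diff_divide_distrib)
     then show ?thesis using \<open>?y B j ~= 0\<close> by simp
    qed
    then show "(1 - t*u*?y B j)/(1 - u*?y B j)*((?y B j - t*u)/(?y B j - u)) =
      ((1 - t*u*x j)*(1 - t*u/x j))/((1 - u*x j)*(1 - u/x j))"
     using nz by (simp add: flip_inverse_def mult_ac)
   qed
   moreover have "hl_phi (?y B) t s S = hl_phi (?y B) t s T*((1 + s*?y B i)/(1 - ?y B i)) *
     (\<Prod>j\<in>T. (1 - t*?y B i*?y B j)/(1 - ?y B i*?y B j))"
    by (subst T(3), rule hl_phi_insert[OF T(1,2)])
   ultimately show ?thesis unfolding bc_coeff_def by (simp only: mult.assoc)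
  qed
  have "(\<Sum>B\<in>Pow S. ?G B i) = (\<Sum>B\<in>Pow T. ?G B i + ?G (insert i B) i)"
   by (subst T(3), rule sum_Pow_insert[OF T(1,2)])
  also have "... = (\<Sum>B\<in>Pow T. (bc_coeff x t s T (x i) + x i^m*bc_coeff x t s T (1/x i)) *
    ((\<Prod>i\<in>B. x i^m)*hl_phi (?y B) t s T))"
  proof (intro sum.cong refl)
   fix B assume "B \<in> Pow T"
   then have B: "i \<notin> B" "finite B" using T by (auto intro: finite_subset)
   have "hl_phi (?y (insert i B)) t s T = hl_phi (?y B) t s T"
    by (rule hl_phi_cong) (use T in "auto simp: flip_inverse_def")
   then show "?G B i + ?G (insert i B) i = (bc_coeff x t s T (x i) + x i^m*bc_coeff x t s T (1/x i)) *
    ((\<Prod>i\<in>B. x i^m)*hl_phi (?y B) t s T)"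
    unfolding mult.assoc key using B by (simp add: flip_inverse_def algebra_simps)
  qed
  finally show "(\<Sum>B\<in>Pow S. ?G B i) =
   (bc_coeff x t s (S - {i}) (x i) + x i^m*bc_coeff x t s (S - {i}) (1/x i))*bc_sum x t s m (S - {i})"
   unfolding T_def[symmetric] bc_sum_def by (simp add: sum_distrib_left)
 qed
 finally show ?thesis .
qed

text \<open>The recursion expresses the value at a set through values at smaller sets, and its
  leading factor is nonzero as \<open>t\<close> is not a root of unity. It serves to recognise
  \<open>bc_sum\<close> in other expressions.\<close>

lemma rec_unique:
 fixes F G :: "nat set => complex"
 assumes "finite S" "G {} = c*F {}" "!!n. n \<ge> 1 ==> t^n ~= 1"
  and "!!T. T \<subseteq> S ==> T ~= {} ==> (1 - t^card T)/(1 - t)*F T = (\<Sum>i\<in>T. a T i*F (T - {i}))"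
  and "!!T. T \<subseteq> S ==> T ~= {} ==> (1 - t^card T)/(1 - t)*G T = (\<Sum>i\<in>T. a T i*G (T - {i}))"
 shows "G S = c*F S"
 using assms
proof (induction S rule: finite_psubset_induct)
 case (psubset S)
 show ?case
 proof (cases "S = {}")
  case False
  have IH: "G (S - {i}) = c*F (S - {i})" if "i \<in> S" for i
  proof (rule psubset.IH)
   show "S - {i} \<subset> S" using that by auto
   fix T assume T: "T \<subseteq> S - {i}" "T ~= {}"
   then have "T \<subseteq> S" by auto
   with T(2) show "(1 - t^card T)/(1 - t)*F T = (\<Sum>i\<in>T. a T i*F (T - {i}))"
    "(1 - t^card T)/(1 - t)*G T = (\<Sum>i\<in>T. a T i*G (T - {i}))"
    using psubset.prems(3,4) by blast+
  qed (use psubset.prems in auto)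
  have "card S \<ge> 1" using False psubset.hyps by (simp add: Suc_le_eq card_gt_0_iff)
  then have nz: "(1 - t^card S)/(1 - t) ~= 0"
   using psubset.prems(2)[of "card S"] psubset.prems(2)[of 1] by auto
  have "(1 - t^card S)/(1 - t)*G S = c*((1 - t^card S)/(1 - t)*F S)"
   using psubset.prems(3)[OF order_refl False] psubset.prems(4)[OF order_refl False]
   by (simp add: IH sum_distrib_left mult_ac)
  then show ?thesis using nz by (simp add: mult.left_commute)
 qed (use psubset in auto)
qed

section \<open>Partial fractions invariant under inversion\<close>

definition refl_prod :: "(nat => complex) => complex => nat set => complex => complex" where
 "refl_prod x t S u = (\<Prod>j\<in>S. ((1 - t*u*x j)*(1 - t*u/x j))/((1 - u*x j)*(1 - u/x j)))"

lemma bc_coeff_refl_prod: "bc_coeff x t s T u = (1 + s*u)/(1 - u)*refl_prod x t T u"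
 by (simp add: bc_coeff_def refl_prod_def)

lemma ratf_refl_prod:
 assumes "finite S" "inj_on x S" "!!i. i \<in> S ==> x i ~= 0"
  "!!i j. i \<in> S ==> j \<in> S ==> x i*x j ~= 1"
 shows "ratf (x ` S \<union> (%i. 1/x i) ` S) (refl_prod x t S)"
proof -
 have 1: "ratf (x ` S) (%u. \<Prod>j\<in>S. (1 - t*u/x j)/(1 - u/x j))"
 proof (rule ratf_prod[OF assms(1) _ assms(2)])
  show "ratf {x i} (%u. (1 - t*u/x i)/(1 - u/x i))" if "i \<in> S" for i
   by (rule ratf_mobius[of _ "- t/x i" 1 "- 1/x i" 1]) (use assms(3)[OF that] in auto)
 qed
 have 2: "ratf ((%i. 1/x i) ` S) (%u. \<Prod>j\<in>S. (1 - t*u*x j)/(1 - u*x j))"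
 proof (rule ratf_prod[OF assms(1)])
  show "ratf {1/x i} (%u. (1 - t*u*x i)/(1 - u*x i))" if "i \<in> S" for i
   by (rule ratf_mobius[of _ "- t*x i" 1 "- x i" 1]) (use assms(3)[OF that] in "auto simp: mult_ac")
  show "inj_on (%i. 1/x i) S" using assms(2) by (auto simp: inj_on_def)
 qed
 have "ratf (x ` S \<union> (%i. 1/x i) ` S)
   (%u. (\<Prod>j\<in>S. (1 - t*u/x j)/(1 - u/x j))*(\<Prod>j\<in>S. (1 - t*u*x j)/(1 - u*x j)))"
  by (rule ratf_mult_disjoint[OF 1 2]) (use assms(3,4) in "fastforce simp: field_simps")
 then show ?thesis
  by (rule ratf_cong) (simp add: refl_prod_def prod.distrib[symmetric] mult.commute)
qed

lemma refl_prod_at_infinity: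
 assumes "!!i. i \<in> S ==> x i ~= 0"
 shows "(refl_prod x t S \<longlongrightarrow> t^(2 * card S)) at_infinity"
proof -
 have "((%u. \<Prod>j\<in>S. ((- t*x j)*u + 1)/((- x j)*u + 1)*(((- t/x j)*u + 1)/((- 1/x j)*u + 1))) \<longlongrightarrow>
   (\<Prod>j\<in>S. (- t*x j)/(- x j)*((- t/x j)/(- 1/x j)))) at_infinity"
  by (intro tendsto_prod tendsto_mult mobius_at_infinity) (use assms in auto)
 moreover have "(\<Prod>j\<in>S. (- t*x j)/(- x j)*((- t/x j)/(- 1/x j))) = (\<Prod>j\<in>S. t\<^sup>2)"
  by (intro prod.cong refl) (use assms in "auto simp: power2_eq_square")
 moreover have "(%u. \<Prod>j\<in>S. ((- t*x j)*u + 1)/((- x j)*u + 1)*(((- t/x j)*u + 1)/((- 1/x j)*u + 1)))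
   = refl_prod x t S"
  by (auto simp: refl_prod_def fun_eq_iff mult_ac intro!: prod.cong)
 ultimately show ?thesis by (simp add: power_mult)
qed

lemma refl_prod_lim:
 assumes "!!j. j \<in> S ==> 1 - u*x j ~= 0" "!!j. j \<in> S ==> 1 - u/x j ~= 0" "!!j. j \<in> S ==> x j ~= 0"
 shows "(refl_prod x t S \<longlongrightarrow> refl_prod x t S u) (at u)"
 unfolding refl_prod_def by (intro tendsto_intros) (use assms in auto)

text \<open>Inverting \<open>x i\<close> leaves the product unchanged, so both poles can be treated
  at once with \<open>u\<close> in the place of \<open>x i\<close>.\<close>

lemma refl_prod_pole:
 assumes "finite S" "inj_on x S" "!!i. i \<in> S ==> x i ~= 0"
  "!!i j. i \<in> S ==> j \<in> S ==> x i*x j ~= 1"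
  and i: "i \<in> S" and u: "u = x i \<or> u = 1/x i"
 shows "((%z. (z - u)*refl_prod x t S z) \<longlongrightarrow>
   - u*(1 - t)*(1 - t*u^2)/(1 - u^2)*refl_prod x t (S - {i}) u) (at u)"
proof -
 have nz: "x i ~= 0" "x i*x i ~= 1" "u ~= 0" using assms by auto
 have "u*u ~= 1" using u nz by (elim disjE) simp_all
 then have u2: "1 - u*u ~= 0" by auto
 define h where "h z = - u*((1 - t*z*u)*(1 - t*z/u))/(1 - z*u)" for z
 have "((%z. h z*refl_prod x t (S - {i}) z) \<longlongrightarrow> h u*refl_prod x t (S - {i}) u) (at u)"
  unfolding h_def
 proof (intro tendsto_intros refl_prod_lim)
  fix j assume j: "j \<in> S - {i}"
  then have "x j ~= x i" using assms(2) i by (auto dest: inj_onD)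
  moreover have "x j ~= 0" "x i*x j ~= 1" using assms(3)[of j] assms(4)[of i j] i j by auto
  ultimately have "u*x j ~= 1" "u ~= x j" using u nz(1) by (auto simp: divide_eq_eq mult.commute)
  then show "1 - u*x j ~= 0" "1 - u/x j ~= 0" using \<open>x j ~= 0\<close> by auto
 qed (use assms nz u2 in auto)
 moreover have "h u = - u*(1 - t)*(1 - t*u^2)/(1 - u^2)"
  using nz by (simp add: h_def power2_eq_square mult_ac)
 moreover have "\<forall>\<^sub>F z in at u. h z*refl_prod x t (S - {i}) z = (z - u)*refl_prod x t S z"
  unfolding eventually_at_filter
 proof (intro always_eventually allI impI)
  fix z assume z: "z ~= u"
  have e: "((1 - t*z*x i)*(1 - t*z/x i))/((1 - z*x i)*(1 - z/x i)) =
    ((1 - t*z*u)*(1 - t*z/u))/((1 - z*u)*(1 - z/u))"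
   using u nz by (auto simp: mult.commute)
  have "(z - u)/(1 - z/u) = - u"
   using z nz(3) by (simp add: divide_simps) (simp add: algebra_simps)
  moreover have "(z - u)*(((1 - t*z*u)*(1 - t*z/u))/((1 - z*u)*(1 - z/u))) =
    (z - u)/(1 - z/u)*((1 - t*z*u)*(1 - t*z/u))/(1 - z*u)"
   by simp
  ultimately have "(z - u)*(((1 - t*z*u)*(1 - t*z/u))/((1 - z*u)*(1 - z/u))) = h z"
   by (simp only: h_def)
  then show "h z*refl_prod x t (S - {i}) z = (z - u)*refl_prod x t S z"
   unfolding refl_prod_def prod.remove[OF assms(1) i] e by (simp only: mult.assoc[symmetric])
 qed
 ultimately show ?thesis using Lim_transform_eventually by fastforce
qed

text \<open>At \<open>u = 1/s\<close> the numerator of each factor consists of the same two terms as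
  its denominator, up to the factor \<open>t = s^2\<close>. The pole at \<open>1/s\<close> thus
  supplies the power of \<open>t\<close> in the recursions.\<close>

lemma refl_prod_inverse_s:
 assumes "!!j. j \<in> S ==> x j ~= 0 \<and> x j * s ~= 1 \<and> x j ~= s" "t = s^2" "s ~= 0"
 shows "refl_prod x t S (1/s) = t^card S"
proof -
 have "((1 - t*(1/s)*x j)*(1 - t*(1/s)/x j))/((1 - (1/s)*x j)*(1 - (1/s)/x j)) = t"
  if "j \<in> S" for j
 proof -
  have nz: "x j ~= 0" "1 - s*x j ~= 0" "x j - s ~= 0" "s ~= 0"
   using assms(1)[OF that] assms(3) by (auto simp: mult.commute)
  have e: "1 - t*(1/s)*x j = 1 - s*x j" "1 - t*(1/s)/x j = (x j - s)/x j"
   "1 - (1/s)*x j = - (x j - s)/s" "1 - (1/s)/x j = - (1 - s*x j)/(s*x j)"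
   using nz by (simp_all add: assms(2) power2_eq_square field_simps)
  have "(A*(B/x j))/((- B/s)*(- A/(s*x j))) = t" if "A ~= 0" "B ~= 0" for A B
   using that nz by (simp add: assms(2) power2_eq_square)
  from this[OF nz(2,3)] show ?thesis unfolding e .
 qed
 then show ?thesis by (simp add: refl_prod_def)
qed

lemma sum_two_times:
 assumes "a ~= b" shows "(\<Sum>i\<in>{a, b} \<times> S. h i) = (\<Sum>i\<in>S. h (a, i) + h (b, i))"
proof -
 have "(\<Sum>i\<in>{a, b} \<times> S. h i) = (\<Sum>(c, i)\<in>{a, b} \<times> S. h (c, i))" by simp
 also have "... = (\<Sum>c\<in>{a, b}. \<Sum>i\<in>S. h (c, i))" by (rule sum.cartesian_product[symmetric])
 finally show ?thesis using assms by (simp add: sum.distrib)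
qed

lemma recip_nonzero:
 fixes v y a :: complex
 assumes "v = y \<or> v = 1/y" "y ~= 0" "a ~= 0" "y*a ~= 1" "y ~= a"
 shows "1 - v * a ~= 0 \<and> 1 - v/a ~= 0"
 using assms(1)
proof
 assume v: "v = y"
 show ?thesis unfolding v using assms(2-) by auto
next
 assume v: "v = 1/y"
 have "1 - 1/y*a = (y - a)/y" "1 - 1/y/a = (y*a - 1)/(y*a)"
  using assms(2,3) by (simp_all add: diff_divide_distrib)
 then show ?thesis unfolding v using assms(2-) by simp
qed

text \<open>Expansion of \<open>refl_prod x t S\<close> times a function \<open>G\<close> that
  vanishes at infinity, evaluated at 0, where \<open>refl_prod\<close> is 1. The residues at
  \<open>x i\<close> and \<open>1/x i\<close> are given in the form \<open>c\<close>, those of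
  \<open>G\<close> by \<open>r\<close>. It is applied with two choices of \<open>G\<close>, for the
  product in \<open>bc_sum_1\<close> and for the torus kernel in \<open>torus_pf\<close>.\<close>

lemma refl_partial_fractions:
 assumes S: "finite S" "inj_on x S" "!!i. i \<in> S ==> x i ~= 0"
  "!!i j. i \<in> S ==> j \<in> S ==> x i*x j ~= 1"
  and J: "inj_on P J" "ratf (P ` J) G" "0 \<notin> P ` J"
  and d: "!!i j. i \<in> S ==> j \<in> J ==> x i ~= P j \<and> x i*P j ~= 1"
  and res: "!!j. j \<in> J ==> ((%z. (z - P j)*G z) \<longlongrightarrow> r j) (at (P j))"
  and G: "!!i u. i \<in> S ==> u = x i \<or> u = 1/x i ==> (G \<longlongrightarrow> G u) (at u)" "(G \<longlongrightarrow> 0) at_infinity"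
  and c: "!!i u. i \<in> S ==> u = x i \<or> u = 1/x i ==>
   (1 - t*u^2)/(1 - u^2)*refl_prod x t (S - {i}) u*G u = c i u"
 shows "G 0 = (1 - t)*(\<Sum>i\<in>S. c i (x i) + c i (1/x i)) + (\<Sum>j\<in>J. refl_prod x t S (P j)*r j/(0 - P j))"
proof -
 have fJ: "finite J" using ratf_finite[OF J(2)] J(1) by (rule finite_imageD)
 define p where "p = case_sum (%(a, i). if a then x i else 1/x i) P"
 define I where "I = {True, False} \<times> S <+> J"
 define f where "f u = refl_prod x t S u*G u" for u
 define R where "R = case_sum (%(a, i). - p (Inl (a, i))*((1 - t) * c i (p (Inl (a, i))))) (%j. refl_prod x t S (P j)*r j)"
 have pv: "p (Inl (True, i)) = x i" "p (Inl (False, i)) = 1/x i" "p (Inr j) = P j" for i j by (simp_all add: p_def)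
 have ne: "x i ~= P j" "1/x i ~= P j" "P j ~= x i" "P j ~= 1/x i" if "i \<in> S" "j \<in> J" for i j
  using d[OF that] S(3)[OF that(1)] by (auto simp: divide_eq_eq mult.commute)
 have ne': "x i ~= 1/x j" "1/x j ~= x i" if "i \<in> S" "j \<in> S" for i j
  using S(4)[OF that] S(3)[OF that(2)] by (auto simp: divide_eq_eq)
 have inj: "inj_on p I"
 proof (rule inj_onI)
  fix v w assume "v \<in> I" "w \<in> I" "p v = p w"
  then show "v = w"
   using inj_onD[OF J(1)] inj_onD[OF S(2)] ne ne' by (auto simp: I_def pv)
 qed
 have I: "I = (Inl \<circ> Pair True) ` S \<union> (Inl \<circ> Pair False) ` S \<union> Inr ` J" by (auto simp: I_def)
 have pI: "p ` I = (x ` S \<union> (%i. 1/x i) ` S) \<union> P ` J"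
  unfolding I by (simp only: image_Un image_image comp_apply pv)
 have rf: "ratf (p ` I) f"
  unfolding pI f_def
  by (intro ratf_mult_disjoint ratf_refl_prod J(2)) (use S ne in blast)+
 have lim: "(f \<longlongrightarrow> 0) at_infinity"
  using tendsto_mult[OF refl_prod_at_infinity G(2), of S x t] S(1,3) by (simp add: f_def[abs_def])
 have "f 0 = 0 + (\<Sum>i\<in>I. R i/(0 - p i))"
 proof (rule partial_fractions_indexed[OF inj rf _ lim])
  fix v assume "v \<in> I"
  then consider (1) a i where "v = Inl (a, i)" "i \<in> S" | (2) j where "v = Inr j" "j \<in> J"
   by (auto simp: I_def)
  then show "((%z. (z - p v)*f z) \<longlongrightarrow> R v) (at (p v))"
  proof cases
   case 1
   define u where "u = p v"
   have u: "u = x i \<or> u = 1/x i" using 1 by (auto simp: u_def p_def)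
   have "((%z. (z - u)*refl_prod x t S z*G z) \<longlongrightarrow>
     - u*(1 - t)*(1 - t*u^2)/(1 - u^2)*refl_prod x t (S - {i}) u*G u) (at u)"
    by (intro tendsto_mult refl_prod_pole[OF S 1(2) u] G(1)[OF 1(2) u])
   moreover have "- u*(1 - t)*(1 - t*u^2)/(1 - u^2)*refl_prod x t (S - {i}) u*G u = R v"
    using c[OF 1(2) u, symmetric] 1 by (simp add: R_def u_def)
   ultimately show ?thesis by (simp add: f_def u_def[symmetric] mult.assoc)
  next
   case 2
   have "((%z. refl_prod x t S z*((z - P j)*G z)) \<longlongrightarrow> refl_prod x t S (P j)*r j) (at (P j))"
   proof (intro tendsto_mult refl_prod_lim res 2)
    fix i assume i: "i \<in> S"
    show "1 - P j*x i ~= 0" "1 - P j/x i ~= 0" "x i ~= 0"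
     using d[OF i 2(2)] S(3)[OF i] by (auto simp: mult.commute)
   qed
   then show ?thesis by (simp add: 2 pv R_def f_def mult_ac)
  qed
 next
  show "0 \<notin> p ` I" unfolding pI using S(3) J(3) by auto
 qed
 also have "(\<Sum>i\<in>I. R i/(0 - p i)) =
   (\<Sum>i\<in>S. R (Inl (True, i))/(0 - p (Inl (True, i))) + R (Inl (False, i))/(0 - p (Inl (False, i)))) +
   (\<Sum>j\<in>J. R (Inr j)/(0 - p (Inr j)))"
  unfolding I_def using S(1) fJ by (subst sum.Plus) (simp_all add: sum_two_times comp_def)
 also have "(\<Sum>i\<in>S. R (Inl (True, i))/(0 - p (Inl (True, i))) + R (Inl (False, i))/(0 - p (Inl (False, i)))) =
   (1 - t)*(\<Sum>i\<in>S. c i (x i) + c i (1/x i))"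
  unfolding sum_distrib_left
 proof (rule sum.cong)
  fix i assume i: "i \<in> S"
  have z: "(- u*A)/(0 - u) = A" if "u ~= 0" for u A :: complex using that by simp
  have "R (Inl (True, i))/(0 - p (Inl (True, i))) = (1 - t) * c i (x i)"
   unfolding R_def pv sum.case prod.case by (rule z[OF S(3)[OF i]])
  moreover have "R (Inl (False, i))/(0 - p (Inl (False, i))) = (1 - t) * c i (1/x i)"
   unfolding R_def pv sum.case prod.case by (rule z) (use S(3)[OF i] in simp)
  ultimately show "R (Inl (True, i))/(0 - p (Inl (True, i))) + R (Inl (False, i))/(0 - p (Inl (False, i))) =
   (1 - t)*(c i (x i) + c i (1/x i))" by (simp only: distrib_left)
 qed simp
 finally show ?thesis by (simp add: f_def refl_prod_def R_def pv)
qed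

lemma mobius_pole:
 assumes "s ~= 0" "(h \<longlongrightarrow> h (1/s)) (at (1/s))"
 shows "((%z :: complex. (z - 1/s)*(h z/(1 - s*z))) \<longlongrightarrow> - (1/s)*h (1/s)) (at (1/s))"
proof (rule Lim_transform_eventually)
 show "((%z. - (1/s)*h z) \<longlongrightarrow> - (1/s)*h (1/s)) (at (1/s))"
  by (intro tendsto_mult tendsto_const assms)
 show "\<forall>\<^sub>F z in at (1/s). - (1/s)*h z = (z - 1/s)*(h z/(1 - s*z))"
  unfolding eventually_at_filter
 proof (intro always_eventually allI impI)
  fix z assume "z ~= 1/s"
  then have "1 - s*z ~= 0" using assms(1) by (auto simp: field_simps)
  moreover have "z - 1/s = - (1/s)*(1 - s*z)" using assms(1) by (simp add: field_simps)
  ultimately show "- (1/s)*h z = (z - 1/s)*(h z/(1 - s*z))" by simp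
 qed
qed

text \<open>The product on the right satisfies the recursion of \<open>bc_sum\<close> for exponent
  1. This is the expansion for \<open>G u = 1/(1 - s*u)\<close>: of
  \<open>1 - t*u^2 = (1 - s*u)*(1 + s*u)\<close> only the second factor survives, as
  \<open>bc_coeff\<close> requires, and the pole at \<open>1/s\<close> yields
  \<open>t^card T\<close>.\<close>

lemma bc_sum_1:
 assumes "finite S" "inj_on x S" "!!i. i \<in> S ==> x i ~= 0"
  "!!i. i \<in> S ==> norm (x i) < 1" "t = s^2" "s ~= 0" "norm s < 1" "!!i. i \<in> S ==> x i ~= s"
 shows "bc_sum x t s 1 S = (\<Prod>i\<in>S. 1 + x i)"
proof -
 have nn: "x i*x j ~= 1" if "i \<in> S" "j \<in> S" for i j
 proof -
  have "norm (x i*x j) < 1*1"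
   unfolding norm_mult by (intro mult_strict_mono assms(4) that) auto
  then show ?thesis by auto
 qed
 have t1: "t^n ~= 1" if "n \<ge> 1" for n
 proof -
  have "norm s^(2*n) < 1" using assms(7) that by (simp add: power_less_one_iff)
  then show ?thesis unfolding assms(5) by (metis norm_one norm_power power_mult less_irrefl)
 qed
 have t1': "t ~= 1" using t1[of 1] by simp
 have base: "1 - t^card T = (1 - t)*(\<Sum>i\<in>T. bc_coeff x t s (T - {i}) (x i)/(1 + x i) +
   bc_coeff x t s (T - {i}) (1/x i)/(1 + 1/x i))" if T: "T \<subseteq> S" for T
 proof -
  have fT: "finite T" "inj_on x T" using T assms by (auto intro: finite_subset inj_on_subset)
  have xs: "x i * s ~= 1" if "i \<in> T" for i
  proof -
   have "norm (x i * s) < 1*1"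
    unfolding norm_mult by (intro mult_strict_mono assms(4,7)) (use that T in auto)
   then show ?thesis by auto
  qed
  have nT: "x i*x j ~= 1" if "i \<in> T" "j \<in> T" for i j using nn that T by blast
  have su: "1 - s*u ~= 0" if "i \<in> T" "u = x i \<or> u = 1/x i" for i u
   using recip_nonzero[OF that(2) _ assms(6) xs[OF that(1)]] assms(3,8) that(1) T by (auto simp: mult.commute)
  have "1/(1 - s*0) = (1 - t)*(\<Sum>i\<in>T. bc_coeff x t s (T - {i}) (x i)/(1 + x i) +
    bc_coeff x t s (T - {i}) (1/x i)/(1 + 1/x i)) +
   (\<Sum>j\<in>{()}. refl_prod x t T (1/s)*(- (1/s)*1)/(0 - 1/s))"
  proof (rule refl_partial_fractions[OF fT])
   show "ratf ((%_. 1/s) ` {()}) (%u. 1/(1 - s*u))"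
    using ratf_mobius[of "%u. 1/(1 - s*u)" 0 1 "- s" 1 "1/s"] assms(6) by simp
   show "((%z. (z - 1/s)*(1/(1 - s*z))) \<longlongrightarrow> - (1/s)*1) (at (1/s))"
    by (rule mobius_pole[where h = "%_. 1"]) (use assms(6) in auto)
   have "((%u. (0*u + 1)/(- s*u + 1)) \<longlongrightarrow> 0/- s) at_infinity"
    by (rule mobius_at_infinity) (use assms(6) in auto)
   then show "((%u. 1/(1 - s*u)) \<longlongrightarrow> 0) at_infinity" by simp
   fix i assume i: "i \<in> T"
   show "x i ~= 1/s \<and> x i*(1/s) ~= 1"
    using xs[OF i] assms(6) assms(8)[of i] i T by (auto simp: eq_divide_eq)
   fix u assume u: "u = x i \<or> u = 1/x i"
   show "((%u. 1/(1 - s*u)) \<longlongrightarrow> 1/(1 - s*u)) (at u)" by (intro tendsto_intros su[OF i u])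
   have "1 - t*u^2 = (1 - s*u)*(1 + s*u)" "1 - u^2 = (1 - u)*(1 + u)"
    by (simp_all add: assms(5) power2_eq_square algebra_simps)
   then show "(1 - t*u^2)/(1 - u^2)*refl_prod x t (T - {i}) u*(1/(1 - s*u)) =
     bc_coeff x t s (T - {i}) u/(1 + u)"
    using su[OF i u] by (simp add: bc_coeff_refl_prod)
  qed (use T assms(3,6) nT in auto)
  also have "refl_prod x t T (1/s) = t^card T"
   by (rule refl_prod_inverse_s) (use T assms(3,5,6,8) xs in auto)
  finally show ?thesis using assms(6) by (simp add: sum_distrib_left algebra_simps)
 qed
 have "(\<Prod>i\<in>S. 1 + x i) = 1*bc_sum x t s 1 S"
 proof (rule rec_unique[OF assms(1) _ t1])
  show "(\<Prod>i\<in>{}. 1 + x i) = 1*bc_sum x t s 1 {}"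
   by (simp add: bc_sum_def hl_phi_def hl_total_def)
  fix T assume T: "T \<subseteq> S" "T ~= {}"
  have fT: "finite T" "inj_on x T" using T assms by (auto intro: finite_subset inj_on_subset)
  let ?a = "%T i. bc_coeff x t s (T - {i}) (x i) + x i^1*bc_coeff x t s (T - {i}) (1/x i)"
  show "(1 - t^card T)/(1 - t)*bc_sum x t s 1 T = (\<Sum>i\<in>T. ?a T i*bc_sum x t s 1 (T - {i}))"
   by (rule bc_sum_rec[OF fT _ _ t1']) (use T assms(3) nn in blast)+
  have "(1 - t^card T)/(1 - t)*(\<Prod>i\<in>T. 1 + x i) =
   (\<Sum>i\<in>T. (bc_coeff x t s (T - {i}) (x i)/(1 + x i) +
   bc_coeff x t s (T - {i}) (1/x i)/(1 + 1/x i))*(\<Prod>i\<in>T. 1 + x i))"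
   unfolding base[OF T(1)] using t1' by (simp add: sum_distrib_right)
  also have "... = (\<Sum>i\<in>T. ?a T i*(\<Prod>i\<in>T - {i}. 1 + x i))"
  proof (intro sum.cong refl)
   fix i assume i: "i \<in> T"
   have nz: "x i ~= 0" "1 + x i ~= 0"
    using i T assms(3) assms(4)[of i] by (auto simp: add_eq_0_iff)
   have e: "1/(1 + 1/x i) = x i/(1 + x i)"
   proof -
    have "1 + 1/x i = (1 + x i)/x i" using nz by (simp add: add_divide_distrib)
    then show ?thesis by simp
   qed
   have "c/(1 + 1/x i) = x i * c/(1 + x i)" for c
   proof -
    have "c/(1 + 1/x i) = c*(1/(1 + 1/x i))" by simp
    then show ?thesis unfolding e by simp
   qed
   then have "bc_coeff x t s (T - {i}) (x i)/(1 + x i) +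
     bc_coeff x t s (T - {i}) (1/x i)/(1 + 1/x i) = ?a T i/(1 + x i)"
    by (simp add: add_divide_distrib)
   then show "(bc_coeff x t s (T - {i}) (x i)/(1 + x i) +
     bc_coeff x t s (T - {i}) (1/x i)/(1 + 1/x i))*(\<Prod>i\<in>T. 1 + x i) = ?a T i*(\<Prod>i\<in>T - {i}. 1 + x i)"
    unfolding prod.remove[OF fT(1) i] using nz by simp
  qed
  finally show "(1 - t^card T)/(1 - t)*(\<Prod>i\<in>T. 1 + x i) = (\<Sum>i\<in>T. ?a T i*(\<Prod>i\<in>T - {i}. 1 + x i))" .
 qed
 then show ?thesis by simp
qed

section \<open>Induction on the largest part\<close>

definition bounded_wt :: "complex => nat => nat => nat => complex" where
 "bounded_wt s m r N = (if r = 0 \<or> r = m then 1 else qpoch (- s) s N)"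

lemma hl_levels_cong: "(!!r. r \<le> M ==> c r = c' r) ==> hl_levels x t c M = hl_levels x t c' M"
 by (induction M) auto

lemma hl_conv_scale:
 assumes "finite S"
 shows "hl_conv x t (%A. (\<Prod>i\<in>A. v i)*f A) (%A. (\<Prod>i\<in>A. v i)*g A) S = (\<Prod>i\<in>S. v i)*hl_conv x t f g S"
 unfolding hl_conv_def sum_distrib_left
proof (intro sum.cong refl)
 fix B assume "B \<in> Pow S"
 then have "(\<Prod>i\<in>S. v i) = (\<Prod>i\<in>S - B. v i)*(\<Prod>i\<in>B. v i)"
  using assms by (intro prod.subset_diff) auto
 then show "hl_cross x t B (S - B)*((\<Prod>i\<in>S - B. v i)*f (S - B))*((\<Prod>i\<in>B. v i)*g B) =
   (\<Prod>i\<in>S. v i)*(hl_cross x t B (S - B)*f (S - B)*g B)"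
  by (simp add: mult_ac)
qed

text \<open>The weight of the lower block is itself the convolution of 1 with \<open>s^card\<close>.
  After reassociation \<open>s^card\<close> meets the upper block, and the two collapse to the
  product of the \<open>x i + s\<close> by \<open>hl_conv_elementary\<close>.\<close>

lemma hl_conv_add_level:
 assumes "finite S" "inj_on x S" "!!i. i \<in> S ==> x i ~= 0" "t = s^2" "s ~= 0"
 shows "hl_conv x t (%A. qpoch (- s) s (card A)) (%B. \<Prod>i\<in>B. x i) S =
  hl_conv x t (%_. 1) (%B. \<Prod>i\<in>B. x i + s) S"
proof -
 have sub: "finite A" "inj_on x A" "!!i. i \<in> A ==> x i ~= 0" if "A \<subseteq> S" for A
  using that assms by (auto intro: finite_subset inj_on_subset)
 have "hl_conv x t (%A. qpoch (- s) s (card A)) (%B. \<Prod>i\<in>B. x i) S =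
   hl_conv x t (hl_conv x t (%_. 1) (%B. s^card B)) (%B. \<Prod>i\<in>B. x i) S"
  by (rule hl_conv_cong) (use sub in "simp_all add: hl_conv_const assms(4) rogers_szego_sqrt")
 also have "... = hl_conv x t (%_. 1) (hl_conv x t (%B. s^card B) (%B. \<Prod>i\<in>B. x i)) S"
  by (rule hl_conv_assoc[OF assms(1)])
 also have "... = hl_conv x t (%_. 1) (%B. \<Prod>i\<in>B. x i + s) S"
 proof (rule hl_conv_cong)
  fix A assume A: "A \<subseteq> S"
  have "hl_conv x t (%B. s^card B) (%B. \<Prod>i\<in>B. x i) A =
    hl_conv x t (%B. (\<Prod>i\<in>B. s)*1) (%B. (\<Prod>i\<in>B. s)*(\<Prod>i\<in>B. (1/s)*x i)) A"
  proof (rule hl_conv_cong)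
   fix C
   show "(\<Prod>i\<in>C. x i) = (\<Prod>i\<in>C. s)*(\<Prod>i\<in>C. (1/s)*x i)"
    unfolding prod.distrib[symmetric] using assms(5) by simp
  qed simp
  also have "... = (\<Prod>i\<in>A. s)*(\<Prod>i\<in>A. 1 + (1/s)*x i)"
   unfolding hl_conv_scale[OF sub(1)[OF A]] using hl_conv_elementary[OF sub[OF A], of t "1/s"] by simp
  also have "... = (\<Prod>i\<in>A. x i + s)"
   unfolding prod.distrib[symmetric] using assms(5) by (intro prod.cong) (auto simp: field_simps)
  finally show "hl_conv x t (%B. s^card B) (%B. \<Prod>i\<in>B. x i) A = (\<Prod>i\<in>A. x i + s)" .
 qed simp
 finally show ?thesis .
qed

lemma hl_cross_inverse:
 assumes "!!i. i \<in> A \<union> B ==> x i ~= 0"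
 shows "hl_cross (%i. 1/x i) t A B = hl_cross x t B A"
 unfolding hl_cross_def
proof (subst prod.swap, intro prod.cong refl)
 fix a b assume "b \<in> B" "a \<in> A"
 then have nz: "x a ~= 0" "x b ~= 0" using assms by auto
 then have "1/x a - t*(1/x b) = (x b - t*x a)/(x a*x b)" "1/x a - 1/x b = (x b - x a)/(x a*x b)"
  by (simp_all add: diff_divide_distrib)
 then show "(1/x a - t*(1/x b))/(1/x a - 1/x b) = (x b - t*x a)/(x b - x a)"
  using nz by simp
qed

text \<open>Taking complements turns a convolution in \<open>x\<close> into one in
  \<open>1/x\<close> with the blocks exchanged. So this is \<open>hl_conv_total\<close> at the
  inverted variables, scaled by \<open>x^Suc m*(1 + s/x)\<close>, where
  \<open>x + s = x*(1 + s/x)\<close> makes the second block fit.\<close>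

lemma hl_conv_phi_inverse:
 assumes "finite S" "inj_on x S" "!!i. i \<in> S ==> x i ~= 0" "!!i. i \<in> S ==> x i ~= 1"
  "!!i j. i \<in> S ==> j \<in> S ==> x i*x j ~= 1"
 shows "hl_conv x t (%A. (\<Prod>i\<in>A. x i^m)*hl_phi (%i. 1/x i) t s A)
   (%B. (\<Prod>i\<in>B. x i^m)*(\<Prod>i\<in>B. x i + s)) S =
  (\<Prod>i\<in>S. x i^Suc m)*hl_phi (%i. 1/x i) t s S"
proof -
 let ?y = "%i. 1/x i"
 have "hl_conv x t (%A. (\<Prod>i\<in>A. x i^m)*hl_phi ?y t s A) (%B. (\<Prod>i\<in>B. x i^m)*(\<Prod>i\<in>B. x i + s)) S =
   hl_conv x t (%A. (\<Prod>i\<in>A. x i^Suc m*(1 + s*?y i))*((\<Prod>i\<in>A. ?y i)*hl_total ?y t A))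
    (%B. (\<Prod>i\<in>B. x i^Suc m*(1 + s*?y i))*1) S"
 proof (rule hl_conv_cong)
  fix A assume A: "A \<subseteq> S"
  have "(\<Prod>i\<in>A. x i^m)*(\<Prod>i\<in>A. 1 + s*?y i) = (\<Prod>i\<in>A. x i^Suc m*(1 + s*?y i))*(\<Prod>i\<in>A. ?y i)"
   unfolding prod.distrib[symmetric] by (intro prod.cong refl) (use A assms(3) in auto)
  then show "(\<Prod>i\<in>A. x i^m)*hl_phi ?y t s A =
    (\<Prod>i\<in>A. x i^Suc m*(1 + s*?y i))*((\<Prod>i\<in>A. ?y i)*hl_total ?y t A)"
   unfolding hl_phi_def by (simp only: mult.assoc[symmetric])
  show "(\<Prod>i\<in>A. x i^m)*(\<Prod>i\<in>A. x i + s) = (\<Prod>i\<in>A. x i^Suc m*(1 + s*?y i))*1"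
   unfolding mult_1_right prod.distrib[symmetric]
  proof (intro prod.cong refl)
   fix i assume "i \<in> A"
   then have "x i ~= 0" using A assms(3) by auto
   then show "x i^m*(x i + s) = x i^Suc m*(1 + s*?y i)" by (simp add: field_simps)
  qed
 qed
 also have "... = (\<Prod>i\<in>S. x i^Suc m*(1 + s*?y i)) *
   hl_conv x t (%A. (\<Prod>i\<in>A. ?y i)*hl_total ?y t A) (%_. 1) S"
  by (rule hl_conv_scale[OF assms(1)])
 also have "hl_conv x t (%A. (\<Prod>i\<in>A. ?y i)*hl_total ?y t A) (%_. 1) S =
   hl_conv ?y t (%_. 1) (%A. (\<Prod>i\<in>A. ?y i)*hl_total ?y t A) S"
  unfolding hl_conv_def
 proof (rule sum.reindex_bij_witness[of _ "%B. S - B" "%B. S - B"])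
  fix B assume "B \<in> Pow S"
  then have e: "S - (S - B) = B" and B: "B \<subseteq> S" by auto
  show "hl_cross ?y t (S - B) (S - (S - B))*1*((\<Prod>i\<in>S - B. ?y i)*hl_total ?y t (S - B)) =
   hl_cross x t B (S - B)*((\<Prod>i\<in>S - B. ?y i)*hl_total ?y t (S - B))*1"
   unfolding e by (subst hl_cross_inverse) (use B assms(3) in auto)
 qed auto
 also have "... = hl_total ?y t S"
 proof (rule hl_conv_total[OF assms(1)])
  show "inj_on ?y S" using assms(2) by (auto simp: inj_on_def)
  show "?y i*?y j ~= 1" if "i \<in> S" "j \<in> S" for i j using assms(5)[OF that] by simp
 qed (use assms(3,4) in auto)
 finally show ?thesis by (simp add: hl_phi_def prod.distrib mult_ac)
qed

text \<open>The left-hand side is the weighted sum of \<open>P\<^sub>\<lambda>(x; t)\<close> over \<open>\<lambda>\<^sub>1 \<le> Suc m\<close>.\<close>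

theorem bounded_littlewood:
 assumes "finite S" "inj_on x S" "!!i. i \<in> S ==> x i ~= 0"
  "!!i. i \<in> S ==> norm (x i) < 1" "t = s^2" "s ~= 0" "norm s < 1" "!!i. i \<in> S ==> x i ~= s"
 shows "hl_levels x t (bounded_wt s (Suc m)) (Suc m) S = bc_sum x t s (Suc m) S"
 using assms(1-4,8)
proof (induction m arbitrary: S)
 case 0
 have "hl_levels x t (bounded_wt s (Suc 0)) (Suc 0) S = hl_conv x t (%_. 1) (%B. \<Prod>i\<in>B. 1*x i) S"
  by (simp add: bounded_wt_def[abs_def])
 also have "... = bc_sum x t s 1 S"
  using hl_conv_elementary[OF 0(1,2,3), where t = t and c = 1] bc_sum_1[OF 0(1,2,3,4) assms(5-7) 0(5)] by simp
 finally show ?case by simp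
next
 case (Suc m)
 have nn: "x i*x j ~= 1" if "i \<in> S" "j \<in> S" for i j
 proof -
  have "norm (x i*x j) < 1*1"
   unfolding norm_mult by (intro mult_strict_mono Suc.prems(4) that) auto
  then show ?thesis by auto
 qed
 have n1: "x i ~= 1" if "i \<in> S" for i using Suc.prems(4)[OF that] by auto
 have sub: "finite A" "inj_on x A" "!!i. i \<in> A ==> x i ~= 0" "!!i. i \<in> A ==> x i ~= 1"
   "!!i. i \<in> A ==> norm (x i) < 1" "!!i. i \<in> A ==> x i ~= s"
  if "A \<subseteq> S" for A
  using that Suc.prems n1 by (auto intro: finite_subset inj_on_subset)
 define M where "M = hl_levels x t (bounded_wt s (Suc m)) m"
 let ?h = "%A. qpoch (- s) s (card A)"
 let ?y = "%i. 1/x i"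
 let ?xm = "%B. \<Prod>i\<in>B. x i^Suc m"
 have M: "hl_levels x t (bounded_wt s (Suc (Suc m))) m = M"
  unfolding M_def by (rule hl_levels_cong) (auto simp: bounded_wt_def[abs_def])
 \<comment> \<open>The former top level \<open>Suc m\<close> becomes an intermediate one of weight
   \<open>(-s; s)\<close>, and a new top level of weight 1 is added.\<close>
 have "hl_levels x t (bounded_wt s (Suc (Suc m))) (Suc (Suc m)) S =
   hl_conv x t (hl_conv x t M (%B. ?xm B*?h B)) (%B. ?xm B*(\<Prod>i\<in>B. x i)) S"
  unfolding hl_levels.simps M by (simp add: bounded_wt_def prod.distrib mult_ac)
 also have "... = hl_conv x t M (hl_conv x t (%B. ?xm B*?h B) (%B. ?xm B*(\<Prod>i\<in>B. x i))) S"
  by (rule hl_conv_assoc[OF Suc.prems(1)])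
 \<comment> \<open>The weight of the former top level returns to 1, so that the induction hypothesis
   applies, at the cost of \<open>x i\<close> turning into \<open>x i + s\<close> on the new
   level.\<close>
 also have "... = hl_conv x t M (hl_conv x t (%B. ?xm B*1) (%B. ?xm B*(\<Prod>i\<in>B. x i + s))) S"
  by (rule hl_conv_cong[OF refl], subst (1 2) hl_conv_scale)
    (use sub in "simp_all add: hl_conv_add_level[OF _ _ _ assms(5,6)]")
 also have "... = hl_conv x t (hl_conv x t M (%B. ?xm B*1)) (%B. ?xm B*(\<Prod>i\<in>B. x i + s)) S"
  by (rule hl_conv_assoc[OF Suc.prems(1), symmetric])
 also have "... = hl_conv x t (bc_sum x t s (Suc m)) (%B. ?xm B*(\<Prod>i\<in>B. x i + s)) S"
 proof (rule hl_conv_cong)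
  fix A assume A: "A \<subseteq> S"
  have "hl_conv x t M (%B. ?xm B*1) A = hl_levels x t (bounded_wt s (Suc m)) (Suc m) A"
   unfolding M_def by (simp add: bounded_wt_def)
  also have "... = bc_sum x t s (Suc m) A"
   by (rule Suc.IH) (use sub[OF A] in auto)
  finally show "hl_conv x t M (%B. ?xm B*1) A = bc_sum x t s (Suc m) A" .
 qed simp
 also have "... = hl_conv x t (hl_conv x t (hl_phi x t s) (%B. ?xm B*hl_phi ?y t s B))
   (%B. ?xm B*(\<Prod>i\<in>B. x i + s)) S"
  by (rule hl_conv_cong) (use sub in "simp_all add: bc_sum_conv")
 also have "... = hl_conv x t (hl_phi x t s)
   (hl_conv x t (%B. ?xm B*hl_phi ?y t s B) (%B. ?xm B*(\<Prod>i\<in>B. x i + s))) S"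
  by (rule hl_conv_assoc[OF Suc.prems(1)])
 also have "... = hl_conv x t (hl_phi x t s) (%B. (\<Prod>i\<in>B. x i^Suc (Suc m))*hl_phi ?y t s B) S"
 proof (rule hl_conv_cong)
  fix A assume A: "A \<subseteq> S"
  show "hl_conv x t (%B. ?xm B*hl_phi ?y t s B) (%B. ?xm B*(\<Prod>i\<in>B. x i + s)) A =
   (\<Prod>i\<in>A. x i^Suc (Suc m))*hl_phi ?y t s A"
   by (rule hl_conv_phi_inverse[OF sub(1-4)[OF A]]) (use A nn in blast)+
 qed simp
 also have "... = bc_sum x t s (Suc (Suc m)) S"
  by (rule bc_sum_conv[symmetric]) (use Suc.prems in auto)
 finally show ?case .
qed

section \<open>Antisymmetric functions and determinants\<close>

definition leib :: "nat => (nat => nat => complex) => complex" where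
 "leib n A = (\<Sum>p | p permutes {..<n}. of_int (sign p)*(\<Prod>i<n. A i (p i)))"

lemma leib_cong: "(!!i j. i < n ==> j < n ==> A i j = B i j) ==> leib n A = leib n B"
 unfolding leib_def
proof (intro sum.cong arg_cong2[of _ _ _ _ "(*)"] refl prod.cong)
 fix p i assume "!!i j. i < n ==> j < n ==> A i j = B i j" "p \<in> {p. p permutes {..<n}}" "i \<in> {..<n}"
 then show "A i (p i) = B i (p i)" using permutes_in_image[of p "{..<n}" i] by auto
qed

lemma leib_permute_rows:
 assumes w: "w permutes {..<n}"
 shows "leib n (%i. A (w i)) = of_int (sign w)*leib n A"
proof -
 have "leib n (%i. A (w i)) = (\<Sum>p | p permutes {..<n}. of_int (sign (p \<circ> w))*(\<Prod>i<n. A (w i) ((p \<circ> w) i)))"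
  unfolding leib_def by (rule sum_permutations_compose_right[OF w])
 also have "... = (\<Sum>p | p permutes {..<n}. of_int (sign w)*(of_int (sign p)*(\<Prod>i<n. A i (p i))))"
 proof (intro sum.cong refl)
  fix p assume "p \<in> {p. p permutes {..<n}}"
  then have p: "p permutes {..<n}" by simp
  have "sign (p \<circ> w) = sign p * sign w"
   using p w by (intro sign_compose) (auto simp: permutation_permutes)
  moreover have "(\<Prod>i<n. A (w i) ((p \<circ> w) i)) = (\<Prod>i<n. A i (p i))"
   using prod.permute[OF w, of "%i. A i (p i)"] by (simp add: o_def)
  ultimately show "of_int (sign (p \<circ> w))*(\<Prod>i<n. A (w i) ((p \<circ> w) i)) =
    of_int (sign w)*(of_int (sign p)*(\<Prod>i<n. A i (p i)))" by simp
 qed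
 finally show ?thesis by (simp add: leib_def sum_distrib_left)
qed

lemma leib_transpose: "leib n (%i j. A j i) = leib n A"
proof -
 have "leib n (%i j. A j i) = (\<Sum>p | p permutes {..<n}. of_int (sign (inv p))*(\<Prod>i<n. A (inv p i) i))"
  unfolding leib_def by (rule sum_permutations_inverse)
 also have "... = leib n A"
  unfolding leib_def
 proof (intro sum.cong refl)
  fix p assume "p \<in> {p. p permutes {..<n}}"
  then have p: "p permutes {..<n}" by simp
  have "sign (inv p) = sign p" using p by (intro sign_inverse) (auto simp: permutation_permutes)
  moreover have "(\<Prod>i<n. A (inv p i) i) = (\<Prod>i<n. A i (p i))"
   using prod.permute[OF p, of "%i. A (inv p i) i"] permutes_inverses(2)[OF p] by (simp add: o_def)
  ultimately show "of_int (sign (inv p))*(\<Prod>i<n. A (inv p i) i) = of_int (sign p)*(\<Prod>i<n. A i (p i))" by simp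
 qed
 finally show ?thesis .
qed

lemma leib_equal_rows:
 assumes "i < n" "j < n" "i ~= j" "!!c. c < n ==> A i c = A j c"
 shows "leib n A = 0"
proof -
 have w: "Transposition.transpose i j permutes {..<n}" by (rule permutes_swap_id) (use assms in auto)
 have "leib n A = leib n (%k. A (Transposition.transpose i j k))"
  by (rule leib_cong) (use assms(4) in "auto simp: Transposition.transpose_def")
 also have "... = - leib n A"
  using leib_permute_rows[OF w, of A] assms(3) by (simp add: sign_swap_id)
 finally show ?thesis by (simp add: eq_neg_iff_add_eq_0)
qed

lemma leib_row_linear:
 assumes "k < n"
 shows "leib n (%i. if i = k then (%j. \<Sum>b\<in>I. c b*B b j) else A i) =
  (\<Sum>b\<in>I. c b*leib n (%i. if i = k then B b else A i))"
proof -
 have *: "(\<Prod>i<n. (if i = k then r else A i) (p i)) = r (p k)*(\<Prod>i\<in>{..<n} - {k}. A i (p i))" for r p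
  using assms by (subst prod.remove[of _ k]) (auto intro!: prod.cong)
 show ?thesis
  unfolding leib_def * sum_distrib_left sum_distrib_right
  by (subst sum.swap) (simp add: mult_ac)
qed

lemma leib_row_expand:
 assumes "k < n"
 shows "leib n (%i. if i = k then r else A i) =
  (\<Sum>c<n. r c*leib n (%i. if i = k then (%j. of_bool (j = c)) else A i))"
proof -
 have "leib n (%i. if i = k then r else A i) =
   leib n (%i. if i = k then (%j. \<Sum>c<n. r c * of_bool (j = c)) else A i)"
 proof (rule leib_cong)
  fix i j assume "i < n" "j < n"
  moreover have "r c * of_bool (j = c) = (if c = j then r c else 0)" for c by simp
  ultimately show "(if i = k then r else A i) j =
    (if i = k then (%j. \<Sum>c<n. r c * of_bool (j = c)) else A i) j"
   by (simp only: if_distribR sum.delta[OF finite_lessThan]) simp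
 qed
 also have "... = (\<Sum>c<n. r c*leib n (%i. if i = k then (%j. of_bool (j = c)) else A i))"
  by (rule leib_row_linear[OF assms, where B = "%c j. of_bool (j = c)"])
 finally show ?thesis .
qed

lemma leib_last_unit_row:
 "leib (Suc n) (%i. if i = n then (%j. of_bool (j = n)) else A i) = leib n A"
proof -
 let ?B = "%i. if i = n then (%j. of_bool (j = n)) else A i"
 have "leib (Suc n) ?B = (\<Sum>p | p permutes {..<n}. of_int (sign p)*(\<Prod>i<Suc n. ?B i (p i)))"
  unfolding leib_def
 proof (rule sum.mono_neutral_right)
  show "{p. p permutes {..<n}} \<subseteq> {p. p permutes {..<Suc n}}"
  proof clarify
   fix p assume "p permutes {..<n}"
   then show "p permutes {..<Suc n}" by (rule permutes_subset) auto
  qed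
  show "\<forall>p\<in>{p. p permutes {..<Suc n}} - {p. p permutes {..<n}}. of_int (sign p)*(\<Prod>i<Suc n. ?B i (p i)) = 0"
  proof
   fix p assume p: "p \<in> {p. p permutes {..<Suc n}} - {p. p permutes {..<n}}"
   have "p n ~= n"
   proof
    assume pn: "p n = n"
    have "p permutes {..<n}"
    proof (rule permutes_superset[of p "{..<Suc n}"])
     show "p permutes {..<Suc n}" using p by simp
     show "p x = x" if "x \<in> {..<Suc n} - {..<n}" for x
     proof -
      have "x = n" using that by auto
      then show ?thesis using pn by simp
     qed
    qed
    with p show False by simp
   qed
   then have "(\<Prod>i<Suc n. ?B i (p i)) = 0" by (intro prod_zero) auto
   then show "of_int (sign p)*(\<Prod>i<Suc n. ?B i (p i)) = 0" by (simp only: mult_zero_right)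
  qed
 qed (simp add: finite_permutations)
 also have "... = leib n A"
  unfolding leib_def
 proof (intro sum.cong refl arg_cong2[of _ _ _ _ "(*)"])
  fix p assume "p \<in> {p. p permutes {..<n}}"
  then have "p n = n" using permutes_not_in[of p "{..<n}" n] by simp
  then have "?B n (p n) = 1" by simp
  then show "(\<Prod>i<Suc n. ?B i (p i)) = (\<Prod>i<n. A i (p i))"
   unfolding prod.lessThan_Suc by (simp cong: prod.cong_simp)
 qed
 finally show ?thesis .
qed

text \<open>Cramer's rule: putting the vanishing combination in place of column \<open>a0\<close>
  gives 0 on the one hand and \<open>c a0\<close> times the determinant on the other.\<close>

lemma leib_nonzero_independent:
 assumes "leib n A ~= 0" "!!i. i < n ==> (\<Sum>a<n. c a*A i a) = 0" "a0 < n"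
 shows "c a0 = 0"
proof -
 let ?B = "%a i. A i a"
 have "0 = leib n (%a. if a = a0 then (%i. \<Sum>b\<in>{}. c b*?B b i) else ?B a)"
  using leib_row_linear[OF assms(3), where I = "{}" and c = c and B = ?B and A = ?B] by (simp only: sum.empty)
 also have "... = leib n (%a. if a = a0 then (%i. \<Sum>b<n. c b*?B b i) else ?B a)"
 proof (rule leib_cong)
  fix a i assume "i < n"
  then show "(if a = a0 then (%i. \<Sum>b\<in>{}. c b*?B b i) else ?B a) i =
    (if a = a0 then (%i. \<Sum>b<n. c b*?B b i) else ?B a) i"
   using assms(2)[of i] by (cases "a = a0") simp_all
 qed
 also have "... = (\<Sum>b<n. c b*leib n (%a. if a = a0 then ?B b else ?B a))"
  by (rule leib_row_linear[OF assms(3), where B = ?B])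
 also have "... = (\<Sum>b<n. if b = a0 then c b*leib n ?B else 0)"
 proof (intro sum.cong refl)
  fix b assume b: "b \<in> {..<n}"
  show "c b*leib n (%a. if a = a0 then ?B b else ?B a) = (if b = a0 then c b*leib n ?B else 0)"
  proof (cases "b = a0")
   case True
   have "leib n (%a. if a = a0 then ?B b else ?B a) = leib n ?B"
    by (rule leib_cong) (use True in auto)
   then show ?thesis using True by (simp only: simp_thms if_True)
  next
   case False
   then have "leib n (%a. if a = a0 then ?B b else ?B a) = 0"
    by (intro leib_equal_rows[of b n a0]) (use b assms(3) in auto)
   then show ?thesis using False by (simp only: if_False mult_zero_right)
  qed
 qed
 also have "... = c a0*leib n ?B" using assms(3) by (subst sum.delta) auto
 also have "leib n ?B = leib n A" by (rule leib_transpose)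
 finally show ?thesis using assms(1) by simp
qed

text \<open>The top exterior power of an \<open>n\<close>-dimensional function space is one-dimensional.\<close>

theorem alternating_proportional:
 fixes psi :: "nat => complex => complex" and F :: "(nat => complex) => complex"
 assumes sect: "!!y i. (!!i. i < n ==> y i \<in> D) ==> i < n ==>
   \<exists>c. \<forall>v\<in>D. F (y(i := v)) = (\<Sum>b<n. c b*psi b v)"
  and alt: "!!y w. (!!i. i < n ==> y i \<in> D) ==> w permutes {..<n} ==>
   F (y \<circ> w) = of_int (sign w)*F y"
  and loc: "!!y y'. (!!i. i < n ==> y i = y' i) ==> F y = F y'"
  and z: "!!i. i < n ==> z i \<in> D" "leib n (%i b. psi b (z i)) ~= 0"
  and y: "!!i. i < n ==> y i \<in> D"
 shows "F y*leib n (%i b. psi b (z i)) = F z*leib n (%i b. psi b (y i))"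
proof -
 define H where "H y = leib n (%i b. psi b (y i))" for y
 \<comment> \<open>The coordinates are freed one at a time; those from \<open>m\<close> on are still
   values of \<open>z\<close>.\<close>
 have P: "F y*H z = F z*H y" if "m \<le> n" "!!i. i < n ==> y i \<in> D" "!!i. m \<le> i ==> i < n ==> y i \<in> z ` {..<n}" for m y
  using that
 proof (induction m arbitrary: y)
  case 0
  define f where "f i = (if i < n then SOME j. j < n \<and> y i = z j else i)" for i
  have f: "f i < n" "y i = z (f i)" if "i < n" for i
  proof -
   have "\<exists>j. j < n \<and> y i = z j" using "0.prems"(3)[of i] that by auto
   from someI_ex[OF this] that show "f i < n" "y i = z (f i)" by (auto simp: f_def)
  qed
  \<comment> \<open>All coordinates are values of \<open>z\<close>: either they are a permutation of
    it, or two of them agree and both sides vanish.\<close>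
  show ?case
  proof (cases "inj_on f {..<n}")
   case True
   have "f ` {..<n} \<subseteq> {..<n}" using f by auto
   then have "bij_betw f {..<n} {..<n}" using True by (simp add: bij_betw_def endo_inj_surj)
   then have w: "f permutes {..<n}" by (rule bij_imp_permutes) (simp add: f_def)
   have "F y = F (z \<circ> f)" by (rule loc) (use f in auto)
   also have "... = of_int (sign f)*F z" by (rule alt) (use z w in auto)
   also have "H y = leib n (%i b. psi b (z (f i)))" unfolding H_def by (rule leib_cong) (use f in auto)
   moreover have "... = of_int (sign f)*H z"
    unfolding H_def using leib_permute_rows[OF w, of "%i b. psi b (z i)"] by simp
   ultimately show ?thesis by simp
  next
   case False
   then obtain i j where ij: "i < n" "j < n" "i ~= j" "y i = y j"
    using f by (auto simp: inj_on_def)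
   have w: "Transposition.transpose i j permutes {..<n}" by (rule permutes_swap_id) (use ij in auto)
   have "F (y \<circ> Transposition.transpose i j) = - F y" using alt[of y, OF _ w] 0 ij by (simp add: sign_swap_id)
   moreover have "y \<circ> Transposition.transpose i j = y" using ij by (auto simp: Transposition.transpose_def fun_eq_iff)
   ultimately have "F y = 0" by (simp add: eq_neg_iff_add_eq_0)
   moreover have "H y = 0" unfolding H_def by (rule leib_equal_rows[OF ij(1,2,3)]) (use ij in simp)
   ultimately show ?thesis by simp
  qed
 next
  case (Suc m)
  have m: "m < n" using Suc.prems by simp
  obtain c where c: "\<forall>v\<in>D. F (y(m := v)) = (\<Sum>b<n. c b*psi b v)"
   using sect[of y m] Suc.prems(2) m by blast
  define d where "d b = leib n (%i. if i = m then (%j. of_bool (j = b)) else (%b. psi b (y i)))" for b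
  have d: "H (y(m := v)) = (\<Sum>b<n. d b*psi b v)" for v
  proof -
   have "H (y(m := v)) = leib n (%i. if i = m then (%b. psi b v) else (%b. psi b (y i)))"
    unfolding H_def by (rule leib_cong) auto
   also have "... = (\<Sum>b<n. psi b v * d b)" unfolding d_def by (rule leib_row_expand[OF m])
   finally show ?thesis by (simp add: mult.commute)
  qed
  have eq: "F (y(m := v))*H z - F z*H (y(m := v)) = (\<Sum>b<n. (c b*H z - F z*d b)*psi b v)" if "v \<in> D" for v
   using c that by (simp add: d sum_distrib_left sum_distrib_right algebra_simps flip: sum_subtractf)
  \<comment> \<open>As functions of coordinate \<open>m\<close> both sides lie in the span of the
    \<open>psi b\<close>, and they agree at the \<open>n\<close> points \<open>z i\<close>, on which
    the \<open>psi b\<close> are independent.\<close>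
  have "(\<Sum>b<n. (c b*H z - F z*d b)*psi b (z i)) = 0" if i: "i < n" for i
  proof -
   have "F (y(m := z i))*H z = F z*H (y(m := z i))"
   proof (rule Suc.IH)
    fix k assume "m \<le> k" "k < n"
    then show "(y(m := z i)) k \<in> z ` {..<n}" using Suc.prems(3)[of k] i by auto
   qed (use Suc.prems z(1) i in auto)
   then show ?thesis using eq[OF z(1)[OF i]] by simp
  qed
  then have "c b*H z - F z*d b = 0" if "b < n" for b
   using leib_nonzero_independent[OF z(2), of "%b. c b*H z - F z*d b"] that by simp
  then have "F (y(m := y m))*H z - F z*H (y(m := y m)) = 0"
   using eq[OF Suc.prems(2)[OF m]] by simp
  then show ?case by simp
 qed
 show ?thesis using P[of n y] y by (simp add: H_def)
qed

text \<open>Expansion along the last row gives a polynomial in \<open>Y n\<close> that vanishes at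
  the other \<open>Y i\<close>. Subtracting the multiple of the product of the
  \<open>Y n - Y i\<close> with the same leading term leaves degree below \<open>n\<close> and
  \<open>n\<close> roots.\<close>

lemma leib_vandermonde:
 fixes P :: "nat => complex poly"
 assumes "!!m. degree (P m) \<le> m"
 shows "leib n (%i j. poly (P j) (Y i)) =
  (\<Prod>m<n. coeff (P m) m)*(\<Prod>(i, j)\<in>{(i, j). i < j \<and> j < n}. Y j - Y i)"
proof (induction n)
 case 0
 have "{p. p permutes ({} :: nat set)} = {id}" by (auto simp: permutes_empty)
 then show ?case by (simp add: leib_def)
next
 case (Suc n)
 have pairs: "{(i, j). i < j \<and> j < Suc n} = {(i, j). i < j \<and> j < n} \<union> (%i. (i, n)) ` {..<n}"
  by (auto simp: less_Suc_eq)
 have fin: "finite {(i, j). i < j \<and> j < (n::nat)}"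
  by (rule finite_subset[of _ "{..<n} \<times> {..<n}"]) auto
 have split: "(\<Prod>(i, j)\<in>{(i, j). i < j \<and> j < Suc n}. Y j - Y i) =
   (\<Prod>(i, j)\<in>{(i, j). i < j \<and> j < n}. Y j - Y i)*(\<Prod>i<n. Y n - Y i)"
  unfolding pairs using fin
  by (subst prod.union_disjoint) (auto simp: prod.reindex inj_on_def)
 let ?A = "%i j. poly (P j) (Y i)"
 show ?case
 proof (cases "inj_on Y {..<n}")
  case False
  then obtain i j where ij: "i < n" "j < n" "i ~= j" "Y i = Y j" by (auto simp: inj_on_def)
  have "leib (Suc n) ?A = 0" "leib n ?A = 0"
   by (rule leib_equal_rows[of i _ j], use ij in auto)+
  then show ?thesis using Suc.IH unfolding split by auto
 next
  case True
  define cof where "cof c = leib (Suc n) (%i. if i = n then (%j. of_bool (j = c)) else ?A i)" for c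
  define Q where "Q = (\<Sum>c<Suc n. smult (cof c) (P c)) - smult (cof n * coeff (P n) n) (\<Prod>i<n. [:- Y i, 1:])"
  have row: "leib (Suc n) (%i. if i = n then (%j. poly (P j) v) else ?A i) = poly (\<Sum>c<Suc n. smult (cof c) (P c)) v" for v
   unfolding cof_def by (subst leib_row_expand) (auto simp: poly_sum mult.commute simp del: sum.lessThan_Suc)
  have degprod: "degree (\<Prod>i<n. [:- Y i, 1:]) = n"
   by (subst degree_prod_eq_sum_degree) auto
  have lc: "coeff (\<Prod>i<n. [:- Y i, 1:]) n = 1"
   using lead_coeff_prod[of "%i. [:- Y i, 1:]" "{..<n}"] by (simp add: degprod)
  have cP: "coeff (P c) n = 0" if "c < n" for c using assms[of c] that by (intro coeff_eq_0) simp
  have "degree Q \<le> n"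
   unfolding Q_def
   by (intro degree_diff_le degree_sum_le order.trans[OF degree_smult_le])
     (auto simp: degprod intro: order.trans[OF assms])
  moreover have "coeff Q n = 0"
   by (simp add: Q_def coeff_sum lc cP)
  ultimately have dQ: "Q = 0 \<or> degree Q < n"
   by (metis le_neq_implies_less leading_coeff_0_iff)
  have root: "poly Q (Y k) = 0" if "k < n" for k
  proof -
   have "leib (Suc n) (%i. if i = n then (%j. poly (P j) (Y k)) else ?A i) = 0"
    by (rule leib_equal_rows[of k _ n]) (use that in auto)
   moreover have "(\<Prod>i<n. Y k - Y i) = 0" using that by auto
   ultimately show ?thesis unfolding Q_def poly_diff row[symmetric] by (simp add: poly_prod)
  qed
  have "Q = 0"
  proof (rule ccontr)
   assume Q: "Q ~= 0"
   have "n = card (Y ` {..<n})" using True by (simp add: card_image)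
   also have "... \<le> card {x. poly Q x = 0}"
    by (rule card_mono) (use poly_roots_finite[OF Q] root in auto)
   also have "... \<le> degree Q" by (rule card_poly_roots_bound[OF Q])
   finally show False using dQ Q by simp
  qed
  then have "poly Q (Y n) = 0" by simp
  then have "leib (Suc n) (%i. if i = n then (%j. poly (P j) (Y n)) else ?A i) =
    cof n * coeff (P n) n*(\<Prod>i<n. Y n - Y i)"
   unfolding row by (simp add: Q_def poly_prod)
  moreover have "(%i. if i = n then (%j. poly (P j) (Y n)) else ?A i) = ?A" by auto
  moreover have "cof n = leib n ?A" unfolding cof_def by (rule leib_last_unit_row)
  ultimately show ?thesis unfolding split using Suc.IH by (simp add: mult_ac)
 qed
qed

lemma vandermonde_permute:
 fixes n :: nat
 assumes "w permutes {..<n}"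
 shows "(\<Prod>(i, j)\<in>{(i, j). i < j \<and> j < n}. x (w j) - x (w i)) =
  of_int (sign w)*(\<Prod>(i, j)\<in>{(i, j). i < j \<and> j < n}. x j - (x i :: complex))"
proof -
 let ?P = "%m. monom (1 :: complex) m"
 have V: "leib n (%i j. poly (?P j) (Y i)) = (\<Prod>(i, j)\<in>{(i, j). i < j \<and> j < n}. Y j - Y i)" for Y
  by (subst leib_vandermonde) (auto simp: degree_monom_le)
 show ?thesis
  using leib_permute_rows[OF assms, of "%i j. poly (?P j) (x i)"] by (simp only: V)
qed

section \<open>Hall--Littlewood polynomials\<close>

text \<open>The symmetrization carried out position by position from the last one, so the list holds
  the exponents in increasing order, zeros included. The chosen \<open>b\<close> stands behind all
  remaining indices, hence \<open>x b\<close> is the second variable of its factors.\<close>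

primrec hl_rec :: "(nat => complex) => complex => nat list => nat set => complex" where
 "hl_rec x t [] S = of_bool (S = {})"
| "hl_rec x t (a # \<mu>) S =
   (\<Sum>b\<in>S. x b^a*(\<Prod>i\<in>S - {b}. (x i - t*x b)/(x i - x b))*hl_rec x t \<mu> (S - {b}))"

lemma lessThan_Suc_pairs:
 "{(i, j). i < j \<and> j < Suc n} = {(i, j). i < j \<and> j < n} \<union> (%i. (i, n)) ` {..<n}"
 by (auto simp: less_Suc_eq)

lemma finite_lessThan_pairs: "finite {(i, j). i < j \<and> j < (n::nat)}"
 by (rule finite_subset[of _ "{..<n} \<times> {..<n}"]) auto

lemma prod_pairs_Suc:
 "(\<Prod>(i, j)\<in>{(i, j). i < j \<and> j < Suc n}. f i j) =
  (\<Prod>(i, j)\<in>{(i, j). i < j \<and> j < n}. f i j)*(\<Prod>i<n. (f i n :: complex))"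
proof -
 have "{(i, j). i < j \<and> j < n} \<inter> (%i. (i, n)) ` {..<n} = {}" by auto
 then have "(\<Prod>(i, j)\<in>{(i, j). i < j \<and> j < Suc n}. f i j) =
   (\<Prod>(i, j)\<in>{(i, j). i < j \<and> j < n}. f i j)*(\<Prod>(i, j)\<in>(%i. (i, n)) ` {..<n}. f i j)"
  unfolding lessThan_Suc_pairs by (intro prod.union_disjoint finite_lessThan_pairs) auto
 also have "(\<Prod>(i, j)\<in>(%i. (i, n)) ` {..<n}. f i j) = (\<Prod>i<n. f i n)"
  by (subst prod.reindex) (auto simp: inj_on_def)
 finally show ?thesis .
qed

text \<open>A permutation is determined by the image of the last position and a permutation of the
  rest; \<open>bt\<close> names the variables that are still available.\<close>

lemma sum_permutations_hl_rec:
 assumes "inj_on bt {..<n}"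
 shows "(\<Sum>w | w permutes {..<n}. (\<Prod>i<n. x (bt (w i))^e i) *
   (\<Prod>(i, j)\<in>{(i, j). i < j \<and> j < n}. (x (bt (w i)) - t*x (bt (w j)))/(x (bt (w i)) - x (bt (w j))))) =
  hl_rec x t (map e (rev [0..<n])) (bt ` {..<n})"
 using assms
proof (induction n arbitrary: bt)
 case 0
 have "{p. p permutes ({} :: nat set)} = {id}" by (auto simp: permutes_empty)
 then show ?case by simp
next
 case (Suc n)
 let ?T = "%n bt w. (\<Prod>i<n. x (bt (w i))^e i) *
   (\<Prod>(i, j)\<in>{(i, j). i < j \<and> j < n}. (x (bt (w i)) - t*x (bt (w j)))/(x (bt (w i)) - x (bt (w j))))"
 have "(\<Sum>w | w permutes {..<Suc n}. ?T (Suc n) bt w) =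
   (\<Sum>b\<in>insert n {..<n}. \<Sum>q | q permutes {..<n}. ?T (Suc n) bt (Transposition.transpose n b \<circ> q))"
  unfolding lessThan_Suc by (rule sum_over_permutations_insert) auto
 also have "... = (\<Sum>b<Suc n. x (bt b)^e n*(\<Prod>i\<in>bt ` {..<Suc n} - {bt b}. (x i - t*x (bt b))/(x i - x (bt b))) *
    hl_rec x t (map e (rev [0..<n])) (bt ` {..<Suc n} - {bt b}))"
  unfolding lessThan_Suc[symmetric]
 proof (intro sum.cong refl)
  fix b assume b: "b \<in> {..<Suc n}"
  define gm where "gm = bt \<circ> Transposition.transpose n b"
  have tr: "Transposition.transpose n b permutes {..<Suc n}" by (rule permutes_swap_id) (use b in auto)
  have injt: "inj (Transposition.transpose n b)" by (rule inj_on_subset[OF permutes_inj[OF tr]]) auto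
  have im: "Transposition.transpose n b ` {..<n} = {..<Suc n} - {b}"
  proof -
   have "{..<n} = {..<Suc n} - {n}" by auto
   then have "Transposition.transpose n b ` {..<n} = Transposition.transpose n b ` {..<Suc n} - Transposition.transpose n b ` {n}"
    using image_set_diff[OF injt] by metis
   then show ?thesis using permutes_image[OF tr] by simp
  qed
  have gmim: "gm ` {..<n} = bt ` {..<Suc n} - {bt b}"
  proof -
   have "gm ` {..<n} = bt ` ({..<Suc n} - {b})" unfolding gm_def image_comp[symmetric] im ..
   also have "... = bt ` {..<Suc n} - bt ` {b}" by (rule inj_on_image_set_diff[OF Suc.prems]) (use b in auto)
   finally show ?thesis by simp
  qed
  have inj: "inj_on gm {..<n}"
   unfolding gm_def
   by (rule comp_inj_on) (use injt im Suc.prems in "auto intro: inj_on_subset")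
  have "(\<Sum>q | q permutes {..<n}. ?T (Suc n) bt (Transposition.transpose n b \<circ> q)) =
    (\<Sum>q | q permutes {..<n}. x (bt b)^e n *
     (\<Prod>i\<in>bt ` {..<Suc n} - {bt b}. (x i - t*x (bt b))/(x i - x (bt b)))*?T n gm q)"
  proof (intro sum.cong refl)
   fix q assume "q \<in> {q. q permutes {..<n}}"
   then have q: "q permutes {..<n}" by simp
   have qn: "q n = n" using q by (auto intro: permutes_not_in)
   have "(\<Prod>i<n. (x (gm (q i)) - t*x (bt b))/(x (gm (q i)) - x (bt b))) =
     (\<Prod>i<n. (x (gm i) - t*x (bt b))/(x (gm i) - x (bt b)))"
    using prod.permute[OF q, of "%i. (x (gm i) - t*x (bt b))/(x (gm i) - x (bt b))"] by (simp add: o_def)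
   also have "... = (\<Prod>i\<in>bt ` {..<Suc n} - {bt b}. (x i - t*x (bt b))/(x i - x (bt b)))"
    unfolding gmim[symmetric] by (simp add: prod.reindex[OF inj])
   finally show "?T (Suc n) bt (Transposition.transpose n b \<circ> q) = x (bt b)^e n *
     (\<Prod>i\<in>bt ` {..<Suc n} - {bt b}. (x i - t*x (bt b))/(x i - x (bt b)))*?T n gm q"
    unfolding prod_pairs_Suc by (simp add: qn gm_def mult_ac)
  qed
  also have "... = x (bt b)^e n *
     (\<Prod>i\<in>bt ` {..<Suc n} - {bt b}. (x i - t*x (bt b))/(x i - x (bt b))) *
     hl_rec x t (map e (rev [0..<n])) (gm ` {..<n})"
   unfolding Suc.IH[OF inj, symmetric] by (rule sum_distrib_left[symmetric])
  finally show "(\<Sum>q | q permutes {..<n}. ?T (Suc n) bt (Transposition.transpose n b \<circ> q)) =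
    x (bt b)^e n*(\<Prod>i\<in>bt ` {..<Suc n} - {bt b}. (x i - t*x (bt b))/(x i - x (bt b))) *
    hl_rec x t (map e (rev [0..<n])) (bt ` {..<Suc n} - {bt b})"
   unfolding gmim .
 qed
 also have "... = (\<Sum>b\<in>bt ` {..<Suc n}. x b^e n*(\<Prod>i\<in>bt ` {..<Suc n} - {b}. (x i - t*x b)/(x i - x b)) *
    hl_rec x t (map e (rev [0..<n])) (bt ` {..<Suc n} - {b}))"
  by (subst sum.reindex[OF Suc.prems]) (simp add: o_def)
 also have "... = hl_rec x t (map e (rev [0..<Suc n])) (bt ` {..<Suc n})"
  by simp
 finally show ?case .
qed

definition level_fun :: "(nat => complex) => nat => nat => nat set => complex" where
 "level_fun x a m A = (\<Prod>i\<in>A. x i^a) * of_bool (card A = m)"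

text \<open>The factor that \<open>m\<close> equal parts contribute to \<open>hl_v\<close>.\<close>

definition qfact :: "complex => nat => complex" where
 "qfact t m = qpoch t t m/(1 - t)^m"

lemma hl_conv_single:
 assumes "finite S"
 shows "hl_conv x t (level_fun x a 1) g S =
  (\<Sum>b\<in>S. x b^a*(\<Prod>i\<in>S - {b}. (x i - t*x b)/(x i - x b))*g (S - {b}))"
proof -
 have inj: "inj_on (%b. S - {b}) S" by (auto simp: inj_on_def)
 have "hl_conv x t (level_fun x a 1) g S =
   (\<Sum>B\<in>(%b. S - {b}) ` S. hl_cross x t B (S - B)*level_fun x a 1 (S - B)*g B)"
  unfolding hl_conv_def
 proof (rule sum.mono_neutral_right)
  show "\<forall>B\<in>Pow S - (%b. S - {b}) ` S. hl_cross x t B (S - B)*level_fun x a 1 (S - B)*g B = 0"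
  proof
   fix B assume B: "B \<in> Pow S - (%b. S - {b}) ` S"
   have "card (S - B) ~= 1"
   proof
    assume "card (S - B) = 1"
    then obtain b where "S - B = {b}" by (auto simp: card_1_singleton_iff)
    then have "b \<in> S" "B = S - {b}" using B by auto
    with B show False by auto
   qed
   then show "hl_cross x t B (S - B)*level_fun x a 1 (S - B)*g B = 0" by (simp add: level_fun_def)
  qed
 qed (use assms in auto)
 also have "... = (\<Sum>b\<in>S. x b^a*(\<Prod>i\<in>S - {b}. (x i - t*x b)/(x i - x b))*g (S - {b}))"
  unfolding sum.reindex[OF inj] o_def
 proof (intro sum.cong refl)
  fix b assume "b \<in> S"
  then have e: "S - (S - {b}) = {b}" by auto
  show "hl_cross x t (S - {b}) (S - (S - {b}))*level_fun x a 1 (S - (S - {b}))*g (S - {b}) =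
    x b^a*(\<Prod>i\<in>S - {b}. (x i - t*x b)/(x i - x b))*g (S - {b})"
   unfolding e by (simp add: hl_cross_def level_fun_def)
 qed
 finally show ?thesis .
qed

lemma hl_conv_level_fun:
 assumes "finite S" "inj_on x S" "!!i. i \<in> S ==> x i ~= 0" "t ~= 1"
 shows "hl_conv x t (level_fun x a 1) (level_fun x a m) S =
  (1 - t^Suc m)/(1 - t)*level_fun x a (Suc m) S"
proof (cases "card S = Suc m")
 case True
 have "hl_conv x t (level_fun x a 1) (level_fun x a m) S =
   (\<Sum>b\<in>S. (\<Prod>i\<in>S - {b}. (x i - t*x b)/(x i - x b))*(\<Prod>i\<in>S. x i^a))"
  unfolding hl_conv_single[OF assms(1)]
 proof (intro sum.cong refl)
  fix b assume b: "b \<in> S"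
  show "x b^a*(\<Prod>i\<in>S - {b}. (x i - t*x b)/(x i - x b))*level_fun x a m (S - {b}) =
    (\<Prod>i\<in>S - {b}. (x i - t*x b)/(x i - x b))*(\<Prod>i\<in>S. x i^a)"
   using b True prod.remove[OF assms(1) b, of "%i. x i^a"] by (simp add: level_fun_def)
 qed
 then show ?thesis
  using True by (simp add: sum_distrib_right[symmetric] sum_cross_single[OF assms] level_fun_def)
next
 case False
 have "hl_conv x t (level_fun x a 1) (level_fun x a m) S = (\<Sum>b\<in>S. 0)"
  unfolding hl_conv_single[OF assms(1)]
 proof (intro sum.cong refl)
  fix b assume b: "b \<in> S"
  then have "card (S - {b}) ~= m" using False assms(1) card_gt_0_iff[of S] by auto
  then show "x b^a*(\<Prod>i\<in>S - {b}. (x i - t*x b)/(x i - x b))*level_fun x a m (S - {b}) = 0"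
   by (simp add: level_fun_def)
 qed
 with False show ?thesis by (simp add: level_fun_def)
qed

lemma hl_conv_zero_level:
 assumes "finite S" shows "hl_conv x t (level_fun x a 0) g S = g S"
proof -
 have "hl_conv x t (level_fun x a 0) g S = (\<Sum>B\<in>{S}. hl_cross x t B (S - B)*level_fun x a 0 (S - B)*g B)"
  unfolding hl_conv_def
 proof (rule sum.mono_neutral_right)
  show "\<forall>B\<in>Pow S - {S}. hl_cross x t B (S - B)*level_fun x a 0 (S - B)*g B = 0"
  proof
   fix B assume "B \<in> Pow S - {S}"
   then have "card (S - B) ~= 0" using assms by auto
   then show "hl_cross x t B (S - B)*level_fun x a 0 (S - B)*g B = 0" by (simp add: level_fun_def)
  qed
 qed (use assms in auto)
 then show ?thesis by (simp add: level_fun_def)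
qed

lemma hl_conv_cmult:
 "hl_conv x t f (%A. c*g A) S = c*hl_conv x t f g S"
 "hl_conv x t (%A. c*f A) g S = c*hl_conv x t f g S"
 by (simp_all add: hl_conv_def sum_distrib_left mult_ac)

text \<open>Symmetrizing over the order within a block of \<open>m\<close> equal exponents
  multiplies by the \<open>t\<close>-factorial of \<open>m\<close>; each further element contributes
  \<open>(1 - t^Suc m)/(1 - t)\<close> by \<open>sum_cross_single\<close>. This is what
  \<open>hl_v\<close> divides out.\<close>

lemma hl_rec_replicate:
 assumes "finite S" "inj_on x S" "!!i. i \<in> S ==> x i ~= 0" "t ~= 1"
 shows "hl_rec x t (replicate m a @ \<mu>) S = qfact t m*hl_conv x t (level_fun x a m) (hl_rec x t \<mu>) S"
 using assms(1-3)
proof (induction m arbitrary: S)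
 case 0
 then show ?case by (simp add: hl_conv_zero_level qfact_def qpoch_def)
next
 case (Suc m)
 have sub: "finite A" "inj_on x A" "!!i. i \<in> A ==> x i ~= 0" if "A \<subseteq> S" for A
  using that Suc.prems by (auto intro: finite_subset inj_on_subset)
 have "hl_rec x t (replicate (Suc m) a @ \<mu>) S =
   hl_conv x t (level_fun x a 1) (hl_rec x t (replicate m a @ \<mu>)) S"
  by (simp only: hl_conv_single[OF Suc.prems(1)] replicate_Suc append_Cons hl_rec.simps)
 also have "... = hl_conv x t (level_fun x a 1) (%A. qfact t m*hl_conv x t (level_fun x a m) (hl_rec x t \<mu>) A) S"
  by (rule hl_conv_cong[OF refl Suc.IH]) (use sub in auto)
 also have "... = qfact t m*hl_conv x t (level_fun x a 1) (hl_conv x t (level_fun x a m) (hl_rec x t \<mu>)) S"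
  by (rule hl_conv_cmult)
 also have "hl_conv x t (level_fun x a 1) (hl_conv x t (level_fun x a m) (hl_rec x t \<mu>)) S =
   hl_conv x t (hl_conv x t (level_fun x a 1) (level_fun x a m)) (hl_rec x t \<mu>) S"
  by (rule hl_conv_assoc[OF Suc.prems(1), symmetric])
 also have "... = hl_conv x t (%A. (1 - t^Suc m)/(1 - t)*level_fun x a (Suc m) A) (hl_rec x t \<mu>) S"
  by (rule hl_conv_cong[OF hl_conv_level_fun refl]) (use sub assms(4) in auto)
 also have "... = (1 - t^Suc m)/(1 - t)*hl_conv x t (level_fun x a (Suc m)) (hl_rec x t \<mu>) S"
  by (rule hl_conv_cmult)
 finally show ?case by (simp add: qfact_def qpoch_Suc mult_ac)
qed

lemma sorted_split:
 assumes "sorted L" "!!p. p \<in> set L ==> j \<le> p"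
 shows "L = replicate (count_list L j) j @ filter (%p. j < p) (L :: nat list)"
 using assms
proof (induction L)
 case (Cons a L)
 show ?case
 proof (cases "a = j")
  case True
  then show ?thesis using Cons by auto
 next
  case False
  then have "j < a" using Cons.prems(2)[of a] by auto
  then have "\<forall>p\<in>set (a # L). j < p" using Cons.prems(1) by auto
  moreover from this have "count_list (a # L) j = 0" by (auto simp: count_list_0_iff)
  ultimately show ?thesis by (simp add: filter_id_conv[THEN iffD2])
 qed
qed simp

lemma count_list_filter: "count_list (filter P L) j = (if P j then count_list L j else 0)"
 by (induction L) auto

text \<open>Blocks of equal parts are split off from below, one level after the other; a level
  without parts contributes the unit of the convolution.\<close>

lemma hl_rec_levels:
 assumes S: "finite S" "inj_on x S" "!!i. i \<in> S ==> x i ~= 0" "t ~= 1"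
  and L: "sorted L" "!!p. p \<in> set L ==> p \<le> M"
 shows "hl_rec x t L S = (\<Prod>r\<le>M. qfact t (count_list L r)) *
  hl_levels x t (%r N. of_bool (N = count_list L r)) M S"
proof -
 let ?c = "%r N. of_bool (N = count_list L r) :: complex"
 have lf: "(%B. (\<Prod>i\<in>B. x i^j)*?c j (card B)) = level_fun x j (count_list L j)" for j
  by (simp add: level_fun_def fun_eq_iff)
 have sub: "finite A" "inj_on x A" "!!i. i \<in> A ==> x i ~= 0" if "A \<subseteq> S" for A
  using that S by (auto intro: finite_subset inj_on_subset)
 have "hl_rec x t L S = (\<Prod>r\<le>j. qfact t (count_list L r)) *
   hl_conv x t (hl_levels x t ?c j) (hl_rec x t (filter (%p. j < p) L)) S" for j
 proof (induction j)
  case 0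
  have "L = replicate (count_list L 0) 0 @ filter (%p. 0 < p) L" by (rule sorted_split) (use L in auto)
  then have "hl_rec x t L S = hl_rec x t (replicate (count_list L 0) 0 @ filter (%p. 0 < p) L) S" by simp
  also have "... = qfact t (count_list L 0)*hl_conv x t (level_fun x 0 (count_list L 0)) (hl_rec x t (filter (%p. 0 < p) L)) S"
   by (rule hl_rec_replicate[OF S])
  finally show ?case by (simp add: level_fun_def[abs_def])
 next
  case (Suc j)
  let ?L = "filter (%p. j < p) L"
  have "?L = replicate (count_list ?L (Suc j)) (Suc j) @ filter (%p. Suc j < p) ?L"
   by (rule sorted_split) (use L in "auto simp: sorted_wrt_filter")
  moreover have "filter (%p. Suc j < p) ?L = filter (%p. Suc j < p) L"
   by (simp add: conj_ac) (rule filter_cong[OF refl], auto)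
  ultimately have e: "?L = replicate (count_list L (Suc j)) (Suc j) @ filter (%p. Suc j < p) L"
   by (simp add: count_list_filter)
  have "hl_conv x t (hl_levels x t ?c j) (hl_rec x t ?L) S =
    hl_conv x t (hl_levels x t ?c j) (%A. qfact t (count_list L (Suc j)) *
     hl_conv x t (level_fun x (Suc j) (count_list L (Suc j))) (hl_rec x t (filter (%p. Suc j < p) L)) A) S"
   by (subst e, rule hl_conv_cong[OF refl hl_rec_replicate]) (use sub S(4) in auto)
  also have "... = qfact t (count_list L (Suc j))*hl_conv x t (hl_levels x t ?c j)
     (hl_conv x t (level_fun x (Suc j) (count_list L (Suc j))) (hl_rec x t (filter (%p. Suc j < p) L))) S"
   by (rule hl_conv_cmult)
  also have "hl_conv x t (hl_levels x t ?c j)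
     (hl_conv x t (level_fun x (Suc j) (count_list L (Suc j))) (hl_rec x t (filter (%p. Suc j < p) L))) S =
    hl_conv x t (hl_levels x t ?c (Suc j)) (hl_rec x t (filter (%p. Suc j < p) L)) S"
   unfolding hl_levels.simps lf by (rule hl_conv_assoc[OF S(1), symmetric])
  finally show ?case using Suc.IH by (simp add: mult_ac)
 qed
 from this[of M] have "hl_rec x t L S = (\<Prod>r\<le>M. qfact t (count_list L r)) *
   hl_conv x t (hl_levels x t ?c M) (hl_rec x t (filter (%p. M < p) L)) S" .
 moreover have "filter (%p. M < p) L = []" using L(2) by (auto simp: filter_empty_conv not_less)
 moreover have "hl_rec x t [] = (%S. of_bool (S = {}))" by (simp add: fun_eq_iff)
 ultimately show ?thesis using hl_conv_unit_right[OF S(1)] by simp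
qed

lemma map_part_at_rev:
 assumes "length lam \<le> n"
 shows "map (part_at lam) (rev [0..<n]) = replicate (n - length lam) 0 @ rev lam"
proof -
 have "map (part_at lam) [0..<n] = lam @ replicate (n - length lam) 0"
  by (rule nth_equalityI) (use assms in "auto simp: part_at_def nth_append")
 then have "rev (map (part_at lam) [0..<n]) = replicate (n - length lam) 0 @ rev lam" by simp
 then show ?thesis by (simp only: rev_map)
qed

lemma power_neq_1_of_norm_less_1: "norm (t::complex) < 1 ==> n \<ge> 1 ==> t^n ~= 1"
 by (metis norm_one norm_power power_less_one_iff norm_ge_zero less_irrefl not_one_le_zero zero_less_iff_neq_zero)

lemma qfact_nonzero: assumes "norm t < 1" shows "qfact t m ~= 0"
proof -
 have "1 - t*t^i ~= 0" for i using power_neq_1_of_norm_less_1[OF assms, of "Suc i"] by auto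
 then show ?thesis using power_neq_1_of_norm_less_1[OF assms, of 1] by (auto simp: qfact_def qpoch_def)
qed

theorem hl_sym_levels:
 assumes lam: "is_partition lam" "!!p. p \<in> set lam ==> p \<le> M" "length lam \<le> n"
  and x: "inj_on x {..<n}" "!!i. i < n ==> x i ~= 0" and t: "norm t < 1"
 shows "hl_sym n lam t x =
  hl_levels x t (%r N. of_bool (N = (if r = 0 then n - length lam else count_list lam r))) M {..<n}"
proof -
 let ?L = "replicate (n - length lam) 0 @ rev lam"
 let ?m = "%r. if r = 0 then n - length lam else count_list lam r"
 have t1: "t ~= 1" using t by auto
 have "sorted (rev lam)" using lam(1) by (simp add: is_partition_def sorted_wrt_rev)
 then have L: "sorted ?L" by (auto simp: sorted_append)
 have "count_list lam 0 = 0" using lam(1) by (simp add: is_partition_def count_list_0_iff)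
 moreover have "count_list (replicate m 0) r = (if r = 0 then m else 0)" for m and r :: nat
  by (induction m) auto
 \<comment> \<open>The zero parts, which \<open>lam\<close> does not list, form the block of level
   0.\<close>
 ultimately have cnt: "count_list ?L r = ?m r" for r by (auto simp: count_list_append)
 have "hl_rec x t ?L {..<n} = (\<Prod>r\<le>M. qfact t (count_list ?L r)) *
   hl_levels x t (%r N. of_bool (N = count_list ?L r)) M {..<n}"
  by (rule hl_rec_levels) (use x t1 L lam(2) in auto)
 moreover have "hl_v n lam t = (\<Prod>r\<le>M. qfact t (count_list ?L r))"
 proof -
  have "(\<Prod>r\<le>M. qfact t (?m r)) = qfact t (n - length lam)*(\<Prod>r\<in>{1..M}. qfact t (?m r))"
  proof -
   have "{..M} = insert 0 {1..M}" by auto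
   then show ?thesis by simp
  qed
  also have "(\<Prod>r\<in>{1..M}. qfact t (?m r)) = (\<Prod>r\<in>set lam. qfact t (count_list lam r))"
  proof (rule prod.mono_neutral_cong_right)
   show "set lam \<subseteq> {1..M}"
   proof
    fix r assume "r \<in> set lam"
    with lam show "r \<in> {1..M}" by (cases r) (auto simp: is_partition_def)
   qed
   show "\<forall>i\<in>{1..M} - set lam. qfact t (?m i) = 1"
    by (auto simp: count_list_0_iff[THEN iffD2] qfact_def qpoch_def)
   show "qfact t (?m r) = qfact t (count_list lam r)" if "r \<in> set lam" for r
    using that lam(1) by (auto simp: is_partition_def)
  qed auto
  finally have e: "(\<Prod>r\<le>M. qfact t (?m r)) =
    qfact t (n - length lam)*(\<Prod>r\<in>set lam. qfact t (count_list lam r))" .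
  show ?thesis unfolding cnt e by (simp add: hl_v_def qfact_def)
 qed
 moreover have "(\<Prod>r\<le>M. qfact t (count_list ?L r)) ~= 0" using qfact_nonzero[OF t] by simp
 moreover have "hl_sym n lam t x = 1/hl_v n lam t*hl_rec x t ?L {..<n}"
  using sum_permutations_hl_rec[of id n x "part_at lam" t] map_part_at_rev[OF lam(3)]
  by (simp add: hl_sym_def)
 ultimately have "hl_sym n lam t x = hl_levels x t (%r N. of_bool (N = count_list ?L r)) M {..<n}" by simp
 then show ?thesis unfolding cnt .
qed

section \<open>Well-definedness of the Hall-Littlewood polynomial\<close>

lemma poly_fun_diff: "poly_fun n f ==> poly_fun n g ==> poly_fun n (%x. f x - g x)"
 using poly_fun.add[OF _ poly_fun.mult[OF poly_fun.const[of n "-1"]], of f g] by simp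

lemma poly_fun_sum:
 "(!!i. i \<in> I ==> poly_fun n (f i)) ==> poly_fun n (%x. \<Sum>i\<in>I. f i x)"
 by (induction I rule: infinite_finite_induct) (auto intro: poly_fun.intros)

lemma poly_fun_prod:
 "(!!i. i \<in> I ==> poly_fun n (f i)) ==> poly_fun n (%x. \<Prod>i\<in>I. f i x)"
 by (induction I rule: infinite_finite_induct) (auto intro: poly_fun.intros)

lemma poly_fun_power: "poly_fun n f ==> poly_fun n (%x. f x^m)"
 by (induction m) (auto intro: poly_fun.intros)

lemma poly_fun_subst:
 assumes "poly_fun n f" "b < n" shows "poly_fun n (%x. f (x(a := x b)))"
 using assms(1)
proof induction
 case (var i)
 then show ?case using assms(2) by (cases "i = a") (auto intro: poly_fun.intros)
qed (auto intro: poly_fun.intros)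

text \<open>The factor theorem for the hyperplane \<open>x a = x b\<close>, with substitution of
  \<open>x b\<close> for \<open>x a\<close> in the role of evaluation at a root.\<close>

lemma poly_fun_factor:
 assumes "poly_fun n f" "a < n" "b < n"
 shows "\<exists>g. poly_fun n g \<and> (\<forall>x. f x - f (x(a := x b)) = (x a - x b)*g x)"
 using assms(1)
proof induction
 case (const c)
 then show ?case by (auto intro!: exI[of _ "%x. 0"] poly_fun.intros)
next
 case (var i)
 show ?case
  by (rule exI[of _ "%x. of_bool (i = a)"]) (auto intro: poly_fun.intros)
next
 case (add f g)
 then obtain f' g' where *: "poly_fun n f'" "!!x. f x - f (x(a := x b)) = (x a - x b)*f' x"
  "poly_fun n g'" "!!x. g x - g (x(a := x b)) = (x a - x b)*g' x" by blast
 have "f x + g x - (f (x(a := x b)) + g (x(a := x b))) = (x a - x b)*(f' x + g' x)" for x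
  unfolding add_diff_add*by (rule distrib_left[symmetric])
 then show ?case using poly_fun.add[OF *(1,3)] by blast
next
 case (mult f g)
 then obtain f' g' where *: "poly_fun n f'" "!!x. f x - f (x(a := x b)) = (x a - x b)*f' x"
  "poly_fun n g'" "!!x. g x - g (x(a := x b)) = (x a - x b)*g' x" by blast
 have "f x*g x - f (x(a := x b))*g (x(a := x b)) = (x a - x b)*(f' x*g x + f (x(a := x b))*g' x)" for x
 proof -
  have "f x*g x - f (x(a := x b))*g (x(a := x b)) =
    (f x - f (x(a := x b)))*g x + f (x(a := x b))*(g x - g (x(a := x b)))"
   by (simp add: algebra_simps)
  then show ?thesis unfolding*by (simp add: algebra_simps)
 qed
 moreover have "poly_fun n (%x. f' x*g x + f (x(a := x b))*g' x)"
  using mult*assms by (intro poly_fun.add poly_fun.mult poly_fun_subst) auto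
 ultimately show ?case by blast
qed

lemma poly_fun_tendsto:
 assumes "poly_fun n f" shows "((%s. f (%i. x i + s * of_nat i)) \<longlongrightarrow> f x) (at 0)"
 using assms
proof induction
 case (var i)
 have "((%s. x i + s * of_nat i) \<longlongrightarrow> x i + 0 * of_nat i) (at 0)" by (intro tendsto_intros)
 then show ?case by simp
qed (auto intro: tendsto_intros)

lemma eventually_inj_on_line:
 "\<forall>\<^sub>F s in at 0. inj_on (%i. x i + s * of_nat i) {..<n::nat}" for x :: "nat => complex"
proof -
 let ?bad = "(%(i, j). (x i - x j)/(of_nat j - of_nat i)) ` ({..<n} \<times> {..<n})"
 have "\<forall>\<^sub>F s in at 0. \<forall>b\<in>?bad. s ~= b"
 proof (intro eventually_ball_finite ballI)
  fix b :: complex show "\<forall>\<^sub>F s in at 0. s ~= b" by (rule eventually_neq_at_within)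
 qed auto
 then show ?thesis
 proof eventually_elim
  case (elim s)
  show ?case
  proof (rule inj_onI, rule ccontr)
   fix i j assume ij: "i \<in> {..<n}" "j \<in> {..<n}" "x i + s * of_nat i = x j + s * of_nat j" "i ~= j"
   have "s*(of_nat j - of_nat i) = x i - x j" using ij(3) by (simp add: algebra_simps)
   moreover have "of_nat j - of_nat i ~= (0::complex)" using ij(4) by simp
   ultimately have "s = (x i - x j)/(of_nat j - of_nat i)" by (simp add: eq_divide_eq)
   with elim ij show False by force
  qed
 qed
qed

text \<open>Every point is the limit, along the line with direction \<open>(0, 1, 2, ...)\<close>,
  of points with distinct coordinates, since only finitely many parameters on that line make two
  coordinates agree.\<close>

lemma poly_fun_eqI:
 assumes "poly_fun n f" "poly_fun n g" "!!x. inj_on x {..<n} ==> f x = g x"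
 shows "f x = g x"
proof -
 have "\<forall>\<^sub>F s in at 0. g (%i. x i + s * of_nat i) = f (%i. x i + s * of_nat i)"
  using eventually_inj_on_line[of x n] by eventually_elim (use assms(3) in auto)
 from Lim_transform_eventually[OF poly_fun_tendsto[OF assms(2)] this]
 show ?thesis by (rule tendsto_unique[OF trivial_limit_at poly_fun_tendsto[OF assms(1)]])
qed

text \<open>Over the common denominator the symmetrization becomes an antisymmetric polynomial
  \<open>A\<close>. It vanishes wherever two coordinates agree and is therefore divisible by the
  Vandermonde product.\<close>

lemma hl_sym_poly:
 "\<exists>P. poly_fun n P \<and> (\<forall>x. inj_on x {..<n} \<longrightarrow> P x = hl_sym n lam t x)"
proof -
 let ?pairs = "{(i, j). i < j \<and> j < n}"
 define A where "A x = (\<Sum>w | w permutes {..<n}. of_int (sign w)*((\<Prod>i<n. x (w i)^part_at lam i) *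
   (\<Prod>(i, j)\<in>?pairs. x (w i) - t*x (w j))))" for x
 have pA: "poly_fun n A"
  unfolding A_def case_prod_unfold
 proof (rule poly_fun_sum)
  fix w assume w: "w \<in> {w. w permutes {..<n}}"
  have wi: "w i < n" if "i < n" for i using permutes_in_image[of w "{..<n}" i] w that by simp
  show "poly_fun n (%x. of_int (sign w)*((\<Prod>i<n. x (w i)^part_at lam i) *
    (\<Prod>p\<in>{p. fst p < snd p \<and> snd p < n}. x (w (fst p)) - t*x (w (snd p)))))"
   by (intro poly_fun.mult poly_fun.const poly_fun_prod poly_fun_power poly_fun_diff poly_fun.var wi) auto
 qed
 have zero: "A x = 0" if ab: "a < n" "b < n" "a ~= b" "x a = x b" for a b x
 proof -
  have tr: "Transposition.transpose a b permutes {..<n}" by (rule permutes_swap_id) (use ab in auto)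
  have xt: "x (Transposition.transpose a b i) = x i" for i using ab by (simp add: Transposition.transpose_def)
  have "A x = (\<Sum>w | w permutes {..<n}. of_int (sign (Transposition.transpose a b \<circ> w)) *
    ((\<Prod>i<n. x ((Transposition.transpose a b \<circ> w) i)^part_at lam i) *
   (\<Prod>(i, j)\<in>?pairs. x ((Transposition.transpose a b \<circ> w) i) - t*x ((Transposition.transpose a b \<circ> w) j))))"
   unfolding A_def by (rule setum_permutations_compose_left[OF tr])
  also have "... = - A x"
   unfolding A_def sum_negf[symmetric]
  proof (intro sum.cong refl)
   fix w assume "w \<in> {w. w permutes {..<n}}"
   then have "sign (Transposition.transpose a b \<circ> w) = - sign w"
    using sign_compose[of "Transposition.transpose a b" w] tr ab by (auto simp: permutation_permutes sign_swap_id)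
   then show "of_int (sign (Transposition.transpose a b \<circ> w))*((\<Prod>i<n. x ((Transposition.transpose a b \<circ> w) i)^part_at lam i) *
   (\<Prod>(i, j)\<in>?pairs. x ((Transposition.transpose a b \<circ> w) i) - t*x ((Transposition.transpose a b \<circ> w) j))) =
    - (of_int (sign w)*((\<Prod>i<n. x (w i)^part_at lam i)*(\<Prod>(i, j)\<in>?pairs. x (w i) - t*x (w j))))"
    by (simp add: xt)
  qed
  finally show ?thesis by (simp add: eq_neg_iff_add_eq_0)
 qed
 \<comment> \<open>The factors are split off one pair at a time. The quotient \<open>g\<close> still
   vanishes on the next hyperplane, because at generic points of it the factors already removed do
   not.\<close>
 have "\<exists>g. poly_fun n g \<and> (\<forall>x. A x = (\<Prod>(i, j)\<in>Q. x j - x i)*g x)" if "finite Q" "Q \<subseteq> ?pairs" for Q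
  using that
 proof (induction Q rule: finite_induct)
  case empty
  then show ?case using pA by auto
 next
  case (insert q Q)
  then obtain g where g: "poly_fun n g" "!!x. A x = (\<Prod>(i, j)\<in>Q. x j - x i)*g x" by blast
  obtain a b where q: "q = (a, b)" "a < b" "b < n" using insert.prems by (cases q) auto
  have "g (x(b := x a)) = 0" for x
  proof (rule poly_fun_eqI[where f = "%x. g (x(b := x a))" and g = "%x. 0" and n = n])
   fix x :: "nat => complex" assume x: "inj_on x {..<n}"
   let ?x = "x(b := x a)"
   have "A ?x = 0" by (rule zero[of a b]) (use q in auto)
   moreover have "(\<Prod>(i, j)\<in>Q. ?x j - ?x i) ~= 0"
   proof -
    have "?x j - ?x i ~= 0" if "(i, j) \<in> Q" for i j
    proof -
     have ij: "i < j" "j < n" "(i, j) ~= (a, b)" using that insert.prems insert.hyps q by auto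
     then have "x j ~= x i" "i ~= a ==> x a ~= x i" "j ~= a ==> x j ~= x a"
      using x q inj_onD[OF x] by (metis lessThan_iff less_trans nat_neq_iff)+
     then show ?thesis using ij q by auto
    qed
    then show ?thesis using insert.hyps by (auto simp: prod_zero_iff)
   qed
   ultimately show "g ?x = 0" using g(2)[of ?x] by simp
  qed (use g q in "auto intro: poly_fun_subst poly_fun.const")
  moreover obtain g' where g': "poly_fun n g'" "!!x. g x - g (x(b := x a)) = (x b - x a)*g' x"
   using poly_fun_factor[OF g(1) q(3), of a] q by auto
  ultimately have "g x = (x b - x a)*g' x" for x by simp
  then have "A x = (\<Prod>(i, j)\<in>insert q Q. x j - x i)*g' x" for x
   using g(2)[of x] insert.hyps q by (simp add: mult_ac)
  then show ?case using g'(1) by blast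
 qed
 from this[OF finite_lessThan_pairs order_refl] obtain g where
  g: "poly_fun n g" "!!x. A x = (\<Prod>(i, j)\<in>?pairs. x j - x i)*g x" by blast
 define c where "c = (-1)^card ?pairs/hl_v n lam t"
 have "c*g x = hl_sym n lam t x" if x: "inj_on x {..<n}" for x
 proof -
  let ?V = "%x. \<Prod>(i, j)\<in>?pairs. x j - x i :: complex"
  have V0: "?V x ~= 0"
  proof -
   have "x j - x i ~= 0" if "i < j" "j < n" for i j
    using inj_onD[OF x, of i j] that by auto
   then show ?thesis by (subst prod_zero_iff[OF finite_lessThan_pairs]) auto
  qed
  have "hl_sym n lam t x = 1/hl_v n lam t*(\<Sum>w | w permutes {..<n}. ((-1)^card ?pairs/?V x) *
    (of_int (sign w)*((\<Prod>i<n. x (w i)^part_at lam i)*(\<Prod>(i, j)\<in>?pairs. x (w i) - t*x (w j)))))"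
   unfolding hl_sym_def
  proof (rule arg_cong[where f = "%v. 1/hl_v n lam t * v"], rule sum.cong[OF refl])
   fix w assume "w \<in> {w. w permutes {..<n}}"
   then have w: "w permutes {..<n}" by simp
   have neg: "(x (w i) - t*x (w j))/(x (w i) - x (w j)) =
     (-1)*((x (w i) - t*x (w j))/(x (w j) - x (w i)))" for i j
    by (metis minus_diff_eq minus_divide_right mult_minus1)
   have "(\<Prod>(i, j)\<in>?pairs. (x (w i) - t*x (w j))/(x (w i) - x (w j))) =
     (\<Prod>(i, j)\<in>?pairs. (-1)*((x (w i) - t*x (w j))/(x (w j) - x (w i))))"
    by (simp only: neg)
   also have "... = (-1)^card ?pairs*((\<Prod>(i, j)\<in>?pairs. x (w i) - t*x (w j))/(\<Prod>(i, j)\<in>?pairs. x (w j) - x (w i)))"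
    unfolding case_prod_unfold prod.distrib prod_dividef by simp
   also have "(\<Prod>(i, j)\<in>?pairs. x (w j) - x (w i)) = of_int (sign w)*?V x"
    by (rule vandermonde_permute[OF w])
   finally have e: "(\<Prod>(i, j)\<in>?pairs. (x (w i) - t*x (w j))/(x (w i) - x (w j))) =
     (-1)^card ?pairs*((\<Prod>(i, j)\<in>?pairs. x (w i) - t*x (w j))/(of_int (sign w)*?V x))" .
   have "of_int (sign w) = (1::complex) \<or> of_int (sign w) = (-1::complex)" by (simp add: sign_def)
   then show "(\<Prod>i<n. x (w i)^part_at lam i) *
     (\<Prod>(i, j)\<in>?pairs. (x (w i) - t*x (w j))/(x (w i) - x (w j))) =
     (-1)^card ?pairs/?V x *
    (of_int (sign w)*((\<Prod>i<n. x (w i)^part_at lam i)*(\<Prod>(i, j)\<in>?pairs. x (w i) - t*x (w j))))"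
    unfolding e by (elim disjE) (simp_all add: mult_ac)
  qed
  also have "... = 1/hl_v n lam t*(((-1)^card ?pairs/?V x)*A x)"
   unfolding A_def by (simp only: sum_distrib_left)
  also have "... = c*g x" unfolding g(2) c_def using V0 by simp
  finally show ?thesis by simp
 qed
 moreover have "poly_fun n (%x. c*g x)" using g(1) by (intro poly_fun.intros)
 ultimately show ?thesis by blast
qed

theorem hall_littlewood_eval:
 assumes "length lam \<le> n" "inj_on x {..<n}"
 shows "hall_littlewood n lam t x = hl_sym n lam t x"
proof -
 have "\<exists>!P. poly_fun n P \<and> (\<forall>x. inj_on x {..<n} \<longrightarrow> P x = hl_sym n lam t x)"
 proof (rule ex_ex1I[OF hl_sym_poly])
  fix P Q assume "poly_fun n P \<and> (\<forall>x. inj_on x {..<n} \<longrightarrow> P x = hl_sym n lam t x)"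
   "poly_fun n Q \<and> (\<forall>x. inj_on x {..<n} \<longrightarrow> Q x = hl_sym n lam t x)"
  then show "P = Q" using poly_fun_eqI[of n P Q] by auto
 qed
 from theI'[OF this] assms show ?thesis by (simp add: hall_littlewood_def)
qed

text \<open>This serves the case \<open>q = 0\<close>, where the evaluation point has repeated
  coordinates and \<open>hl_sym\<close> does not give the value of the polynomial.\<close>

lemma hall_littlewood_empty:
 assumes "norm t < 1" shows "hall_littlewood n [] t x = 1"
proof -
 have "\<exists>!P. poly_fun n P \<and> (\<forall>x. inj_on x {..<n} \<longrightarrow> P x = hl_sym n [] t x)"
 proof (rule ex_ex1I[OF hl_sym_poly])
  fix P Q assume "poly_fun n P \<and> (\<forall>x. inj_on x {..<n} \<longrightarrow> P x = hl_sym n [] t x)"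
   "poly_fun n Q \<and> (\<forall>x. inj_on x {..<n} \<longrightarrow> Q x = hl_sym n [] t x)"
  then show "P = Q" using poly_fun_eqI[of n P Q] by auto
 qed
 from theI'[OF this] have P: "poly_fun n (hall_littlewood n [] t)"
  "!!x. inj_on x {..<n} ==> hall_littlewood n [] t x = hl_sym n [] t x"
  by (auto simp: hall_littlewood_def)
 have one: "hall_littlewood n [] t x = 1" if x: "inj_on x {..<n}" "!!i. i < n ==> x i ~= 0" for x
 proof -
  have "hl_sym n [] t x = hl_levels x t (%r N. of_bool (N = (if r = 0 then n - length ([] :: nat list) else count_list [] r))) 0 {..<n}"
   by (rule hl_sym_levels) (use x assms in "auto simp: is_partition_def")
  then show ?thesis using P(2)[OF x(1)] by simp
 qed
 \<comment> \<open>The perturbation uses \<open>Suc i\<close> instead of \<open>i\<close>: with 0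
   adjoined as a further coordinate of index 0, small \<open>s\<close> make the coordinates distinct
   and also nonzero.\<close>
 have lim: "((%s. hall_littlewood n [] t (%i. x i + s * of_nat (Suc i))) \<longlongrightarrow> hall_littlewood n [] t x) (at 0)"
  using P(1)
 proof induction
  case (var i)
  have "((%s. x i + s * of_nat (Suc i)) \<longlongrightarrow> x i + 0 * of_nat (Suc i)) (at 0)" by (intro tendsto_intros)
  then show ?case by simp
 qed (auto intro: tendsto_intros)
 have "\<forall>\<^sub>F s in at 0. inj_on (%i. case_nat 0 x i + s * of_nat i) {..<Suc n}" by (rule eventually_inj_on_line)
 then have "\<forall>\<^sub>F s in at 0. 1 = hall_littlewood n [] t (%i. x i + s * of_nat (Suc i))"
 proof eventually_elim
  case (elim s)
  have "inj_on (%i. x i + s * of_nat (Suc i)) {..<n}"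
  proof (rule inj_onI)
   fix i j assume "i \<in> {..<n}" "j \<in> {..<n}" "x i + s * of_nat (Suc i) = x j + s * of_nat (Suc j)"
   then show "i = j" using inj_onD[OF elim, of "Suc i" "Suc j"] by simp
  qed
  moreover have "x i + s * of_nat (Suc i) ~= 0" if "i < n" for i
   using inj_onD[OF elim, of "Suc i" 0] that by auto
  ultimately show ?case using one by simp
 qed
 from Lim_transform_eventually[OF tendsto_const this] show ?thesis
  by (rule tendsto_unique[OF trivial_limit_at lim])
qed

section \<open>Infinite products and Laurent expansions\<close>

lemma norm_qpoch_terms_summable:
 "norm q < 1 ==> summable (%i. norm ((1 - a*q^i) - (1::complex)))"
 by (simp add: norm_mult norm_power summable_mult summable_geometric)

lemma qpoch_LIMSEQ:
 assumes "norm q < 1" shows "(%N. qpoch a q N) \<longlonglongrightarrow> qpoch_inf a q"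
proof -
 have "convergent_prod (%i. 1 - a*q^i)"
  by (intro abs_convergent_prod_imp_convergent_prod summable_imp_abs_convergent_prod norm_qpoch_terms_summable assms)
 from convergent_prod_LIMSEQ[OF this]
 have "(%n. qpoch a q (Suc n)) \<longlonglongrightarrow> qpoch_inf a q"
  by (simp add: qpoch_def qpoch_inf_def lessThan_Suc_atMost)
 then show ?thesis by (rule filterlim_sequentially_Suc[THEN iffD1])
qed

lemma qpoch_inf_eqI:
 assumes "norm q < 1" "(%N. qpoch a q N) \<longlonglongrightarrow> c" shows "qpoch_inf a q = c"
 by (rule LIMSEQ_unique[OF qpoch_LIMSEQ[OF assms(1)] assms(2)])

lemma qpoch_inf_nonzero:
 assumes "norm q < 1" "!!i. a*q^i ~= 1" shows "qpoch_inf a q ~= 0"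
proof -
 have "convergent_prod (%i. 1 - a*q^i)"
  by (intro abs_convergent_prod_imp_convergent_prod summable_imp_abs_convergent_prod norm_qpoch_terms_summable assms)
 then show ?thesis unfolding qpoch_inf_def
  by (rule prodinf_nonzero) (use assms(2) in auto)
qed

lemma qpoch_inf_self_nonzero:
 assumes "norm q < 1" shows "qpoch_inf q q ~= 0"
 using qpoch_inf_nonzero[OF assms, of q] power_neq_1_of_norm_less_1[OF assms, of "Suc _"] by simp

lemma qpoch_Suc_shift: "qpoch a q (Suc N) = (1 - a)*qpoch (a*q) q N"
 by (simp add: qpoch_def prod.lessThan_Suc_shift mult_ac del: prod.lessThan_Suc)

lemma qpoch_inf_shift:
 assumes "norm q < 1" shows "qpoch_inf a q = (1 - a)*qpoch_inf (a*q) q"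
proof (rule qpoch_inf_eqI[OF assms])
 have "(%N. qpoch a q (Suc N)) \<longlonglongrightarrow> (1 - a)*qpoch_inf (a*q) q"
  unfolding qpoch_Suc_shift by (intro tendsto_intros qpoch_LIMSEQ assms)
 then show "(%N. qpoch a q N) \<longlonglongrightarrow> (1 - a)*qpoch_inf (a*q) q"
  by (rule filterlim_sequentially_Suc[THEN iffD1])
qed

lemma norm_qpoch_le:
 assumes "norm q < 1" shows "norm (qpoch a q N) \<le> exp (norm a/(1 - norm q))"
proof -
 have "norm (qpoch a q N) \<le> (\<Prod>i<N. 1 + norm a*norm q^i)"
  unfolding qpoch_def prod_norm[symmetric]
  by (intro prod_mono conjI order.trans[OF norm_triangle_ineq4]) (auto simp: norm_mult norm_power)
 also have "... \<le> exp (\<Sum>i<N. norm a*norm q^i)"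
  by (rule prod_le_exp_sum) auto
 also have "(\<Sum>i<N. norm a*norm q^i) \<le> norm a*(1/(1 - norm q))"
  unfolding sum_distrib_left[symmetric]
  by (intro mult_left_mono) (use assms sum_le_suminf[of "%i. norm q^i" "{..<N}"] suminf_geometric[of "norm q"] in auto)
 finally show ?thesis by simp
qed

lemma norm_qpoch_inf_le:
 assumes "norm q < 1" shows "norm (qpoch_inf a q) \<le> exp (norm a/(1 - norm q))"
 by (rule LIMSEQ_le_const2[OF tendsto_norm[OF qpoch_LIMSEQ[OF assms]]]) (use norm_qpoch_le[OF assms] in auto)

text \<open>Joint continuity in argument and base, by uniform convergence on compact sets. The base
  moves in the continuity argument that removes the exceptional \<open>t\<close>.\<close>

lemma continuous_on_qpoch_inf:
 assumes "r < 1"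
 shows "continuous_on (cball 0 A \<times> cball 0 r) (%v. qpoch_inf (fst v) (snd v))"
proof -
 let ?S = "cball (0::complex) A \<times> cball (0::complex) r"
 have cS: "compact ?S" by (intro compact_Times compact_cball)
 have "uniformly_convergent_on ?S (%N v. \<Prod>n<N. (1 + (- fst v * snd v^n)))"
 proof (rule uniformly_convergent_on_prod[OF _ cS])
  have W1: "norm (norm (- fst v * snd v^n)) \<le> A*r^n" if "v \<in> ?S" for v n
   using that by (auto simp: norm_mult norm_power intro!: mult_mono power_mono intro: order.trans[OF norm_ge_zero])
  have W2: "summable (%n. A*r^n)" if "?S ~= {}"
  proof -
   have "0 \<le> r" using that by auto
   then show ?thesis using assms by (intro summable_mult summable_geometric) auto
  qed
  show "uniformly_convergent_on ?S (%N v. \<Sum>n<N. norm (- fst v * snd v^n))"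
  proof (cases "?S = {}")
   case True
   then show ?thesis by (simp only: uniformly_convergent_on_def uniform_limit_iff) simp
  next
   case False
   then show ?thesis
    by (intro Weierstrass_m_test'[where M = "%n. A*r^n"] W1 W2)
  qed
 qed (intro continuous_intros)
 then obtain l where l: "uniform_limit ?S (%N v. \<Prod>n<N. (1 + (- fst v * snd v^n))) l sequentially"
  by (auto simp: uniformly_convergent_on_def)
 have "continuous_on ?S l"
  by (rule uniform_limit_theorem[OF _ l]) (auto intro!: always_eventually continuous_intros)
 moreover have "l v = qpoch_inf (fst v) (snd v)" if "v \<in> ?S" for v
 proof -
  have "(%N. qpoch (fst v) (snd v) N) \<longlonglongrightarrow> l v"
   using tendsto_uniform_limitI[OF l that] by (simp add: qpoch_def)
  moreover have "norm (snd v) < 1" using that assms by auto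
  ultimately show ?thesis using qpoch_inf_eqI by simp
 qed
 ultimately show ?thesis by (rule continuous_on_eq) auto
qed

lemma tendsto_qpoch_inf:
 assumes "(a \<longlongrightarrow> a0) F" "(q \<longlongrightarrow> q0) F" "norm q0 < 1"
 shows "((%z. qpoch_inf (a z) (q z)) \<longlongrightarrow> qpoch_inf a0 q0) F"
proof -
 obtain r where r: "norm q0 < r" "r < 1" using assms(3) dense by blast
 let ?S = "cball (0::complex) (norm a0 + 1) \<times> cball (0::complex) r"
 have l: "((%z. (a z, q z)) \<longlongrightarrow> (a0, q0)) F" by (intro tendsto_Pair assms)
 have e: "\<forall>\<^sub>F z in F. (a z, q z) \<in> ?S"
 proof -
  have "\<forall>\<^sub>F z in F. norm (a z) < norm a0 + 1" "\<forall>\<^sub>F z in F. norm (q z) < r"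
   using order_tendstoD(2)[OF tendsto_norm[OF assms(1)], of "norm a0 + 1"]
    order_tendstoD(2)[OF tendsto_norm[OF assms(2)] r(1)] by auto
  then show ?thesis by eventually_elim auto
 qed
 have "((%z. (%v. qpoch_inf (fst v) (snd v)) (a z, q z)) \<longlongrightarrow> (%v. qpoch_inf (fst v) (snd v)) (a0, q0)) F"
  by (rule continuous_on_tendsto_compose[OF continuous_on_qpoch_inf[OF r(2)] l _ e]) (use r in auto)
 then show ?thesis by simp
qed

lemma isCont_qpoch_inf: "norm q < 1 ==> isCont (%a. qpoch_inf a q) z"
 unfolding isCont_def by (intro tendsto_qpoch_inf tendsto_intros)

lemma tendsto_theta:
 assumes "(a \<longlongrightarrow> a0) F" "(p \<longlongrightarrow> p0) F" "norm p0 < 1" "a0 ~= 0"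
 shows "((%z. theta (a z) (p z)) \<longlongrightarrow> theta a0 p0) F"
 unfolding theta_def by (intro tendsto_mult tendsto_qpoch_inf tendsto_divide assms)

section \<open>Series expansions of infinite products\<close>

definition euler_coeff :: "complex => nat => complex" where
 "euler_coeff q n = (-1)^n*q^(n*(n - 1) div 2)/qpoch q q n"

lemma triangle_Suc: "Suc n*(Suc n - 1) div 2 = n*(n - 1) div 2 + n"
 by (cases n) (auto simp: field_simps)

lemma euler_coeff_Suc:
 assumes "norm q < 1"
 shows "euler_coeff q (Suc n) = - euler_coeff q n*q^n/(1 - q^Suc n)"
 unfolding euler_coeff_def triangle_Suc qpoch_Suc power_add by simp

lemma euler_coeff_summable:
 assumes "norm q < 1" shows "summable (%n. norm (euler_coeff q n*z^n))"
proof -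
 have "(%n. norm (- (q^n)/(1 - q^Suc n)*z)) \<longlonglongrightarrow> norm (- 0/(1 - 0)*z)"
  by (intro tendsto_intros LIMSEQ_power_zero LIMSEQ_Suc[OF LIMSEQ_power_zero] assms) auto
 then have "\<forall>\<^sub>F n in sequentially. norm (- (q^n)/(1 - q^Suc n)*z) < 1/2"
  by (intro order_tendstoD) auto
 then obtain N where N: "!!n. n \<ge> N ==> norm (- (q^n)/(1 - q^Suc n)*z) < 1/2"
  by (auto simp: eventually_sequentially)
 show ?thesis
 proof (rule summable_ratio_test[of "1/2" N])
  fix n assume "n \<ge> N"
  have "euler_coeff q (Suc n)*z^Suc n = (- (q^n)/(1 - q^Suc n)*z)*(euler_coeff q n*z^n)"
   unfolding euler_coeff_Suc[OF assms] by simp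
  then have "norm (euler_coeff q (Suc n)*z^Suc n) =
    norm (- (q^n)/(1 - q^Suc n)*z)*norm (euler_coeff q n*z^n)"
   by (simp only: norm_mult)
  also have "... \<le> 1/2*norm (euler_coeff q n*z^n)"
   by (intro mult_right_mono less_imp_le[OF N[OF \<open>n \<ge> N\<close>]]) auto
  finally show "norm (norm (euler_coeff q (Suc n)*z^Suc n)) \<le> 1/2*norm (norm (euler_coeff q n*z^n))"
   by simp
 qed simp
qed

text \<open>The power series \<open>E\<close> satisfies \<open>E z = (1 - z)*E (z*q)\<close>;
  iterating this and letting \<open>z*q^N\<close> tend to 0 produces the infinite product.\<close>

lemma euler_expansion:
 assumes "norm q < 1"
 shows "((%n. euler_coeff q n*z^n) has_sum qpoch_inf z q) UNIV"
proof -
 define E where "E z = (\<Sum>n. euler_coeff q n*z^n)" for z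
 have summ: "summable (%n. euler_coeff q n*z^n)" for z
  by (rule summable_norm_cancel[OF euler_coeff_summable[OF assms]])
 have rec: "E z = (1 - z)*E (z*q)" for z
 proof -
  have 1: "E v = euler_coeff q 0 + (\<Sum>n. euler_coeff q (Suc n) * v^Suc n)" for v
   unfolding E_def using suminf_split_head[OF summ[of v]] by simp
  have s: "summable (%n. euler_coeff q (Suc n) * v^Suc n)" for v
   using summ[of v] by (subst summable_Suc_iff)
  have "E (z*q) - z*E (z*q) = euler_coeff q 0 +
    ((\<Sum>n. euler_coeff q (Suc n)*(z*q)^Suc n) - (\<Sum>n. z*(euler_coeff q n*(z*q)^n)))"
   unfolding suminf_mult[OF summ] E_def[symmetric] by (subst 1) simp
  also have "(\<Sum>n. euler_coeff q (Suc n)*(z*q)^Suc n) - (\<Sum>n. z*(euler_coeff q n*(z*q)^n)) =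
    (\<Sum>n. euler_coeff q (Suc n)*(z*q)^Suc n - z*(euler_coeff q n*(z*q)^n))"
   by (intro suminf_diff s summable_mult summ)
  also have "(%n. euler_coeff q (Suc n)*(z*q)^Suc n - z*(euler_coeff q n*(z*q)^n)) =
    (%n. euler_coeff q (Suc n)*z^Suc n)"
  proof
   fix n
   have nz: "1 - q^Suc n ~= 0" using power_neq_1_of_norm_less_1[OF assms, of "Suc n"] by auto
   have "euler_coeff q n*q^n = - (euler_coeff q (Suc n)*(1 - q^Suc n))"
    unfolding euler_coeff_Suc[OF assms] using nz by (simp del: power_Suc)
   moreover have "z*(euler_coeff q n*(z*q)^n) = (euler_coeff q n*q^n)*z^Suc n"
    by (simp add: power_mult_distrib)
   ultimately have "z*(euler_coeff q n*(z*q)^n) = - (euler_coeff q (Suc n)*(1 - q^Suc n))*z^Suc n"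
    by simp
   then show "euler_coeff q (Suc n)*(z*q)^Suc n - z*(euler_coeff q n*(z*q)^n) =
     euler_coeff q (Suc n)*z^Suc n"
    by (simp add: power_mult_distrib algebra_simps)
  qed
  finally show ?thesis using 1[of z] by (simp add: algebra_simps)
 qed
 have iter: "E z = qpoch z q N*E (z*q^N)" for N
 proof (induction N)
  case (Suc N)
  then show ?case using rec[of "z*q^N"] by (simp add: qpoch_Suc mult_ac)
 qed (simp add: qpoch_def)
 have "isCont E 0"
  unfolding E_def by (rule isCont_powser[where K = 1]) (use summ[of 1] in auto)
 then have "(%N. E (z*q^N)) \<longlonglongrightarrow> E 0"
 proof (rule isCont_tendsto_compose)
  have "(%N. z*q^N) \<longlonglongrightarrow> z*0" by (intro tendsto_intros LIMSEQ_power_zero assms)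
  then show "(%N. z*q^N) \<longlonglongrightarrow> 0" by simp
 qed
 then have "(%N. qpoch z q N*E (z*q^N)) \<longlonglongrightarrow> qpoch_inf z q*E 0"
  by (intro tendsto_mult qpoch_LIMSEQ assms)
 then have "(%N. E z) \<longlonglongrightarrow> qpoch_inf z q*E 0" using iter by simp
 then have "E z = qpoch_inf z q*E 0" by (simp add: LIMSEQ_const_iff)
 moreover have "E 0 = euler_coeff q 0" unfolding E_def by (rule powser_zero)
 then have "E 0 = 1" by (simp add: euler_coeff_def qpoch_def)
 ultimately have "(%n. euler_coeff q n*z^n) sums qpoch_inf z q"
  using summable_sums[OF summ[of z]] by (simp add: E_def)
 with euler_coeff_summable[OF assms] show ?thesis by (rule norm_summable_imp_has_sum)
qed

text \<open>Convergence is demanded on the whole punctured plane. As \<open>has_sum\<close> is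
  unordered, it is absolute, which permits the rearrangements below.\<close>

definition laurent :: "(complex => complex) => (int => complex) => bool" where
 "laurent f a \<longleftrightarrow> (\<forall>y. y ~= 0 \<longrightarrow> ((%n. a n*y powi n) has_sum f y) UNIV)"

lemma laurentD: "laurent f a ==> y ~= 0 ==> ((%n. a n*y powi n) has_sum f y) UNIV"
 by (simp add: laurent_def)

lemma laurent_cong: "laurent f a ==> (!!y. y ~= 0 ==> f y = g y) ==> laurent g a"
 by (simp add: laurent_def)

lemma laurent_add: "laurent f a ==> laurent g b ==> laurent (%y. f y + g y) (%n. a n + b n)"
 by (auto simp: laurent_def distrib_right intro: has_sum_add)

lemma laurent_cmult: "laurent f a ==> laurent (%y. c*f y) (%n. c*a n)"
 unfolding laurent_def mult.assoc by (auto intro: has_sum_cmult_right)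

lemma laurent_scale: "laurent f a ==> c ~= 0 ==> laurent (%y. f (c*y)) (%n. a n * c powi n)"
 unfolding laurent_def
proof (intro allI impI)
 fix y :: complex assume "\<forall>y. y ~= 0 \<longrightarrow> ((%n. a n*y powi n) has_sum f y) UNIV" "c ~= 0" "y ~= 0"
 then have "((%n. a n*(c*y) powi n) has_sum f (c*y)) UNIV" by simp
 then show "((%n. a n * c powi n*y powi n) has_sum f (c*y)) UNIV"
  by (simp add: power_int_mult_distrib mult.assoc)
qed

lemma laurent_reflect: "laurent f a ==> laurent (%y. f (1/y)) (%n. a (- n))"
 unfolding laurent_def
proof (intro allI impI)
 fix y :: complex assume *: "\<forall>y. y ~= 0 \<longrightarrow> ((%n. a n*y powi n) has_sum f y) UNIV" "y ~= 0"
 then have "((%n. a n*(1/y) powi n) has_sum f (1/y)) UNIV" by simp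
 also have "?this \<longleftrightarrow> ((%n. a (- n)*y powi n) has_sum f (1/y)) UNIV"
  by (rule has_sum_reindex_bij_witness[of _ uminus uminus])
    (auto simp: power_int_minus power_int_inverse divide_inverse)
 finally show "((%n. a (- n)*y powi n) has_sum f (1/y)) UNIV" .
qed

lemma laurent_shift: "laurent f a ==> laurent (%y. y powi m*f y) (%n. a (n - m))"
 unfolding laurent_def
proof (intro allI impI)
 fix y :: complex assume *: "\<forall>y. y ~= 0 \<longrightarrow> ((%n. a n*y powi n) has_sum f y) UNIV" "y ~= 0"
 then have "((%n. y powi m*(a n*y powi n)) has_sum y powi m*f y) UNIV" by (intro has_sum_cmult_right) simp
 also have "?this \<longleftrightarrow> ((%n. a (n - m)*y powi n) has_sum y powi m*f y) UNIV"
  by (rule has_sum_reindex_bij_witness[of _ "%n. n - m" "%n. n + m"])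
    (use*in \<open>auto simp: power_int_add power_int_diff\<close>)
 finally show "((%n. a (n - m)*y powi n) has_sum y powi m*f y) UNIV" .
qed

lemma laurent_1: "laurent (%_. 1) (%n. of_bool (n = 0))"
 unfolding laurent_def
proof (intro allI impI)
 fix y :: complex
 have "((%n. of_bool (n = 0)*y powi n) has_sum 1) {0::int}"
  using has_sum_finite[of "{0::int}" "%n. of_bool (n = 0)*y powi n"] by simp
 then show "((%n. of_bool (n = 0)*y powi n) has_sum 1) UNIV"
  by (rule has_sum_cong_neutral[THEN iffD1, rotated -1]) auto
qed

lemma laurent_powi: "laurent (%y. y powi m) (%n. of_bool (n = m))"
 using laurent_shift[OF laurent_1, of m] by simp

lemma laurent_entire:
 assumes "!!y. ((%n::nat. c n*y^n) has_sum f y) UNIV"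
 shows "laurent f (%n. if n \<ge> 0 then c (nat n) else 0)"
 unfolding laurent_def
proof (intro allI impI)
 fix y :: complex
 let ?a = "%n. if n \<ge> 0 then c (nat n) else 0"
 have "((%n. c n*y^n) has_sum f y) UNIV \<longleftrightarrow> ((%n. ?a n*y powi n) has_sum f y) {0..}"
  by (rule has_sum_reindex_bij_witness[of _ nat int]) (auto simp: power_int_def)
 then have "((%n. ?a n*y powi n) has_sum f y) {0..}" using assms by simp
 then show "((%n. ?a n*y powi n) has_sum f y) UNIV"
  by (rule has_sum_cong_neutral[THEN iffD1, rotated -1]) auto
qed

text \<open>The Cauchy product: the double series is absolutely summable and may be summed along its
  diagonals.\<close>

lemma laurent_mult:
 assumes "laurent f a" "laurent g b"
 shows "laurent (%y. f y*g y) (%n. \<Sum>\<^sub>\<infinity>m. a m*b (n - m))"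
 unfolding laurent_def
proof (intro allI impI)
 have main: "(\<forall>n. (%m. a m*b (n - m)*y powi n) summable_on UNIV) \<and>
   ((%n. \<Sum>\<^sub>\<infinity>m. a m*b (n - m)*y powi n) has_sum f y*g y) UNIV" if y: "y ~= 0" for y
 proof -
  define F G where "F m = a m*y powi m" and "G m = b m*y powi m" for m
  have F: "(F has_sum f y) UNIV" and G: "(G has_sum g y) UNIV"
   using assms y by (auto simp: laurent_def F_def[abs_def] G_def[abs_def])
  have "(%m. norm (F m)) summable_on UNIV" "(%m. norm (G m)) summable_on UNIV"
   using F G by (auto simp: summable_on_iff_abs_summable_on_complex[symmetric] summable_on_def)
  then have "(%v. norm (case v of (m, k) => F m*G k)) summable_on UNIV \<times> UNIV"
   by (subst Infinite_Sum.abs_summable_on_Sigma_iff) (auto simp: norm_mult infsum_cmult_right' abs_mult intro!: summable_on_cmult_right summable_on_cmult_left)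
  then have summ: "(%(m, k). F m*G k) summable_on UNIV \<times> UNIV" by (rule abs_summable_summable)
  have "((%(m, k). F m*G k) has_sum f y*g y) (UNIV \<times> UNIV)"
   by (rule has_sum_SigmaI[where g = "%m. F m*g y"])
     (auto intro!: has_sum_cmult_right has_sum_cmult_left F G summ[unfolded UNIV_Times_UNIV])
  also have "((%(m, k). F m*G k) has_sum f y*g y) (UNIV \<times> UNIV) \<longleftrightarrow>
    ((%(n, m). a m*b (n - m)*y powi n) has_sum f y*g y) (UNIV \<times> UNIV)"
   by (rule has_sum_reindex_bij_witness[of _ "%(n, m). (m, n - m)" "%(m, k). (m + k, m)"])
     (use y in "auto simp: F_def G_def power_int_add mult_ac")
  finally have hs: "((%(n, m). a m*b (n - m)*y powi n) has_sum f y*g y) (UNIV \<times> UNIV)" .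
  then have "(%(n, m). a m*b (n - m)*y powi n) summable_on (UNIV \<times> UNIV)" by (auto simp: summable_on_def)
  then have inner: "(%m. a m*b (n - m)*y powi n) summable_on UNIV" for n
   using summable_on_SigmaD1[of "%n m. a m*b (n - m)*y powi n" UNIV "%_. UNIV" n] by simp
  have "((%n. \<Sum>\<^sub>\<infinity>m. a m*b (n - m)*y powi n) has_sum f y*g y) UNIV"
   by (rule has_sum_SigmaD[OF hs]) (use inner in auto)
  with inner show ?thesis by blast
 qed
 fix y :: complex assume y: "y ~= 0"
 have "(\<Sum>\<^sub>\<infinity>m. a m*b (n - m)*y powi n) = (\<Sum>\<^sub>\<infinity>m. a m*b (n - m))*y powi n" for n
  using main[of 1] by (intro infsum_cmult_left) auto
 with main[OF y] show "((%n. (\<Sum>\<^sub>\<infinity>m. a m*b (n - m))*y powi n) has_sum f y*g y) UNIV" by simp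
qed

definition is_laurent :: "(complex => complex) => bool" where
 "is_laurent f \<longleftrightarrow> (\<exists>a. laurent f a)"

lemma is_laurent_mult: "is_laurent f ==> is_laurent g ==> is_laurent (%y. f y*g y)"
 unfolding is_laurent_def using laurent_mult by blast

lemma is_laurent_add: "is_laurent f ==> is_laurent g ==> is_laurent (%y. f y + g y)"
 unfolding is_laurent_def using laurent_add by blast

lemma is_laurent_const: "is_laurent (%_. c)"
 unfolding is_laurent_def using laurent_cmult[OF laurent_1, of c] by auto

lemma is_laurent_prod: "(!!i. i \<in> I ==> is_laurent (f i)) ==> is_laurent (%y. \<Prod>i\<in>I. f i y)"
 by (induction I rule: infinite_finite_induct) (auto intro: is_laurent_mult is_laurent_const)

lemma is_laurent_powi: "is_laurent (%y. y powi m)"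
 unfolding is_laurent_def using laurent_powi by blast

lemma is_laurent_ident: "is_laurent (%y. y)"
 using is_laurent_powi[of 1] by simp

lemma is_laurent_reflect: "is_laurent f ==> is_laurent (%y. f (1/y))"
 unfolding is_laurent_def using laurent_reflect by blast

lemma is_laurent_scale: "is_laurent f ==> is_laurent (%y. f (c*y))"
 by (cases "c = 0") (auto simp: is_laurent_const is_laurent_def intro: laurent_scale)

lemma is_laurent_inverse: "is_laurent (%y. c/y)"
 using is_laurent_mult[OF is_laurent_const[of c] is_laurent_reflect[OF is_laurent_ident]] by simp

lemma is_laurent_qpoch_inf:
 assumes "norm q < 1"
 shows "is_laurent (%y. qpoch_inf (c*y) q)" "is_laurent (%y. qpoch_inf (c/y) q)"
proof -
 have 1: "is_laurent (%y. qpoch_inf y q)"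
  unfolding is_laurent_def using laurent_entire[OF euler_expansion[OF assms]] by blast
 show 2: "is_laurent (%y. qpoch_inf (c*y) q)" for c by (rule is_laurent_scale[OF 1])
 show "is_laurent (%y. qpoch_inf (c/y) q)"
  using is_laurent_reflect[OF 2[of c]] by simp
qed

lemma is_laurent_theta:
 assumes "norm p < 1" shows "is_laurent (%y. theta (c*y) p)"
proof -
 have "is_laurent (%y. qpoch_inf (c*y) p*qpoch_inf ((p/c)/y) p)"
  by (intro is_laurent_mult is_laurent_qpoch_inf assms)
 then show ?thesis by (simp add: theta_def)
qed

section \<open>Constant terms as circle integrals\<close>

definition circ :: "real measure" where
 "circ = restrict_space lborel {0..1}"

definition ee :: "real => complex" where
 "ee vt = cis (2*pi * vt)"

lemma norm_ee [simp]: "norm (ee vt) = 1"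
 by (simp add: ee_def)

lemma ee_nonzero [simp]: "ee vt ~= 0"
 by (simp add: ee_def)

lemma space_circ [simp]: "space circ = {0..1}"
 by (simp add: circ_def space_restrict_space)

lemma borel_measurable_circ: "f \<in> borel_measurable borel ==> f \<in> borel_measurable circ"
 unfolding circ_def by (rule measurable_restrict_space1) simp

lemma emeasure_circ_space: "emeasure circ (space circ) = 1"
 by (simp add: circ_def emeasure_restrict_space space_restrict_space)

lemma finite_measure_circ: "finite_measure circ"
 by (rule finite_measureI) (simp only: emeasure_circ_space, simp)

lemma measure_circ_space: "measure circ {0..1} = 1"
 using emeasure_circ_space by (simp add: measure_def)

lemma measurable_ee [measurable]: "ee \<in> borel_measurable circ"
proof (rule borel_measurable_circ)
 have "continuous_on UNIV ee" unfolding ee_def[abs_def] by (intro continuous_intros)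
 then show "ee \<in> borel_measurable borel" by (rule borel_measurable_continuous_onI)
qed

lemma ee_powi: "ee vt powi n = cis (2*pi * of_int n * vt)"
 by (simp add: ee_def cis_power_int mult_ac)

lemma integral_ee_powi: "(\<integral>vt. ee vt powi n \<partial>circ) = of_bool (n = 0)"
proof (cases "n = 0")
 case True
 show ?thesis using True by (simp add: measure_circ_space)
next
 case False
 define c where "c = 2*pi*real_of_int n"
 have c: "c ~= 0" using False by (simp add: c_def)
 define F where "F vt = cis (c * vt)/(\<i> * of_real c)" for vt
 have d: "(F has_vector_derivative cis (c * vt)) (at vt within {0..1})" for vt
 proof -
  have "((%vt. cis (c * vt)) has_vector_derivative (of_real c*(\<i> * cis (c * vt)))) (at vt within {0..1})"
  proof -
   have "((%vt. exp (\<i> * of_real c * of_real vt)) has_vector_derivative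
     (exp (\<i> * of_real c * of_real vt)*(\<i> * of_real c))) (at vt within {0..1})"
    by (rule has_vector_derivative_real_field) (auto intro!: derivative_eq_intros)
   then show ?thesis by (simp add: cis_conv_exp mult_ac)
  qed
  then have "(F has_vector_derivative (of_real c*(\<i> * cis (c * vt)))/(\<i> * of_real c)) (at vt within {0..1})"
   unfolding F_def by (rule has_vector_derivative_divide)
  then show ?thesis using c by simp
 qed
 have "(\<integral>vt. ee vt powi n \<partial>circ) = (\<integral>vt. indicator {0..1} vt *\<^sub>R cis (c * vt) \<partial>lborel)"
  unfolding circ_def ee_powi c_def by (subst integral_restrict_space) auto
 also have "... = F 1 - F 0"
  by (rule integral_FTC_atLeastAtMost) (auto intro!: d continuous_intros)
 also have "... = 0"
  using cis_multiple_2pi[of "of_int n"] by (simp add: F_def c_def)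
 finally show ?thesis using False by simp
qed

text \<open>The symmetric partial sums are dominated by the sum of the \<open>norm (a n)\<close>,
  and every term but the constant one integrates to 0.\<close>

lemma laurent_circle_integral:
 assumes "laurent f a"
 shows "(\<integral>vt. f (ee vt) \<partial>circ) = a 0"
proof -
 interpret finite_measure circ by (rule finite_measure_circ)
 define S where "S N vt = (\<Sum>n\<in>{- int N..int N}. a n*ee vt powi n)" for N vt
 have hs: "((%n. a n*ee vt powi n) has_sum f (ee vt)) UNIV" for vt
  using laurentD[OF assms ee_nonzero] .
 have "((%n. a n*1 powi n) has_sum f 1) UNIV" by (rule laurentD[OF assms]) simp
 then have "a summable_on UNIV" by (auto simp: summable_on_def)
 then have abs: "(%n. norm (a n)) summable_on UNIV" by (simp add: summable_on_iff_abs_summable_on_complex)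
 define B where "B = (\<Sum>\<^sub>\<infinity>n. norm (a n))"
 have fl: "filterlim (%N. {- int N..int N}) (finite_subsets_at_top UNIV) sequentially"
  unfolding filterlim_finite_subsets_at_top
 proof (intro allI impI)
  fix X :: "int set" assume "finite X \<and> X \<subseteq> UNIV"
  then have X: "finite X" by simp
  obtain N where N: "!!x. x \<in> X ==> nat \<bar>x\<bar> \<le> N"
   using finite_nat_set_iff_bounded_le[of "(%x. nat \<bar>x\<bar>) ` X"] X by auto
  show "\<forall>\<^sub>F n in sequentially. finite {- int n..int n} \<and> X \<subseteq> {- int n..int n} \<and> {- int n..int n} \<subseteq> UNIV"
   unfolding eventually_sequentially
   by (rule exI[of _ N]) (use N in force)
 qed
 have "(%N. integral\<^sup>L circ (S N)) \<longlonglongrightarrow> (\<integral>vt. f (ee vt) \<partial>circ)"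
 proof (rule integral_dominated_convergence[where w = "%_. B"])
  have lim: "(%N. S N vt) \<longlonglongrightarrow> f (ee vt)" for vt
   unfolding S_def using filterlim_compose[OF hs[of vt, unfolded has_sum_def] fl] by simp
  then show "AE vt in circ. (%N. S N vt) \<longlonglongrightarrow> f (ee vt)" by simp
  show mS: "S N \<in> borel_measurable circ" for N
  proof -
   have "(%vt. cis (2*pi * of_int n * vt)) \<in> borel_measurable circ" for n :: int
    by (intro borel_measurable_circ borel_measurable_continuous_onI continuous_intros)
   then show ?thesis unfolding S_def ee_powi by measurable
  qed
  show "(%vt. f (ee vt)) \<in> borel_measurable circ"
   by (rule borel_measurable_LIMSEQ_metric[OF mS lim])
  show "AE vt in circ. norm (S N vt) \<le> B" for N
  proof (intro AE_I2)
   fix vt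
   have "norm (S N vt) \<le> (\<Sum>n\<in>{- int N..int N}. norm (a n))"
    unfolding S_def by (rule order.trans[OF norm_sum]) (simp add: norm_mult norm_power_int)
   also have "... \<le> B" unfolding B_def by (rule finite_sum_le_infsum[OF abs]) auto
   finally show "norm (S N vt) \<le> B" .
  qed
 qed simp
 moreover have "integral\<^sup>L circ (S N) = a 0" for N
 proof -
  have int: "integrable circ (%vt. ee vt powi n)" for n
   by (rule integrable_const_bound[of _ 1])
     (auto simp: norm_power_int ee_powi intro!: borel_measurable_circ borel_measurable_continuous_onI continuous_intros)
  have "integral\<^sup>L circ (S N) = (\<Sum>n\<in>{- int N..int N}. a n * of_bool (n = 0))"
   unfolding S_def using int by (simp add: integral_ee_powi)
  also have "... = (\<Sum>n\<in>{0}. a n * of_bool (n = 0))"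
   by (rule sum.mono_neutral_right) auto
  finally show ?thesis by simp
 qed
 ultimately have "(%N. a 0) \<longlonglongrightarrow> (\<integral>vt. f (ee vt) \<partial>circ)" by simp
 then show ?thesis by (simp add: LIMSEQ_const_iff)
qed

text \<open>Rescaling the variable does not touch the constant term, so all circles around 0 give
  the same integral.\<close>

lemma is_laurent_integral_scale:
 assumes "is_laurent f" "c ~= 0"
 shows "(\<integral>vt. f (c*ee vt) \<partial>circ) = (\<integral>vt. f (ee vt) \<partial>circ)"
proof -
 obtain a where a: "laurent f a" using assms by (auto simp: is_laurent_def)
 from laurent_circle_integral[OF laurent_scale[OF a assms(2)]] laurent_circle_integral[OF a]
 show ?thesis by simp
qed

lemma laurent_unique:
 assumes "laurent f a" "laurent f b" shows "a = b"
proof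
 fix n
 from laurent_circle_integral[OF laurent_shift[OF assms(1), of "- n"]]
  laurent_circle_integral[OF laurent_shift[OF assms(2), of "- n"]]
 show "a n = b n" by simp
qed

section \<open>The Jacobi triple product\<close>

lemma theta_shift:
 assumes "norm p < 1" "p ~= 0" "z ~= 0"
 shows "theta (p*z) p = - theta z p/z"
proof -
 have 1: "qpoch_inf z p = (1 - z)*qpoch_inf (p*z) p"
  using qpoch_inf_shift[OF assms(1), of z] by (simp add: mult.commute)
 have 2: "qpoch_inf (1/z) p = (1 - 1/z)*qpoch_inf (p/z) p"
  using qpoch_inf_shift[OF assms(1), of "1/z"] by simp
 have "theta (p*z) p = qpoch_inf (p*z) p*qpoch_inf (1/z) p"
  using assms by (simp add: theta_def)
 also have "... = - (1 - z)*qpoch_inf (p*z) p*qpoch_inf (p/z) p/z"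
 proof -
  have e: "1 - 1/z = - (1 - z)/z" using assms(3) by (simp add: field_simps)
  have "A*((- C/z)*B) = - C*A*B/z" for A B C by simp
  then show ?thesis unfolding 2 e .
 qed
 also have "... = - theta z p/z" unfolding theta_def 1 by (simp only: minus_mult_left)
 finally show ?thesis .
qed

lemma theta_inverse:
 assumes "norm p < 1" "p ~= 0" "z ~= 0"
 shows "theta (1/z) p = - theta z p/z"
proof -
 have "theta (1/z) p = theta (p*z) p"
  using assms by (simp add: theta_def mult.commute)
 then show ?thesis using theta_shift[OF assms] by simp
qed

definition jtp_coeff :: "complex => int => complex" where
 "jtp_coeff p n = (-1) powi n*p^nat (n*(n - 1) div 2)"

lemma int_triangle: "(n + 1)*(n + 1 - 1) div 2 = n*(n - 1) div 2 + (n :: int)"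
proof -
 have "(n + 1)*(n + 1 - 1) = n*(n - 1) + 2*n" by (simp add: algebra_simps)
 then show ?thesis by simp
qed

lemma int_triangle_nonneg: "0 \<le> n*(n - 1) div (2 :: int)"
proof -
 have "0 \<le> n*(n - 1)" by (cases "n \<le> 0") (auto intro: mult_nonpos_nonpos)
 then show ?thesis by simp
qed

lemma jtp_coeff_powi:
 assumes "p ~= 0" shows "jtp_coeff p n = (-1) powi n*p powi (n*(n - 1) div 2)"
 using int_triangle_nonneg[of n] by (simp add: jtp_coeff_def power_int_def)

lemma jtp_coeff_Suc:
 assumes "p ~= 0" shows "jtp_coeff p (n + 1) = - jtp_coeff p n*p powi n"
 unfolding jtp_coeff_powi[OF assms] int_triangle power_int_add[OF disjI1[OF assms]]
 by (simp add: power_int_add)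

lemma rec_int_coeffs:
 assumes "!!n. c (n + 1) = - c n*p powi n" "(p::complex) ~= 0"
 shows "c n = jtp_coeff p n * c 0"
proof (induction n rule: int_induct[where k = 0])
 case base
 show ?case by (simp add: jtp_coeff_def)
next
 case (step1 n)
 then show ?case by (simp add: assms(1) jtp_coeff_Suc[OF assms(2)])
next
 case (step2 n)
 have "- (jtp_coeff p (n - 1) * c 0)*p powi (n - 1) = - c (n - 1)*p powi (n - 1)"
  using step2 assms(1)[of "n - 1"] jtp_coeff_Suc[OF assms(2), of "n - 1"] by simp
 then have "jtp_coeff p (n - 1) * c 0 = c (n - 1)" using assms(2) by simp
 then show ?case by (rule sym)
qed

lemma qpoch_self_bound:
 assumes "norm p < 1" obtains dl where "dl > 0" "!!n. norm (1/qpoch p p n) \<le> dl"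
proof -
 have "(%n. 1/qpoch p p n) \<longlonglongrightarrow> 1/qpoch_inf p p"
  by (intro tendsto_intros qpoch_LIMSEQ assms qpoch_inf_self_nonzero)
 then have "Bseq (%n. 1/qpoch p p n)" by (intro convergent_imp_Bseq convergentI)
 then show ?thesis using that by (auto elim!: BseqE)
qed

text \<open>The functional equation of \<open>theta\<close> determines the coefficients up to
  \<open>c 0\<close>. Multiplying the two Euler series shows that the quotient of \<open>c n\<close>
  by \<open>jtp_coeff p n\<close> is a series of terms \<open>g j n\<close>. Its sum is
  \<open>c 0\<close> for every \<open>n\<close>, and as \<open>n\<close> grows only the term
  \<open>j = 0\<close> survives, with limit \<open>1/qpoch_inf p p\<close>.\<close>

theorem jacobi_triple_product:
 assumes "norm p < 1" "p ~= 0"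
 shows "laurent (%z. theta z p) (%n. jtp_coeff p n/qpoch_inf p p)"
proof -
 define e where "e n = (if n \<ge> 0 then euler_coeff p (nat n) else 0)" for n :: int
 have 1: "laurent (%y. qpoch_inf y p) e"
  unfolding e_def by (rule laurent_entire[OF euler_expansion[OF assms(1)]])
 have 2: "laurent (%y. qpoch_inf (p*(1/y)) p) (%n. e (- n)*p powi (- n))"
  by (rule laurent_reflect[OF laurent_scale[OF 1 assms(2)]])
 define c where "c n = (\<Sum>\<^sub>\<infinity>m. e m*(e (- (n - m))*p powi (- (n - m))))" for n
 have L: "laurent (%z. theta z p) c"
  using laurent_mult[OF 1 2] by (simp add: theta_def c_def[abs_def])
 have A: "laurent (%z. theta (p*z) p) (%n. c n*p powi n)" by (rule laurent_scale[OF L assms(2)])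
 have B: "laurent (%z. theta (p*z) p) (%n. (-1) * c (n - (- 1)))"
  by (rule laurent_cong[OF laurent_cmult[OF laurent_shift[OF L]]])
    (use theta_shift[OF assms] in "auto simp: power_int_minus divide_inverse mult_ac")
 have rec: "c (n + 1) = - c n*p powi n" for n
  using fun_cong[OF laurent_unique[OF A B], of n] by simp
 have c: "c n = jtp_coeff p n * c 0" for n by (rule rec_int_coeffs[OF rec assms(2)])
 obtain dl where dl: "dl > 0" "!!n. norm (1/qpoch p p n) \<le> dl" using qpoch_self_bound[OF assms(1)] by blast
 define g where "g j n = p^(n*j + j*j)*(1/qpoch p p (n + j))*(1/qpoch p p j)" for j n :: nat
 have g_le: "norm (g j n) \<le> norm p^e*dl*dl" if "e \<le> n*j + j*j" for e j n
 proof -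
  have "norm (p^(n*j + j*j)) \<le> norm p^e"
   unfolding norm_power using that assms(1) by (intro power_decreasing) simp_all
  then have "norm (p^(n*j + j*j))*norm (1/qpoch p p (n + j)) \<le> norm p^e*dl"
   using dl(2) by (rule mult_mono) simp_all
  then have "norm (p^(n*j + j*j))*norm (1/qpoch p p (n + j))*norm (1/qpoch p p j) \<le> norm p^e*dl*dl"
   using dl(2) by (rule mult_mono) (use dl(1) in simp_all)
  then show ?thesis unfolding g_def norm_mult .
 qed
 have jle: "j \<le> n*j + j*j" for j n :: nat by (rule order.trans[OF le_square]) simp
 have prod: "euler_coeff p (n + j)*(euler_coeff p j*p^j) = jtp_coeff p (int n)*g j n" for n j
 proof -
  have t: "(n + j)*(n + j - 1) div 2 + j*(j - 1) div 2 + j = n*(n - 1) div 2 + (n*j + j*j)"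
  proof (induction j)
   case (Suc j)
   have "(n + Suc j)*(n + Suc j - 1) div 2 = (n + j)*(n + j - 1) div 2 + (n + j)"
    using triangle_Suc[of "n + j"] by simp
   with Suc triangle_Suc[of j] show ?case by simp
  qed simp
  have "nat (int n*(int n - 1) div 2) = n*(n - 1) div 2"
  proof (cases n)
   case (Suc m)
   have "int n*(int n - 1) div 2 = int (n*(n - 1) div 2)" using Suc by (simp add: zdiv_int algebra_simps)
   then show ?thesis by simp
  qed simp
  then have j: "jtp_coeff p (int n) = (-1)^n*p^(n*(n - 1) div 2)" by (simp add: jtp_coeff_def)
  have "euler_coeff p (n + j)*(euler_coeff p j*p^j) =
    ((-1)^(n + j)*(-1)^j)*p^((n + j)*(n + j - 1) div 2 + j*(j - 1) div 2 + j)
     * (1/qpoch p p (n + j))*(1/qpoch p p j)"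
   by (simp add: euler_coeff_def power_add)
  also have "(-1)^(n + j)*(-1)^j = ((-1)^n :: complex)"
   by (simp add: minus_one_power_iff)
  finally show ?thesis unfolding t j g_def by (simp add: power_add mult_ac)
 qed
 have sums: "(\<Sum>j. g j n) = c 0" for n
 proof -
  have "(%m. e m*(e (- (int n - m))*p powi (- (int n - m)))) summable_on UNIV"
  proof -
   have *: "(%j. euler_coeff p (n + j)*(euler_coeff p j*p^j)) summable_on UNIV"
   proof -
    have "summable (%j. norm (euler_coeff p (n + j)*(euler_coeff p j*p^j)))"
     unfolding prod
    proof (rule summable_comparison_test')
     show "summable (%j. norm (jtp_coeff p (int n))*(norm p^j*dl*dl))"
      by (intro summable_mult summable_mult2 summable_geometric) (use assms in simp)
     show "norm (norm (jtp_coeff p (int n)*g j n)) \<le> norm (jtp_coeff p (int n))*(norm p^j*dl*dl)"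
      if "j \<ge> 0" for j
     proof -
      have "norm (norm (jtp_coeff p (int n)*g j n)) = norm (jtp_coeff p (int n)*g j n)"
       by (simp only: real_norm_def abs_norm_cancel)
      also have "... = norm (jtp_coeff p (int n))*norm (g j n)"
       by (rule norm_mult)
      also have "... \<le> norm (jtp_coeff p (int n))*(norm p^j*dl*dl)"
       by (rule mult_left_mono[OF g_le[OF jle] norm_ge_zero])
      finally show ?thesis .
     qed
    qed
    then show ?thesis
     by (rule abs_summable_summable[OF summable_on_UNIV_nonneg_real_iff[THEN iffD2, rotated]]) simp
   qed
   then show ?thesis
   proof -
    have "(%j. euler_coeff p (n + j)*(euler_coeff p j*p^j)) summable_on UNIV \<longleftrightarrow>
      (%m. e m*(e (- (int n - m))*p powi (- (int n - m)))) summable_on {int n..}"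
     by (rule summable_on_reindex_bij_witness[of _ "%m. nat (m - int n)" "%j. int n + int j"])
       (auto simp: e_def nat_add_distrib power_int_def)
    with*have "(%m. e m*(e (- (int n - m))*p powi (- (int n - m)))) summable_on {int n..}" by simp
    then show ?thesis
     by (rule summable_on_cong_neutral[THEN iffD1, rotated -1]) (auto simp: e_def)
   qed
  qed
  then have "((%m. e m*(e (- (int n - m))*p powi (- (int n - m)))) has_sum c (int n)) UNIV"
   unfolding c_def by (rule has_sum_infsum)
  then have "((%m. e m*(e (- (int n - m))*p powi (- (int n - m)))) has_sum c (int n)) {int n..}"
   by (rule has_sum_cong_neutral[THEN iffD1, rotated -1]) (auto simp: e_def)
  also have "?this \<longleftrightarrow> ((%j. euler_coeff p (n + j)*(euler_coeff p j*p^j)) has_sum c (int n)) UNIV"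
   by (rule has_sum_reindex_bij_witness[symmetric, of _ "%m. nat (m - int n)" "%j. int n + int j"])
     (auto simp: e_def nat_add_distrib power_int_def)
  finally have "(%j. jtp_coeff p (int n)*g j n) sums (jtp_coeff p (int n) * c 0)"
   unfolding prod c[of "int n"] by (rule has_sum_imp_sums)
  moreover have "jtp_coeff p (int n) ~= 0" using assms by (simp add: jtp_coeff_def)
  ultimately have "(%j. g j n) sums c 0" by (simp add: sums_mult_iff)
  then show ?thesis by (simp add: sums_unique[symmetric])
 qed
 have "(%n. \<Sum>j. g j (Suc n)) \<longlonglongrightarrow> (\<Sum>j. if j = 0 then 1/qpoch_inf p p else 0)"
 proof (rule tannerys_theorem[where M = "%j. norm p^j*dl*dl", THEN conjunct2, THEN conjunct2])
  fix j
  show "(%n. g j (Suc n)) \<longlonglongrightarrow> (if j = 0 then 1/qpoch_inf p p else 0)"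
  proof (cases "j = 0")
   case True
   have "(%n. 1/qpoch p p (Suc n)) \<longlonglongrightarrow> 1/qpoch_inf p p"
    by (intro tendsto_intros LIMSEQ_Suc[OF qpoch_LIMSEQ] assms qpoch_inf_self_nonzero)
   then show ?thesis using True by (simp add: g_def qpoch_def)
  next
   case False
   have "(%n. norm p^Suc n*dl*dl) \<longlonglongrightarrow> 0*dl*dl"
    by (intro tendsto_intros LIMSEQ_Suc[OF LIMSEQ_power_zero]) (use assms in auto)
   moreover have "norm (g j (Suc n)) \<le> norm p^Suc n*dl*dl" for n
   proof (rule g_le)
    have "Suc n*1 \<le> Suc n*j" using False by (intro mult_le_mono) auto
    then show "Suc n \<le> Suc n*j + j*j" by simp
   qed
   ultimately have "(%n. g j (Suc n)) \<longlonglongrightarrow> 0"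
    using Lim_null_comparison[of "%n. g j (Suc n)" "%n. norm p^Suc n*dl*dl" sequentially]
    by (metis (mono_tags, lifting) always_eventually mult_zero_left)
   with False show ?thesis by simp
  qed
 next
  have "norm (g j (Suc n)) \<le> norm p^j*dl*dl" for j n
   by (rule g_le[OF jle])
  then show "\<forall>\<^sub>F (j, n) in at_top \<times>\<^sub>F sequentially. norm (g j (Suc n)) \<le> norm p^j*dl*dl"
   by (intro always_eventually) (simp only: split_paired_All split_conv, blast)
  show "summable (%j. norm p^j*dl*dl)"
   by (intro summable_mult2 summable_geometric) (use assms in auto)
 qed simp
 then have "c 0 = (\<Sum>j. if j = 0 then 1/qpoch_inf p p else 0)"
  unfolding sums by (simp only: LIMSEQ_const_iff)
 also have "... = 1/qpoch_inf p p"
  using suminf_finite[of "{0::nat}" "%j. if j = 0 then 1/qpoch_inf p p else 0"] by simp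
 finally have c0: "c 0 = 1/qpoch_inf p p" .
 have "c = (%n. jtp_coeff p n/qpoch_inf p p)"
  by (rule ext, subst c) (simp only: c0 times_divide_eq_right mult_1_right)
 with L show ?thesis by simp
qed

section \<open>Macdonald identities\<close>

lemma laurent_sum:
 assumes "finite I" "!!b. b \<in> I ==> laurent (f b) (a b)"
 shows "laurent (%y. \<Sum>b\<in>I. f b y) (%n. \<Sum>b\<in>I. a b n)"
 using assms
proof (induction I rule: finite_induct)
 case empty
 show ?case using laurent_cmult[OF laurent_1, of 0] by simp
next
 case (insert b I)
 then show ?case using laurent_add[of "f b" "a b"] by simp
qed

lemma laurent_power_subst:
 assumes "laurent g c" "m > 0"
 shows "laurent (%y. g (y^m)) (%n. if int m dvd n then c (n div int m) else 0)"
 unfolding laurent_def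
proof (intro allI impI)
 fix y :: complex assume y: "y ~= 0"
 let ?a = "%n. (if int m dvd n then c (n div int m) else 0)*y powi n"
 have "((%r. c r*(y^m) powi r) has_sum g (y^m)) UNIV" using laurentD[OF assms(1)] y by simp
 also have "?this \<longleftrightarrow> (?a has_sum g (y^m)) (range (%r. int m*r))"
  by (rule has_sum_reindex_bij_witness[of _ "%n. n div int m" "%r. int m*r"])
    (use assms(2) in "auto simp: power_int_mult")
 finally show "(?a has_sum g (y^m)) UNIV"
  by (rule has_sum_cong_neutral[THEN iffD1, rotated -1]) auto
qed

text \<open>The exponent of \<open>s\<close> that the recursion
  \<open>a (n + 2k) = s^(2n + 1) a n\<close> accumulates over \<open>r\<close> steps from index
  \<open>b\<close>.\<close>

definition mac_exp :: "nat => nat => int => int" where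
 "mac_exp k b r = r*(2*int b + 1 + 2*int k*(r - 1))"

text \<open>For \<open>b < k\<close> these span the functions analytic on the punctured plane with
  \<open>f (s^2*y) = f y/(s*y^(2*k))\<close> and \<open>f (1/y) = f y/y^(2*k - 1)\<close>. The
  second summand is the reflection of the first.\<close>

definition psi :: "nat => complex => nat => complex => complex" where
 "psi k s b y = qpoch_inf (s^(4*k)) (s^(4*k)) *
   (y^b*theta (- (s^(2*b + 1))*y^(2*k)) (s^(4*k)) +
   y powi (2*int k - 1 - int b)*theta (- (s^(2*b + 1))*(1/y)^(2*k)) (s^(4*k)))"

definition psi_coeff :: "nat => complex => nat => int => complex" where
 "psi_coeff k s b n =
   (if 2*int k dvd n - int b then s powi mac_exp k b ((n - int b) div (2*int k)) else 0) +
   (if 2*int k dvd 2*int k - 1 - int b - n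
   then s powi mac_exp k b ((2*int k - 1 - int b - n) div (2*int k)) else 0)"

definition mac_h :: "complex => complex => complex => complex" where
 "mac_h t u v = v * theta (u * v) t*theta (u/v) t"

text \<open>The Macdonald denominator for the root system \<open>B_k\<close> in the variables
  \<open>- y i\<close>, with base \<open>s\<close> for short roots and \<open>s^2\<close> for long
  roots. The prefactor in \<open>mac_h\<close> makes it antisymmetric.\<close>

definition mac_theta :: "nat => complex => (nat => complex) => complex" where
 "mac_theta k s y = (\<Prod>i<k. theta (- y i) s)*pair_prod (%i j. mac_h (s^2) (y i) (y j)) {..<k}"

lemma pair_prod_lessThan: "pair_prod h {..<k} = (\<Prod>(i, j)\<in>{(i, j). i < j \<and> j < k}. h i j)"
 unfolding pair_prod_def by (rule arg_cong2[where f = prod]) auto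

lemma pair_prod_reindex:
 assumes "finite S" "inj_on bt S" "!!i j. g i j = g j i"
 shows "pair_prod (%i j. g (bt i) (bt j)) S = pair_prod g (bt ` S)"
 using assms(1,2)
proof (induction S rule: finite_induct)
 case (insert k S)
 have "pair_prod (%i j. g (bt i) (bt j)) (insert k S) = pair_prod (%i j. g (bt i) (bt j)) S*(\<Prod>i\<in>S. g (bt k) (bt i))"
  using insert assms(3) by (intro pair_prod_insert) auto
 also have "... = pair_prod g (bt ` S)*(\<Prod>i\<in>bt ` S. g (bt k) i)"
  using insert by (simp add: prod.reindex)
 also have "... = pair_prod g (insert (bt k) (bt ` S))"
  using insert assms(3) by (intro pair_prod_insert[symmetric]) auto
 finally show ?case by simp
qed simp

lemma pair_prod_mult: "finite S ==> pair_prod (%i j. f i j*g i j) S = pair_prod f S*pair_prod g S"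
 unfolding pair_prod_def case_prod_unfold by (rule prod.distrib)

text \<open>For antisymmetric \<open>h\<close> the quotient by \<open>j - i\<close> is symmetric, so under a permutation of the indices
  the sign of \<open>pair_prod h S\<close> is that of the Vandermonde product of the labels.\<close>

lemma pair_prod_antisym_split:
 fixes h :: "nat => nat => complex"
 assumes "finite S"
 shows "pair_prod h S = pair_prod (%i j. h i j/(of_nat j - of_nat i)) S*pair_prod (%i j. of_nat j - of_nat i) S"
 unfolding pair_prod_mult[OF assms, symmetric] by (rule pair_prod_cong) auto

lemma antisym_quot_sym:
 fixes h :: "nat => nat => complex"
 assumes "!!i j. h j i = - h i j"
 shows "h i j/(of_nat j - of_nat i) = h j i/(of_nat i - of_nat j)"
 unfolding assms[of j i] by (metis minus_diff_eq minus_divide_left minus_divide_right)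

lemma pair_prod_permute_antisym:
 assumes "w permutes {..<k}" and anti: "!!i j. h j i = - (h i j :: complex)"
 shows "pair_prod (%i j. h (w i) (w j)) {..<k} = of_int (sign w)*pair_prod h {..<k}"
proof -
 let ?g = "%i j. h i j/(of_nat j - of_nat i)"
 let ?V = "pair_prod (%i j. of_nat j - of_nat i :: complex) {..<k}"
 have inj: "inj_on w {..<k}" using assms(1) by (simp add: permutes_inj_on)
 have "pair_prod (%i j. h (w i) (w j)) {..<k} =
   pair_prod (%i j. ?g (w i) (w j)*(of_nat (w j) - of_nat (w i))) {..<k}"
 proof (rule pair_prod_cong)
  fix i j assume "i \<in> {..<k}" "j \<in> {..<k}" "i < j"
  then have "w i ~= w j" using inj by (auto dest: inj_onD)
  then show "h (w i) (w j) = ?g (w i) (w j)*(of_nat (w j) - of_nat (w i))" by simp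
 qed
 also have "... = pair_prod (%i j. ?g (w i) (w j)) {..<k}*pair_prod (%i j. of_nat (w j) - of_nat (w i)) {..<k}"
  by (rule pair_prod_mult) simp
 also have "pair_prod (%i j. ?g (w i) (w j)) {..<k} = pair_prod ?g (w ` {..<k})"
  by (rule pair_prod_reindex[OF _ inj]) (simp, rule antisym_quot_sym[OF anti])
 also have "w ` {..<k} = {..<k}" by (rule permutes_image[OF assms(1)])
 also have "pair_prod (%i j. of_nat (w j) - of_nat (w i)) {..<k} = of_int (sign w)*?V"
  unfolding pair_prod_lessThan by (rule vandermonde_permute[OF assms(1)])
 finally show ?thesis using pair_prod_antisym_split[of "{..<k}" h] by (simp add: mult_ac)
qed

lemma mac_h_antisym:
 assumes "norm t < 1" "t ~= 0" "u ~= 0" "v ~= 0"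
 shows "mac_h t v u = - mac_h t u v"
proof -
 have "theta (v/u) t = - theta (u/v) t/(u/v)"
  using theta_inverse[OF assms(1,2), of "u/v"] assms(3,4) by simp
 then show ?thesis using assms by (simp add: mac_h_def mult_ac)
qed

lemma mac_exp_Suc: "mac_exp k b (r + 1) = mac_exp k b r + (2*(int b + 2*int k*r) + 1)"
 by (simp add: mac_exp_def algebra_simps)

context
 fixes k :: nat and s :: complex
 assumes k: "k \<ge> 1" and s: "s ~= 0" "norm s < 1"
begin

lemma norm_pow_s: "n \<ge> 1 ==> norm (s^n) < 1"
 using s by (simp add: norm_power power_less_one_iff)

lemma norm_sq_s: "norm (s^2) < 1"
 by (rule norm_pow_s) simp

lemma psi_part:
 "laurent (%y. qpoch_inf (s^(4*k)) (s^(4*k))*theta (- (s^(2*b + 1))*y^(2*k)) (s^(4*k)))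
   (%n. if 2*int k dvd n then s powi mac_exp k b (n div (2*int k)) else 0)"
proof -
 let ?Q = "s^(4*k)"
 have Q: "norm ?Q < 1" "?Q ~= 0" using k s by (auto intro!: norm_pow_s)
 have "laurent (%y. qpoch_inf ?Q ?Q*theta (- (s^(2*b + 1))*y) ?Q)
   (%n. qpoch_inf ?Q ?Q*(jtp_coeff ?Q n/qpoch_inf ?Q ?Q*(- (s^(2*b + 1))) powi n))"
  by (intro laurent_cmult laurent_scale[OF jacobi_triple_product[OF Q]]) (use s in simp)
 also have "(%n. qpoch_inf ?Q ?Q*(jtp_coeff ?Q n/qpoch_inf ?Q ?Q*(- (s^(2*b + 1))) powi n)) =
   (%n. s powi mac_exp k b n)"
 proof
  fix n :: int
  have e: "mac_exp k b n = int (4*k)*(n*(n - 1) div 2) + int (2*b + 1)*n"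
  proof -
   have "2*(n*(n - 1) div 2) = n*(n - 1)" by simp
   then have "int (4*k)*(n*(n - 1) div 2) = 2*int k*(n*(n - 1))" by simp
   then show ?thesis by (simp add: mac_exp_def algebra_simps)
  qed
  have "(- (s^(2*b + 1))) powi n = (-1) powi n * s powi (int (2*b + 1)*n)"
   by (metis mult_minus1 power_int_mult_distrib power_int_mult power_int_of_nat)
  moreover have "jtp_coeff ?Q n = (-1) powi n * s powi (int (4*k)*(n*(n - 1) div 2))"
   unfolding jtp_coeff_powi[OF Q(2)] by (metis power_int_mult power_int_of_nat)
  moreover have "(-1 :: complex) powi n*(-1) powi n = 1"
   by (simp flip: power_int_mult_distrib)
  moreover have "(u*A)*(u*B) = A*B" if "u*u = 1" for u A B :: complex
   using that by (metis mult.assoc mult.left_commute mult_1)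
  ultimately have "jtp_coeff ?Q n*(- (s^(2*b + 1))) powi n = s powi mac_exp k b n"
   unfolding e power_int_add[OF disjI1[OF s(1)]] by simp
  then show "qpoch_inf ?Q ?Q*(jtp_coeff ?Q n/qpoch_inf ?Q ?Q*(- (s^(2*b + 1))) powi n) = s powi mac_exp k b n"
   using qpoch_inf_self_nonzero[OF Q(1)] by simp
 qed
 finally have "laurent (%y. qpoch_inf ?Q ?Q*theta (- (s^(2*b + 1))*y) ?Q) (%n. s powi mac_exp k b n)" .
 moreover have "0 < 2*k" using k by simp
 ultimately have "laurent (%y. qpoch_inf ?Q ?Q*theta (- (s^(2*b + 1))*y^(2*k)) ?Q)
   (%n. if int (2*k) dvd n then s powi mac_exp k b (n div int (2*k)) else 0)"
  by (rule laurent_power_subst)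
 then show ?thesis by (simp only: of_nat_mult of_nat_numeral)
qed

lemma laurent_psi: "laurent (psi k s b) (psi_coeff k s b)"
proof -
 let ?c = "%n. if 2*int k dvd n then s powi mac_exp k b (n div (2*int k)) else 0"
 let ?g = "%y. qpoch_inf (s^(4*k)) (s^(4*k))*theta (- (s^(2*b + 1))*y^(2*k)) (s^(4*k))"
 have 1: "laurent (%y. y powi int b*?g y) (%n. ?c (n - int b))"
  by (rule laurent_shift[OF psi_part])
 have 2: "laurent (%y. y powi (2*int k - 1 - int b)*?g (1/y)) (%n. ?c (- (n - (2*int k - 1 - int b))))"
  by (rule laurent_shift[OF laurent_reflect[OF psi_part]])
 have "psi k s b y = y powi int b*?g y + y powi (2*int k - 1 - int b)*?g (1/y)" for y
  by (simp add: psi_def algebra_simps)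
 then have e1: "psi k s b = (%y. y powi int b*?g y + y powi (2*int k - 1 - int b)*?g (1/y))" by (rule ext)
 have e2: "psi_coeff k s b = (%n. ?c (n - int b) + ?c (- (n - (2*int k - 1 - int b))))"
  by (rule ext) (simp only: psi_coeff_def minus_diff_eq)
 show ?thesis unfolding e1 e2 by (rule laurent_add[OF 1 2])
qed

text \<open>The recursion reduces an index modulo \<open>2*k\<close>, and the reflection exchanges
  the residues below \<open>k\<close> with the others. So the coefficients at
  \<open>0, ..., k - 1\<close> determine the function.\<close>

lemma mac_space:
 assumes f: "laurent f a"
  and a1: "!!n. a (n + 2*int k) = s powi (2*n + 1)*a n"
  and a2: "!!n. a (2*int k - 1 - n) = a n"
  and y: "y ~= 0"
 shows "f y = (\<Sum>b<k. a (int b)*psi k s b y)"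
proof -
 have a: "a (int b + 2*int k*r) = s powi mac_exp k b r*a (int b)" for b r
 proof (induction r rule: int_induct[where k = 0])
  case base
  show ?case by (simp add: mac_exp_def)
 next
  case (step1 r)
  have "a (int b + 2*int k*(r + 1)) = a ((int b + 2*int k*r) + 2*int k)" by (simp add: algebra_simps)
  also have "... = s powi (2*(int b + 2*int k*r) + 1)*a (int b + 2*int k*r)" by (rule a1)
  finally show ?case unfolding step1(2) mac_exp_Suc power_int_add[OF disjI1[OF s(1)]] by (simp only: mult_ac)
 next
  case (step2 r)
  have "a (int b + 2*int k*r) = a ((int b + 2*int k*(r - 1)) + 2*int k)" by (simp add: algebra_simps)
  also have "... = s powi (2*(int b + 2*int k*(r - 1)) + 1)*a (int b + 2*int k*(r - 1))" by (rule a1)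
  finally have "s powi (2*(int b + 2*int k*(r - 1)) + 1)*a (int b + 2*int k*(r - 1)) =
    s powi mac_exp k b ((r - 1) + 1)*a (int b)" using step2(2) by simp
  then have "s powi (2*(int b + 2*int k*(r - 1)) + 1)*a (int b + 2*int k*(r - 1)) =
    s powi (2*(int b + 2*int k*(r - 1)) + 1)*(s powi mac_exp k b (r - 1)*a (int b))"
   unfolding mac_exp_Suc power_int_add[OF disjI1[OF s(1)]] by (simp only: mult_ac)
  then show ?case using s(1) by simp
 qed
 have coeff: "(\<Sum>b<k. a (int b)*psi_coeff k s b n) = a n" for n
 proof -
  \<comment> \<open>Exactly one \<open>b < k\<close> has a nonzero coefficient at \<open>n\<close>:
    it is \<open>rh\<close> if \<open>rh < k\<close> and \<open>2*k - 1 - rh\<close>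
    otherwise.\<close>
  define rh where "rh = nat (n mod (2*int k))"
  define q where "q = n div (2*int k)"
  have n: "n = int rh + 2*int k*q" and rh: "rh < 2*k"
   using k by (auto simp: rh_def q_def nat_less_iff)
  have dv: "2*int k dvd int rh + 2*int k*q - c \<longleftrightarrow> c = int rh" if "0 \<le> c" "c < 2*int k" for c
  proof
   assume "2*int k dvd int rh + 2*int k*q - c"
   then have "2*int k dvd (int rh + 2*int k*q - c) - 2*int k*q" by (rule dvd_diff) simp
   then have "2*int k dvd int rh - c" by (simp add: algebra_simps)
   moreover have "\<bar>int rh - c\<bar> < 2*int k" using rh that by auto
   ultimately show "c = int rh" using zdvd_imp_le[of "2*int k" "\<bar>int rh - c\<bar>"] by auto
  qed (use that in auto)
  show ?thesis
  proof (cases "rh < k")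
   case True
   have "(\<Sum>b<k. a (int b)*psi_coeff k s b n) = (\<Sum>b\<in>{rh}. a (int b)*psi_coeff k s b n)"
   proof (rule sum.mono_neutral_right)
    show "\<forall>b\<in>{..<k} - {rh}. a (int b)*psi_coeff k s b n = 0"
    proof
     fix b assume b: "b \<in> {..<k} - {rh}"
     have "\<not> 2*int k dvd n - int b" unfolding n using dv[of "int b"] b by auto
     moreover have "\<not> 2*int k dvd n - (2*int k - 1 - int b)"
      unfolding n using dv[of "2*int k - 1 - int b"] b True by auto
     then have "\<not> 2*int k dvd 2*int k - 1 - int b - n" by (simp add: dvd_diff_commute)
     ultimately show "a (int b)*psi_coeff k s b n = 0" by (simp add: psi_coeff_def)
    qed
   qed (use True in auto)
   moreover have "psi_coeff k s rh n = s powi mac_exp k rh q"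
   proof -
    have "\<not> 2*int k dvd n - (2*int k - 1 - int rh)"
     unfolding n using dv[of "2*int k - 1 - int rh"] True by auto
    then have "\<not> 2*int k dvd 2*int k - 1 - int rh - n" by (simp add: dvd_diff_commute)
    then show ?thesis using k by (simp add: psi_coeff_def n)
   qed
   moreover have "a n = s powi mac_exp k rh q*a (int rh)" using a[of rh q] unfolding n[symmetric] .
   ultimately show ?thesis by simp
  next
   case False
   define b0 where "b0 = 2*k - 1 - rh"
   have b0: "b0 < k" "int b0 = 2*int k - 1 - int rh" using False rh k by (auto simp: b0_def of_nat_diff)
   have S0: "(\<Sum>b<k. a (int b)*psi_coeff k s b n) = (\<Sum>b\<in>{b0}. a (int b)*psi_coeff k s b n)"
   proof (rule sum.mono_neutral_right)
    show "\<forall>b\<in>{..<k} - {b0}. a (int b)*psi_coeff k s b n = 0"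
    proof
     fix b assume b: "b \<in> {..<k} - {b0}"
     have "\<not> 2*int k dvd n - int b" unfolding n using dv[of "int b"] b False by auto
     moreover have "\<not> 2*int k dvd n - (2*int k - 1 - int b)"
      unfolding n using dv[of "2*int k - 1 - int b"] b b0 by auto
     then have "\<not> 2*int k dvd 2*int k - 1 - int b - n" by (simp add: dvd_diff_commute)
     ultimately show "a (int b)*psi_coeff k s b n = 0" by (simp add: psi_coeff_def)
    qed
   qed (use b0 in auto)
   have pc: "psi_coeff k s b0 n = s powi mac_exp k b0 (- q)"
   proof -
    have "\<not> 2*int k dvd n - int b0" unfolding n using dv[of "int b0"] False b0 by auto
    moreover have "2*int k - 1 - int b0 - n = 2*int k*(- q)" by (simp add: n b0(2))
    moreover have "2*int k*(- q) div (2*int k) = - q" using k by (intro nonzero_mult_div_cancel_left) auto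
    ultimately show ?thesis by (simp only: psi_coeff_def if_False if_True dvd_triv_left add_0_left)
   qed
   note S0
   also have "(\<Sum>b\<in>{b0}. a (int b)*psi_coeff k s b n) = a (int b0)*psi_coeff k s b0 n" by simp
   also note pc
   also have "a (int b0) * s powi mac_exp k b0 (- q) = a (int b0 + 2*int k*(- q))" by (subst a) (rule mult.commute)
   also have "int b0 + 2*int k*(- q) = 2*int k - 1 - n" by (simp add: n b0(2))
   also have "a (2*int k - 1 - n) = a n" by (rule a2)
   finally show ?thesis .
  qed
 qed
 have "((%n. \<Sum>b<k. a (int b)*(psi_coeff k s b n*y powi n)) has_sum (\<Sum>b<k. a (int b)*psi k s b y)) UNIV"
  using laurentD[OF laurent_sum[OF finite_lessThan laurent_cmult[OF laurent_psi]] y, of "%b. a (int b)" "%b. b" k]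
  by (simp only: sum_distrib_right mult.assoc)
 then have "((%n. a n*y powi n) has_sum (\<Sum>b<k. a (int b)*psi k s b y)) UNIV"
  by (simp only: mult.assoc[symmetric] sum_distrib_right[symmetric] coeff)
 then show ?thesis using laurentD[OF f y] has_sum_unique by blast
qed

text \<open>In each single variable the Macdonald product has the quasi-periodicity and the
  reflection symmetry that characterise the span of \<open>psi\<close>; uniqueness of Laurent
  coefficients translates both into the relations required by \<open>mac_space\<close>.\<close>

lemma mac_section_space:
 assumes J: "finite J" "card J = k - 1" and v: "!!j. j \<in> J ==> v j ~= 0"
 shows "\<exists>c. \<forall>y. y ~= 0 \<longrightarrow>
  theta (- y) s*(\<Prod>j\<in>J. theta (y * v j) (s^2)*theta (y/v j) (s^2)) = (\<Sum>b<k. c b*psi k s b y)"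
proof -
 define f where "f y = theta (- y) s*(\<Prod>j\<in>J. theta (y * v j) (s^2)*theta (y/v j) (s^2))" for y
 note t = norm_sq_s
 have t0: "s^2 ~= 0" using s by simp
 have "is_laurent (%y. theta ((-1)*y) s*(\<Prod>j\<in>J. theta (v j*y) (s^2)*theta ((1/v j)*y) (s^2)))"
  by (intro is_laurent_mult is_laurent_prod is_laurent_theta s t)
 then obtain a where a: "laurent f a"
  unfolding is_laurent_def f_def[abs_def] by (auto simp: mult.commute)
 have th1: "theta (- (s^2*y)) s = theta (- y) s/(s*y^2)" if "y ~= 0" for y
 proof -
  have "theta (- (s^2*y)) s = theta (s*(s*(- y))) s" by (simp add: power2_eq_square mult.assoc)
  also have "... = - (- theta (- y) s/(- y))/(s*(- y))"
   using theta_shift[OF s(2,1), of "s*(- y)"] theta_shift[OF s(2,1), of "- y"] that s by simp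
  finally show ?thesis by (simp add: power2_eq_square)
 qed
 have th2: "theta (s^2*y*u) (s^2)*theta (s^2*y/u) (s^2) = theta (y*u) (s^2)*theta (y/u) (s^2)/y^2"
  if "y ~= 0" "u ~= 0" for y u
  using theta_shift[OF t t0, of "y*u"] theta_shift[OF t t0, of "y/u"] that
  by (simp add: mult.assoc power2_eq_square)
 have th3: "theta (1/y*u) (s^2)*theta (1/y/u) (s^2) = theta (y*u) (s^2)*theta (y/u) (s^2)/y^2"
  if "y ~= 0" "u ~= 0" for y u
  using theta_inverse[OF t t0, of "y*u"] theta_inverse[OF t t0, of "y/u"] that
  by (simp add: mult.assoc power2_eq_square mult_ac)
 have th4: "theta (- (1/y)) s = theta (- y) s/y" if "y ~= 0" for y
  using theta_inverse[OF s(2,1), of "- y"] that by simp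
 have pc: "(\<Prod>j\<in>J. y\<^sup>2) = y^(2*(k - 1))" for y :: complex by (simp add: J power_mult)
 have q1: "f (s^2*y) = (1/s)*(y powi (- (2*int k))*f y)" if y: "y ~= 0" for y
 proof -
  have "f (s^2*y) = theta (- y) s/(s*y^2)*(\<Prod>j\<in>J. theta (y * v j) (s^2)*theta (y/v j) (s^2)/y^2)"
   unfolding f_def th1[OF y] by (intro arg_cong2[of _ _ _ _ "(*)"] refl prod.cong th2 y v)
  also have "... = f y/(s*y^2*y^(2*(k - 1)))" unfolding prod_dividef pc f_def by simp
  also have "y^2*y^(2*(k - 1)) = y^(2*k)" using k by (cases k) (simp_all add: power2_eq_square)
  then have "s*y^2*y^(2*(k - 1)) = s*y^(2*k)" by (simp add: mult.assoc)
  finally have e: "f (s^2*y) = f y/(s*y^(2*k))" .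
  have "2*int k = int (2*k)" by simp
  then have "y powi (- (2*int k)) = 1/y^(2*k)"
   by (simp only: power_int_minus power_int_of_nat inverse_eq_divide)
  then show ?thesis using e by simp
 qed
 have q2: "f (1/y) = y powi (- (2*int k - 1))*f y" if y: "y ~= 0" for y
 proof -
  have "f (1/y) = theta (- y) s/y*(\<Prod>j\<in>J. theta (y * v j) (s^2)*theta (y/v j) (s^2)/y^2)"
   unfolding f_def th4[OF y] by (intro arg_cong2[of _ _ _ _ "(*)"] refl prod.cong th3 y v)
  also have "... = f y/(y*y^(2*(k - 1)))" unfolding prod_dividef pc f_def by simp
  also have "y*y^(2*(k - 1)) = y powi (2*int k - 1)"
  proof -
   have "2*int k - 1 = int (Suc (2*(k - 1)))" using k by (simp add: of_nat_diff)
   then show ?thesis by (simp only: power_int_of_nat power_Suc)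
  qed
  finally show ?thesis by (simp only: power_int_minus divide_inverse mult.commute)
 qed
 have A1: "a n*(s^2) powi n = (1/s)*a (n + 2*int k)" for n
 proof -
  have "laurent (%y. f (s^2*y)) (%n. a n*(s^2) powi n)" by (rule laurent_scale[OF a t0])
  moreover have "laurent (%y. f (s^2*y)) (%n. (1/s)*a (n - (- (2*int k))))"
   by (rule laurent_cong[OF laurent_cmult[OF laurent_shift[OF a]]]) (rule q1[symmetric])
  ultimately have "(%n. a n*(s^2) powi n) = (%n. (1/s)*a (n - (- (2*int k))))" by (rule laurent_unique)
  from fun_cong[OF this, of n] show ?thesis by simp
 qed
 have A2: "a (- n) = a (n + (2*int k - 1))" for n
 proof -
  have "laurent (%y. f (1/y)) (%n. a (- n))" by (rule laurent_reflect[OF a])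
  moreover have "laurent (%y. f (1/y)) (%n. a (n - (- (2*int k - 1))))"
   by (rule laurent_cong[OF laurent_shift[OF a]]) (rule q2[symmetric])
  ultimately have "(%n. a (- n)) = (%n. a (n - (- (2*int k - 1))))" by (rule laurent_unique)
  from fun_cong[OF this, of n] show ?thesis by (simp add: algebra_simps)
 qed
 have R1: "a (n + 2*int k) = s powi (2*n + 1)*a n" for n
 proof -
  have "s powi (2*n + 1) = s powi (2*n) * s" using s(1) by (simp add: power_int_add)
  also have "s powi (2*n) = (s powi 2) powi n" by (rule power_int_mult)
  finally show ?thesis using A1[of n] s(1) by (simp add: field_simps)
 qed
 have R2: "a (2*int k - 1 - n) = a n" for n
  using A2[of "- n"] by (simp add: algebra_simps)
 show ?thesis
 proof (intro exI allI impI)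
  fix y :: complex assume "y ~= 0"
  from mac_space[OF a R1 R2 this]
  show "theta (- y) s*(\<Prod>j\<in>J. theta (y * v j) (s^2)*theta (y/v j) (s^2)) = (\<Sum>b<k. a (int b)*psi k s b y)"
   unfolding f_def .
 qed
qed

lemma mac_theta_alternating:
 assumes y: "!!i. i < k ==> y i ~= 0" and w: "w permutes {..<k}"
 shows "mac_theta k s (y \<circ> w) = of_int (sign w)*mac_theta k s y"
proof -
 let ?y = "%i. if i < k then y i else 1"
 let ?h = "%i j. mac_h (s^2) (?y i) (?y j)"
 have wk: "w i < k" if "i < k" for i using permutes_in_image[OF w, of i] that by simp
 have "pair_prod (%i j. mac_h (s^2) ((y \<circ> w) i) ((y \<circ> w) j)) {..<k} = pair_prod (%i j. ?h (w i) (w j)) {..<k}"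
  by (rule pair_prod_cong) (simp add: wk)
 also have "... = of_int (sign w)*pair_prod ?h {..<k}"
  by (rule pair_prod_permute_antisym[OF w], rule mac_h_antisym) (use norm_sq_s s y in auto)
 also have "pair_prod ?h {..<k} = pair_prod (%i j. mac_h (s^2) (y i) (y j)) {..<k}"
  by (rule pair_prod_cong) simp
 finally show ?thesis
  using prod.permute[OF w, of "%i. theta (- y i) s"] by (simp add: mac_theta_def o_def mult_ac)
qed

lemma mac_theta_section:
 assumes y: "!!i. i < k ==> y i ~= 0" and i: "i < k"
 shows "\<exists>c. \<forall>v\<in>- {0}. mac_theta k s (y(i := v)) = (\<Sum>b<k. c b*psi k s b v)"
proof -
 define J where "J = {..<k} - {i}"
 have J: "finite J" "i \<notin> J" "{..<k} = insert i J" "card J = k - 1" using i by (auto simp: J_def)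
 obtain c where c: "!!v. v ~= 0 ==>
  theta (- v) s*(\<Prod>j\<in>J. theta (v * y j) (s^2)*theta (v/y j) (s^2)) = (\<Sum>b<k. c b*psi k s b v)"
  using mac_section_space[OF J(1,4), of y] y J(3) by blast
 define C where "C = (\<Prod>j\<in>J. theta (- y j) s) *
   (pair_prod (%a b. mac_h (s^2) (y a) (y b)/(of_nat b - of_nat a)) J *
    pair_prod (%a b. of_nat b - of_nat a) {..<k})*(\<Prod>j\<in>J. y j/(of_nat j - of_nat i))"
 have "mac_theta k s (y(i := v)) = C*(\<Sum>b<k. c b*psi k s b v)" if v: "v ~= 0" for v
 proof -
  let ?y = "%j. if j < k then (y(i := v)) j else 1"
  let ?h = "%a b. mac_h (s^2) (?y a) (?y b)"
  let ?g = "%a b. ?h a b/(of_nat b - of_nat a)"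
  have anti: "?h b a = - ?h a b" for a b
   by (rule mac_h_antisym) (use norm_sq_s s y v in auto)
  have "pair_prod (%a b. mac_h (s^2) ((y(i := v)) a) ((y(i := v)) b)) {..<k} = pair_prod ?h {..<k}"
   by (rule pair_prod_cong) simp
  also have "... = pair_prod ?g {..<k}*pair_prod (%a b. of_nat b - of_nat a) {..<k}"
   by (rule pair_prod_antisym_split) simp
  also have "pair_prod ?g {..<k} = pair_prod ?g J*(\<Prod>j\<in>J. ?g i j)"
   unfolding J(3) by (rule pair_prod_insert[OF J(1,2)]) (rule antisym_quot_sym[OF anti])
  finally have calc0: "pair_prod (%a b. mac_h (s^2) ((y(i := v)) a) ((y(i := v)) b)) {..<k} =
   pair_prod ?g J*(\<Prod>j\<in>J. ?g i j)*pair_prod (%a b. of_nat b - of_nat a) {..<k}" .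
  have Jm: "j < k" "j ~= i" if "j \<in> J" for j using that by (auto simp: J_def)
  note calc0
  also have "pair_prod ?g J = pair_prod (%a b. mac_h (s^2) (y a) (y b)/(of_nat b - of_nat a)) J"
   by (rule pair_prod_cong) (simp add: Jm)
  also have "(\<Prod>j\<in>J. ?g i j) = (\<Prod>j\<in>J. y j/(of_nat j - of_nat i)) *
    (\<Prod>j\<in>J. theta (v * y j) (s^2)*theta (v/y j) (s^2))"
   unfolding prod.distrib[symmetric]
   by (intro prod.cong refl) (use i in "auto simp: J_def mac_h_def")
  finally have pp: "pair_prod (%a b. mac_h (s^2) ((y(i := v)) a) ((y(i := v)) b)) {..<k} =
   pair_prod (%a b. mac_h (s^2) (y a) (y b)/(of_nat b - of_nat a)) J *
   ((\<Prod>j\<in>J. y j/(of_nat j - of_nat i))*(\<Prod>j\<in>J. theta (v * y j) (s^2)*theta (v/y j) (s^2))) *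
   pair_prod (%a b. of_nat b - of_nat a) {..<k}" .
  have th: "(\<Prod>j<k. theta (- (y(i := v)) j) s) = theta (- v) s*(\<Prod>j\<in>J. theta (- y j) s)"
  proof -
   have "(\<Prod>j<k. theta (- (y(i := v)) j) s) = theta (- (y(i := v)) i) s*(\<Prod>j\<in>J. theta (- (y(i := v)) j) s)"
    unfolding J_def by (rule prod.remove) (use i in auto)
   also have "(\<Prod>j\<in>J. theta (- (y(i := v)) j) s) = (\<Prod>j\<in>J. theta (- y j) s)"
    by (rule prod.cong) (use J in auto)
   finally show ?thesis by simp
  qed
  show ?thesis unfolding mac_theta_def pp th c[OF v, symmetric] C_def by (simp only: mult_ac)
 qed
 then show ?thesis
  by (intro exI[of _ "%b. C * c b"]) (simp add: sum_distrib_left mult.assoc)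
qed

text \<open>\<open>mac_theta\<close> is alternating with sections in a \<open>k\<close>-dimensional
  space, so it is proportional to the determinant. The constant remains to be found at one
  convenient point \<open>z\<close>.\<close>

lemma mac_theta_proportional:
 assumes "!!i. i < k ==> z i ~= 0" "leib k (%i b. psi k s b (z i)) ~= 0" "!!i. i < k ==> y i ~= 0"
 shows "mac_theta k s y*leib k (%i b. psi k s b (z i)) = mac_theta k s z*leib k (%i b. psi k s b (y i))"
proof (rule alternating_proportional[where D = "- {0}"])
 show "\<exists>c. \<forall>v\<in>- {0}. mac_theta k s (y(i := v)) = (\<Sum>b<k. c b*psi k s b v)"
  if "!!i. i < k ==> y i \<in> - {0}" "i < k" for y i
  using mac_theta_section[of y i] that by auto
 show "mac_theta k s (y \<circ> w) = of_int (sign w)*mac_theta k s y"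
  if "!!i. i < k ==> y i \<in> - {0}" "w permutes {..<k}" for y w
  using mac_theta_alternating[of y w] that by auto
 show "mac_theta k s y = mac_theta k s y'" if "!!i. i < k ==> y i = y' i" for y y'
  unfolding mac_theta_def by (intro arg_cong2[of _ _ _ _ "(*)"] prod.cong pair_prod_cong) (auto simp: that)
qed (use assms in auto)

end

section \<open>Evaluation at the 2k-th roots of -1\<close>

definition mac_node :: "nat => nat => complex" where
 "mac_node k j = cis (pi*(2*real j + 1)/(2*real k))"

lemma mac_node_nonzero [simp]: "mac_node k j ~= 0"
 by (simp add: mac_node_def)

lemma cis_odd_inj:
 assumes "i < n" "j < n" "cis (pi*(2*real i + 1)/real n) = cis (pi*(2*real j + 1)/real n)"
 shows "i = j"
proof -
 have n: "0 < real n" using assms by simp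
 have *: "pi*(2*real l + 1)/real n \<in> {0..<2*pi}" if "l < n" for l
 proof -
  have "2*real l + 1 < 2*real n" using that by linarith
  then have "pi*(2*real l + 1) < pi*(2*real n)" by (intro mult_strict_left_mono) auto
  then show ?thesis using n by (auto simp: divide_less_eq mult_ac)
 qed
 have "pi*(2*real i + 1)/real n = pi*(2*real j + 1)/real n"
 proof -
  let ?a = "pi*(2*real i + 1)/real n" and ?b = "pi*(2*real j + 1)/real n"
  have "sin ?a = sin ?b \<and> cos ?a = cos ?b" using assms(3) by (simp add: complex_eq_iff)
  then obtain m :: int where m: "?a = ?b + 2*pi*m" using sin_cos_eq_iff[of ?a ?b] by auto
  have "\<bar>?a - ?b\<bar> < 2*pi" using *[OF assms(1)] *[OF assms(2)] unfolding atLeastLessThan_iff by linarith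
  then have "2*pi*\<bar>real_of_int m\<bar> < 2*pi*1" unfolding m by (simp add: abs_mult)
  then have "m = 0" by simp
  then show ?thesis using m by simp
 qed
 then show ?thesis using n by simp
qed

lemma cis_odd_power: "n > 0 ==> cis (pi*(2*real j + 1)/real n)^n = - 1"
proof -
 assume n: "n > 0"
 have "cis (pi*(2*real j + 1)/real n)^n = cis (real n*(pi*(2*real j + 1)/real n))"
  by (rule Complex.DeMoivre)
 also have "real n*(pi*(2*real j + 1)/real n) = pi + 2*pi * of_int (int j)" using n by (simp add: field_simps)
 also have "cis ... = cis pi * cis (2*pi * of_int (int j))" by (simp only: cis_mult)
 also have "cis (2*pi * of_int (int j)) = 1" by (rule cis_multiple_2pi) simp
 finally show ?thesis by simp
qed

lemma prod_roots_minus_one: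
 assumes n: "n > 0"
 shows "(\<Prod>j<n. 1 - X * cis (pi*(2*real j + 1)/real n)) = 1 + X^n"
proof -
 define u where "u j = cis (pi*(2*real j + 1)/real n)" for j
 define Z where "Z = (%j. u j) ` {..<n}"
 have inj: "inj_on u {..<n}"
  unfolding u_def by (rule inj_onI) (auto dest: cis_odd_inj)
 have cZ: "finite Z" "card Z = n" using inj by (auto simp: Z_def card_image)
 have root: "a^n = - 1" if "a \<in> Z" for a using that cis_odd_power[OF n] by (auto simp: Z_def u_def)
 define P where "P = (\<Prod>a\<in>Z. [:- a, 1:])"
 have dP: "degree P = n" by (simp add: P_def degree_prod_linear cZ)
 have "lead_coeff P = 1" unfolding P_def lead_coeff_prod by simp
 with dP have lP: "coeff P n = 1" by simp
 define Q where "Q = monom 1 n + [:1 :: complex:]"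
 have dQ: "degree Q = n" "coeff Q n = 1"
 proof -
  have "degree [:1 :: complex:] < degree (monom (1 :: complex) n)" using n by (simp add: degree_monom_eq)
  then show "degree Q = n" unfolding Q_def by (subst degree_add_eq_left) (auto simp: degree_monom_eq)
  show "coeff Q n = 1" using n by (cases n) (auto simp: Q_def)
 qed
 have "P dvd Q" unfolding P_def
  by (rule roots_prod_dvd[OF cZ(1)]) (simp add: Q_def poly_monom root)
 then obtain h where h: "Q = P*h" by (auto elim: dvdE)
 have Q0: "Q ~= 0" using dQ by auto
 then have "degree Q = degree P + degree h" unfolding h by (intro degree_mult_eq) auto
 then have "degree h = 0" using dP dQ by simp
 then obtain c where c: "h = [:c:]" by (metis degree_eq_zeroE)
 have "coeff Q n = coeff P n * c" unfolding h c by simp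
 then have QP: "Q = P" using lP dQ h c by simp
 have main: "(\<Prod>a\<in>Z. w - a) = w^n + 1" for w
 proof -
  have "poly Q w = (\<Prod>a\<in>Z. w - a)" by (simp only: QP P_def poly_prod_linear)
  moreover have "poly Q w = w^n + 1" by (simp add: Q_def poly_monom)
  ultimately show ?thesis by simp
 qed
 have pz: "(\<Prod>j<n. w - u j) = w^n + 1" for w
  using main[of w] unfolding Z_def by (simp add: prod.reindex[OF inj])
 show ?thesis
 proof (cases "X = 0")
  case True
  then show ?thesis using n by simp
 next
  case False
  have "(\<Prod>j<n. 1 - X*u j) = (\<Prod>j<n. X*(1/X - u j))"
   using False by (intro prod.cong) (auto simp: right_diff_distrib)
  also have "... = X^n*((1/X)^n + 1)" by (simp add: prod.distrib pz)
  also have "... = 1 + X^n" using False by (simp add: distrib_left power_divide)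
  finally show ?thesis by (simp add: u_def)
 qed
qed

lemma pair_prod_factor:
 fixes g :: "nat => complex"
 shows "pair_prod (%i j. g i*g j) {..<n} = (\<Prod>j<n. g j)^(n - 1)"
proof (induction n)
 case (Suc n)
 have "pair_prod (%i j. g i*g j) {..<Suc n} = pair_prod (%i j. g i*g j) {..<n}*(\<Prod>i<n. g n*g i)"
  unfolding lessThan_Suc by (rule pair_prod_insert) (auto simp: mult.commute)
 also have "(\<Prod>i<n. g n*g i) = g n^n*(\<Prod>i<n. g i)" by (simp add: prod.distrib)
 also have "pair_prod (%i j. g i*g j) {..<n}*(g n^n*(\<Prod>i<n. g i)) = (\<Prod>j<Suc n. g j)^n"
  unfolding Suc.IH by (cases n) (auto simp: power_mult_distrib mult_ac)
 finally show ?case by simp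
qed simp

lemma pair_prod_square:
 fixes h :: "nat => nat => complex"
 assumes "!!i j. h i j = h j i"
 shows "(\<Prod>i<n. \<Prod>j<n. h i j) = (pair_prod h {..<n})\<^sup>2*(\<Prod>i<n. h i i)"
proof (induction n)
 case (Suc n)
 have "(\<Prod>i<Suc n. \<Prod>j<Suc n. h i j) = (\<Prod>i<n. \<Prod>j<n. h i j)*(\<Prod>i<n. h i n)*((\<Prod>j<n. h n j)*h n n)"
  by (simp add: prod.distrib)
 also have "(\<Prod>i<n. h i n) = (\<Prod>i<n. h n i)" by (intro prod.cong assms refl)
 moreover have "pair_prod h {..<Suc n} = pair_prod h {..<n}*(\<Prod>i<n. h n i)"
  unfolding lessThan_Suc by (rule pair_prod_insert) (auto intro: assms)
 ultimately show ?case by (simp add: Suc.IH power2_eq_square mult_ac)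
qed simp

text \<open>A double product over all \<open>i\<close> and \<open>j\<close> determines the product
  over pairs only up to sign. For polynomials in \<open>X\<close> the sign is settled by the value
  at 0.\<close>

lemma poly_sign_unique:
 fixes A B :: "complex poly"
 assumes "!!X. (poly A X)\<^sup>2 = (poly B X)\<^sup>2" "poly A 0 = poly B 0" "poly B 0 ~= 0"
 shows "A = B"
proof -
 have "poly ((A - B)*(A + B)) X = 0" for X
  using assms(1)[of X] by (simp add: power2_eq_square algebra_simps)
 then have "(A - B)*(A + B) = 0" by (metis poly_all_0_iff_0)
 moreover have "A + B ~= 0"
 proof
  assume "A + B = 0"
  then have "poly A 0 + poly B 0 = 0" by (metis poly_0 poly_add)
  then show False using assms(2,3) by simp
 qed
 ultimately show ?thesis by simp
qed

text \<open>In the variable \<open>y + 1 / y\<close>, suitable \<open>P0\<close> and \<open>P1\<close> give the orthogonal characters of types B and D.\<close>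

fun bd_poly :: "complex poly => complex poly => nat => complex poly" where
 "bd_poly P0 P1 0 = P0"
| "bd_poly P0 P1 (Suc 0) = P1"
| "bd_poly P0 P1 (Suc (Suc n)) = [:0, 1:]*bd_poly P0 P1 (Suc n) - bd_poly P0 P1 n"

lemma bd_poly_degree:
 assumes "degree P0 \<le> 0" "degree P1 \<le> 1" "coeff P1 1 = 1"
 shows "degree (bd_poly P0 P1 n) \<le> n \<and> (n \<ge> 1 \<longrightarrow> coeff (bd_poly P0 P1 n) n = 1)"
 using assms
proof (induction P0 P1 n rule: bd_poly.induct)
 case (3 P0 P1 n)
 let ?P = "bd_poly P0 P1"
 have 1: "degree (?P (Suc n)) \<le> Suc n" "coeff (?P (Suc n)) (Suc n) = 1" "degree (?P n) \<le> n" using 3 by auto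
 have "degree ([:0, 1:]*?P (Suc n)) \<le> Suc (Suc n)"
  by (rule order.trans[OF degree_mult_le]) (use 1 in simp)
 then have "degree (?P (Suc (Suc n))) \<le> Suc (Suc n)"
  using 1 by (auto intro!: degree_diff_le)
 moreover have "coeff (?P n) (Suc (Suc n)) = 0" using 1 by (intro coeff_eq_0) simp
 ultimately show ?case using 1 by simp
qed auto

lemma bd_poly_eval:
 fixes c :: complex
 assumes y: "y ~= 0" and P0: "c*poly P0 (y + 1/y) = y^0 + e*y powi (- d)"
  and P1: "c*poly P1 (y + 1/y) = y^1 + e*y powi (- 1 - d)"
 shows "c*poly (bd_poly P0 P1 n) (y + 1/y) = y^n + e*y powi (- int n - d)"
proof (induction n rule: less_induct)
 case (less n)
 show ?case
 proof (cases n)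
  case 0
  then show ?thesis using P0 by simp
 next
  case (Suc m)
  show ?thesis
  proof (cases m)
   case 0
   then show ?thesis using Suc P1 by simp
  next
   case (Suc l)
   have n: "n = Suc (Suc l)" using Suc \<open>n = Suc m\<close> by simp
   let ?P = "%n. poly (bd_poly P0 P1 n) (y + 1/y)"
   have "c*?P n = (y + 1/y)*(c*?P (Suc l)) - c*?P l"
    by (simp add: n algebra_simps)
   also have "c*?P (Suc l) = y^Suc l + e*y powi (- int (Suc l) - d)" by (rule less) (simp add: n)
   also have "c*?P l = y^l + e*y powi (- int l - d)" by (rule less) (simp add: n)
   also have "y powi (- int l - d) = y*y powi (- int (Suc l) - d)"
    using power_int_add_1'[of y "- int (Suc l) - d"] y by auto
   also have "y powi (- int (Suc l) - d) = y*y powi (- int n - d)"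
    using power_int_add_1'[of y "- int n - d"] y by (simp add: n algebra_simps)
   finally show ?thesis using y by (simp add: n field_simps)
  qed
 qed
qed

text \<open>In \<open>y + 1/y\<close> the polynomials \<open>bd_poly\<close> have leading
  coefficient 1 from index 1 on, so the Vandermonde evaluation leaves only the constant
  \<open>P0\<close>, which is 1 in type B and 2 in type D.\<close>

lemma leib_bd:
 fixes y :: "nat => complex"
 assumes "degree P0 \<le> 0" "degree P1 \<le> 1" "coeff P1 1 = 1"
  and "!!i. i < n ==> y i ~= 0"
  and "!!i. i < n ==> c i*poly P0 (y i + 1/y i) = y i^0 + e*y i powi (- d)"
  and "!!i. i < n ==> c i*poly P1 (y i + 1/y i) = y i^1 + e*y i powi (- 1 - d)"
  and "n \<ge> 1"
 shows "leib n (%i b. y i^b + e*y i powi (- int b - d)) =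
  coeff P0 0*(\<Prod>i<n. c i)*pair_prod (%i j. (y j + 1/y j) - (y i + 1/y i)) {..<n}"
proof -
 have "leib n (%i b. y i^b + e*y i powi (- int b - d)) =
   leib n (%i b. c i*poly (bd_poly P0 P1 b) (y i + 1/y i))"
  by (rule leib_cong) (rule bd_poly_eval[symmetric], use assms in auto)
 also have "... = (\<Prod>i<n. c i)*leib n (%i b. poly (bd_poly P0 P1 b) (y i + 1/y i))"
  by (simp add: leib_def prod.distrib sum_distrib_left mult_ac)
 also have "leib n (%i b. poly (bd_poly P0 P1 b) (y i + 1/y i)) =
   (\<Prod>m<n. coeff (bd_poly P0 P1 m) m) *
   (\<Prod>(i, j)\<in>{(i, j). i < j \<and> j < n}. (y j + 1/y j) - (y i + 1/y i))"
  by (rule leib_vandermonde) (use bd_poly_degree[OF assms(1-3)] in auto)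
 also have "(\<Prod>m<n. coeff (bd_poly P0 P1 m) m) = coeff P0 0"
 proof -
  have "(\<Prod>m<n. coeff (bd_poly P0 P1 m) m) = (\<Prod>m\<in>{0}. coeff (bd_poly P0 P1 m) m)"
   by (rule prod.mono_neutral_right) (use assms bd_poly_degree[OF assms(1-3)] in auto)
  then show ?thesis by simp
 qed
 finally show ?thesis by (simp add: pair_prod_lessThan mult_ac)
qed

lemma leib_B:
 assumes "n \<ge> 1" "e = 1 \<or> e = - 1" "!!i. i < n ==> y i ~= 0"
 shows "leib n (%i b. y i^b + e*y i powi (- int b - 1)) =
  (\<Prod>i<n. 1 + e/y i)*pair_prod (%i j. (y j + 1/y j) - (y i + 1/y i)) {..<n}"
proof -
 have "leib n (%i b. y i^b + e*y i powi (- int b - 1)) =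
  coeff [:1:] 0*(\<Prod>i<n. 1 + e/y i)*pair_prod (%i j. (y j + 1/y j) - (y i + 1/y i)) {..<n}"
 proof (rule leib_bd[where ?P1.0 = "[:- e, 1:]"])
  fix i assume "i < n"
  then have y: "y i ~= 0" by (rule assms(3))
  have p: "y i powi (- 1) = 1/y i" "y i powi (- 1 - 1) = 1/(y i*y i)"
   using y by (auto simp: power_int_def power2_eq_square field_simps)
  show "(1 + e/y i)*poly [:1:] (y i + 1/y i) = y i^0 + e*y i powi (- 1)"
   by (simp add: field_simps)
  show "(1 + e/y i)*poly [:- e, 1:] (y i + 1/y i) = y i^1 + e*y i powi (- 1 - 1)"
   unfolding p using assms(2) y by (auto simp: field_simps)
 qed (use assms in auto)
 then show ?thesis by simp
qed

lemma leib_D: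
 assumes "n \<ge> 1" "!!i. i < n ==> y i ~= 0"
 shows "leib n (%i b. y i^b + y i powi (- int b)) =
  2*pair_prod (%i j. (y j + 1/y j) - (y i + 1/y i)) {..<n}"
proof -
 have "leib n (%i b. y i^b + 1*y i powi (- int b - 0)) =
  coeff [:2:] 0*(\<Prod>i<n. 1)*pair_prod (%i j. (y j + 1/y j) - (y i + 1/y i)) {..<n}"
  by (rule leib_bd[where ?P1.0 = "[:0, 1:]"]) (use assms in "auto simp: power_int_minus divide_inverse")
 then show ?thesis by simp
qed

context
 fixes k :: nat
 assumes k: "k \<ge> 1"
begin

lemma mac_node_rev: "j < k ==> mac_node k (k - Suc j) = - 1/mac_node k j"
proof -
 assume j: "j < k"
 have "pi*(2*real (k - Suc j) + 1)/(2*real k) = pi - pi*(2*real j + 1)/(2*real k)"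
  using j by (simp add: of_nat_diff field_simps)
 then have "mac_node k (k - Suc j) = cis pi/mac_node k j"
  unfolding mac_node_def by (simp only: cis_divide)
 then show ?thesis by simp
qed

lemma mac_node_cases:
 assumes "a < 2*k"
 shows "cis (pi*(2*real a + 1)/real (2*k)) =
  (if a < k then mac_node k a else 1/mac_node k (2*k - 1 - a))"
proof (cases "a < k")
 case False
 have "real (2*k - 1 - a) = 2*real k - 1 - real a" using assms by (simp add: of_nat_diff)
 then have "pi*(2*real a + 1)/real (2*k) = 2*pi - pi*(2*real (2*k - 1 - a) + 1)/(2*real k)"
  using k by (simp add: field_simps)
 then have "cis (pi*(2*real a + 1)/real (2*k)) = cis (2*pi)/mac_node k (2*k - 1 - a)"
  unfolding mac_node_def by (simp only: cis_divide)
 then show ?thesis using False by simp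
qed (simp add: mac_node_def)

lemma prod_mac_node: "(\<Prod>j<k. (1 - X*mac_node k j)*(1 - X/mac_node k j)) = 1 + X^(2*k)"
proof -
 define g where "g a = 1 - X * cis (pi*(2*real a + 1)/real (2*k))" for a
 have "1 + X^(2*k) = (\<Prod>a<2*k. g a)" unfolding g_def using k by (intro prod_roots_minus_one[symmetric]) auto
 also have "{..<2*k} = {..<k} \<union> {k..<2*k}" by auto
 also have "prod g ({..<k} \<union> {k..<2*k}) = prod g {..<k}*prod g {k..<2*k}"
  by (rule prod.union_disjoint) auto
 also have "prod g {..<k} = (\<Prod>j<k. 1 - X*mac_node k j)"
  by (intro prod.cong) (auto simp: g_def mac_node_cases[simplified])
 also have "prod g {k..<2*k} = (\<Prod>j<k. 1 - X/mac_node k j)"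
 proof (rule prod.reindex_bij_witness[of _ "%j. 2*k - 1 - j" "%a. 2*k - 1 - a"])
  fix a assume "a \<in> {k..<2*k}"
  then have "a < 2*k" "\<not> a < k" by auto
  then show "1 - X/mac_node k (2*k - 1 - a) = g a"
   unfolding g_def using mac_node_cases[of a] by simp
 qed auto
 finally show ?thesis by (simp add: prod.distrib)
qed

lemma mac_node_power: "mac_node k j^(2*k) = - 1"
 using cis_odd_power[of "2*k" j] k by (simp add: mac_node_def)

lemma prod_mac_node_sq:
 "(\<Prod>j<k. 1 - X*mac_node k j^2) = 1 + X^k" "(\<Prod>j<k. 1 - X/mac_node k j^2) = 1 + X^k"
proof -
 have e: "mac_node k j^2 = cis (pi*(2*real j + 1)/real k)" for j
 proof -
  have "mac_node k j^2 = cis (real 2*(pi*(2*real j + 1)/(2*real k)))"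
   unfolding mac_node_def by (rule Complex.DeMoivre)
  also have "real 2*(pi*(2*real j + 1)/(2*real k)) = pi*(2*real j + 1)/real k" by simp
  finally show ?thesis .
 qed
 show 1: "(\<Prod>j<k. 1 - X*mac_node k j^2) = 1 + X^k"
  unfolding e using k by (intro prod_roots_minus_one) auto
 have "(\<Prod>j<k. 1 - X/mac_node k j^2) = (\<Prod>j<k. 1 - X*mac_node k j^2)"
 proof (rule prod.reindex_bij_witness[of _ "%j. k - Suc j" "%j. k - Suc j"])
  fix j assume "j \<in> {..<k}"
  then show "1 - X*mac_node k (k - Suc j)^2 = 1 - X/mac_node k j^2"
   using mac_node_rev[of j] by (simp add: power_divide)
 qed auto
 then show "(\<Prod>j<k. 1 - X/mac_node k j^2) = 1 + X^k" using 1 by simp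
qed

lemma prod_mac_node_rev: "(\<Prod>j<k. 1 + mac_node k j) = (\<Prod>j<k. 1 - 1/mac_node k j)"
proof (rule prod.reindex_bij_witness[of _ "%j. k - Suc j" "%j. k - Suc j"])
 fix j assume "j \<in> {..<k}"
 then show "1 - 1/mac_node k (k - Suc j) = 1 + mac_node k j"
  using mac_node_rev[of j] by simp
qed auto

lemma prod_mac_node_all: "(\<Prod>j<k. mac_node k j) = \<i>^k"
proof -
 have c: "(\<Prod>j<m. cis (f j)) = cis (\<Sum>j<m. f j)" for m :: nat and f
  by (induction m) (auto simp: cis_mult)
 have "(\<Sum>j<m. 2*real j + 1) = (real m)\<^sup>2" for m :: nat
  by (induction m) (auto simp: power2_eq_square algebra_simps)
 then have "(\<Sum>j<k. pi*(2*real j + 1)/(2*real k)) = real k*(pi/2)"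
  using k by (simp add: sum_divide_distrib[symmetric] sum_distrib_left[symmetric] power2_eq_square)
 then have "(\<Prod>j<k. mac_node k j) = cis (pi/2)^k"
  unfolding mac_node_def c by (simp only: Complex.DeMoivre)
 then show ?thesis by simp
qed

lemma pair_prod_mac_node_sign: "pair_prod (%i j. - (mac_node k i*mac_node k j)) {..<k} = 1"
proof -
 have "pair_prod (%i j. - (mac_node k i*mac_node k j)) {..<k} =
   pair_prod (%i j. (\<i>*mac_node k i)*(\<i>*mac_node k j)) {..<k}"
  by (rule pair_prod_cong) (simp add: algebra_simps)
 also have "... = (\<Prod>j<k. \<i>*mac_node k j)^(k - 1)" by (rule pair_prod_factor)
 also have "(\<Prod>j<k. \<i>*mac_node k j) = \<i>^k*\<i>^k" by (simp add: prod.distrib prod_mac_node_all)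
 also have "... = (- 1)^k" by (simp flip: power_mult_distrib)
 also have "((- 1 :: complex)^k)^(k - 1) = 1"
 proof -
  have "even (k*(k - 1))" using k by (cases k) auto
  then show ?thesis by (simp flip: power_mult)
 qed
 finally show ?thesis .
qed

text \<open>The factors that a pair of nodes contributes to the theta functions of base
  \<open>s^2\<close> at one power \<open>X\<close> of that base.\<close>

definition mac_quad :: "complex => nat => nat => complex" where
 "mac_quad X i j = (1 - X*(mac_node k i*mac_node k j))*(1 - X/(mac_node k i*mac_node k j)) *
   ((1 - X*(mac_node k i/mac_node k j))*(1 - X/(mac_node k i/mac_node k j)))"

lemma mac_quad_sym: "mac_quad X i j = mac_quad X j i"
 by (simp add: mac_quad_def mult_ac)

text \<open>The double product over all nodes is evaluated row by row with
  \<open>prod_mac_node\<close>; its diagonal accounts for the factor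
  \<open>(1 - X)^k*(1 + X^k)\<close>.\<close>

lemma pair_prod_mac_quad_sq:
 "(pair_prod (mac_quad X) {..<k}*((1 - X)^k*(1 + X^k)))\<^sup>2 = ((1 - X^(2*k))^k)\<^sup>2"
proof -
 have row: "(\<Prod>j<k. mac_quad X i j) = (1 - X^(2*k))\<^sup>2" for i
 proof -
  define z where "z = mac_node k i"
  have z: "z ~= 0" "z^(2*k) = - 1" by (auto simp: z_def mac_node_power)
  have "(\<Prod>j<k. mac_quad X i j) =
    (\<Prod>j<k. ((1 - (X*z)*mac_node k j)*(1 - (X*z)/mac_node k j)) *
        ((1 - (X/z)*mac_node k j)*(1 - (X/z)/mac_node k j)))"
   by (intro prod.cong) (auto simp: mac_quad_def z_def mult_ac)
  also have "... = (1 + (X*z)^(2*k))*(1 + (X/z)^(2*k))"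
   by (simp only: prod.distrib[of _ _ "{..<k}", symmetric] prod.distrib[of "%j. (1 - (X*z)*mac_node k j)*(1 - (X*z)/mac_node k j)"] prod_mac_node)
  also have "... = (1 - X^(2*k))\<^sup>2"
   by (simp add: power_mult_distrib power_divide z power2_eq_square)
  finally show ?thesis .
 qed
 have diag: "(\<Prod>i<k. mac_quad X i i) = ((1 - X)^k*(1 + X^k))\<^sup>2"
 proof -
  have "(\<Prod>i<k. mac_quad X i i) =
    (\<Prod>i<k. ((1 - X*mac_node k i^2)*(1 - X/mac_node k i^2))*(1 - X)\<^sup>2)"
   by (intro prod.cong) (auto simp: mac_quad_def power2_eq_square)
  also have "... = ((1 + X^k)*(1 + X^k))*((1 - X)\<^sup>2)^k"
   by (simp add: prod.distrib prod_mac_node_sq)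
  finally show ?thesis by (simp add: power2_eq_square power_mult_distrib mult_ac)
 qed
 have "(\<Prod>i<k. \<Prod>j<k. mac_quad X i j) = (pair_prod (mac_quad X) {..<k})\<^sup>2*(\<Prod>i<k. mac_quad X i i)"
  by (rule pair_prod_square) (rule mac_quad_sym)
 then have "((1 - X^(2*k))\<^sup>2)^k = (pair_prod (mac_quad X) {..<k})\<^sup>2*((1 - X)^k*(1 + X^k))\<^sup>2"
  unfolding row diag by simp
 then show ?thesis by (simp add: power_mult_distrib power2_eq_square)
qed

lemma pair_prod_mac_quad:
 "pair_prod (mac_quad X) {..<k}*((1 - X)^k*(1 + X^k)) = (1 - X^(2*k))^k"
proof -
 let ?z = "mac_node k"
 define A where "A = (\<Prod>(i, j)\<in>{(i, j). i < j \<and> j < k}.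
   [:1, - (?z i*?z j):]*[:1, - 1/(?z i*?z j):]*([:1, - (?z i/?z j):]*[:1, - 1/(?z i/?z j):])) *
   ([:1, - 1:]^k*(1 + monom 1 k))"
 define B where "B = (1 - monom (1 :: complex) (2*k))^k"
 have pA: "poly A X = pair_prod (mac_quad X) {..<k}*((1 - X)^k*(1 + X^k))" for X
 proof -
  have q: "poly ([:1, - a:]*[:1, - 1/a:]*([:1, - b:]*[:1, - 1/b:])) X =
    (1 - X*a)*(1 - X/a)*((1 - X*b)*(1 - X/b))" for a b :: complex by (simp add: algebra_simps)
  have r: "poly ([:1, - 1:]^k*(1 + monom 1 k)) X = (1 - X)^k*(1 + X^k)" by (simp add: poly_monom)
  have m: "poly (prod f I * R) X = (\<Prod>i\<in>I. poly (f i) X)*poly R X" for f :: "nat \<times> nat => complex poly" and I R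
   by (simp add: poly_prod)
  show ?thesis by (simp only: A_def pair_prod_lessThan case_prod_unfold m q r mac_quad_def)
 qed
 have pB: "poly B X = (1 - X^(2*k))^k" for X by (simp add: B_def poly_monom)
 have A0: "pair_prod (mac_quad 0) {..<k} = 1"
  unfolding pair_prod_lessThan by (rule prod.neutral) (auto simp: mac_quad_def)
 have "A = B"
  by (rule poly_sign_unique) (unfold pA pB, use pair_prod_mac_quad_sq A0 k in "auto simp: power_0_left")
 then show ?thesis using pA[of X] pB[of X] by simp
qed

text \<open>The finite type B determinant at the nodes. It occurs in both evaluations and is
  cancelled in the end, for which it has to be nonzero.\<close>

definition mac_F :: complex where
 "mac_F = (\<Prod>j<k. 1 - 1/mac_node k j) *
   pair_prod (%i j. (mac_node k j + 1/mac_node k j) - (mac_node k i + 1/mac_node k i)) {..<k}"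

lemma mac_node_neq:
 assumes "i < k" "j < k" "i ~= j"
 shows "mac_node k j + 1/mac_node k j ~= mac_node k i + 1/mac_node k i"
proof
 define z w where "z = mac_node k i" and "w = mac_node k j"
 have nz: "z ~= 0" "w ~= 0" by (auto simp: z_def w_def)
 assume "mac_node k j + 1/mac_node k j = mac_node k i + 1/mac_node k i"
 then have "w + 1/w = z + 1/z" by (simp add: z_def w_def)
 then have "(w - z)*(w*z - 1) = 0" using nz by (simp add: field_simps)
 then have "w = z \<or> w*z = 1" by simp
 then have "w = z \<or> w = 1/z" using nz by (auto simp: field_simps)
 then show False
 proof
  assume "w = z"
  then have "cis (pi*(2*real j + 1)/real (2*k)) = cis (pi*(2*real i + 1)/real (2*k))"
   by (simp add: z_def w_def mac_node_def)
  then show False using cis_odd_inj[of j "2*k" i] assms by simp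
 next
  assume "w = 1/z"
  have "cis (pi*(2*real (2*k - 1 - i) + 1)/real (2*k)) = 1/z"
   using mac_node_cases[of "2*k - 1 - i"] assms by (auto simp: z_def)
  moreover have "cis (pi*(2*real j + 1)/real (2*k)) = w" by (simp add: w_def mac_node_def)
  ultimately have "j = 2*k - 1 - i"
   using cis_odd_inj[of j "2*k" "2*k - 1 - i"] assms \<open>w = 1/z\<close> by simp
  then show False using assms by simp
 qed
qed

lemma mac_node_neq_1: "j < k ==> mac_node k j ~= 1"
 using mac_node_power[of j] by auto

lemma mac_F_nonzero: "mac_F ~= 0"
 unfolding mac_F_def pair_prod_lessThan
 using mac_node_neq_1 mac_node_neq by (auto simp: finite_lessThan_pairs)

lemma mac_F_alt:
 "(\<Prod>j<k. 1 + mac_node k j)*pair_prod (%i j. mac_node k j *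
   ((1 - mac_node k i*mac_node k j)*(1 - mac_node k i/mac_node k j))) {..<k} = mac_F"
proof -
 have "pair_prod (%i j. mac_node k j *
   ((1 - mac_node k i*mac_node k j)*(1 - mac_node k i/mac_node k j))) {..<k} =
   pair_prod (%i j. (- (mac_node k i*mac_node k j)) *
    ((mac_node k j + 1/mac_node k j) - (mac_node k i + 1/mac_node k i))) {..<k}"
  by (rule pair_prod_cong) (simp add: field_simps)
 also have "... = pair_prod (%i j. (mac_node k j + 1/mac_node k j) - (mac_node k i + 1/mac_node k i)) {..<k}"
  unfolding pair_prod_mult[OF finite_lessThan] pair_prod_mac_node_sign by simp
 finally show ?thesis unfolding mac_F_def prod_mac_node_rev by simp
qed

context
 fixes s :: complex
 assumes s: "s ~= 0" "norm s < 1"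
begin

lemma norm_s_pow: "n \<ge> 1 ==> norm (s^n) < 1"
 using s by (simp add: norm_power power_less_one_iff)

text \<open>The exponents \<open>2*b + 1\<close> and their complements
  \<open>4*k - (2*b + 1)\<close> run through the odd numbers below \<open>4*k\<close>; shifted by
  multiples of \<open>4*k\<close> they give every odd power of \<open>s\<close> once.\<close>

lemma prod_theta_odd:
 "(\<Prod>b<k. theta (s^(2*b + 1)) (s^(4*k))) = qpoch_inf s (s^2)"
proof -
 have Q: "norm (s^(4*k)) < 1" and t: "norm (s^2) < 1" using k norm_s_pow[of "4*k"] norm_s_pow[of 2] by auto
 have fin: "(\<Prod>b<k. (1 - s^(2*b + 1)*X)*(1 - s^(4*k)/s^(2*b + 1)*X)) = (\<Prod>l<2*k. 1 - s^(2*l + 1)*X)" for X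
 proof -
  have "(\<Prod>l\<in>{k..<2*k}. 1 - s^(2*l + 1)*X) = (\<Prod>b<k. 1 - s^(4*k)/s^(2*b + 1)*X)"
  proof (rule prod.reindex_bij_witness[of _ "%b. 2*k - 1 - b" "%l. 2*k - 1 - l"])
   fix l assume l: "l \<in> {k..<2*k}"
   have "2*l + 1 + (2*(2*k - 1 - l) + 1) = 4*k" using l by auto
   then have "s^(4*k) = s^(2*l + 1) * s^(2*(2*k - 1 - l) + 1)" by (metis power_add)
   then have "s^(4*k)/s^(2*(2*k - 1 - l) + 1) = s^(2*l + 1)"
    using s(1) by simp
   then show "1 - s^(4*k)/s^(2*(2*k - 1 - l) + 1)*X = 1 - s^(2*l + 1)*X" by simp
  qed auto
  moreover have "(\<Prod>l<2*k. 1 - s^(2*l + 1)*X) = (\<Prod>l<k. 1 - s^(2*l + 1)*X)*(\<Prod>l\<in>{k..<2*k}. 1 - s^(2*l + 1)*X)"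
  proof -
   have "{..<k} \<union> {k..<2*k} = {..<2*k}" by auto
   moreover have "(\<Prod>l\<in>{..<k} \<union> {k..<2*k}. 1 - s^(2*l + 1)*X) = (\<Prod>l<k. 1 - s^(2*l + 1)*X)*(\<Prod>l\<in>{k..<2*k}. 1 - s^(2*l + 1)*X)"
    by (rule prod.union_disjoint) auto
   ultimately show ?thesis by (simp only:)
  qed
  ultimately show ?thesis by (simp only: prod.distrib)
 qed
 have p: "(\<Prod>b<k. qpoch (s^(2*b + 1)) (s^(4*k)) N*qpoch (s^(4*k)/s^(2*b + 1)) (s^(4*k)) N) =
   qpoch s (s^2) (2*k*N)" for N
 proof -
  have "(\<Prod>b<k. qpoch (s^(2*b + 1)) (s^(4*k)) N*qpoch (s^(4*k)/s^(2*b + 1)) (s^(4*k)) N) =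
   (\<Prod>b<k. \<Prod>i<N. (1 - s^(2*b + 1)*(s^(4*k))^i)*(1 - s^(4*k)/s^(2*b + 1)*(s^(4*k))^i))"
   by (simp add: qpoch_def prod.distrib)
  also have "... = (\<Prod>i<N. \<Prod>l<2*k. 1 - s^(2*l + 1)*(s^(4*k))^i)"
   by (subst prod.swap) (simp only: fin)
  also have "... = (\<Prod>i<N. \<Prod>l<2*k. 1 - s*(s^2)^(2*k*i + l))"
  proof (intro prod.cong refl arg_cong2[of _ _ _ _ "(-)"])
   fix i l :: nat
   have "2*l + 1 + 4*k*i = Suc (2*(2*k*i + l))" by simp
   then show "s^(2*l + 1)*(s^(4*k))^i = s*(s^2)^(2*k*i + l)"
    by (metis power_Suc power_add power_mult)
  qed
  also have "... = qpoch s (s^2) (2*k*N)"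
  proof (induction N)
   case (Suc N)
   have "qpoch s (s^2) (2*k*Suc N) = qpoch s (s^2) (2*k*N)*(\<Prod>l<2*k. 1 - s*(s^2)^(2*k*N + l))"
   proof -
    have "(\<Prod>i<m + n. f i) = (\<Prod>i<m. f i)*(\<Prod>l<n. f (m + l))" for m n :: nat and f :: "nat => complex"
     by (induction n) (auto simp: mult.assoc)
    from this[where m = "2*k*N" and n = "2*k"] show ?thesis by (simp add: qpoch_def algebra_simps)
   qed
   then show ?case by (simp add: Suc.IH)
  qed (simp add: qpoch_def)
  finally show ?thesis .
 qed
 have "(%N. \<Prod>b<k. qpoch (s^(2*b + 1)) (s^(4*k)) N*qpoch (s^(4*k)/s^(2*b + 1)) (s^(4*k)) N)
   \<longlonglongrightarrow> (\<Prod>b<k. theta (s^(2*b + 1)) (s^(4*k)))"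
  unfolding theta_def by (intro tendsto_prod tendsto_mult qpoch_LIMSEQ Q)
 moreover have "(%N. qpoch s (s^2) (2*k*N)) \<longlonglongrightarrow> qpoch_inf s (s^2)"
  using LIMSEQ_subseq_LIMSEQ[OF qpoch_LIMSEQ[OF t, of s], of "%N. 2*k*N"] k
  by (simp add: strict_mono_def o_def)
 ultimately show ?thesis unfolding p by (rule LIMSEQ_unique)
qed

text \<open>A node satisfies \<open>z^(2*k) = - 1\<close>, so the theta factors of
  \<open>psi\<close> are the same for all nodes and leave the determinant as scalars. What remains
  is a determinant of finite type B.\<close>

lemma leib_psi_node:
 "leib k (%i b. psi k s b (mac_node k i)) = mac_F*qpoch_inf (s^(4*k)) (s^(4*k))^k*qpoch_inf s (s^2)"
proof -
 let ?Q = "s^(4*k)" and ?z = "mac_node k"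
 define ta where "ta b = qpoch_inf ?Q ?Q*theta (s^(2*b + 1)) ?Q" for b
 have psi: "psi k s b (?z i) = ta b*(?z i^b + (- 1)*?z i powi (- int b - 1))" for i b
 proof -
  have e: "- (s^(2*b + 1))*?z i^(2*k) = s^(2*b + 1)" by (simp add: mac_node_power)
  have e': "- (s^(2*b + 1))*(1/?z i)^(2*k) = s^(2*b + 1)" by (simp add: mac_node_power power_divide)
  have "?z i powi (2*int k - 1 - int b) = ?z i powi (int (2*k))*?z i powi (- int b - 1)"
   by (simp flip: power_int_add) (simp add: algebra_simps)
  also have "?z i powi (int (2*k)) = - 1" by (simp only: power_int_of_nat mac_node_power)
  finally show ?thesis unfolding psi_def e e' by (simp add: ta_def algebra_simps)
 qed
 have "leib k (%i b. psi k s b (?z i)) = leib k (%b i. ta b*(?z i^b + (- 1)*?z i powi (- int b - 1)))"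
  unfolding psi by (subst leib_transpose[symmetric]) simp
 also have "... = (\<Prod>b<k. ta b)*leib k (%b i. ?z i^b + (- 1)*?z i powi (- int b - 1))"
  by (simp add: leib_def prod.distrib sum_distrib_left mult_ac)
 also have "leib k (%b i. ?z i^b + (- 1)*?z i powi (- int b - 1)) =
   leib k (%i b. ?z i^b + (- 1)*?z i powi (- int b - 1))"
  by (rule leib_transpose)
 also have "... = mac_F" using leib_B[of k "- 1" ?z] k by (simp add: mac_F_def)
 also have "(\<Prod>b<k. ta b) = qpoch_inf ?Q ?Q^k*qpoch_inf s (s^2)"
  unfolding ta_def prod.distrib prod_theta_odd by simp
 finally show ?thesis by (simp add: mult_ac)
qed

text \<open>All theta functions are truncated to \<open>N\<close> steps. For each \<open>N\<close>
  the products over the nodes collapse exactly by \<open>prod_mac_node\<close> and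
  \<open>pair_prod_mac_quad\<close>; only then is the limit taken.\<close>

lemma mac_theta_node:
 "mac_theta k s (mac_node k)*qpoch_inf (s^2) (s^2)^k = mac_F*qpoch_inf (s^(4*k)) (s^(4*k))^k"
proof -
 let ?Q = "s^(4*k)" and ?z = "mac_node k" and ?t = "s^2"
 have Q: "norm ?Q < 1" and t: "norm ?t < 1" using k norm_s_pow[of "4*k"] norm_s_pow[of 2] by auto
 \<comment> \<open>The factor \<open>1 - a\<close> is kept apart so that the others form pairs
   symmetric under \<open>a \<mapsto> 1/a\<close>.\<close>
 define th where "th a p N = (1 - a)*(\<Prod>r<N. (1 - p^Suc r*a)*(1 - p^Suc r/a))" for a p :: complex and N
 have th: "(%N. th a p N) \<longlonglongrightarrow> theta a p" if "norm p < 1" for a p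
 proof -
  have "th a p N = qpoch a p (Suc N)*qpoch (p/a) p N" for N
   by (simp add: th_def qpoch_Suc_shift) (simp add: qpoch_def prod.distrib mult_ac)
  then show ?thesis unfolding theta_def
   by (simp only:) (intro tendsto_mult LIMSEQ_Suc qpoch_LIMSEQ that)
 qed
 have fin: "(\<Prod>j<k. th (- ?z j) s N)*pair_prod (%i j. ?z j*th (?z i*?z j) ?t N*th (?z i/?z j) ?t N) {..<k} *
   qpoch ?t ?t N^k = mac_F*qpoch ?Q ?Q N^k" for N
 proof -
  have 1: "(\<Prod>j<k. th (- ?z j) s N) = (\<Prod>j<k. 1 + ?z j)*(\<Prod>r<N. 1 + ?t^(k*Suc r))"
  proof -
   have "(\<Prod>j<k. th (- ?z j) s N) = (\<Prod>j<k. 1 + ?z j) *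
     (\<Prod>j<k. \<Prod>r<N. (1 - (- (s^Suc r))*?z j)*(1 - (- (s^Suc r))/?z j))"
    by (simp add: th_def prod.distrib)
   also have "(\<Prod>j<k. \<Prod>r<N. (1 - (- (s^Suc r))*?z j)*(1 - (- (s^Suc r))/?z j)) =
     (\<Prod>r<N. 1 + (- (s^Suc r))^(2*k))"
    by (subst prod.swap) (simp only: prod_mac_node)
   also have "... = (\<Prod>r<N. 1 + ?t^(k*Suc r))"
   proof (intro prod.cong refl)
    fix r
    have "(- (s^Suc r))^(2*k) = (s^Suc r)^(2*k)" by (rule power_minus_even) simp
    also have "... = ?t^(k*Suc r)" by (simp only: power_mult[symmetric] mult_ac)
    finally show "1 + (- (s^Suc r))^(2*k) = 1 + ?t^(k*Suc r)" by simp
   qed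
   finally show ?thesis .
  qed
  have 2: "pair_prod (%i j. ?z j*th (?z i*?z j) ?t N*th (?z i/?z j) ?t N) {..<k} =
    pair_prod (%i j. ?z j*((1 - ?z i*?z j)*(1 - ?z i/?z j))) {..<k} *
    (\<Prod>r<N. pair_prod (mac_quad (?t^Suc r)) {..<k})"
  proof -
   have "pair_prod (%i j. ?z j*th (?z i*?z j) ?t N*th (?z i/?z j) ?t N) {..<k} =
    pair_prod (%i j. (?z j*((1 - ?z i*?z j)*(1 - ?z i/?z j)))*(\<Prod>r<N. mac_quad (?t^Suc r) i j)) {..<k}"
    by (rule pair_prod_cong) (simp add: th_def mac_quad_def prod.distrib mult_ac)
   also have "... = pair_prod (%i j. ?z j*((1 - ?z i*?z j)*(1 - ?z i/?z j))) {..<k} *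
    pair_prod (%i j. \<Prod>r<N. mac_quad (?t^Suc r) i j) {..<k}"
    by (rule pair_prod_mult) simp
   also have "pair_prod (%i j. \<Prod>r<N. mac_quad (?t^Suc r) i j) {..<k} =
    (\<Prod>r<N. pair_prod (mac_quad (?t^Suc r)) {..<k})"
    unfolding pair_prod_def case_prod_unfold by (rule prod.swap)
   finally show ?thesis .
  qed
  have 3: "(\<Prod>r<N. 1 + ?t^(k*Suc r))*(\<Prod>r<N. pair_prod (mac_quad (?t^Suc r)) {..<k})*qpoch ?t ?t N^k =
    qpoch ?Q ?Q N^k"
  proof -
   have "qpoch ?t ?t N^k = (\<Prod>r<N. (1 - ?t^Suc r)^k)"
    by (simp add: qpoch_def prod_power_distrib)
   then have "(\<Prod>r<N. 1 + ?t^(k*Suc r))*(\<Prod>r<N. pair_prod (mac_quad (?t^Suc r)) {..<k})*qpoch ?t ?t N^k =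
     (\<Prod>r<N. pair_prod (mac_quad (?t^Suc r)) {..<k}*((1 - ?t^Suc r)^k*(1 + (?t^Suc r)^k)))"
    by (simp only: prod.distrib[symmetric] power_mult[symmetric] mult_ac)
   also have "... = (\<Prod>r<N. (1 - (?t^Suc r)^(2*k))^k)" by (simp only: pair_prod_mac_quad)
   also have "... = (\<Prod>r<N. (1 - ?Q*?Q^r)^k)"
   proof (intro prod.cong refl arg_cong2[of _ _ _ _ "(-)"] arg_cong2[of _ _ _ _ "(^)"])
    fix r
    have "2*Suc r*(2*k) = 4*k*Suc r" by simp
    then show "(?t^Suc r)^(2*k) = ?Q*?Q^r" by (metis power_Suc power_mult)
   qed
   also have "... = qpoch ?Q ?Q N^k" by (simp add: qpoch_def prod_power_distrib)
   finally show ?thesis .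
  qed
  have "(\<Prod>j<k. th (- ?z j) s N)*pair_prod (%i j. ?z j*th (?z i*?z j) ?t N*th (?z i/?z j) ?t N) {..<k} *
    qpoch ?t ?t N^k =
   ((\<Prod>j<k. 1 + ?z j)*pair_prod (%i j. ?z j*((1 - ?z i*?z j)*(1 - ?z i/?z j))) {..<k}) *
   ((\<Prod>r<N. 1 + ?t^(k*Suc r))*(\<Prod>r<N. pair_prod (mac_quad (?t^Suc r)) {..<k})*qpoch ?t ?t N^k)"
   unfolding 1 2 by (simp only: mult_ac)
  then show ?thesis unfolding 3 mac_F_alt .
 qed
 have "(%N. (\<Prod>j<k. th (- ?z j) s N)*(\<Prod>(i, j)\<in>{(i, j). i < j \<and> j < k}. ?z j*th (?z i*?z j) ?t N*th (?z i/?z j) ?t N) *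
   qpoch ?t ?t N^k) \<longlonglongrightarrow>
   (\<Prod>j<k. theta (- ?z j) s)*(\<Prod>(i, j)\<in>{(i, j). i < j \<and> j < k}. ?z j*theta (?z i*?z j) ?t*theta (?z i/?z j) ?t) *
   qpoch_inf ?t ?t^k"
  unfolding case_prod_unfold by (intro tendsto_mult tendsto_prod tendsto_power tendsto_const th qpoch_LIMSEQ t s)
 moreover have "(%N. mac_F*qpoch ?Q ?Q N^k) \<longlonglongrightarrow> mac_F*qpoch_inf ?Q ?Q^k"
  by (intro tendsto_intros qpoch_LIMSEQ Q)
 ultimately show ?thesis
  using LIMSEQ_unique unfolding mac_theta_def mac_h_def pair_prod_lessThan fin[unfolded pair_prod_lessThan] by blast
qed

lemma qpoch_inf_split: "qpoch_inf s s = qpoch_inf s (s^2)*qpoch_inf (s^2) (s^2)"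
proof (rule LIMSEQ_unique)
 have t: "norm (s^2) < 1" by (rule norm_s_pow) simp
 show "(%N. qpoch s s (2*N)) \<longlonglongrightarrow> qpoch_inf s s"
  using LIMSEQ_subseq_LIMSEQ[OF qpoch_LIMSEQ[OF s(2), of s], of "%N. 2*N"]
  by (simp add: strict_mono_def o_def)
 have "qpoch s s (2*N) = qpoch s (s^2) N*qpoch (s^2) (s^2) N" for N
 proof (induction N)
  case (Suc N)
  have "s * s^(2*N) = s*(s^2)^N" "s * s^Suc (2*N) = s^2*(s^2)^N"
   by (simp_all add: power_mult power2_eq_square)
  moreover have "qpoch s s (2*Suc N) = qpoch s s (2*N)*(1 - s * s^(2*N))*(1 - s * s^Suc (2*N))"
   by (simp add: qpoch_def)
  ultimately have "qpoch s s (2*Suc N) = qpoch s s (2*N)*(1 - s*(s^2)^N)*(1 - s^2*(s^2)^N)"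
   by simp
  also have "... = (qpoch s (s^2) N*(1 - s*(s^2)^N))*(qpoch (s^2) (s^2) N*(1 - s^2*(s^2)^N))"
   unfolding Suc.IH by (simp only: mult_ac)
  finally show ?case by (simp add: qpoch_def)
 qed (simp add: qpoch_def)
 then show "(%N. qpoch s s (2*N)) \<longlonglongrightarrow> qpoch_inf s (s^2)*qpoch_inf (s^2) (s^2)"
  by (simp only:) (intro tendsto_mult qpoch_LIMSEQ t)
qed

text \<open>The nodes fix the constant: the quotient of the two evaluations is
  \<open>qpoch_inf s (s^2)*qpoch_inf (s^2) (s^2)^k\<close>, and one factor combines with the first
  by \<open>qpoch_inf_split\<close>.\<close>

theorem macdonald_identity:
 assumes "!!i. i < k ==> y i ~= 0"
 shows "leib k (%i b. psi k s b (y i)) = mac_theta k s y*(qpoch_inf s s*qpoch_inf (s^2) (s^2)^(k - 1))"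
proof -
 let ?Q = "s^(4*k)" and ?t = "s^2"
 have Q: "norm ?Q < 1" and t: "norm ?t < 1" using k norm_s_pow[of "4*k"] norm_s_pow[of 2] by auto
 have nz: "qpoch_inf ?Q ?Q ~= 0" "qpoch_inf ?t ?t ~= 0" "qpoch_inf s s ~= 0"
  by (intro qpoch_inf_self_nonzero Q t s)+
 then have nz': "qpoch_inf s ?t ~= 0" using qpoch_inf_split by auto
 have l: "leib k (%i b. psi k s b (mac_node k i)) ~= 0"
  unfolding leib_psi_node using nz nz' mac_F_nonzero by simp
 have "mac_theta k s y*leib k (%i b. psi k s b (mac_node k i)) =
   mac_theta k s (mac_node k)*leib k (%i b. psi k s b (y i))"
  by (rule mac_theta_proportional[OF k s _ l assms]) auto
 then have "mac_theta k s y*(mac_F*qpoch_inf ?Q ?Q^k)*qpoch_inf s ?t*qpoch_inf ?t ?t^k =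
   (mac_theta k s (mac_node k)*qpoch_inf ?t ?t^k)*leib k (%i b. psi k s b (y i))"
  unfolding leib_psi_node by (simp only: mult_ac)
 then have "mac_theta k s y*qpoch_inf s ?t*qpoch_inf ?t ?t^k = leib k (%i b. psi k s b (y i))"
  unfolding mac_theta_node using nz mac_F_nonzero by (simp add: mult_ac)
 moreover have "qpoch_inf s ?t*qpoch_inf ?t ?t^k = qpoch_inf s s*qpoch_inf ?t ?t^(k - 1)"
  using k by (cases k) (auto simp: qpoch_inf_split)
 ultimately show ?thesis by (simp add: mult.assoc)
qed

end

end

section \<open>The torus integral\<close>

text \<open>At \<open>u = x i\<close> or \<open>u = 1/x i\<close> this is, up to the power
  \<open>(1/u)^k\<close>, the quotient of the kernel without \<open>x i\<close> by the full kernel;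
  see \<open>tor_K_remove\<close>.\<close>

definition tor_Y :: "nat => (nat => complex) => complex => complex" where
 "tor_Y k y u = (\<Prod>l<k. 1/((1 + u*y l)*(1 + u/y l)))"

text \<open>For \<open>v = y l\<close> or \<open>v = 1/y l\<close>, the residue of
  \<open>(1 + u)/(1 - s*u)*tor_Y k y u\<close> at \<open>u = - v\<close>, divided by
  \<open>v\<close>.\<close>

definition tor_b :: "nat => complex => (nat => complex) => nat => complex => complex" where
 "tor_b k s y l v = 1/((1 + s * v)*(1 + v))*(\<Prod>m\<in>{..<k} - {l}. 1/((1 - v * y m)*(1 - v/y m)))"

lemma neg_recip:
 fixes a b :: complex
 assumes "a ~= 0" "b ~= 0" "a*b ~= - 1" "a ~= - b"
 shows "a ~= - (1/b)" "a ~= - b" "1/a ~= - (1/b)" "1/a ~= - b"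
proof -
 show "a ~= - (1/b)" using assms(2,3) by auto
 show "a ~= - b" by fact
 show "1/a ~= - (1/b)"
 proof
  assume "1/a = - (1/b)"
  then have "1/(1/a) = 1/(- (1/b))" by simp
  then show False using assms(4) by simp
 qed
 show "1/a ~= - b"
 proof
  assume "1/a = - b"
  then have "a*(1/a) = a*(- b)" by simp
  then show False using assms(1,3) by (simp add: minus_equation_iff[of _ 1])
 qed
qed

text \<open>The norms of the \<open>y l\<close> are distinct, exceed 1 and stay below the inverse
  norms of \<open>s\<close> and of the \<open>x i\<close>. Together with the conditions on
  \<open>x\<close> this separates the poles \<open>x i\<close>, \<open>1/x i\<close>,
  \<open>- y l\<close>, \<open>- 1/y l\<close> and \<open>1/s\<close>.\<close>

locale torus_point =
 fixes k :: nat and s t :: complex and S :: "nat set" and x y :: "nat => complex"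
 assumes k: "k \<ge> 1" and t: "t = s^2" and s: "s ~= 0" "norm s < 1"
  and S: "finite S" "inj_on x S"
  and x: "!!i. i \<in> S ==> x i ~= 0" "!!i. i \<in> S ==> norm (x i) < 1" "!!i. i \<in> S ==> x i ~= s"
  and y: "inj_on (%l. norm (y l)) {..<k}" "!!l. l < k ==> norm (y l) > 1" "!!l. l < k ==> norm (y l)*norm s < 1"
   "!!i l. i \<in> S ==> l < k ==> norm (y l)*norm (x i) < 1"
begin

lemma xx: "i \<in> S ==> j \<in> S ==> x i*x j ~= 1"
proof -
 assume "i \<in> S" "j \<in> S"
 then have "norm (x i*x j) < 1*1" unfolding norm_mult by (intro mult_strict_mono x) auto
 then show ?thesis by auto
qed

lemma xs: "i \<in> S ==> x i * s ~= 1"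
proof -
 assume "i \<in> S"
 then have "norm (x i * s) < 1*1" unfolding norm_mult by (intro mult_strict_mono x s) auto
 then show ?thesis by auto
qed

lemma xy: "i \<in> S ==> l < k ==> x i*y l ~= - 1"
proof
 assume "i \<in> S" "l < k" "x i*y l = - 1"
 then have "norm (y l)*norm (x i) = 1" by (metis mult.commute norm_minus_cancel norm_mult norm_one)
 then show False using y(4)[of i l] \<open>i \<in> S\<close> \<open>l < k\<close> by simp
qed

lemma xy': "i \<in> S ==> l < k ==> x i ~= - y l"
 using x(2)[of i] y(2)[of l] by (metis norm_minus_cancel not_less_iff_gr_or_eq)

lemma y0: "l < k ==> y l ~= 0" using y(2)[of l] by auto

lemma yy: "l < k ==> m < k ==> y l*y m ~= 1"
proof -
 assume "l < k" "m < k"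
 then have "1*1 < norm (y l*y m)" unfolding norm_mult by (intro mult_strict_mono y(2)) (use y0 in auto)
 then show ?thesis by auto
qed

lemma yy': "l < k ==> m < k ==> y l = y m \<longleftrightarrow> l = m"
 using inj_onD[OF y(1), of l m] by auto

lemma ys: "l < k ==> y l * s ~= - 1"
proof
 assume "l < k" "y l * s = - 1"
 then have "norm (y l)*norm s = 1" by (metis norm_minus_cancel norm_mult norm_one)
 then show False using y(3)[of l] \<open>l < k\<close> by simp
qed

lemma ys': "l < k ==> y l ~= - s"
 using s(2) y(2)[of l] by (metis norm_minus_cancel not_less_iff_gr_or_eq)

lemma y1: "l < k ==> y l ~= - 1" "l < k ==> y l ~= 1"
 using y(2)[of l] by auto

lemma v_facts:
 assumes l: "l < k" and v: "v = y l \<or> v = 1/y l"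
 shows "v ~= 0" "1 + v ~= 0" "1 - v ~= 0" "1 + s * v ~= 0" "1 - v * v ~= 0"
  "!!m. m < k ==> m ~= l ==> 1 - v * y m ~= 0" "!!m. m < k ==> m ~= l ==> 1 - v/y m ~= 0"
  "!!i. i \<in> S ==> 1 + v * x i ~= 0" "!!i. i \<in> S ==> 1 + v/x i ~= 0"
proof -
 note R = recip_nonzero[OF v y0[OF l]]
 show "v ~= 0" using v y0[OF l] by auto
 have "y l*(- 1) ~= 1" using y1(1)[OF l] by (simp add: minus_equation_iff[of _ 1])
 then have v1: "1 + v ~= 0 \<and> 1 - v ~= 0" using R[of 1] R[of "- 1"] y1[OF l] by simp
 then show "1 + v ~= 0" "1 - v ~= 0" by blast+
 from v1 have "(1 - v)*(1 + v) ~= 0" by simp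
 then show "1 - v * v ~= 0" by (simp add: algebra_simps)
 show "1 + s * v ~= 0" using R[of "- s"] ys[OF l] ys'[OF l] s(1) by (simp add: minus_equation_iff[of _ 1] mult.commute)
 show "1 - v * y m ~= 0" "1 - v/y m ~= 0" if "m < k" "m ~= l" for m
  using R[of "y m"] yy[OF l that(1)] yy'[OF l that(1)] y0[OF that(1)] that(2) by auto
 show "1 + v * x i ~= 0" "1 + v/x i ~= 0" if "i \<in> S" for i
 proof -
  have "y l*(- x i) ~= 1" using xy[OF that l] by (simp add: minus_equation_iff[of _ 1] mult.commute)
  moreover have "y l ~= - x i" using xy'[OF that l] by auto
  ultimately show "1 + v * x i ~= 0" "1 + v/x i ~= 0" using R[of "- x i"] x(1)[OF that] by auto
 qed
qed

text \<open>The expansion with \<open>G u = (1 + u)/(1 - s*u)*tor_Y k y u\<close>, evaluated at 0.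
  At \<open>x i\<close> and \<open>1/x i\<close> the factor \<open>(1 + u)/(1 - s*u)\<close> turns
  \<open>(1 - t*u^2)/(1 - u^2)\<close> into \<open>(1 + s*u)/(1 - u)\<close>, the prefactor of
  \<open>bc_coeff\<close>.\<close>

lemma torus_pf:
 "1 = (1 - t)*(\<Sum>i\<in>S. bc_coeff x t s (S - {i}) (x i)*tor_Y k y (x i) +
     bc_coeff x t s (S - {i}) (1/x i)*tor_Y k y (1/x i)) +
   (\<Sum>l<k. tor_b k s y l (y l)*refl_prod x t S (- y l) + tor_b k s y l (1/y l)*refl_prod x t S (- (1/y l))) +
   (1 + 1/s)*tor_Y k y (1/s)*t^card S"
proof -
 \<comment> \<open>The first component encodes the kind of pole of \<open>G\<close>: 0 for
   \<open>- 1/y i\<close>, 1 for \<open>- y i\<close>, 2 for the single pole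
   \<open>1/s\<close>.\<close>
 define P where "P = (%(a, i). if a = (0::nat) then - (1/y i) else if a = 1 then - y i else 1/s)"
 define J where "J = {0, 1 :: nat} \<times> {..<k} \<union> {(2, 0)}"
 define g where "g u = (1 + u)/(1 - s*u)" for u
 define r where "r = (%(a, i). if a = (2::nat) then - (1/s)*((1 + 1/s)*tor_Y k y (1/s))
   else - P (a, i)*tor_b k s y i (- P (a, i)))"
 have ne4: "- (1/y l) ~= - y m" "- y m ~= - (1/y l)" "- (1/y l) = - (1/y m) \<longleftrightarrow> l = m" "- y l = - y m \<longleftrightarrow> l = m"
  if "l < k" "m < k" for l m
  using yy[OF that] yy'[OF that] y0[OF that(1)] y0[OF that(2)] by (auto simp: field_simps)
 have ne5: "- (1/y l) ~= 1/s" "- y l ~= 1/s" "1/s ~= - (1/y l)" "1/s ~= - y l" if "l < k" for l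
 proof -
  have "s*y l ~= - 1" "s ~= - y l" using ys[OF that] ys'[OF that] by (auto simp: mult.commute)
  then show "- (1/y l) ~= 1/s" "- y l ~= 1/s" "1/s ~= - (1/y l)" "1/s ~= - y l"
   using neg_recip[OF s(1) y0[OF that]] by metis+
 qed
 have Pv: "P (0, i) = - (1/y i)" "P (Suc 0, i) = - y i" "P (2, i) = 1/s" for i by (simp_all add: P_def)
 have PJ: "P ` J = {1/s} \<union> ((%l. - (1/y l)) ` {..<k} \<union> (%l. - y l) ` {..<k})"
 proof -
  have "J = {(2, 0)} \<union> (Pair 0 ` {..<k} \<union> Pair (Suc 0) ` {..<k})" unfolding J_def by auto
  then show ?thesis by (simp only: image_Un image_image image_insert image_empty Pv)
 qed
 have Jc: thesis if "v \<in> J" "!!l. v = (0, l) ==> l < k ==> thesis" "!!l. v = (Suc 0, l) ==> l < k ==> thesis"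
  "v = (2, 0) ==> thesis" for v thesis
  using that unfolding J_def by auto
 have inj: "inj_on P J"
 proof (rule inj_onI)
  fix v w assume vw: "v \<in> J" "w \<in> J" "P v = P w"
  show "v = w"
   by (rule Jc[OF vw(1)]; rule Jc[OF vw(2)]; use vw(3) in "simp only: Pv ne4 ne5")
 qed
 have limY: "(tor_Y k y \<longlongrightarrow> tor_Y k y u) (at u)"
  if "!!l. l < k ==> 1 + u*y l ~= 0 \<and> 1 + u/y l ~= 0" for u
  unfolding tor_Y_def by (intro tendsto_intros) (use that y0 in auto)
 have limg: "(g \<longlongrightarrow> g u) (at u)" if "1 - s*u ~= 0" for u
  unfolding g_def by (intro tendsto_intros) (use that in auto)
 have "g 0*tor_Y k y 0 = (1 - t)*(\<Sum>i\<in>S. bc_coeff x t s (S - {i}) (x i)*tor_Y k y (x i) +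
     bc_coeff x t s (S - {i}) (1/x i)*tor_Y k y (1/x i)) + (\<Sum>j\<in>J. refl_prod x t S (P j)*r j/(0 - P j))"
 proof (rule refl_partial_fractions[OF S x(1) xx inj])
  have "ratf ((%l. - (1/y l)) ` {..<k} \<union> (%l. - y l) ` {..<k})
    (%u. (\<Prod>l<k. 1/(1 + u*y l))*(\<Prod>l<k. 1/(1 + u/y l)))"
  proof (rule ratf_mult_disjoint)
   show "ratf ((%l. - (1/y l)) ` {..<k}) (%u. \<Prod>l<k. 1/(1 + u*y l))"
   proof (rule ratf_prod)
    fix l assume "l \<in> {..<k}"
    then show "ratf {- (1/y l)} (%u. 1/(1 + u*y l))"
     by (intro ratf_mobius[of _ 0 1 "y l" 1]) (use y0 in "auto simp: mult.commute add.commute")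
   qed (use ne4 in "auto intro!: inj_onI")
   show "ratf ((%l. - y l) ` {..<k}) (%u. \<Prod>l<k. 1/(1 + u/y l))"
   proof (rule ratf_prod)
    fix l assume "l \<in> {..<k}"
    then show "ratf {- y l} (%u. 1/(1 + u/y l))"
     by (intro ratf_mobius[of _ 0 1 "1/y l" 1]) (use y0 in "auto simp: add.commute")
   qed (use ne4 in "auto intro!: inj_onI")
   show "(%l. - (1/y l)) ` {..<k} \<inter> (%l. - y l) ` {..<k} = {}" using ne4 by fastforce
  qed
  then have "ratf ((%l. - (1/y l)) ` {..<k} \<union> (%l. - y l) ` {..<k}) (tor_Y k y)"
   by (rule ratf_cong) (simp add: tor_Y_def prod.distrib[symmetric])
  moreover have "ratf {1/s} g"
   by (rule ratf_mobius[of _ 1 1 "- s" 1]) (use s in "auto simp: g_def add.commute")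
  moreover have "{1/s} \<inter> ((%l. - (1/y l)) ` {..<k} \<union> (%l. - y l) ` {..<k}) = {}" using ne5 by fastforce
  ultimately show "ratf (P ` J) (%u. g u*tor_Y k y u)" unfolding PJ by (intro ratf_mult_disjoint)
  show "0 \<notin> P ` J" unfolding PJ using y0 s(1) by auto
  have "((%u. (1*u + 1)/(- s*u + 1)) \<longlongrightarrow> 1/- s) at_infinity"
   by (rule mobius_at_infinity) (use s in auto)
  then have 2: "(g \<longlongrightarrow> 1/- s) at_infinity" by (simp add: g_def[abs_def] add.commute)
  have "((%u. \<Prod>l<k. ((0*u + 1)/(y l*u + 1))*((0*u + 1)/((1/y l)*u + 1))) \<longlongrightarrow>
    (\<Prod>l<k. (0/y l)*(0/(1/y l)))) at_infinity"
   by (intro tendsto_prod tendsto_mult mobius_at_infinity) (use y0 in auto)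
  also have "(\<Prod>l<k. (0/y l)*(0/(1/y l))) = 0" using k by auto
  also have "(%u. \<Prod>l<k. ((0*u + 1)/(y l*u + 1))*((0*u + 1)/((1/y l)*u + 1))) = tor_Y k y"
   by (rule ext) (simp add: tor_Y_def add.commute mult.commute)
  finally have 3: "(tor_Y k y \<longlongrightarrow> 0) at_infinity" .
  show "((%u. g u*tor_Y k y u) \<longlongrightarrow> 0) at_infinity" using tendsto_mult[OF 2 3] by simp
 next
  fix i v assume i: "i \<in> S" and v: "v \<in> J"
  note nr = neg_recip[OF x(1)[OF i] y0 xy[OF i] xy'[OF i]]
  show "x i ~= P v \<and> x i*P v ~= 1"
  proof (rule Jc[OF v])
   fix l assume l: "v = (0, l)" "l < k"
   have "x i = - y l" if "x i*- (1/y l) = 1"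
    using that y0[OF l(2)] by (simp add: minus_equation_iff[of _ 1] eq_divide_eq)
   then show ?thesis unfolding l Pv using nr(1)[OF l(2,2,2)] xy'[OF i l(2)] by blast
  next
   fix l assume l: "v = (Suc 0, l)" "l < k"
   show ?thesis unfolding l Pv using xy'[OF i l(2)] xy[OF i l(2)] by (auto simp: minus_equation_iff[of _ 1])
  next
   assume "v = (2, 0)"
   then show ?thesis using xs[OF i] x(3)[OF i] s(1) by (auto simp: Pv eq_divide_eq)
  qed
 next
  fix i u assume i: "i \<in> S" and u: "u = x i \<or> u = 1/x i"
  note R = recip_nonzero[OF u x(1)[OF i]]
  have su: "1 - s*u ~= 0" using R[OF s(1) xs[OF i] x(3)[OF i]] by (simp add: mult.commute)
  have "x i ~= 1 \<and> x i ~= - 1" using xx[OF i i] by auto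
  then have u1: "1 + u ~= 0" using R[of "- 1"] by (auto simp: minus_equation_iff[of _ 1])
  have uy: "1 + u*y l ~= 0 \<and> 1 + u/y l ~= 0" if "l < k" for l
   using R[of "- y l"] xy[OF i that] xy'[OF i that] y0[OF that] by (simp add: minus_equation_iff[of _ 1])
  show "((%u. g u*tor_Y k y u) \<longlongrightarrow> g u*tor_Y k y u) (at u)"
   by (intro tendsto_mult limg su limY uy)
  have "1 - t*u^2 = (1 - s*u)*(1 + s*u)" "1 - u^2 = (1 - u)*(1 + u)"
   by (simp_all add: t power2_eq_square algebra_simps)
  then show "(1 - t*u^2)/(1 - u^2)*refl_prod x t (S - {i}) u*(g u*tor_Y k y u) =
    bc_coeff x t s (S - {i}) u*tor_Y k y u"
   using su u1 by (simp add: bc_coeff_refl_prod g_def)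
 next
  fix v assume "v \<in> J"
  then consider (1) a l where "v = (a, l)" "a = 0 \<or> a = 1" "l < k" | (2) "v = (2, 0)" by (auto simp: J_def)
  then show "((%z. (z - P v)*(g z*tor_Y k y z)) \<longlongrightarrow> r v) (at (P v))"
  proof cases
   case 1
   define w where "w = - P v"
   have w: "w = y l \<or> w = 1/y l" using 1 by (auto simp: w_def P_def)
   note nz = v_facts[OF 1(3) w]
   define R where "R z = g z*(\<Prod>m\<in>{..<k} - {l}. 1/((1 + z*y m)*(1 + z/y m)))" for z
   have Yd: "tor_Y k y z = 1/((1 + z*w)*(1 + z/w))*(\<Prod>m\<in>{..<k} - {l}. 1/((1 + z*y m)*(1 + z/y m)))" for z
   proof -
    have "1/((1 + z*y l)*(1 + z/y l)) = 1/((1 + z*w)*(1 + z/w))" using w by auto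
    then show ?thesis unfolding tor_Y_def using 1(3) by (subst prod.remove[of _ l]) auto
   qed
   have "((%z. w/(1 + z*w) * R z) \<longlongrightarrow> w/(1 + (- w)*w) * R (- w)) (at (- w))"
    unfolding R_def
    by (intro tendsto_mult limg tendsto_prod tendsto_divide tendsto_add tendsto_const tendsto_ident_at)
      (use nz y0 in auto)
   moreover have "\<forall>\<^sub>F z in at (- w). w/(1 + z*w) * R z = (z - (- w))*(g z*tor_Y k y z)"
    unfolding eventually_at_filter
   proof (intro always_eventually allI impI)
    fix z assume z: "z ~= - w"
    have zz: "(z - (- w))*(1/((1 + z*w)*(1 + z/w))) = w/(1 + z*w)"
    proof -
     have "1 + z/w = (z + w)/w" using nz(1) by (simp add: field_simps)
     moreover have "z + w ~= 0" using z by (auto simp: add_eq_0_iff)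
     ultimately show ?thesis using nz(1) by simp
    qed
    show "w/(1 + z*w) * R z = (z - (- w))*(g z*tor_Y k y z)"
     unfolding R_def Yd zz[symmetric] by (simp only: mult_ac)
   qed
   ultimately have "((%z. (z - (- w))*(g z*tor_Y k y z)) \<longlongrightarrow> w/(1 + (- w)*w) * R (- w)) (at (- w))"
    by (rule Lim_transform_eventually)
   moreover have "w/(1 + (- w)*w) * R (- w) = r v"
   proof -
    have "1 + (- w)*w = (1 - w)*(1 + w)" by (simp add: algebra_simps)
    then have "w/(1 + (- w)*w) * R (- w) = w*tor_b k s y l w"
     using nz(2,3,4) by (simp add: R_def g_def tor_b_def)
    also have "... = r v" using 1 by (auto simp: r_def w_def)
    finally show ?thesis .
   qed
   moreover have "- w = P v" by (simp add: w_def)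
   ultimately show ?thesis by simp
  next
   case 2
   have sy: "1 + 1/s*y l ~= 0 \<and> 1 + 1/s/y l ~= 0" if "l < k" for l
   proof -
    have "s*(- y l) ~= 1" "s ~= - y l"
     using ys[OF that] ys'[OF that] by (auto simp: mult.commute minus_equation_iff[of _ 1])
    then show ?thesis using recip_nonzero[of "1/s" s "- y l"] s(1) y0[OF that] by simp
   qed
   have "((%z. (z - 1/s)*((1 + z)*tor_Y k y z/(1 - s*z))) \<longlongrightarrow>
     - (1/s)*((1 + 1/s)*tor_Y k y (1/s))) (at (1/s))"
    by (rule mobius_pole) (intro s(1) tendsto_mult limY sy tendsto_const tendsto_add tendsto_ident_at)+
   then show ?thesis by (simp add: 2 Pv r_def g_def)
  qed
 qed
 also have "g 0*tor_Y k y 0 = 1" by (simp add: g_def tor_Y_def)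
 also have "(\<Sum>j\<in>J. refl_prod x t S (P j)*r j/(0 - P j)) =
   (\<Sum>j\<in>{0, 1} \<times> {..<k}. refl_prod x t S (P j)*r j/(0 - P j)) + refl_prod x t S (P (2, 0))*r (2, 0)/(0 - P (2, 0))"
  unfolding J_def by (subst sum.union_disjoint) auto
 also have "(\<Sum>j\<in>{0, 1} \<times> {..<k}. refl_prod x t S (P j)*r j/(0 - P j)) =
   (\<Sum>l<k. refl_prod x t S (P (0, l))*r (0, l)/(0 - P (0, l)) + refl_prod x t S (P (1, l))*r (1, l)/(0 - P (1, l)))"
  by (rule sum_two_times) simp
 also have "... = (\<Sum>l<k. tor_b k s y l (y l)*refl_prod x t S (- y l) + tor_b k s y l (1/y l)*refl_prod x t S (- (1/y l)))"
  by (rule sum.cong) (use y0 in "simp_all add: r_def Pv")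
 also have "refl_prod x t S (P (2, 0))*r (2, 0)/(0 - P (2, 0)) = (1 + 1/s)*tor_Y k y (1/s)*t^card S"
 proof -
  have "refl_prod x t S (1/s) = t^card S"
   by (rule refl_prod_inverse_s[OF _ t s(1)]) (use x xs in auto)
  then show ?thesis using s(1) by (simp add: r_def Pv)
 qed
 finally show ?thesis by (simp only: add.assoc)
qed

end

section \<open>The kernel and its recursion\<close>

definition tor_K :: "nat => (nat => complex) => nat set => (nat => complex) => complex" where
 "tor_K k x S y = (\<Prod>i\<in>S. \<Prod>l<k. (x i + 1/x i) + (y l + 1/y l))"

context torus_point
begin

lemma tor_K_remove:
 assumes i: "i \<in> S" and u: "u = x i \<or> u = 1/x i"
 shows "tor_Y k y u*tor_K k x S y = (1/u)^k*tor_K k x (S - {i}) y"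
proof -
 have xi: "x i ~= 0" by (rule x(1)[OF i])
 then have u0: "u ~= 0" using u by auto
 have e: "(1 + u*y l)*(1 + u/y l) = u*((x i + 1/x i) + (y l + 1/y l))" if "l < k" for l
 proof -
  have "x i + 1/x i = u + 1/u" using u by (auto simp: add.commute)
  then show ?thesis using u0 y0[OF that] by (simp add: algebra_simps)
 qed
 have nz: "(x i + 1/x i) + (y l + 1/y l) ~= 0" if "l < k" for l
 proof -
  have "1 + u*y l ~= 0" "1 + u/y l ~= 0"
   using recip_nonzero[OF u xi, of "- y l"] xy[OF i that] xy'[OF i that] y0[OF that]
   by (simp_all add: minus_equation_iff[of _ 1])
  then show ?thesis using e[OF that] by auto
 qed
 have "tor_Y k y u = (\<Prod>l<k. (1/u)*(1/((x i + 1/x i) + (y l + 1/y l))))"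
  unfolding tor_Y_def by (rule prod.cong) (use e in auto)
 also have "... = (1/u)^k*(\<Prod>l<k. 1/((x i + 1/x i) + (y l + 1/y l)))"
  by (simp only: prod.distrib prod_constant card_lessThan)
 also have "(\<Prod>l<k. 1/((x i + 1/x i) + (y l + 1/y l))) = 1/(\<Prod>l<k. (x i + 1/x i) + (y l + 1/y l))"
  by (simp add: prod_dividef)
 finally have Y: "tor_Y k y u = (1/u)^k*(1/(\<Prod>l<k. (x i + 1/x i) + (y l + 1/y l)))" .
 have K: "tor_K k x S y = (\<Prod>l<k. (x i + 1/x i) + (y l + 1/y l))*tor_K k x (S - {i}) y"
  unfolding tor_K_def by (rule prod.remove[OF S(1) i])
 have "(\<Prod>l<k. (x i + 1/x i) + (y l + 1/y l)) ~= 0" using nz by simp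
 then show ?thesis unfolding Y K by simp
qed

text \<open>Each factor of \<open>refl_prod\<close> at \<open>- v\<close> replaces the kernel factor
  of \<open>x j\<close> at \<open>v\<close> by \<open>t\<close> times the one at
  \<open>t * v\<close>, so multiplication by it acts as a shift of \<open>y l\<close>.\<close>

lemma tor_K_shift:
 assumes l: "l < k" and v: "v = y l \<or> v = 1/y l" and t0: "t ~= 0"
 shows "refl_prod x t S (- v)*tor_K k x S y = t^card S*tor_K k x S (y(l := t * v))"
proof -
 note nz = v_facts[OF l v]
 have "((1 - t*(- v)*x j)*(1 - t*(- v)/x j))/((1 - (- v)*x j)*(1 - (- v)/x j)) *
   (\<Prod>m<k. (x j + 1/x j) + (y m + 1/y m)) =
   t*(\<Prod>m<k. (x j + 1/x j) + ((y(l := t * v)) m + 1/(y(l := t * v)) m))" if j: "j \<in> S" for j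
 proof -
  have xj: "x j ~= 0" by (rule x(1)[OF j])
  let ?P = "\<Prod>m\<in>{..<k} - {l}. (x j + 1/x j) + (y m + 1/y m)"
  have P1: "(\<Prod>m<k. (x j + 1/x j) + (y m + 1/y m)) = ((x j + 1/x j) + (v + 1/v))*?P"
  proof -
   have "y l + 1/y l = v + 1/v" using v by auto
   then show ?thesis using l by (subst prod.remove[of _ l]) auto
  qed
  have P2: "(\<Prod>m<k. (x j + 1/x j) + ((y(l := t * v)) m + 1/(y(l := t * v)) m)) =
    ((x j + 1/x j) + (t * v + 1/(t * v)))*?P"
   using l by (subst prod.remove[of _ l]) auto
  have a: "(1 - (- v)*x j)*(1 - (- v)/x j) = v * ((x j + 1/x j) + (v + 1/v))"
   using xj nz(1) by (simp add: field_simps)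
  have b: "(1 - t*(- v)*x j)*(1 - t*(- v)/x j) = t * v * ((x j + 1/x j) + (t * v + 1/(t * v)))"
   using xj nz(1) t0 by (simp add: field_simps)
  have "(1 - (- v)*x j)*(1 - (- v)/x j) ~= 0" using nz(8,9)[OF j] by simp
  then have c: "(x j + 1/x j) + (v + 1/v) ~= 0" unfolding a by auto
  have "(t * v * B)/(v * A)*(A*P) = t*(B*P)" if "A ~= 0" for A B P :: complex
   using that nz(1) by simp
  from this[OF c] show ?thesis unfolding P1 P2 a b .
 qed
 then show ?thesis
  unfolding refl_prod_def tor_K_def prod.distrib[symmetric] by (simp add: prod.distrib[symmetric] flip: prod_constant)
qed

end

text \<open>The coefficient of the pole at \<open>1/s\<close> is known from the expansion for the
  empty set, in which all coefficients sum to 1. Eliminating it turns the terms in \<open>y\<close>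
  into differences between the shifted and the original kernel.\<close>

lemma (in torus_point) tor_K_recursion:
 "(1 - t^card S)*tor_K k x S y =
  (1 - t)*(\<Sum>i\<in>S. (bc_coeff x t s (S - {i}) (x i)*(1/x i)^k + bc_coeff x t s (S - {i}) (1/x i)*x i^k) *
    tor_K k x (S - {i}) y) +
  t^card S*(\<Sum>l<k. tor_b k s y l (y l)*(tor_K k x S (y(l := t*y l)) - tor_K k x S y) +
    tor_b k s y l (1/y l)*(tor_K k x S (y(l := t*(1/y l))) - tor_K k x S y))"
proof -
 have t0: "t ~= 0" using s(1) t by simp
 interpret E: torus_point k s t "{}" x y
  by unfold_locales (use k t s y in auto)
 define C where "C = (1 + 1/s)*tor_Y k y (1/s)"
 define b1 b2 where "b1 l = tor_b k s y l (y l)" and "b2 l = tor_b k s y l (1/y l)" for l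
 define K where "K = tor_K k x S y"
 have C: "C = 1 - (\<Sum>l<k. b1 l + b2 l)"
  using E.torus_pf by (simp add: C_def b1_def b2_def refl_prod_def algebra_simps)
 have "K = 1*K" by simp
 also have "... = (1 - t)*(\<Sum>i\<in>S. (bc_coeff x t s (S - {i}) (x i)*tor_Y k y (x i) +
     bc_coeff x t s (S - {i}) (1/x i)*tor_Y k y (1/x i))*K) +
   (\<Sum>l<k. (b1 l*refl_prod x t S (- y l) + b2 l*refl_prod x t S (- (1/y l)))*K) + C*t^card S*K"
  by (subst torus_pf) (simp only: b1_def b2_def C_def distrib_right sum_distrib_right mult.assoc)
 also have "(\<Sum>i\<in>S. (bc_coeff x t s (S - {i}) (x i)*tor_Y k y (x i) +
     bc_coeff x t s (S - {i}) (1/x i)*tor_Y k y (1/x i))*K) =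
   (\<Sum>i\<in>S. (bc_coeff x t s (S - {i}) (x i)*(1/x i)^k + bc_coeff x t s (S - {i}) (1/x i)*x i^k) *
    tor_K k x (S - {i}) y)"
 proof (rule sum.cong)
  fix i assume i: "i \<in> S"
  have "tor_Y k y (x i)*K = (1/x i)^k*tor_K k x (S - {i}) y"
   unfolding K_def by (rule tor_K_remove[OF i]) simp
  moreover have "tor_Y k y (1/x i)*K = x i^k*tor_K k x (S - {i}) y"
   unfolding K_def using tor_K_remove[OF i, of "1/x i"] by simp
  ultimately show "(bc_coeff x t s (S - {i}) (x i)*tor_Y k y (x i) +
     bc_coeff x t s (S - {i}) (1/x i)*tor_Y k y (1/x i))*K =
   (bc_coeff x t s (S - {i}) (x i)*(1/x i)^k + bc_coeff x t s (S - {i}) (1/x i)*x i^k)*tor_K k x (S - {i}) y"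
   by (simp only: distrib_right mult.assoc)
 qed simp
 also have "(\<Sum>l<k. (b1 l*refl_prod x t S (- y l) + b2 l*refl_prod x t S (- (1/y l)))*K) =
   t^card S*(\<Sum>l<k. b1 l*tor_K k x S (y(l := t*y l)) + b2 l*tor_K k x S (y(l := t*(1/y l))))"
  unfolding sum_distrib_left
 proof (rule sum.cong)
  fix l assume "l \<in> {..<k}"
  then have l: "l < k" by simp
  have "refl_prod x t S (- y l)*K = t^card S*tor_K k x S (y(l := t*y l))"
   unfolding K_def by (rule tor_K_shift[OF l _ t0]) simp
  moreover have "refl_prod x t S (- (1/y l))*K = t^card S*tor_K k x S (y(l := t*(1/y l)))"
   unfolding K_def by (rule tor_K_shift[OF l _ t0]) simp
  ultimately show "(b1 l*refl_prod x t S (- y l) + b2 l*refl_prod x t S (- (1/y l)))*K =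
   t^card S*(b1 l*tor_K k x S (y(l := t*y l)) + b2 l*tor_K k x S (y(l := t*(1/y l))))"
   by (simp only: distrib_right distrib_left mult.assoc mult.left_commute[of "t^card S"])
 qed simp
 finally have main: "K = (1 - t)*(\<Sum>i\<in>S. (bc_coeff x t s (S - {i}) (x i)*(1/x i)^k + bc_coeff x t s (S - {i}) (1/x i)*x i^k) *
    tor_K k x (S - {i}) y) +
   t^card S*(\<Sum>l<k. b1 l*tor_K k x S (y(l := t*y l)) + b2 l*tor_K k x S (y(l := t*(1/y l)))) + C*t^card S*K"
  (is "K = ?A + ?n*?B + _") .
 have "(\<Sum>l<k. b1 l*(tor_K k x S (y(l := t*y l)) - K) + b2 l*(tor_K k x S (y(l := t*(1/y l))) - K)) =
   ?B - (\<Sum>l<k. b1 l + b2 l)*K"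
 proof -
  have "c*(A - K) + d*(A' - K) = (c*A + d*A') - (c + d)*K" for c d A A' :: complex
   by (simp add: algebra_simps)
  then show ?thesis by (simp only: sum_subtractf sum_distrib_right)
 qed
 moreover have "(1 - ?n)*K = ?A + ?n*(?B - (\<Sum>l<k. b1 l + b2 l)*K)"
 proof -
  have "K - ?n*K = (?A + ?n*?B + C*?n*K) - ?n*K" using main by simp
  then show ?thesis unfolding C by (simp add: algebra_simps)
 qed
 ultimately show ?thesis unfolding K_def b1_def b2_def by simp
qed

section \<open>The torus density and exactness of the surplus terms\<close>

definition tor_h :: "complex => complex => complex => complex" where
 "tor_h t u v = qpoch_inf (u * v) t*qpoch_inf (u/v) t*(qpoch_inf (v/u) t*qpoch_inf (1/(u * v)) t)"

text \<open>Invariant under permutations and inversions of the variables. Its infinite products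
  absorb the denominators of \<open>tor_b\<close>, and the result \<open>tor_V\<close> takes equal
  values at \<open>1/v\<close> and \<open>v/s^2\<close>, which is what exactness needs.\<close>

definition tor_w :: "nat => complex => (nat => complex) => complex" where
 "tor_w k s y = (\<Prod>j<k. qpoch_inf (- y j) s*qpoch_inf (- 1/y j) s)*pair_prod (%i j. tor_h (s^2) (y i) (y j)) {..<k}"

text \<open>The part of the density that involves the \<open>l\<close>-th variable \<open>v\<close>,
  multiplied by \<open>tor_b\<close>: the denominators cancel the first factors of the products in
  positive powers of \<open>v\<close>.\<close>

definition tor_V :: "nat => complex => (nat => complex) => nat => complex => complex" where
 "tor_V k s y l v = qpoch_inf ((- (s^2)) * v) s*qpoch_inf ((- 1)/v) s *
   (\<Prod>m\<in>{..<k} - {l}. qpoch_inf ((s^2*y m) * v) (s^2)*qpoch_inf ((s^2/y m) * v) (s^2) *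
    (qpoch_inf (y m/v) (s^2)*qpoch_inf ((1/y m)/v) (s^2)))"

lemma tor_h_sym: "tor_h t u v = tor_h t v u"
 by (simp add: tor_h_def mult_ac)

lemma tor_h_inverse: "tor_h t (1/u) v = tor_h t u v"
 by (simp add: tor_h_def mult_ac)

definition tor_rest :: "nat => complex => (nat => complex) => nat => complex" where
 "tor_rest k s y l = (\<Prod>j\<in>{..<k} - {l}. qpoch_inf (- y j) s*qpoch_inf (- 1/y j) s) *
   pair_prod (%i j. tor_h (s^2) (y i) (y j)) ({..<k} - {l})"

lemma tor_w_split:
 assumes "l < k"
 shows "tor_w k s y = (qpoch_inf (- y l) s*qpoch_inf (- 1/y l) s*(\<Prod>m\<in>{..<k} - {l}. tor_h (s^2) (y l) (y m)))*tor_rest k s y l"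
proof -
 have "{..<k} = insert l ({..<k} - {l})" using assms by auto
 then have "pair_prod (%i j. tor_h (s^2) (y i) (y j)) {..<k} =
   pair_prod (%i j. tor_h (s^2) (y i) (y j)) ({..<k} - {l})*(\<Prod>m\<in>{..<k} - {l}. tor_h (s^2) (y l) (y m))"
  using pair_prod_insert[of "{..<k} - {l}" l "%i j. tor_h (s^2) (y i) (y j)"] tor_h_sym by auto
 moreover have "(\<Prod>j<k. qpoch_inf (- y j) s*qpoch_inf (- 1/y j) s) = qpoch_inf (- y l) s*qpoch_inf (- 1/y l) s *
   (\<Prod>j\<in>{..<k} - {l}. qpoch_inf (- y j) s*qpoch_inf (- 1/y j) s)"
  using assms by (intro prod.remove) auto
 ultimately show ?thesis by (simp add: tor_w_def tor_rest_def mult_ac)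
qed

lemma tor_b_V:
 assumes s: "norm s < 1" and v: "v ~= 0" "1 + v ~= 0" "1 + s * v ~= 0"
  "!!m. m < k ==> m ~= l ==> 1 - v * y m ~= 0" "!!m. m < k ==> m ~= l ==> 1 - v/y m ~= 0"
 shows "qpoch_inf (- v) s*qpoch_inf (- 1/v) s*(\<Prod>m\<in>{..<k} - {l}. tor_h (s^2) v (y m))*tor_b k s y l v = tor_V k s y l v"
proof -
 have t: "norm (s^2) < 1" using s by (simp add: norm_power power_less_one_iff)
 have 1: "qpoch_inf (- v) s*(1/((1 + s * v)*(1 + v))) = qpoch_inf ((- (s^2)) * v) s"
  using qpoch_inf_shift[OF s, of "- v"] qpoch_inf_shift[OF s, of "- v * s"] v
  by (simp add: power2_eq_square mult_ac)
 have 2: "tor_h (s^2) v (y m)*(1/((1 - v * y m)*(1 - v/y m))) =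
   qpoch_inf ((s^2*y m) * v) (s^2)*qpoch_inf ((s^2/y m) * v) (s^2) *
    (qpoch_inf (y m/v) (s^2)*qpoch_inf ((1/y m)/v) (s^2))" if "m \<in> {..<k} - {l}" for m
 proof -
  have m: "1 - v * y m ~= 0" "1 - v/y m ~= 0" using v that by auto
  have "qpoch_inf (v * y m) (s^2) = (1 - v * y m)*qpoch_inf ((s^2*y m) * v) (s^2)"
   using qpoch_inf_shift[OF t, of "v * y m"] by (simp add: mult_ac)
  moreover have "qpoch_inf (v/y m) (s^2) = (1 - v/y m)*qpoch_inf ((s^2/y m) * v) (s^2)"
   using qpoch_inf_shift[OF t, of "v/y m"] by (simp add: mult_ac)
  moreover have "1/(v * y m) = (1/y m)/v" by simp
  ultimately show ?thesis unfolding tor_h_def using m by (simp add: ac_simps)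
 qed
 have "qpoch_inf (- v) s*qpoch_inf (- 1/v) s*(\<Prod>m\<in>{..<k} - {l}. tor_h (s^2) v (y m))*tor_b k s y l v =
   (qpoch_inf (- v) s*(1/((1 + s * v)*(1 + v))))*qpoch_inf ((- 1)/v) s *
   (\<Prod>m\<in>{..<k} - {l}. tor_h (s^2) v (y m)*(1/((1 - v * y m)*(1 - v/y m))))"
  unfolding tor_b_def prod.distrib by (simp only: mult_ac)
 also have "... = tor_V k s y l v"
  unfolding tor_V_def 1 using 2 by (metis (no_types, lifting) prod.cong)
 finally show ?thesis .
qed

definition tor_eps :: "nat => complex => (nat => complex) => nat set => (nat => complex) => nat => complex" where
 "tor_eps k s x S y l = tor_rest k s y l *
   (tor_V k s y l (y l)*(tor_K k x S (y(l := s^2*y l)) - tor_K k x S y) +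
   tor_V k s y l (1/y l)*(tor_K k x S (y(l := s^2*(1/y l))) - tor_K k x S y))"

lemma (in torus_point) tor_Kw_recursion:
 "(1 - t^card S)*(tor_K k x S y*tor_w k s y) =
  (1 - t)*(\<Sum>i\<in>S. (bc_coeff x t s (S - {i}) (x i)*(1/x i)^k + bc_coeff x t s (S - {i}) (1/x i)*x i^k) *
    (tor_K k x (S - {i}) y*tor_w k s y)) +
  t^card S*(\<Sum>l<k. tor_eps k s x S y l)"
proof -
 have eps: "tor_w k s y*(tor_b k s y l (y l)*(tor_K k x S (y(l := t*y l)) - tor_K k x S y) +
    tor_b k s y l (1/y l)*(tor_K k x S (y(l := t*(1/y l))) - tor_K k x S y)) = tor_eps k s x S y l"
  if l: "l < k" for l
 proof -
  have "tor_w k s y*tor_b k s y l v = tor_rest k s y l*tor_V k s y l v" if v: "v = y l \<or> v = 1/y l" for v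
  proof -
   note nz = v_facts[OF l v]
   have "tor_w k s y = (qpoch_inf (- v) s*qpoch_inf (- 1/v) s*(\<Prod>m\<in>{..<k} - {l}. tor_h (s^2) v (y m)))*tor_rest k s y l"
   proof (cases "v = y l")
    case True
    then show ?thesis using tor_w_split[OF l] by simp
   next
    case False
    then have "v = 1/y l" using v by simp
    then show ?thesis using tor_w_split[OF l, of s y] by (simp add: tor_h_inverse mult_ac)
   qed
   moreover have "qpoch_inf (- v) s*qpoch_inf (- 1/v) s*(\<Prod>m\<in>{..<k} - {l}. tor_h (s^2) v (y m))*tor_b k s y l v =
     tor_V k s y l v"
    by (rule tor_b_V[OF s(2) nz(1,2,4)]) (use nz(6,7) in auto)
   ultimately show ?thesis by (simp add: algebra_simps)
  qed
  from this[of "y l"] this[of "1/y l"] show ?thesis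
   unfolding tor_eps_def t[symmetric] by (simp add: distrib_left mult.assoc[symmetric])
 qed
 have "(1 - t^card S)*(tor_K k x S y*tor_w k s y) = ((1 - t^card S)*tor_K k x S y)*tor_w k s y"
  by simp
 also have "... = (1 - t)*(\<Sum>i\<in>S. (bc_coeff x t s (S - {i}) (x i)*(1/x i)^k + bc_coeff x t s (S - {i}) (1/x i)*x i^k) *
    (tor_K k x (S - {i}) y*tor_w k s y)) +
   t^card S*(\<Sum>l<k. tor_w k s y*(tor_b k s y l (y l)*(tor_K k x S (y(l := t*y l)) - tor_K k x S y) +
    tor_b k s y l (1/y l)*(tor_K k x S (y(l := t*(1/y l))) - tor_K k x S y)))"
  unfolding tor_K_recursion by (simp only: distrib_right sum_distrib_right mult.assoc mult.commute[of "tor_w k s y"])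
 also have "(\<Sum>l<k. tor_w k s y*(tor_b k s y l (y l)*(tor_K k x S (y(l := t*y l)) - tor_K k x S y) +
    tor_b k s y l (1/y l)*(tor_K k x S (y(l := t*(1/y l))) - tor_K k x S y))) = (\<Sum>l<k. tor_eps k s x S y l)"
  by (rule sum.cong) (use eps in auto)
 finally show ?thesis .
qed

text \<open>By \<open>HG\<close> the constant terms of \<open>H\<close> and \<open>G\<close> agree,
  and inversion of the variable preserves constant terms.\<close>

lemma laurent_exact_integral:
 assumes H: "is_laurent H" and G: "is_laurent G" and HG: "!!v. v ~= 0 ==> G (1/v) = H (v/t)"
  and t: "t ~= 0" and c: "c ~= 0"
 shows "(\<integral>vt. H (c*ee vt) - G (c*ee vt) + (H (1/(c*ee vt)) - G (1/(c*ee vt))) \<partial>circ) = 0"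
proof -
 obtain h g where h: "laurent H h" and g: "laurent G g" using H G by (auto simp: is_laurent_def)
 have "laurent (%v. H ((1/t) * v)) (%n. h n*(1/t) powi n)" by (rule laurent_scale[OF h]) (use t in simp)
 moreover have "laurent (%v. H ((1/t) * v)) (%n. g (- n))"
  by (rule laurent_cong[OF laurent_reflect[OF g]]) (simp add: HG)
 ultimately have "(%n. h n*(1/t) powi n) = (%n. g (- n))" by (rule laurent_unique)
 from fun_cong[OF this, of 0] have hg: "h 0 = g 0" by simp
 define F where "F v = H v + (- 1)*G v + (H (1/v) + (- 1)*G (1/v))" for v
 have F: "laurent F (%n. h n + (- 1)*g n + (h (- n) + (- 1)*g (- n)))"
  unfolding F_def by (intro laurent_add laurent_cmult laurent_reflect h g)
 have "(\<integral>vt. F (c*ee vt) \<partial>circ) = (\<integral>vt. F (ee vt) \<partial>circ)"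
  by (rule is_laurent_integral_scale) (use F c in "auto simp: is_laurent_def")
 also have "... = 0" using laurent_circle_integral[OF F] hg by simp
 finally show ?thesis by (simp add: F_def)
qed

section \<open>Integrability on the product torus\<close>

definition bdm :: "'a measure => ('a => complex) => bool" where
 "bdm M f \<longleftrightarrow> f \<in> borel_measurable M \<and> (\<exists>B. \<forall>x\<in>space M. norm (f x) \<le> B)"

lemma bdm_integrable: "finite_measure M ==> bdm M f ==> integrable M f"
 unfolding bdm_def by (auto intro!: finite_measure.integrable_const_bound AE_I2)

lemma bdm_const: "bdm M (%_. c)"
 by (auto simp: bdm_def)

lemma bdm_add: "bdm M f ==> bdm M g ==> bdm M (%x. f x + g x)"
 unfolding bdm_def by (auto intro!: borel_measurable_add) (metis add_mono norm_triangle_le)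

lemma bdm_mult: "bdm M f ==> bdm M g ==> bdm M (%x. f x*g x)"
proof -
 assume f: "bdm M f" and g: "bdm M g"
 obtain A where A: "!!x. x \<in> space M ==> norm (f x) \<le> A" using f by (auto simp: bdm_def)
 obtain B where B: "!!x. x \<in> space M ==> norm (g x) \<le> B" using g by (auto simp: bdm_def)
 have "norm (f x*g x) \<le> \<bar>A\<bar>*\<bar>B\<bar>" if "x \<in> space M" for x
  unfolding norm_mult using A[OF that] B[OF that] by (intro mult_mono) auto
 then show ?thesis using f g unfolding bdm_def by (auto intro!: borel_measurable_times)
qed

lemma bdm_diff: "bdm M f ==> bdm M g ==> bdm M (%x. f x - g x)"
 using bdm_add[of M f "%x. (- 1)*g x"] bdm_mult[OF bdm_const, of M g "- 1"] by simp

lemma bdm_uminus: "bdm M f ==> bdm M (%x. - f x)"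
 using bdm_mult[OF bdm_const, of M f "- 1"] by simp

lemma bdm_prod: "(!!i. i \<in> I ==> bdm M (f i)) ==> bdm M (%x. \<Prod>i\<in>I. f i x)"
 by (induction I rule: infinite_finite_induct) (auto intro: bdm_mult bdm_const)

lemma bdm_qpoch_inf:
 assumes "norm q < 1" "bdm M f" shows "bdm M (%x. qpoch_inf (f x) q)"
proof -
 obtain B where B: "!!x. x \<in> space M ==> norm (f x) \<le> B" using assms(2) by (auto simp: bdm_def)
 have "norm (qpoch_inf (f x) q) \<le> exp (B/(1 - norm q))" if "x \<in> space M" for x
  by (rule order.trans[OF norm_qpoch_inf_le[OF assms(1)]]) (use B[OF that] assms(1) in "auto intro!: divide_right_mono")
 moreover have "(%a. qpoch_inf a q) \<in> borel_measurable borel"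
  by (intro borel_measurable_continuous_onI continuous_at_imp_continuous_on ballI isCont_qpoch_inf assms)
 then have "(%x. qpoch_inf (f x) q) \<in> borel_measurable M"
  using assms(2) unfolding bdm_def by (auto intro: measurable_compose)
 ultimately show ?thesis unfolding bdm_def by blast
qed

abbreviation tor_measure :: "nat => (nat => real) measure" where
 "tor_measure k \<equiv> Pi\<^sub>M {..<k} (%_. circ)"

definition tor_y :: "(nat => real) => (nat => real) => nat => complex" where
 "tor_y rh vt l = of_real (rh l)*ee (vt l)"

lemma product_sigma_finite_circ: "product_sigma_finite (%_ :: nat. circ)"
 unfolding product_sigma_finite_def using finite_measure_circ by (auto intro: finite_measure.axioms)

lemma finite_measure_tor: "finite_measure (tor_measure k)"
proof (rule finite_measureI)
 interpret product_sigma_finite "%_ :: nat. circ" by (rule product_sigma_finite_circ)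
 have "emeasure (tor_measure k) (Pi\<^sub>E {..<k} (%_. space circ)) = (\<Prod>i<k. emeasure circ (space circ))"
  by (rule emeasure_PiM; force)
 then show "emeasure (tor_measure k) (space (tor_measure k)) ~= \<infinity>"
  by (simp only: space_PiM emeasure_circ_space) simp
qed

lemma bdm_tor_y:
 assumes "l < k" "rh l > 0"
 shows "bdm (tor_measure k) (%vt. tor_y rh vt l)" "bdm (tor_measure k) (%vt. 1/tor_y rh vt l)"
proof -
 have m: "(%vt. ee (vt l)) \<in> borel_measurable (tor_measure k)"
 proof -
  have "(%vt. vt l) \<in> tor_measure k \<rightarrow>\<^sub>M circ"
   by (rule measurable_component_singleton) (use assms in auto)
  then show ?thesis using measurable_compose[of "%vt. vt l" _ circ ee borel] measurable_ee by simp
 qed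
 then show "bdm (tor_measure k) (%vt. tor_y rh vt l)"
  unfolding bdm_def tor_y_def using assms
  by (auto intro!: borel_measurable_times exI[of _ "rh l"] simp: norm_mult)
 from m show "bdm (tor_measure k) (%vt. 1/tor_y rh vt l)"
  unfolding bdm_def tor_y_def using assms
  by (auto intro!: borel_measurable_times borel_measurable_divide exI[of _ "1/rh l"] simp: norm_mult norm_divide)
qed

lemma bdm_tor_y_divide:
 assumes "l < k" "rh l > 0" "bdm (tor_measure k) f"
 shows "bdm (tor_measure k) (%vt. f vt/tor_y rh vt l)"
 using bdm_mult[OF assms(3) bdm_tor_y(2)[of l k rh]] assms(1,2) by simp

context
 fixes k :: nat and s :: complex and rh :: "nat => real"
 assumes s: "s ~= 0" "norm s < 1" and rh: "!!l. l < k ==> rh l > 0"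
begin

lemma norm_s_sq: "norm (s^2) < 1"
 using s by (simp add: norm_power power_less_one_iff)

lemma bdm_tor_h:
 assumes "i < k" "j < k"
 shows "bdm (tor_measure k) (%vt. tor_h (s^2) (tor_y rh vt i) (tor_y rh vt j))"
proof -
 have "tor_h t u v = qpoch_inf (u * v) t*qpoch_inf (u/v) t*(qpoch_inf (v/u) t*qpoch_inf (1/u/v) t)" for t u v
  by (simp add: tor_h_def)
 then show ?thesis
  by (simp only:) (intro bdm_mult bdm_qpoch_inf norm_s_sq bdm_tor_y bdm_tor_y_divide assms rh)
qed

lemma bdm_tor_pair:
 assumes "I \<subseteq> {..<k}"
 shows "bdm (tor_measure k) (%vt. pair_prod (%i j. tor_h (s^2) (tor_y rh vt i) (tor_y rh vt j)) I)"
 unfolding pair_prod_def case_prod_unfold by (intro bdm_prod bdm_tor_h) (use assms in auto)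

lemma bdm_tor_rest: "bdm (tor_measure k) (%vt. tor_rest k s (tor_y rh vt) l)"
 unfolding tor_rest_def
 by (intro bdm_mult bdm_tor_pair bdm_prod bdm_qpoch_inf s bdm_uminus bdm_tor_y bdm_tor_y_divide bdm_const rh) auto

lemma bdm_tor_w: "bdm (tor_measure k) (%vt. tor_w k s (tor_y rh vt))"
 unfolding tor_w_def
 by (intro bdm_mult bdm_tor_pair bdm_prod bdm_qpoch_inf s bdm_uminus bdm_tor_y bdm_tor_y_divide bdm_const rh) auto

lemma bdm_tor_V:
 assumes v: "bdm (tor_measure k) v" "bdm (tor_measure k) (%vt. 1/v vt)"
 shows "bdm (tor_measure k) (%vt. tor_V k s (tor_y rh vt) l (v vt))"
proof -
 have d: "bdm (tor_measure k) (%vt. f vt/v vt)" if "bdm (tor_measure k) f" for f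
  using bdm_mult[OF that v(2)] by simp
 show ?thesis
  unfolding tor_V_def
  by (intro bdm_mult bdm_prod bdm_qpoch_inf s norm_s_sq bdm_const v d bdm_tor_y bdm_tor_y_divide rh) auto
qed

lemma bdm_tor_K:
 assumes u: "bdm (tor_measure k) u" "bdm (tor_measure k) (%vt. 1/u vt)"
 shows "bdm (tor_measure k) (%vt. tor_K k x S ((tor_y rh vt)(l := u vt)))"
 unfolding tor_K_def
proof (intro bdm_prod bdm_add bdm_const)
 fix m assume m: "m \<in> {..<k}"
 show "bdm (tor_measure k) (%vt. ((tor_y rh vt)(l := u vt)) m)"
  using u m bdm_tor_y[of m k rh] rh by (cases "m = l") auto
 show "bdm (tor_measure k) (%vt. 1/((tor_y rh vt)(l := u vt)) m)"
  using u m bdm_tor_y[of m k rh] rh by (cases "m = l") auto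
qed

lemma bdm_tor_K': "bdm (tor_measure k) (%vt. tor_K k x S (tor_y rh vt))"
 unfolding tor_K_def by (intro bdm_prod bdm_add bdm_const bdm_tor_y rh) auto

lemma bdm_tor_eps:
 assumes "l < k"
 shows "bdm (tor_measure k) (%vt. tor_eps k s x S (tor_y rh vt) l)"
proof -
 have 1: "bdm (tor_measure k) (%vt. 1/(s^2*tor_y rh vt l))"
  using bdm_mult[OF bdm_const bdm_tor_y(2)[of l k rh], of "1/s^2"] rh assms by simp
 have 2: "bdm (tor_measure k) (%vt. 1/(s^2*(1/tor_y rh vt l)))"
  using bdm_mult[OF bdm_const bdm_tor_y(1)[of l k rh], of "1/s^2"] rh assms by simp
 have 3: "bdm (tor_measure k) (%vt. 1/(1/tor_y rh vt l))"
  using bdm_tor_y(1)[of l k rh] rh assms by simp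
 show ?thesis
  unfolding tor_eps_def
  by (intro bdm_mult bdm_add bdm_diff bdm_tor_rest bdm_tor_V bdm_tor_K bdm_tor_K' bdm_const bdm_tor_y 1 2 3 assms rh)
qed

lemma is_laurent_tor_V: "is_laurent (tor_V k s y l)"
 unfolding tor_V_def[abs_def]
 by (intro is_laurent_mult is_laurent_prod is_laurent_qpoch_inf s norm_s_sq)

lemma is_laurent_tor_K: "is_laurent (%v. tor_K k x S (y(l := v)))"
 unfolding tor_K_def
proof (intro is_laurent_prod is_laurent_add is_laurent_const)
 fix m
 show "is_laurent (%v. (y(l := v)) m)"
  by (cases "m = l") (auto intro: is_laurent_ident is_laurent_const)
 show "is_laurent (%v. 1/(y(l := v)) m)"
  by (cases "m = l") (auto intro: is_laurent_inverse is_laurent_const)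
qed

text \<open>The symmetry that makes the surplus terms exact: reflection of the unshifted term yields
  the shifted one at \<open>v/s^2\<close>.\<close>

lemma tor_V_inverse:
 assumes "v ~= 0"
 shows "tor_V k s y l (1/v) = tor_V k s y l (v/s^2)"
proof -
 have "s^2 ~= 0" using s by simp
 then show ?thesis
  unfolding tor_V_def using assms by (simp add: mult_ac)
qed

text \<open>Fubini isolates the angle of the \<open>l\<close>-th variable. With the others fixed,
  the integrand is a constant times the expression in \<open>laurent_exact_integral\<close>, as the
  kernel is invariant under inversion.\<close>

lemma tor_eps_integral:
 assumes l: "l < k"
 shows "(\<integral>vt. tor_eps k s x S (tor_y rh vt) l \<partial>tor_measure k) = 0"
proof -
 interpret product_sigma_finite "%_ :: nat. circ" by (rule product_sigma_finite_circ)
 define I where "I = {..<k} - {l}"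
 have I: "finite I" "l \<notin> I" "insert l I = {..<k}" using l by (auto simp: I_def)
 have int: "integrable (Pi\<^sub>M (insert l I) (%_. circ)) (%vt. tor_eps k s x S (tor_y rh vt) l)"
  unfolding I(3) by (rule bdm_integrable[OF finite_measure_tor bdm_tor_eps[OF l]])
 have inner: "(\<integral>phi. tor_eps k s x S (tor_y rh (vt(l := phi))) l \<partial>circ) = 0" for vt
 proof -
  define Y where "Y = tor_y rh vt"
  define c where "c = complex_of_real (rh l)"
  have c: "c ~= 0" using rh[OF l] by (simp add: c_def)
  define V where "V = tor_V k s Y l"
  define K where "K v = tor_K k x S (Y(l := v))" for v
  define H where "H v = V v * K (s^2 * v)" for v
  define G where "G v = V v * K v" for v
  have Y': "tor_y rh (vt(l := phi)) = Y(l := c*ee phi)" for phi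
   by (rule ext) (simp add: Y_def c_def tor_y_def)
  have Kinv: "K (1/v) = K v" for v
   unfolding K_def tor_K_def by (intro prod.cong refl) (auto simp: add.commute)
  have rest: "tor_rest k s (Y(l := w)) l = tor_rest k s Y l" for w
   unfolding tor_rest_def by (intro arg_cong2[where f = "(*)"] prod.cong pair_prod_cong) auto
  have V': "tor_V k s (Y(l := w)) l v = V v" for w v
   unfolding tor_V_def V_def by (intro arg_cong2[where f = "(*)"] refl prod.cong) auto
  have "tor_eps k s x S (tor_y rh (vt(l := phi))) l = tor_rest k s Y l *
    (H (c*ee phi) - G (c*ee phi) + (H (1/(c*ee phi)) - G (1/(c*ee phi))))" for phi
   unfolding tor_eps_def Y' rest V' H_def G_def Kinv by (simp add: K_def right_diff_distrib)
  moreover have "(\<integral>phi. H (c*ee phi) - G (c*ee phi) + (H (1/(c*ee phi)) - G (1/(c*ee phi))) \<partial>circ) = 0"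
  proof (rule laurent_exact_integral[where t = "s^2"])
   have K: "is_laurent K" unfolding K_def by (rule is_laurent_tor_K)
   have V: "is_laurent V" unfolding V_def by (rule is_laurent_tor_V)
   show "is_laurent H" unfolding H_def by (intro is_laurent_mult V is_laurent_scale K)
   show "is_laurent G" unfolding G_def by (intro is_laurent_mult V K)
   show "G (1/v) = H (v/s^2)" if "v ~= 0" for v
    using tor_V_inverse[OF that, of Y l] s(1) unfolding G_def H_def Kinv V_def by simp
  qed (use s c in auto)
  ultimately show ?thesis by simp
 qed
 have "(\<integral>vt. tor_eps k s x S (tor_y rh vt) l \<partial>tor_measure k) =
   (\<integral>vt. (\<integral>phi. tor_eps k s x S (tor_y rh (vt(l := phi))) l \<partial>circ) \<partial>Pi\<^sub>M I (%_. circ))"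
  using product_integral_insert[OF I(1,2) int] unfolding I(3) .
 also have "... = 0" unfolding inner by simp
 finally show ?thesis .
qed

end

text \<open>Integration removes the surplus terms of the kernel recursion. Multiplying by the
  product of the \<open>x i^k\<close> turns \<open>(1/x i)^k\<close> into 1 and \<open>x i^k\<close>
  into \<open>x i^(2*k)\<close>, so the recursion becomes that of \<open>bc_sum\<close> with
  exponent \<open>2*k\<close>, and \<open>rec_unique\<close> applies.\<close>

theorem torus_littlewood:
 fixes k :: nat and s t :: complex and S :: "nat set" and x :: "nat => complex" and rh :: "nat => real"
 assumes k: "k \<ge> 1" and t: "t = s^2" and s: "s ~= 0" "norm s < 1"
  and S: "finite S" "inj_on x S"
  and x: "!!i. i \<in> S ==> x i ~= 0" "!!i. i \<in> S ==> norm (x i) < 1" "!!i. i \<in> S ==> x i ~= s"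
  and rh: "inj_on rh {..<k}" "!!l. l < k ==> rh l > 1" "!!l. l < k ==> rh l*norm s < 1"
   "!!i l. i \<in> S ==> l < k ==> rh l*norm (x i) < 1"
 shows "(\<integral>vt. (\<Prod>i\<in>S. \<Prod>l<k. (1 + x i*tor_y rh vt l)*(1 + x i/tor_y rh vt l))*tor_w k s (tor_y rh vt) \<partial>tor_measure k) =
  bc_sum x t s (2*k) S*(\<integral>vt. tor_w k s (tor_y rh vt) \<partial>tor_measure k)"
proof -
 define J where "J T = (\<integral>vt. tor_K k x T (tor_y rh vt)*tor_w k s (tor_y rh vt) \<partial>tor_measure k)" for T
 define G where "G T = (\<Prod>i\<in>T. x i^k)*J T" for T
 have rh0: "rh l > 0" if "l < k" for l using rh(2)[OF that] by simp
 have ny: "norm (tor_y rh vt l) = rh l" if "l < k" for vt l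
  using rh0[OF that] by (simp add: tor_y_def norm_mult)
 have pt: "torus_point k s t T x (tor_y rh vt)" if TS: "T \<subseteq> S" for T vt
 proof
  show "x i ~= 0" "norm (x i) < 1" "x i ~= s" if "i \<in> T" for i using x that TS by blast+
  show "inj_on (%l. norm (tor_y rh vt l)) {..<k}" using rh(1) ny by (auto simp: inj_on_def)
  show "finite T" "inj_on x T" using S that by (auto intro: finite_subset inj_on_subset)
  show "norm (tor_y rh vt l)*norm (x i) < 1" if "i \<in> T" "l < k" for i l
   using rh(4) that TS by (auto simp: ny)
 qed (use k t s rh ny in auto)
 have t1: "t^n ~= 1" if "n \<ge> 1" for n
 proof -
  have "norm s^(2*n) < 1" using s that by (simp add: power_less_one_iff)
  then show ?thesis unfolding t by (metis norm_one norm_power power_mult less_irrefl)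
 qed
 have t1': "t ~= 1" using t1[of 1] by simp
 have nn: "x i*x j ~= 1" if "i \<in> S" "j \<in> S" for i j
 proof -
  have "norm (x i*x j) < 1*1" unfolding norm_mult by (intro mult_strict_mono x that) auto
  then show ?thesis by auto
 qed
 define co where "co T i = bc_coeff x t s (T - {i}) (x i)*(1/x i)^k + bc_coeff x t s (T - {i}) (1/x i)*x i^k" for T i
 have hJ: "has_bochner_integral (tor_measure k) (%vt. tor_K k x T (tor_y rh vt)*tor_w k s (tor_y rh vt)) (J T)" for T
  unfolding J_def
  by (intro has_bochner_integral_integrable bdm_integrable[OF finite_measure_tor] bdm_mult bdm_tor_K'[of s k rh, OF s rh0] bdm_tor_w[of s k rh, OF s rh0])
 have heps: "has_bochner_integral (tor_measure k) (%vt. tor_eps k s x T (tor_y rh vt) l) 0" if "l \<in> {..<k}" for T l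
  using has_bochner_integral_integrable[OF bdm_integrable[OF finite_measure_tor bdm_tor_eps[of s k rh l x T]]]
   tor_eps_integral[of s k rh l x T] s rh0 that by auto
 have recJ: "(1 - t^card T)*J T = (1 - t)*(\<Sum>i\<in>T. co T i*J (T - {i}))" if T: "T \<subseteq> S" for T
 proof -
  have "has_bochner_integral (tor_measure k)
    (%vt. (1 - t)*(\<Sum>i\<in>T. co T i*(tor_K k x (T - {i}) (tor_y rh vt)*tor_w k s (tor_y rh vt))) +
     t^card T*(\<Sum>l<k. tor_eps k s x T (tor_y rh vt) l))
    ((1 - t)*(\<Sum>i\<in>T. co T i*J (T - {i})) + t^card T*(\<Sum>l<k. 0))"
   by (intro has_bochner_integral_add has_bochner_integral_mult_right has_bochner_integral_sum hJ heps)
  moreover have "has_bochner_integral (tor_measure k)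
    (%vt. (1 - t^card T)*(tor_K k x T (tor_y rh vt)*tor_w k s (tor_y rh vt))) ((1 - t^card T)*J T)"
   by (intro has_bochner_integral_mult_right hJ)
  moreover have "(1 - t^card T)*(tor_K k x T (tor_y rh vt)*tor_w k s (tor_y rh vt)) =
     (1 - t)*(\<Sum>i\<in>T. co T i*(tor_K k x (T - {i}) (tor_y rh vt)*tor_w k s (tor_y rh vt))) +
     t^card T*(\<Sum>l<k. tor_eps k s x T (tor_y rh vt) l)" for vt
   unfolding co_def by (rule torus_point.tor_Kw_recursion[OF pt[OF T]])
  ultimately show ?thesis using has_bochner_integral_eq by fastforce
 qed
 have "G S = J {}*bc_sum x t s (2*k) S"
 proof (rule rec_unique[where t = t and a = "%T i. bc_coeff x t s (T - {i}) (x i) + x i^(2*k)*bc_coeff x t s (T - {i}) (1/x i)"])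
  show "G {} = J {}*bc_sum x t s (2*k) {}"
   by (simp add: G_def bc_sum_def hl_phi_def hl_total_def)
  fix T assume T: "T \<subseteq> S" "T ~= {}"
  have fT: "finite T" "inj_on x T" using S T by (auto intro: finite_subset inj_on_subset)
  show "(1 - t^card T)/(1 - t)*bc_sum x t s (2*k) T =
   (\<Sum>i\<in>T. (bc_coeff x t s (T - {i}) (x i) + x i^(2*k)*bc_coeff x t s (T - {i}) (1/x i))*bc_sum x t s (2*k) (T - {i}))"
   by (rule bc_sum_rec[OF fT]) (use T x(1) nn t1' in blast)+
  have "(1 - t^card T)/(1 - t)*G T = (\<Prod>i\<in>T. x i^k)*(((1 - t^card T)*J T)/(1 - t))"
   by (simp add: G_def)
  also have "... = (\<Prod>i\<in>T. x i^k)*(\<Sum>i\<in>T. co T i*J (T - {i}))"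
   unfolding recJ[OF T(1)] using t1' by simp
  also have "... = (\<Sum>i\<in>T. (bc_coeff x t s (T - {i}) (x i) + x i^(2*k)*bc_coeff x t s (T - {i}) (1/x i))*G (T - {i}))"
   unfolding sum_distrib_left
  proof (rule sum.cong)
   fix i assume i: "i \<in> T"
   then have xi: "x i ~= 0" using x(1) T by auto
   have p: "(\<Prod>i\<in>T. x i^k) = x i^k*(\<Prod>i\<in>T - {i}. x i^k)" by (rule prod.remove[OF fT(1) i])
   have "x i^k * co T i = bc_coeff x t s (T - {i}) (x i) + x i^(2*k)*bc_coeff x t s (T - {i}) (1/x i)"
    unfolding co_def using xi by (simp add: distrib_left power_divide power_mult power2_eq_square mult_ac)
   then show "(\<Prod>i\<in>T. x i^k)*(co T i*J (T - {i})) =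
    (bc_coeff x t s (T - {i}) (x i) + x i^(2*k)*bc_coeff x t s (T - {i}) (1/x i))*G (T - {i})"
    unfolding p G_def by (metis (no_types, lifting) mult.assoc mult.left_commute)
  qed simp
  finally show "(1 - t^card T)/(1 - t)*G T =
   (\<Sum>i\<in>T. (bc_coeff x t s (T - {i}) (x i) + x i^(2*k)*bc_coeff x t s (T - {i}) (1/x i))*G (T - {i}))" .
 qed (use S t1 in auto)
 moreover have "J {} = (\<integral>vt. tor_w k s (tor_y rh vt) \<partial>tor_measure k)"
  by (simp add: J_def tor_K_def)
 moreover have "(\<integral>vt. (\<Prod>i\<in>S. \<Prod>l<k. (1 + x i*tor_y rh vt l)*(1 + x i/tor_y rh vt l))*tor_w k s (tor_y rh vt) \<partial>tor_measure k) = G S"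
 proof -
  have e: "(1 + x i*y)*(1 + x i/y) = x i*((x i + 1/x i) + (y + 1/y))" if "i \<in> S" "y ~= 0" for i y
   using x(1)[OF that(1)] that(2) by (simp add: field_simps)
  have "(\<Prod>i\<in>S. \<Prod>l<k. (1 + x i*tor_y rh vt l)*(1 + x i/tor_y rh vt l)) = (\<Prod>i\<in>S. x i^k)*tor_K k x S (tor_y rh vt)" for vt
   unfolding tor_K_def prod.distrib[symmetric]
  proof (rule prod.cong)
   fix i assume i: "i \<in> S"
   have "(\<Prod>l<k. (1 + x i*tor_y rh vt l)*(1 + x i/tor_y rh vt l)) =
     (\<Prod>l<k. x i*((x i + 1/x i) + (tor_y rh vt l + 1/tor_y rh vt l)))"
   proof (intro prod.cong refl e i)
    fix l assume "l \<in> {..<k}"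
    then show "tor_y rh vt l ~= 0" using ny[of l vt] rh0[of l] by auto
   qed
   then show "(\<Prod>l<k. (1 + x i*tor_y rh vt l)*(1 + x i/tor_y rh vt l)) =
     x i^k*(\<Prod>l<k. (x i + 1/x i) + (tor_y rh vt l + 1/tor_y rh vt l))"
    by (simp add: prod.distrib)
  qed simp
  then show ?thesis by (simp add: G_def J_def mult.assoc)
 qed
 ultimately show ?thesis by (simp add: mult.commute)
qed

section \<open>Evaluation by constant terms\<close>

lemma bdm_circ_ee:
 assumes "c ~= 0"
 shows "bdm circ (%vt. c*ee vt)" "bdm circ (%vt. a/(c*ee vt))"
proof -
 show "bdm circ (%vt. c*ee vt)"
  unfolding bdm_def by (auto intro!: borel_measurable_times measurable_ee exI[of _ "norm c"] simp: norm_mult)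
 show "bdm circ (%vt. a/(c*ee vt))"
  unfolding bdm_def
  by (auto intro!: borel_measurable_times borel_measurable_divide measurable_ee exI[of _ "norm a/norm c"] simp: norm_mult norm_divide)
qed

lemma bdm_power: "bdm M f ==> bdm M (%x. f x^n)"
 by (induction n) (auto intro: bdm_mult bdm_const)

lemma bdm_circ_powi:
 assumes "c ~= 0" shows "bdm circ (%vt. (c*ee vt) powi n)"
proof (cases "n \<ge> 0")
 case True
 then show ?thesis using bdm_power[OF bdm_circ_ee(1)[OF assms], of "nat n"] by (simp add: power_int_def)
next
 case False
 then show ?thesis using bdm_power[OF bdm_circ_ee(2)[OF assms, of 1], of "nat (- n)"]
  by (simp add: power_int_def divide_inverse)
qed

definition ct :: "(complex => complex) => complex" where
 "ct f = (\<integral>vt. f (ee vt) \<partial>circ)"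

lemma ct_laurent: "laurent f a ==> ct f = a 0"
 unfolding ct_def by (rule laurent_circle_integral)

text \<open>Both determinants are expanded. Each product of entries integrates coordinate by
  coordinate to constant terms, and after a permutation of rows every outer permutation contributes
  the same determinant.\<close>

lemma tor_andreief:
 fixes g :: "complex => complex" and E P :: "nat => complex => complex"
 assumes L: "!!a b. a < k ==> b < k ==> is_laurent (%v. g v * E a v * P b v)"
  and B: "!!a b c. a < k ==> b < k ==> c ~= 0 ==> bdm circ (%vt. g (c*ee vt)*E a (c*ee vt)*P b (c*ee vt))"
  and rh: "!!l. l < k ==> rh l > 0"
 shows "(\<integral>vt. (\<Prod>l<k. g (tor_y rh vt l))*leib k (%l a. E a (tor_y rh vt l))*leib k (%l b. P b (tor_y rh vt l)) \<partial>tor_measure k) =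
  fact k*leib k (%a b. ct (%v. g v * E a v * P b v))"
proof -
 interpret product_sigma_finite "%_ :: nat. circ" by (rule product_sigma_finite_circ)
 define F where "F a b v = g v * E a v * P b v" for a b v
 define perms where "perms = {p. p permutes {..<k}}"
 have pk: "p l < k" if "p \<in> perms" "l < k" for p l using that permutes_in_image[of p "{..<k}" l] by (auto simp: perms_def)
 have expand: "(\<Prod>l<k. g (y l))*leib k (%l a. E a (y l))*leib k (%l b. P b (y l)) =
   (\<Sum>p\<in>perms. \<Sum>r\<in>perms. (of_int (sign p) * of_int (sign r))*(\<Prod>l<k. F (p l) (r l) (y l)))" for y
 proof -
  have "(\<Prod>l<k. g (y l))*leib k (%l a. E a (y l))*leib k (%l b. P b (y l)) =
    (\<Sum>p\<in>perms. \<Sum>r\<in>perms. (\<Prod>l<k. g (y l))*(of_int (sign p)*(\<Prod>l<k. E (p l) (y l)))*(of_int (sign r)*(\<Prod>l<k. P (r l) (y l))))"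
   unfolding leib_def perms_def by (simp add: sum_distrib_left sum_distrib_right sum_product mult_ac)
  also have "... = (\<Sum>p\<in>perms. \<Sum>r\<in>perms. (of_int (sign p) * of_int (sign r))*(\<Prod>l<k. F (p l) (r l) (y l)))"
   by (intro sum.cong refl) (simp add: F_def prod.distrib mult_ac)
  finally show ?thesis .
 qed
 have one: "has_bochner_integral (tor_measure k) (%vt. \<Prod>l<k. F (p l) (r l) (tor_y rh vt l)) (\<Prod>l<k. ct (F (p l) (r l)))"
  if "p \<in> perms" "r \<in> perms" for p r
 proof -
  define f where "f l phi = F (p l) (r l) (complex_of_real (rh l)*ee phi)" for l phi
  have int: "integrable circ (f l)" if l: "l \<in> {..<k}" for l
   unfolding f_def F_def
   by (rule bdm_integrable[OF finite_measure_circ B]) (use l pk \<open>p \<in> perms\<close> \<open>r \<in> perms\<close> rh[of l] in auto)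
  have val: "integral\<^sup>L circ (f l) = ct (F (p l) (r l))" if l: "l \<in> {..<k}" for l
   unfolding f_def ct_def
   by (rule is_laurent_integral_scale) (use l pk \<open>p \<in> perms\<close> \<open>r \<in> perms\<close> rh[of l] L in "auto simp: F_def[abs_def]")
  have i: "integrable (tor_measure k) (%vt. \<Prod>l\<in>{..<k}. f l (vt l))"
   by (rule product_integrable_prod[OF finite_lessThan int])
  have v: "(\<integral>vt. (\<Prod>l\<in>{..<k}. f l (vt l)) \<partial>tor_measure k) = (\<Prod>l\<in>{..<k}. integral\<^sup>L circ (f l))"
   by (rule product_integral_prod[OF finite_lessThan int])
  have "has_bochner_integral (tor_measure k) (%vt. \<Prod>l<k. f l (vt l)) (\<Prod>l<k. ct (F (p l) (r l)))"
   using has_bochner_integral_integrable[OF i] unfolding v by (simp add: val)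
  then show ?thesis by (simp add: f_def tor_y_def)
 qed
 have "has_bochner_integral (tor_measure k)
   (%vt. \<Sum>p\<in>perms. \<Sum>r\<in>perms. (of_int (sign p) * of_int (sign r))*(\<Prod>l<k. F (p l) (r l) (tor_y rh vt l)))
   (\<Sum>p\<in>perms. \<Sum>r\<in>perms. (of_int (sign p) * of_int (sign r))*(\<Prod>l<k. ct (F (p l) (r l))))"
  by (intro has_bochner_integral_sum has_bochner_integral_mult_right one)
 then have "(\<integral>vt. (\<Prod>l<k. g (tor_y rh vt l))*leib k (%l a. E a (tor_y rh vt l))*leib k (%l b. P b (tor_y rh vt l)) \<partial>tor_measure k) =
   (\<Sum>p\<in>perms. \<Sum>r\<in>perms. (of_int (sign p) * of_int (sign r))*(\<Prod>l<k. ct (F (p l) (r l))))"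
  unfolding expand by (rule has_bochner_integral_integral_eq)
 also have "... = (\<Sum>p\<in>perms. of_int (sign p)*leib k (%l. (%a b. ct (F a b)) (p l)))"
  unfolding leib_def perms_def by (simp add: sum_distrib_left mult.assoc)
 also have "... = (\<Sum>p\<in>perms. leib k (%a b. ct (F a b)))"
 proof (rule sum.cong)
  fix p assume "p \<in> perms"
  then have "leib k (%l. (%a b. ct (F a b)) (p l)) = of_int (sign p)*leib k (%a b. ct (F a b))"
   unfolding perms_def by (intro leib_permute_rows) simp
  moreover have "of_int (sign p) * of_int (sign p) = (1 :: complex)"
   by (metis of_int_1 of_int_mult sign_idempotent)
  ultimately show "of_int (sign p)*leib k (%l. (%a b. ct (F a b)) (p l)) = leib k (%a b. ct (F a b))"
   by (metis mult.assoc mult_1)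
 qed simp
 also have "... = fact k*leib k (%a b. ct (F a b))"
  using card_permutations[of "{..<k}" k] by (simp add: perms_def)
 finally show ?thesis by (simp add: F_def[abs_def])
qed

lemma leib_diag: "leib k (%a b. if a = b then c else 0) = c^k"
proof -
 have "leib k (%a b. if a = b then c else 0) =
   (\<Sum>p\<in>{id}. of_int (sign p)*(\<Prod>i<k. if i = p i then c else 0))"
  unfolding leib_def
 proof (rule sum.mono_neutral_right)
  show "\<forall>p\<in>{p. p permutes {..<k}} - {id}. of_int (sign p)*(\<Prod>i<k. if i = p i then c else 0) = 0"
  proof
   fix p assume p: "p \<in> {p. p permutes {..<k}} - {id}"
   then obtain i where i: "p i ~= i" by (auto simp: fun_eq_iff)
   then have "i < k" using p permutes_not_in[of p "{..<k}" i] by auto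
   then have "(\<Prod>i<k. if i = p i then c else 0) = 0" using i by (intro prod_zero; force)
   then show "of_int (sign p)*(\<Prod>i<k. if i = p i then c else 0) = 0" by simp
  qed
 qed (auto simp: finite_permutations permutes_id)
 then show ?thesis by (simp add: sign_id)
qed

lemma leib_scale: "leib k (%a b. alp a*bt b*A a b) = (\<Prod>a<k. alp a)*(\<Prod>b<k. bt b)*leib k A"
 unfolding leib_def sum_distrib_left
proof (rule sum.cong)
 fix p assume "p \<in> {p. p permutes {..<k}}"
 then have "(\<Prod>i<k. bt (p i)) = (\<Prod>i<k. bt i)" using prod.permute[of p "{..<k}" bt] by (simp add: o_def)
 then show "of_int (sign p)*(\<Prod>i<k. alp i*bt (p i)*A i (p i)) =
   (\<Prod>a<k. alp a)*(\<Prod>b<k. bt b)*(of_int (sign p)*(\<Prod>i<k. A i (p i)))"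
  by (simp add: prod.distrib mult_ac)
qed simp

text \<open>Peeling the first factor off the products in \<open>1/v\<close>, \<open>v/u\<close> and
  \<open>1/(u * v)\<close> separates the density into the affine product \<open>mac_theta\<close>
  and a finite denominator of type B.\<close>

lemma tor_w_mac:
 assumes s: "norm s < 1" and y: "!!i. i < k ==> y i ~= 0"
 shows "tor_w k s y = pair_prod (%_ _. - 1) {..<k}*mac_theta k s y*(\<Prod>j<k. (1/y j)^(k - 1)*(1 + 1/y j)) *
  pair_prod (%i j. (y j + 1/y j) - (y i + 1/y i)) {..<k}"
proof -
 have t: "norm (s^2) < 1" using s by (simp add: norm_power power_less_one_iff)
 have 1: "qpoch_inf (- v) s*qpoch_inf (- 1/v) s = theta (- v) s*(1 + 1/v)" for v
  using qpoch_inf_shift[OF s, of "- 1/v"] by (simp add: theta_def)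
 have 2: "tor_h (s^2) u v = (- 1)*(mac_h (s^2) u v * (((1/u)*(1/v))*((v + 1/v) - (u + 1/u))))"
  if "u ~= 0" "v ~= 0" for u v
 proof -
  have "(1 - 1/(u * v))*(1 - v/u) = v * ((- 1)*(((1/u)*(1/v))*((v + 1/v) - (u + 1/u))))"
   using that by (simp add: field_simps)
  moreover have "qpoch_inf (1/(u * v)) (s^2) = (1 - 1/(u * v))*qpoch_inf (s^2/(u * v)) (s^2)"
   using qpoch_inf_shift[OF t, of "1/(u * v)"] by simp
  moreover have "qpoch_inf (v/u) (s^2) = (1 - v/u)*qpoch_inf (s^2/(u/v)) (s^2)"
   using qpoch_inf_shift[OF t, of "v/u"] by (simp add: mult.commute)
  ultimately have "tor_h (s^2) u v = theta (u * v) (s^2)*theta (u/v) (s^2) *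
    (v * ((- 1)*(((1/u)*(1/v))*((v + 1/v) - (u + 1/u)))))"
   unfolding tor_h_def theta_def by (simp add: ac_simps)
  then show ?thesis unfolding mac_h_def by (simp only: mult_ac)
 qed
 have "pair_prod (%i j. tor_h (s^2) (y i) (y j)) {..<k} =
   pair_prod (%i j. (- 1)*(mac_h (s^2) (y i) (y j)*(((1/y i)*(1/y j))*((y j + 1/y j) - (y i + 1/y i))))) {..<k}"
  by (rule pair_prod_cong, rule 2) (use y in auto)
 also have "... = pair_prod (%_ _. - 1) {..<k}*(pair_prod (%i j. mac_h (s^2) (y i) (y j)) {..<k} *
   ((\<Prod>j<k. 1/y j)^(k - 1)*pair_prod (%i j. (y j + 1/y j) - (y i + 1/y i)) {..<k}))"
  unfolding pair_prod_factor[symmetric]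
  by (subst pair_prod_mult[OF finite_lessThan], subst pair_prod_mult[OF finite_lessThan], subst pair_prod_mult[OF finite_lessThan]) (rule refl)
 finally have 3: "pair_prod (%i j. tor_h (s^2) (y i) (y j)) {..<k} = ..." .
 show ?thesis
  unfolding tor_w_def mac_theta_def 1 3 by (simp add: prod.distrib prod_power_distrib mult_ac)
qed

text \<open>Entries of a determinant of type B for \<open>sg = 0\<close> and of type D for
  \<open>sg = 1\<close>. Both express the same finite denominator; \<open>tor_c\<close> is the part
  of it that type D does not contain.\<close>

definition tor_E :: "nat => nat => complex => complex" where
 "tor_E sg a v = v^a + v powi (int sg - int a - 1)"

definition tor_c :: "nat => complex => complex" where
 "tor_c sg v = (if sg = 0 then 1 else 1 + 1/v)"

text \<open>The factor \<open>sg + 1\<close> is the 2 of type D, and it ends up as the denominator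
  \<open>\<sigma> + 1\<close> of the theorem.\<close>

lemma leib_tor_E:
 assumes "k \<ge> 1" "sg \<in> {0, 1}" "!!i. i < k ==> y i ~= 0"
 shows "(\<Prod>j<k. tor_c sg (y j))*leib k (%i a. tor_E sg a (y i)) =
  of_nat (sg + 1)*((\<Prod>j<k. 1 + 1/y j)*pair_prod (%i j. (y j + 1/y j) - (y i + 1/y i)) {..<k})"
proof (cases "sg = 0")
 case True
 then show ?thesis using leib_B[OF assms(1), of 1 y] assms(3)
  by (simp add: tor_c_def tor_E_def[abs_def])
next
 case False
 then have "sg = 1" using assms(2) by simp
 then show ?thesis using leib_D[OF assms(1), of y] assms(3)
  by (simp add: tor_c_def tor_E_def[abs_def])
qed

lemma bdm_circ_psi:
 assumes "k \<ge> 1" "s ~= 0" "norm s < 1" "c ~= 0"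
 shows "bdm circ (%vt. psi k s b (c*ee vt))"
proof -
 have Q: "norm (s^(4*k)) < 1" using assms by (simp add: norm_power power_less_one_iff)
 have th: "bdm circ (%vt. theta (a*f vt) (s^(4*k)))"
  if "bdm circ f" "bdm circ (%vt. 1/f vt)" for a f
 proof -
  have "bdm circ (%vt. s^(4*k)/(a*f vt))"
   using bdm_mult[OF bdm_const that(2), of "s^(4*k)/a"] by simp
  then show ?thesis unfolding theta_def by (intro bdm_mult bdm_qpoch_inf Q bdm_const that)
 qed
 have 1: "bdm circ (%vt. 1/(c*ee vt)^n)" for n
  using bdm_power[OF bdm_circ_ee(2)[OF assms(4), of 1], of n] by (simp add: power_divide)
 have 2: "bdm circ (%vt. 1/(1/(c*ee vt))^n)" for n
  using bdm_power[OF bdm_circ_ee(1)[OF assms(4)], of n] by (simp add: power_divide)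
 show ?thesis
  unfolding psi_def
  by (intro bdm_mult bdm_add bdm_const bdm_power bdm_circ_powi th bdm_circ_ee 1 2 assms)
qed

context
 fixes k :: nat and s :: complex
 assumes k: "k \<ge> 1" and s: "s ~= 0" "norm s < 1"
begin

lemma is_laurent_psi: "is_laurent (psi k s b)"
 using laurent_psi[OF k s] by (auto simp: is_laurent_def)

lemma is_laurent_tor_E: "is_laurent (tor_E sg a)"
proof -
 have "is_laurent (%v. v powi int a + v powi (int sg - int a - 1))"
  by (intro is_laurent_add is_laurent_powi)
 then show ?thesis by (simp add: tor_E_def[abs_def])
qed

lemma is_laurent_tor_c: "is_laurent (%v. (1/v)^(k - 1)*tor_c sg v)"
proof -
 have "is_laurent (%v. \<Prod>i<k - 1. 1/v)" by (intro is_laurent_prod is_laurent_inverse)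
 moreover have "is_laurent (tor_c sg)"
  unfolding tor_c_def[abs_def] by (cases "sg = 0") (auto intro!: is_laurent_add is_laurent_const is_laurent_inverse)
 ultimately show ?thesis using is_laurent_mult by fastforce
qed

text \<open>The density is a product of two determinants, one by \<open>macdonald_identity\<close>
  and one of finite type, as Andreief's formula requires. \<open>G\<close> is the kernel in one
  torus variable, or 1 for the total mass.\<close>

lemma tor_integral_leib:
 assumes sg: "sg \<in> {0, 1}" and G: "is_laurent G" "!!c. c ~= 0 ==> bdm circ (%vt. G (c*ee vt))"
  and rh: "!!l. l < k ==> rh l > 0"
 shows "of_nat (sg + 1)*(qpoch_inf s s*qpoch_inf (s^2) (s^2)^(k - 1)) *
   (\<integral>vt. (\<Prod>l<k. G (tor_y rh vt l))*tor_w k s (tor_y rh vt) \<partial>tor_measure k) =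
  pair_prod (%_ _. - 1) {..<k}*(fact k*leib k (%a b. ct (%v. (G v * ((1/v)^(k - 1)*tor_c sg v))*tor_E sg a v * psi k s b v)))"
proof -
 let ?C = "qpoch_inf s s*qpoch_inf (s^2) (s^2)^(k - 1)" and ?ep = "pair_prod (%_ _. - 1) {..<k}"
 define g where "g v = G v * ((1/v)^(k - 1)*tor_c sg v)" for v
 have y0: "tor_y rh vt i ~= 0" if "i < k" for vt i using rh[OF that] by (simp add: tor_y_def)
 have pt: "of_nat (sg + 1)*?C*((\<Prod>l<k. G (y l))*tor_w k s y) =
   ?ep*((\<Prod>l<k. g (y l))*leib k (%l a. tor_E sg a (y l))*leib k (%l b. psi k s b (y l)))"
  if y: "!!i. i < k ==> y i ~= 0" for y
 proof -
  let ?V = "pair_prod (%i j. (y j + 1/y j) - (y i + 1/y i)) {..<k}"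
  have "(\<Prod>l<k. g (y l))*leib k (%l a. tor_E sg a (y l)) =
    (\<Prod>l<k. G (y l))*(\<Prod>l<k. (1/y l)^(k - 1))*((\<Prod>j<k. tor_c sg (y j))*leib k (%l a. tor_E sg a (y l)))"
   by (simp only: g_def prod.distrib mult.assoc)
  also have "... = (\<Prod>l<k. G (y l))*(\<Prod>l<k. (1/y l)^(k - 1))*(of_nat (sg + 1)*((\<Prod>j<k. 1 + 1/y j)*?V))"
   by (simp only: leib_tor_E[OF k sg y])
  finally have "?ep*((\<Prod>l<k. g (y l))*leib k (%l a. tor_E sg a (y l))*leib k (%l b. psi k s b (y l))) =
    ?ep*((\<Prod>l<k. G (y l))*(\<Prod>l<k. (1/y l)^(k - 1))*(of_nat (sg + 1)*((\<Prod>j<k. 1 + 1/y j)*?V)) *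
     (mac_theta k s y*?C))"
   by (simp only: macdonald_identity[OF k s y])
  moreover from tor_w_mac[of s k y, OF s(2)] y
  have "tor_w k s y = ?ep*mac_theta k s y*(\<Prod>j<k. (1/y j)^(k - 1)*(1 + 1/y j))*?V" by blast
  ultimately show ?thesis by (simp only: prod.distrib mult_ac)
 qed
 have "of_nat (sg + 1)*?C*(\<integral>vt. (\<Prod>l<k. G (tor_y rh vt l))*tor_w k s (tor_y rh vt) \<partial>tor_measure k) =
   (\<integral>vt. of_nat (sg + 1)*?C*((\<Prod>l<k. G (tor_y rh vt l))*tor_w k s (tor_y rh vt)) \<partial>tor_measure k)"
  by (rule integral_mult_right_zero[symmetric])
 also have "... = (\<integral>vt. ?ep*((\<Prod>l<k. g (tor_y rh vt l))*leib k (%l a. tor_E sg a (tor_y rh vt l))*leib k (%l b. psi k s b (tor_y rh vt l))) \<partial>tor_measure k)"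
  by (simp only: pt[OF y0])
 also have "... = ?ep*(\<integral>vt. (\<Prod>l<k. g (tor_y rh vt l))*leib k (%l a. tor_E sg a (tor_y rh vt l))*leib k (%l b. psi k s b (tor_y rh vt l)) \<partial>tor_measure k)"
  by (rule integral_mult_right_zero)
 also have "(\<integral>vt. (\<Prod>l<k. g (tor_y rh vt l))*leib k (%l a. tor_E sg a (tor_y rh vt l))*leib k (%l b. psi k s b (tor_y rh vt l)) \<partial>tor_measure k) =
   fact k*leib k (%a b. ct (%v. g v * tor_E sg a v * psi k s b v))"
 proof (rule tor_andreief)
  show "is_laurent (%v. g v * tor_E sg a v * psi k s b v)" for a b
   unfolding g_def by (intro is_laurent_mult G is_laurent_tor_c is_laurent_tor_E is_laurent_psi)
  fix a b and c :: complex assume c: "c ~= 0"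
  have "bdm circ (%vt. tor_c sg (c*ee vt))"
   unfolding tor_c_def by (cases "sg = 0") (auto intro!: bdm_add bdm_const bdm_circ_ee c)
  then show "bdm circ (%vt. g (c*ee vt)*tor_E sg a (c*ee vt)*psi k s b (c*ee vt))"
   unfolding g_def tor_E_def
   by (intro bdm_mult bdm_add G c bdm_power bdm_circ_ee bdm_circ_powi bdm_circ_psi k s)
 qed (rule rh)
 finally show ?thesis by (simp add: g_def)
qed

text \<open>Only coefficients of \<open>psi\<close> at exponents between 0 and
  \<open>2*k - 1\<close> occur. These are 1 at \<open>b\<close> and at \<open>2*k - 1 - b\<close>
  and 0 elsewhere, so the matrix for the total mass is antidiagonal.\<close>

lemma ct_psi_E0:
 assumes "a < k" "b < k"
 shows "ct (%v. (1*((1/v)^(k - 1)*tor_c 0 v))*tor_E 0 a v * psi k s b v) = (if a + b = k - 1 then 2 else 0)"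
proof -
 have "laurent (%v. v powi (int a - (int k - 1))*psi k s b v + v powi (- int a - int k)*psi k s b v)
   (%n. psi_coeff k s b (n - (int a - (int k - 1))) + psi_coeff k s b (n - (- int a - int k)))"
  by (intro laurent_add laurent_shift laurent_psi k s)
 then have "laurent (%v. (1*((1/v)^(k - 1)*tor_c 0 v))*tor_E 0 a v * psi k s b v)
   (%n. psi_coeff k s b (n - (int a - (int k - 1))) + psi_coeff k s b (n - (- int a - int k)))"
 proof (rule laurent_cong)
  fix v :: complex assume v: "v ~= 0"
  have 1: "(1/v)^(k - 1) = v powi (- (int k - 1))"
  proof -
   have "int k - 1 = int (k - 1)" using k by (simp add: of_nat_diff)
   then show ?thesis by (simp only: power_int_minus power_int_of_nat) (simp add: field_simps)
  qed
  have "v powi (int a - (int k - 1)) = v powi (- (int k - 1)) * v powi (int a)"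
   by (subst power_int_add[symmetric]) (use v in "simp_all add: algebra_simps")
  moreover have "v powi (- int a - int k) = v powi (- (int k - 1)) * v powi (int 0 - int a - 1)"
   by (subst power_int_add[symmetric]) (use v in "simp_all add: algebra_simps")
  ultimately show "v powi (int a - (int k - 1))*psi k s b v + v powi (- int a - int k)*psi k s b v =
    (1*((1/v)^(k - 1)*tor_c 0 v))*tor_E 0 a v * psi k s b v"
   unfolding 1 tor_E_def tor_c_def by (simp add: distrib_left distrib_right mult_ac)
 qed
 then have "ct (%v. (1*((1/v)^(k - 1)*tor_c 0 v))*tor_E 0 a v * psi k s b v) =
   psi_coeff k s b (0 - (int a - (int k - 1))) + psi_coeff k s b (0 - (- int a - int k))"
  by (rule ct_laurent)
 moreover have "0 - (int a - (int k - 1)) = int k - 1 - int a" "0 - (- int a - int k) = int k + int a" by simp_all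
 ultimately have "ct (%v. (1*((1/v)^(k - 1)*tor_c 0 v))*tor_E 0 a v * psi k s b v) =
   psi_coeff k s b (int k - 1 - int a) + psi_coeff k s b (int k + int a)"
  by (simp only:)
 moreover have dv: "2*int k dvd x \<longleftrightarrow> x = 0" if "\<bar>x\<bar> < 2*int k" for x
  using that zdvd_imp_le[of "2*int k" "\<bar>x\<bar>"] by auto
 have "psi_coeff k s b (int k - 1 - int a) = (if a + b = k - 1 then 1 else 0)"
  unfolding psi_coeff_def using assms by (subst (1 2) dv) (auto simp: mac_exp_def)
 moreover have "psi_coeff k s b (int k + int a) = (if a + b = k - 1 then 1 else 0)"
  unfolding psi_coeff_def using assms by (subst (1 2) dv) (auto simp: mac_exp_def)
 ultimately show ?thesis by simp
qed

end

lemma pair_prod_const_nonzero: "pair_prod (%_ _. - 1) {..<k} ~= 0"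
 unfolding pair_prod_lessThan by (auto simp: finite_lessThan_pairs)

section \<open>Specialisation to a geometric progression\<close>

definition lw_z :: "nat => complex => nat => complex" where
 "lw_z sg h i = h^(sg + 1)*(h^2)^i"

lemma lw_z_power: "lw_z sg h i = h^(sg + 1 + 2*i)"
 by (simp add: lw_z_def power_add power_mult)

definition product_side :: "nat => nat => complex => complex => complex" where
 "product_side k sg s h = (let ph = s*h^(2*k); p = ph^2; q = h^2 in
   qpoch_inf ph ph*qpoch_inf p p^(k - 1)/(of_nat (sg + 1)*qpoch_inf q q^k) *
   (\<Prod>i = 1..k. theta (- (h^(2*i - (sg + 1)))) ph) *
   (\<Prod>(i, j)\<in>{(i, j). 1 \<le> i \<and> i < j \<and> j \<le> k}. theta (q^(j - i)) p*theta (q^(i + j - sg - 1)) p))"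

text \<open>\<open>h\<close> is a square root of \<open>q\<close>. By \<open>hs\<close> the
  variables avoid \<open>s\<close>, as in the bounded Littlewood identity; the excluded values of
  \<open>s\<close> are recovered later by continuity.\<close>

locale lw_point =
 fixes k sg :: nat and s h :: complex
 assumes k: "k \<ge> 1" and sg: "sg \<in> {0, 1}" and s: "s ~= 0" "norm s < 1" and h: "h ~= 0" "norm h < 1"
  and hs: "!!i. lw_z sg h i ~= s"
begin

lemma norm_lw_z: "norm (lw_z sg h i) \<le> norm h"
proof -
 have "norm h^(sg + 1 + 2*i) \<le> norm h^1" by (rule power_decreasing) (use h in auto)
 then show ?thesis by (simp only: lw_z_power norm_power power_one_right)
qed

lemma norm_q: "norm (h^2) < 1"
 using h by (simp add: norm_power power_less_one_iff)

lemma inj_lw_z: "inj_on (lw_z sg h) S"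
proof (rule inj_onI)
 fix i j assume "lw_z sg h i = lw_z sg h j"
 then have "norm h^(sg + 1 + 2*i) = norm h^(sg + 1 + 2*j)" by (metis lw_z_power norm_power)
 then show "i = j"
  using h power_strict_decreasing[of "sg + 1 + 2*i" "sg + 1 + 2*j" "norm h"]
   power_strict_decreasing[of "sg + 1 + 2*j" "sg + 1 + 2*i" "norm h"] by (cases i j rule: linorder_cases) auto
qed

definition M :: "nat => nat => nat => complex" where
 "M n a b = ct (%v. ((\<Prod>i<n. (1 + lw_z sg h i * v)*(1 + lw_z sg h i/v))*((1/v)^(k - 1)*tor_c sg v)) *
   tor_E sg a v * psi k s b v)"

lemma radii_exist:
 obtains rh :: "nat => real" where "inj_on rh {..<k}" "!!l. rh l > 1" "!!l. rh l*norm s < 1" "!!l. rh l*norm h < 1"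
proof -
 define m where "m = max (norm s) (norm h)"
 have m: "0 < m" "m < 1" "norm s \<le> m" "norm h \<le> m" using s h by (auto simp: m_def less_max_iff_disj)
 \<comment> \<open>All radii lie strictly between 1 and \<open>1/m\<close>, and the excess over 1
   decreases with \<open>l\<close>, so they are distinct.\<close>
 define rh where "rh l = 1 + (1/m - 1)/real (l + 2)" for l :: nat
 have d: "1/m - 1 > 0" using m by (simp add: field_simps)
 have r1: "rh l > 1" for l using d by (simp add: rh_def)
 have "rh l < 1/m" for l
 proof -
  have "(1/m - 1)/real (l + 2) < (1/m - 1)/1"
   using d by (intro divide_strict_left_mono) auto
  then show ?thesis by (simp add: rh_def)
 qed
 then have rm: "rh l*m < 1" for l using m by (simp add: pos_less_divide_eq)
 have "rh l*norm s < 1" "rh l*norm h < 1" for l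
  using rm[of l] r1[of l] m mult_left_mono[of "norm s" m "rh l"] mult_left_mono[of "norm h" m "rh l"] by linarith+
 moreover have "inj_on rh {..<k}"
 proof (rule inj_onI)
  fix x y assume "rh x = rh y"
  then have "(1/m - 1)/real (x + 2) = (1/m - 1)/real (y + 2)"
   unfolding rh_def by (simp only: add_left_cancel)
  moreover have "e/real (x + 2) = e/real (y + 2) ==> e > 0 ==> x = y" for e :: real
   by (simp add: field_simps)
  ultimately show "x = y" using d by blast
 qed
 ultimately show ?thesis using that r1 by blast
qed

text \<open>The quotient of the kernel integral by the total mass, both written as determinants.
  Reversing the rows makes the matrix of the total mass diagonal, with determinant
  \<open>2^k\<close>; the sign of the reversal enters both determinants and cancels.\<close>

lemma bc_sum_leib:
 "of_nat (sg + 1)*bc_sum (lw_z sg h) (s^2) s (2*k) {..<n}*2^k = leib k (%a b. M n (k - Suc a) b)"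
proof -
 obtain rh :: "nat => real" where rh: "inj_on rh {..<k}" "!!l. rh l > 1" "!!l. rh l*norm s < 1" "!!l. rh l*norm h < 1"
  using radii_exist by blast
 have rh0: "rh l > 0" for l using rh(2)[of l] by simp
 define C where "C = qpoch_inf s s*qpoch_inf (s^2) (s^2)^(k - 1)"
 define ep where "ep = pair_prod (%_ _. - 1) {..<k}"
 define A where "A a b = (if a + b = k - 1 then 2 else 0 :: complex)" for a b :: nat
 define W where "W = (\<integral>vt. tor_w k s (tor_y rh vt) \<partial>tor_measure k)"
 let ?b = "bc_sum (lw_z sg h) (s^2) s (2*k) {..<n}"
 define G where "G v = (\<Prod>i<n. (1 + lw_z sg h i * v)*(1 + lw_z sg h i/v))" for v
 have nz: "ep*fact k ~= 0" using pair_prod_const_nonzero by (simp add: ep_def)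
 have 1: "of_nat (0 + 1)*C*(\<integral>vt. (\<Prod>l<k. 1)*tor_w k s (tor_y rh vt) \<partial>tor_measure k) =
   ep*(fact k*leib k (%a b. ct (%v. (1*((1/v)^(k - 1)*tor_c 0 v))*tor_E 0 a v * psi k s b v)))"
  unfolding C_def ep_def by (rule tor_integral_leib) (use k s rh0 is_laurent_const bdm_const in auto)
 have "leib k (%a b. ct (%v. (1*((1/v)^(k - 1)*tor_c 0 v))*tor_E 0 a v * psi k s b v)) = leib k A"
  unfolding A_def by (rule leib_cong) (rule ct_psi_E0[OF k s])
 then have 1: "C*W = ep*(fact k*leib k A)" using 1 by (simp add: W_def)
 have 2: "of_nat (sg + 1)*C*(\<integral>vt. (\<Prod>l<k. G (tor_y rh vt l))*tor_w k s (tor_y rh vt) \<partial>tor_measure k) =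
   ep*(fact k*leib k (%a b. ct (%v. (G v * ((1/v)^(k - 1)*tor_c sg v))*tor_E sg a v * psi k s b v)))"
  unfolding C_def ep_def
 proof (rule tor_integral_leib)
  show "is_laurent G" unfolding G_def[abs_def]
   by (intro is_laurent_prod is_laurent_mult is_laurent_add is_laurent_const is_laurent_inverse is_laurent_ident)
  show "bdm circ (%vt. G (c*ee vt))" if "c ~= 0" for c
   unfolding G_def by (intro bdm_prod bdm_mult bdm_add bdm_const bdm_circ_ee that)
 qed (use k s sg rh0 in auto)
 have "(\<integral>vt. (\<Prod>i\<in>{..<n}. \<Prod>l<k. (1 + lw_z sg h i*tor_y rh vt l)*(1 + lw_z sg h i/tor_y rh vt l))*tor_w k s (tor_y rh vt) \<partial>tor_measure k) =
   ?b*W" unfolding W_def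
 proof (rule torus_littlewood[OF k refl s])
  show "lw_z sg h i ~= 0" for i using h by (simp add: lw_z_power)
  show "norm (lw_z sg h i) < 1" for i using norm_lw_z[of i] h by simp
  show "rh l*norm (lw_z sg h i) < 1" for i l
   using mult_left_mono[OF norm_lw_z[of i], of "rh l"] rh(4)[of l] rh0[of l] by linarith
 qed (use rh hs inj_lw_z in auto)
 moreover have "(\<Prod>i\<in>{..<n}. \<Prod>l<k. (1 + lw_z sg h i*y l)*(1 + lw_z sg h i/y l)) = (\<Prod>l<k. G (y l))" for y
  unfolding G_def by (rule prod.swap)
 ultimately have "of_nat (sg + 1)*C*(?b*W) = ep*(fact k*leib k (M n))"
  using 2 by (simp add: M_def[abs_def] G_def)
 then have "of_nat (sg + 1)*?b*(C*W) = ep*(fact k*leib k (M n))" by (simp only: mult_ac)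
 then have "(ep*fact k)*(of_nat (sg + 1)*?b*leib k A) = (ep*fact k)*leib k (M n)"
  unfolding 1 by (simp only: mult_ac)
 then have main: "of_nat (sg + 1)*?b*leib k A = leib k (M n)" using nz by simp
 define rv where "rv i = (if i < k then k - Suc i else i)" for i
 have "bij_betw rv {..<k} {..<k}"
  by (rule bij_betw_byWitness[where f' = rv]) (auto simp: rv_def)
 then have rv: "rv permutes {..<k}" by (rule bij_imp_permutes) (simp add: rv_def)
 have "leib k (%a b. M n (k - Suc a) b) = leib k (%a. M n (rv a))" by (rule leib_cong) (simp add: rv_def)
 also have "... = of_int (sign rv)*leib k (M n)" by (rule leib_permute_rows[OF rv])
 also have "... = of_nat (sg + 1)*?b*(of_int (sign rv)*leib k A)" by (simp only: main[symmetric] mult_ac)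
 also have "of_int (sign rv)*leib k A = leib k (%a. A (rv a))" by (rule leib_permute_rows[OF rv, symmetric])
 also have "... = leib k (%a b. if a = b then 2 else 0)" by (rule leib_cong) (auto simp: A_def rv_def)
 also have "... = 2^k" by (rule leib_diag)
 finally show ?thesis by simp
qed

text \<open>The kernel for infinitely many variables. The factor \<open>tor_c\<close> completes it
  to a theta function: \<open>theta (- h * v) (h^2)\<close> for \<open>sg = 0\<close> and
  \<open>theta (- 1/v) (h^2)\<close> for \<open>sg = 1\<close>.\<close>

definition Th :: "complex => complex" where
 "Th v = qpoch_inf (- (h^(sg + 1)) * v) (h^2)*qpoch_inf (- (h^(sg + 1))/v) (h^2)*tor_c sg v"

text \<open>Dominated convergence: on the unit circle the finite products are bounded independently
  of \<open>n\<close> by \<open>norm_qpoch_le\<close>.\<close>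

lemma M_LIMSEQ: "(%n. M n a b) \<longlonglongrightarrow> ct (%v. Th v * ((1/v)^(k - 1)*tor_E sg a v)*psi k s b v)"
proof -
 define r where "r v = (1/v)^(k - 1)*tor_c sg v * tor_E sg a v * psi k s b v" for v
 define z where "z = - (h^(sg + 1))"
 have Gn: "(\<Prod>i<n. (1 + lw_z sg h i * v)*(1 + lw_z sg h i/v)) = qpoch (z * v) (h^2) n*qpoch (z/v) (h^2) n" for n v
  by (simp add: qpoch_def prod.distrib[symmetric] lw_z_def z_def mult_ac)
 have r: "bdm circ (%vt. r (c*ee vt))" if c: "c ~= 0" for c
 proof -
  have tc: "bdm circ (%vt. tor_c sg (c*ee vt))"
   unfolding tor_c_def by (cases "sg = 0") (auto intro!: bdm_add bdm_const bdm_circ_ee c)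
  have i: "bdm circ (%vt. 1/(c*ee vt))" by (rule bdm_circ_ee(2)[OF c])
  show ?thesis
   unfolding r_def tor_E_def
   by (intro bdm_mult tc bdm_add bdm_power[OF i] bdm_power[OF bdm_circ_ee(1)[OF c]] bdm_circ_powi c bdm_circ_psi k s)
 qed
 obtain R where "\<forall>vt\<in>space circ. norm (r (ee vt)) \<le> R" using r[of 1] unfolding bdm_def by auto
 then have R: "norm (r (ee vt)) \<le> R" if "vt \<in> space circ" for vt using that by blast
 have rm: "(%vt. r (ee vt)) \<in> borel_measurable circ" using r[of 1] unfolding bdm_def by simp
 define K where "K = exp (norm z/(1 - norm (h^2)))"
 have bp: "bdm circ (%vt. (\<Prod>i<n. (1 + lw_z sg h i*(c*ee vt))*(1 + lw_z sg h i/(c*ee vt))))" if "c ~= 0" for n c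
  by (intro bdm_prod bdm_mult bdm_add bdm_const bdm_circ_ee that)
 have bi: "bdm circ (%vt. qpoch_inf (z*(c*ee vt)) (h^2)*qpoch_inf (z/(c*ee vt)) (h^2))" if "c ~= 0" for c
  by (intro bdm_mult bdm_qpoch_inf norm_q bdm_const bdm_circ_ee that)
 have "(%n. \<integral>vt. (\<Prod>i<n. (1 + lw_z sg h i*ee vt)*(1 + lw_z sg h i/ee vt))*r (ee vt) \<partial>circ) \<longlonglongrightarrow>
   (\<integral>vt. (qpoch_inf (z*ee vt) (h^2)*qpoch_inf (z/ee vt) (h^2))*r (ee vt) \<partial>circ)"
 proof (rule integral_dominated_convergence[where w = "%_. K*K * R"])
  show "(%vt. (qpoch_inf (z*ee vt) (h^2)*qpoch_inf (z/ee vt) (h^2))*r (ee vt)) \<in> borel_measurable circ"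
   using bi[of 1] rm by (auto simp: bdm_def)
  show "(%vt. (\<Prod>i<n. (1 + lw_z sg h i*ee vt)*(1 + lw_z sg h i/ee vt))*r (ee vt)) \<in> borel_measurable circ" for n
   using bp[of 1 n] rm by (auto simp: bdm_def)
  show "integrable circ (%_. K*K * R)" using finite_measure.integrable_const[OF finite_measure_circ] .
  show "AE vt in circ. (%n. (\<Prod>i<n. (1 + lw_z sg h i*ee vt)*(1 + lw_z sg h i/ee vt))*r (ee vt)) \<longlonglongrightarrow>
    (qpoch_inf (z*ee vt) (h^2)*qpoch_inf (z/ee vt) (h^2))*r (ee vt)"
   unfolding Gn by (intro AE_I2 tendsto_mult tendsto_const qpoch_LIMSEQ norm_q)
  show "AE vt in circ. norm ((\<Prod>i<n. (1 + lw_z sg h i*ee vt)*(1 + lw_z sg h i/ee vt))*r (ee vt)) \<le> K*K * R" for n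
  proof (rule AE_I2)
   fix vt assume vt: "vt \<in> space circ"
   have "norm (qpoch (z*ee vt) (h^2) n) \<le> K" "norm (qpoch (z/ee vt) (h^2) n) \<le> K"
    using norm_qpoch_le[OF norm_q, of "z*ee vt" n] norm_qpoch_le[OF norm_q, of "z/ee vt" n]
    by (simp_all add: K_def norm_mult norm_divide)
   then show "norm ((\<Prod>i<n. (1 + lw_z sg h i*ee vt)*(1 + lw_z sg h i/ee vt))*r (ee vt)) \<le> K*K * R"
    unfolding Gn norm_mult using R[OF vt] by (intro mult_mono) (auto simp: K_def)
  qed
 qed
 then show ?thesis
  unfolding M_def ct_def r_def Th_def z_def by (simp add: mult_ac)
qed

text \<open>The Laurent coefficients of \<open>Th\<close>. After cancellation of the signs in the
  triple product both cases have this Gaussian form.\<close>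

definition ta :: "int => complex" where
 "ta n = h powi (n*(n + int sg))/qpoch_inf (h^2) (h^2)"

lemma laurent_Th: "laurent Th ta"
proof -
 let ?q = "h^2"
 have q0: "?q ~= 0" using h by simp
 have m1: "(- 1 :: complex) powi n*(- 1) powi n = 1" for n by (simp flip: power_int_mult_distrib)
 have tri: "2*(n*(n - 1) div 2) = n*(n - 1)" for n :: int by simp
 have qp: "?q powi (n*(n - 1) div 2) = h powi (n*(n - 1))" for n
 proof -
  have "h powi (n*(n - 1)) = h powi (2*(n*(n - 1) div 2))" by (simp only: tri)
  also have "... = (h powi 2) powi (n*(n - 1) div 2)" by (rule power_int_mult)
  finally show ?thesis by simp
 qed
 show ?thesis
 proof (cases "sg = 0")
  case True
  have "laurent (%v. theta (- h * v) ?q) (%n. jtp_coeff ?q n/qpoch_inf ?q ?q*(- h) powi n)"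
   by (rule laurent_scale[OF jacobi_triple_product[OF norm_q q0]]) (use h in simp)
  moreover have "(%n. jtp_coeff ?q n/qpoch_inf ?q ?q*(- h) powi n) = ta"
  proof
   fix n
   have "(- h) powi n = (- 1) powi n*h powi n" by (metis mult_minus1 power_int_mult_distrib)
   moreover have "h powi (n*(n - 1))*h powi n = h powi (n*(n + int sg))"
    using h True by (simp flip: power_int_add) (simp add: algebra_simps)
   moreover have "(e*A)/Q*(e*B) = (A*B)/Q" if "e*e = 1" for e A B Q :: complex
   proof -
    have "(e*A)/Q*(e*B) = (e*e)*(A*B)/Q" by (simp add: mult_ac)
    then show ?thesis using that by simp
   qed
   from this[OF m1[of n], of "h powi (n*(n - 1))" _ "h powi n"]
   have "((- 1) powi n*h powi (n*(n - 1)))/Q*((- 1) powi n*h powi n) = (h powi (n*(n - 1))*h powi n)/Q" for Q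
    by blast
   ultimately show "jtp_coeff ?q n/qpoch_inf ?q ?q*(- h) powi n = ta n"
    by (simp only: jtp_coeff_powi[OF q0] qp ta_def)
  qed
  ultimately have "laurent (%v. theta (- h * v) ?q) ta" by simp
  then show ?thesis
   by (rule laurent_cong) (unfold Th_def theta_def tor_c_def, use True h in "simp add: power2_eq_square")
 next
  case False
  then have s1: "sg = 1" using sg by simp
  have "laurent (%v. theta ((- 1)*(1/v)) ?q) (%n. jtp_coeff ?q (- n)/qpoch_inf ?q ?q*(- 1) powi (- n))"
   by (rule laurent_reflect[OF laurent_scale[OF jacobi_triple_product[OF norm_q q0]]]) simp
  moreover have "(%n. jtp_coeff ?q (- n)/qpoch_inf ?q ?q*(- 1) powi (- n)) = ta"
  proof
   fix n
   have "- n*(- n - 1) = n*(n + int sg)" by (simp add: s1 algebra_simps)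
   then have "h powi (- n*(- n - 1)) = h powi (n*(n + int sg))" by simp
   moreover have "(e*A)/Q*e = A/Q" if "e*e = 1" for e A Q :: complex
   proof -
    have "(e*A)/Q*e = (e*e)*A/Q" by (simp add: mult_ac)
    then show ?thesis using that by simp
   qed
   from this[OF m1[of "- n"], of "h powi (- n*(- n - 1))"]
   have "((- 1) powi (- n)*h powi (- n*(- n - 1)))/Q*(- 1) powi (- n) = h powi (- n*(- n - 1))/Q" for Q
    by blast
   ultimately show "jtp_coeff ?q (- n)/qpoch_inf ?q ?q*(- 1) powi (- n) = ta n"
    by (simp only: jtp_coeff_powi[OF q0] qp ta_def)
  qed
  ultimately have "laurent (%v. theta ((- 1)*(1/v)) ?q) ta" by simp
  then show ?thesis
  proof (rule laurent_cong)
   fix v :: complex assume v: "v ~= 0"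
   have "qpoch_inf (- 1/v) ?q = (1 + 1/v)*qpoch_inf (- ?q/v) ?q"
    using qpoch_inf_shift[OF norm_q, of "- 1/v"] by simp
   then show "theta ((- 1)*(1/v)) ?q = Th v"
    unfolding Th_def theta_def tor_c_def using v by (simp add: s1 power2_eq_square mult_ac)
  qed
 qed
qed

lemma ta_sym: "ta (- n - int sg) = ta n"
 by (simp add: ta_def algebra_simps)

text \<open>The coefficient of \<open>v powi (- m)\<close> in
  \<open>Th v * ((1/v)^(k - 1)*tor_E sg a v)\<close>.\<close>

definition et :: "nat => int => complex" where
 "et a m = ta (int k - 1 - m - int a) + ta (int k + int a - int sg - m)"

lemma et_sym: "et a (2*int k - 1 - m) = et a m"
proof -
 have "int k - 1 - (2*int k - 1 - m) - int a = - (int k + int a - int sg - m) - int sg"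
  "int k + int a - int sg - (2*int k - 1 - m) = - (int k - 1 - m - int a) - int sg" by simp_all
 then show ?thesis by (simp only: et_def ta_sym add.commute)
qed

lemma ct_Th_psi:
 "ct (%v. Th v * ((1/v)^(k - 1)*tor_E sg a v)*psi k s b v) = (\<Sum>\<^sub>\<infinity>m. psi_coeff k s b m*et a m)"
proof -
 have "laurent (%v. v powi (int a - (int k - 1))*Th v + v powi (int sg - int a - int k)*Th v)
   (%n. ta (n - (int a - (int k - 1))) + ta (n - (int sg - int a - int k)))"
  by (intro laurent_add laurent_shift laurent_Th)
 from laurent_mult[OF laurent_psi[OF k s] this]
 have "laurent (%v. Th v * ((1/v)^(k - 1)*tor_E sg a v)*psi k s b v)
   (%n. \<Sum>\<^sub>\<infinity>m. psi_coeff k s b m*(ta (n - m - (int a - (int k - 1))) + ta (n - m - (int sg - int a - int k))))"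
 proof (rule laurent_cong)
  fix v :: complex assume v: "v ~= 0"
  have 1: "(1/v)^(k - 1) = v powi (- (int k - 1))"
  proof -
   have "int k - 1 = int (k - 1)" using k by (simp add: of_nat_diff)
   then show ?thesis by (simp only: power_int_minus power_int_of_nat) (simp add: field_simps)
  qed
  have "v powi (int a - (int k - 1)) = v powi (- (int k - 1)) * v powi (int a)"
   by (subst power_int_add[symmetric]) (use v in "simp_all add: algebra_simps")
  moreover have "v powi (int sg - int a - int k) = v powi (- (int k - 1)) * v powi (int sg - int a - 1)"
   by (subst power_int_add[symmetric]) (use v in "simp_all add: algebra_simps")
  ultimately show "psi k s b v * (v powi (int a - (int k - 1))*Th v + v powi (int sg - int a - int k)*Th v) =
    Th v * ((1/v)^(k - 1)*tor_E sg a v)*psi k s b v"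
   unfolding 1 tor_E_def by (simp add: distrib_left distrib_right mult_ac)
 qed
 then have "ct (%v. Th v * ((1/v)^(k - 1)*tor_E sg a v)*psi k s b v) =
   (\<Sum>\<^sub>\<infinity>m. psi_coeff k s b m*(ta (0 - m - (int a - (int k - 1))) + ta (0 - m - (int sg - int a - int k))))"
  by (rule ct_laurent)
 moreover have "0 - m - (int a - (int k - 1)) = int k - 1 - m - int a" "0 - m - (int sg - int a - int k) = int k + int a - int sg - m" for m
  by simp_all
 ultimately show ?thesis by (simp only: et_def)
qed

end

section \<open>Constant terms as values of theta functions with a new base\<close>

definition psi_half :: "nat => complex => nat => int => complex" where
 "psi_half k s b n = (if 2*int k dvd n - int b then s powi mac_exp k b ((n - int b) div (2*int k)) else 0)"

lemma psi_coeff_half: "psi_coeff k s b n = psi_half k s b n + psi_half k s b (2*int k - 1 - n)"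
 by (simp add: psi_coeff_def psi_half_def algebra_simps)

lemma psi_half_has_sum:
 assumes "k \<ge> 1" "s ~= 0" "norm s < 1" "Y ~= 0"
 shows "((%m. psi_half k s b m*(Y powi m + Y powi (2*int k - 1 - m))) has_sum psi k s b Y) UNIV"
proof -
 let ?g = "%y. qpoch_inf (s^(4*k)) (s^(4*k))*theta (- (s^(2*b + 1))*y^(2*k)) (s^(4*k))"
 have L: "laurent (%y. y powi int b*?g y) (psi_half k s b)"
  unfolding psi_half_def[abs_def] by (rule laurent_shift[OF psi_part[OF assms(1-3)]])
 have 1: "((%m. psi_half k s b m*Y powi m) has_sum Y powi int b*?g Y) UNIV"
  by (rule laurentD[OF L assms(4)])
 have "((%m. psi_half k s b m*(1/Y) powi m) has_sum (1/Y) powi int b*?g (1/Y)) UNIV"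
  by (rule laurentD[OF L]) (use assms in simp)
 from has_sum_cmult_right[OF this, of "Y powi (2*int k - 1)"]
 have "((%m. psi_half k s b m*Y powi (2*int k - 1 - m)) has_sum Y powi (2*int k - 1 - int b)*?g (1/Y)) UNIV"
 proof (rule back_subst[of "%f. (f has_sum _) UNIV", THEN back_subst[of "%v. (_ has_sum v) UNIV"]])
  have e: "Y powi (2*int k - 1)*(1/Y) powi m = Y powi (2*int k - 1 - m)" for m
   using assms(4) by (simp add: power_int_diff power_int_divide_distrib)
  show "(%m. Y powi (2*int k - 1)*(psi_half k s b m*(1/Y) powi m)) = (%m. psi_half k s b m*Y powi (2*int k - 1 - m))"
   using e by (simp add: mult.left_commute)
  show "Y powi (2*int k - 1)*((1/Y) powi int b*?g (1/Y)) = Y powi (2*int k - 1 - int b)*?g (1/Y)"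
   using e[of "int b"] by (simp only: mult.assoc[symmetric])
 qed
 from has_sum_add[OF 1 this] show ?thesis
  by (simp add: psi_def algebra_simps)
qed

context lw_point
begin

abbreviation (input) Y :: "nat => complex" where
 "Y a \<equiv> h^(2*k - 1 - 2*a - sg)"

lemma Y_powi: "a < k ==> Y a = h powi (2*int k - 1 - 2*int a - int sg)"
proof -
 assume "a < k"
 then have "2*int k - 1 - 2*int a - int sg = int (2*k - 1 - 2*a - sg)" using sg by auto
 then show ?thesis by (simp only: power_int_of_nat)
qed

lemma ph: "s*h^(2*k) ~= 0" "norm (s*h^(2*k)) < 1"
proof -
 show "s*h^(2*k) ~= 0" using s h by simp
 have "norm (s*h^(2*k)) \<le> norm s*1"
  unfolding norm_mult norm_power using h by (intro mult_left_mono power_le_one) auto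
 then show "norm (s*h^(2*k)) < 1" using s by simp
qed

text \<open>Along \<open>m = b + 2*k*r\<close> the exponent of \<open>h\<close> in either term of
  \<open>et\<close> is \<open>2*k\<close> times the exponent \<open>mac_exp k b r\<close> of
  \<open>s\<close>, plus a multiple of \<open>m\<close> or of \<open>2*k - 1 - m\<close>, plus a
  constant that separates into \<open>a\<close> and \<open>b\<close>. Hence \<open>s\<close> becomes
  \<open>s*h^(2*k)\<close>, and the linear part is evaluation at \<open>Y a\<close>.\<close>

lemma psi_half_et:
 assumes a: "a < k"
 shows "psi_half k s b m*et (k - Suc a) m =
  h powi (int a*(int a + int sg))*h powi (int b*int b - (2*int k - 1)*int b)/qpoch_inf (h^2) (h^2) *
   (psi_half k (s*h^(2*k)) b m*(Y a powi m + Y a powi (2*int k - 1 - m)))"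
proof (cases "2*int k dvd m - int b")
 case False
 then show ?thesis by (simp add: psi_half_def)
next
 case True
 then obtain r where r: "m = int b + 2*int k*r" by (metis dvdE add.commute diff_add_cancel)
 have k0: "2*int k ~= 0" using k by simp
 have div: "(m - int b) div (2*int k) = r" using k0 by (simp add: r)
 let ?Q = "qpoch_inf (h^2) (h^2)"
 let ?e = "mac_exp k b r"
 let ?c = "int a*(int a + int sg) + (int b*int b - (2*int k - 1)*int b)"
 let ?d = "2*int k - 1 - 2*int a - int sg"
 have ia: "int (k - Suc a) = int k - 1 - int a" using a by (simp add: of_nat_diff)
 define j1 j2 where "j1 = int k - 1 - m - int (k - Suc a)" and "j2 = int k + int (k - Suc a) - int sg - m"
 have E1: "j1*(j1 + int sg) = ?c + 2*int k*?e + ?d*m"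
  unfolding j1_def ia r mac_exp_def by (simp add: algebra_simps)
 have E2: "j2*(j2 + int sg) = ?c + 2*int k*?e + ?d*(2*int k - 1 - m)"
  unfolding j2_def ia r mac_exp_def by (simp add: algebra_simps)
 have pe: "(s*h^(2*k)) powi ?e = s powi ?e*h powi (2*int k*?e)"
 proof -
  have "h^(2*k) = h powi (2*int k)" by (metis of_nat_mult of_nat_numeral power_int_of_nat)
  then show ?thesis by (simp only: power_int_mult_distrib power_int_mult)
 qed
 have Yp: "Y a powi x = h powi (?d*x)" for x unfolding Y_powi[OF a] by (simp only: power_int_mult)
 have "psi_half k s b m*et (k - Suc a) m = s powi ?e*(h powi (j1*(j1 + int sg)) + h powi (j2*(j2 + int sg)))/?Q"
  using True by (simp add: psi_half_def div et_def ta_def j1_def j2_def add_divide_distrib[symmetric])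
 also have "... = h powi (int a*(int a + int sg))*h powi (int b*int b - (2*int k - 1)*int b)/?Q *
   ((s powi ?e*h powi (2*int k*?e))*(h powi (?d*m) + h powi (?d*(2*int k - 1 - m))))"
  unfolding E1 E2 power_int_add[OF disjI1[OF h(1)]] by (simp add: field_simps)
 finally show ?thesis using True by (simp only: psi_half_def if_True div pe Yp)
qed

text \<open>The reflection \<open>m \<mapsto> 2*k - 1 - m\<close> exchanges the two halves of
  \<open>psi_coeff\<close> and preserves \<open>et\<close>, so the halves contribute equally; this
  gives the factor 2.\<close>

lemma ct_Th_psi_eval:
 assumes a: "a < k"
 shows "ct (%v. Th v * ((1/v)^(k - 1)*tor_E sg (k - Suc a) v)*psi k s b v) =
  (2/qpoch_inf (h^2) (h^2)*h powi (int a*(int a + int sg)))*h powi (int b*int b - (2*int k - 1)*int b) *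
   psi k (s*h^(2*k)) b (Y a)"
proof -
 let ?t = "%m. psi_half k s b m*et (k - Suc a) m"
 let ?kp = "h powi (int a*(int a + int sg))*h powi (int b*int b - (2*int k - 1)*int b)/qpoch_inf (h^2) (h^2)"
 have Y0: "Y a ~= 0" using h by simp
 have 1: "(?t has_sum ?kp*psi k (s*h^(2*k)) b (Y a)) UNIV"
  unfolding psi_half_et[OF a] by (intro has_sum_cmult_right psi_half_has_sum k ph Y0)
 have "bij_betw (%m. 2*int k - 1 - m) UNIV UNIV"
  by (rule bij_betw_byWitness[where f' = "%m. 2*int k - 1 - m"]) auto
 from has_sum_reindex_bij_betw[OF this, of ?t] 1
 have 2: "((%m. ?t (2*int k - 1 - m)) has_sum ?kp*psi k (s*h^(2*k)) b (Y a)) UNIV" by simp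
 have "psi_coeff k s b m*et (k - Suc a) m = ?t m + ?t (2*int k - 1 - m)" for m
  by (simp add: psi_coeff_half et_sym distrib_right)
 then have "((%m. psi_coeff k s b m*et (k - Suc a) m) has_sum
   ?kp*psi k (s*h^(2*k)) b (Y a) + ?kp*psi k (s*h^(2*k)) b (Y a)) UNIV"
  using has_sum_add[OF 1 2] by simp
 then show ?thesis unfolding ct_Th_psi by (simp add: infsumI mult_ac)
qed

lemma prod_pairs_snd:
 fixes f :: "nat => complex"
 shows "pair_prod (%_ j. f j) {..<n} = (\<Prod>j<n. f j^j)"
proof (induction n)
 case (Suc n)
 have "{(i, j). i < j \<and> j < Suc n} = {(i, j). i < j \<and> j < n} \<union> (%i. (i, n)) ` {..<n}" by auto
 then have "pair_prod (%_ j. f j) {..<Suc n} = pair_prod (%_ j. f j) {..<n}*(\<Prod>(i, j)\<in>(%i. (i, n)) ` {..<n}. f j)"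
  unfolding pair_prod_lessThan by (simp only:) (rule prod.union_disjoint, auto simp: finite_lessThan_pairs)
 also have "(\<Prod>(i, j)\<in>(%i. (i, n)) ` {..<n}. f j) = f n^n" by (subst prod.reindex) (auto simp: inj_on_def)
 finally show ?case using Suc.IH by simp
qed simp

text \<open>Up to scalars from rows and columns the limiting matrix consists again of values of
  \<open>psi\<close>, now with parameter \<open>s*h^(2*k)\<close>, so
  \<open>macdonald_identity\<close> applies a second time.\<close>

theorem bc_sum_LIMSEQ: "(%n. bc_sum (lw_z sg h) (s^2) s (2*k) {..<n}) \<longlonglongrightarrow> product_side k sg s h"
proof -
 let ?ph = "s*h^(2*k)" and ?q = "h^2"
 let ?p = "?ph\<^sup>2"
 define D where "D = leib k (%a b. ct (%v. Th v * ((1/v)^(k - 1)*tor_E sg (k - Suc a) v)*psi k s b v))"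
 have "(%n. leib k (%a b. M n (k - Suc a) b)) \<longlonglongrightarrow> D"
  unfolding D_def leib_def by (intro tendsto_sum tendsto_mult tendsto_const tendsto_prod M_LIMSEQ)
 then have "(%n. of_nat (sg + 1)*bc_sum (lw_z sg h) (s^2) s (2*k) {..<n}*2^k) \<longlonglongrightarrow> D"
  unfolding bc_sum_leib .
 then have "(%n. (of_nat (sg + 1)*bc_sum (lw_z sg h) (s^2) s (2*k) {..<n}*2^k)/(of_nat (sg + 1)*2^k)) \<longlonglongrightarrow>
   D/(of_nat (sg + 1)*2^k)"
  by (rule tendsto_divide) (auto simp del: of_nat_Suc)
 then have lim: "(%n. bc_sum (lw_z sg h) (s^2) s (2*k) {..<n}) \<longlonglongrightarrow> D/(of_nat (sg + 1)*2^k)"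
  by (rule Lim_transform_eventually) (auto simp del: of_nat_Suc of_nat_add)
 have Y0: "Y i ~= 0" for i using h by simp
 define al be where "al a = h powi (int a*(int a + int sg))" and "be b = h powi (int b*int b - (2*int k - 1)*int b)" for a b :: nat
 have "D = leib k (%a b. (2/qpoch_inf ?q ?q*al a)*be b*psi k ?ph b (Y a))"
  unfolding D_def al_def be_def by (rule leib_cong) (rule ct_Th_psi_eval)
 also have "... = (\<Prod>a<k. 2/qpoch_inf ?q ?q*al a)*(\<Prod>b<k. be b)*leib k (%a b. psi k ?ph b (Y a))"
  by (rule leib_scale)
 also have "leib k (%a b. psi k ?ph b (Y a)) = mac_theta k ?ph (%a. Y a)*(qpoch_inf ?ph ?ph*qpoch_inf ?p ?p^(k - 1))"
  by (rule macdonald_identity[OF k ph Y0])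
 also have "mac_theta k ?ph (%a. Y a) = (\<Prod>i<k. theta (- Y i) ?ph) *
   (pair_prod (%_ j. Y j) {..<k}*pair_prod (%i j. theta (Y i*Y j) ?p*theta (Y i/Y j) ?p) {..<k})"
  unfolding mac_theta_def mac_h_def pair_prod_mult[OF finite_lessThan, symmetric] by (simp only: mult.assoc)
 also have "pair_prod (%_ j. Y j) {..<k} = (\<Prod>j<k. Y j^j)" by (rule prod_pairs_snd)
 also have "(\<Prod>a<k. 2/qpoch_inf ?q ?q*al a)*(\<Prod>b<k. be b)*((\<Prod>i<k. theta (- Y i) ?ph) *
   ((\<Prod>j<k. Y j^j)*pair_prod (%i j. theta (Y i*Y j) ?p*theta (Y i/Y j) ?p) {..<k}) *
   (qpoch_inf ?ph ?ph*qpoch_inf ?p ?p^(k - 1))) =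
   (2/qpoch_inf ?q ?q)^k*(\<Prod>a<k. al a*be a*Y a^a)*((\<Prod>i<k. theta (- Y i) ?ph) *
   pair_prod (%i j. theta (Y i*Y j) ?p*theta (Y i/Y j) ?p) {..<k} *
   (qpoch_inf ?ph ?ph*qpoch_inf ?p ?p^(k - 1)))"
  by (simp only: prod.distrib prod_constant card_lessThan mult_ac)
 \<comment> \<open>The scalars from rows and columns cancel against the powers of \<open>Y j\<close>
   that stem from the prefactor of \<open>mac_h\<close>.\<close>
 also have "(\<Prod>a<k. al a*be a*Y a^a) = 1"
 proof (rule prod.neutral, rule ballI)
  fix a assume "a \<in> {..<k}"
  then have a: "a < k" by simp
  have "Y a^a = h powi ((2*int k - 1 - 2*int a - int sg)*int a)"
   unfolding Y_powi[OF a] by (simp only: power_int_mult power_int_of_nat)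
  then have "al a*be a*Y a^a = h powi (int a*(int a + int sg) + (int a*int a - (2*int k - 1)*int a) +
    (2*int k - 1 - 2*int a - int sg)*int a)"
   unfolding al_def be_def by (simp only: power_int_add[OF disjI1[OF h(1)]])
  also have "int a*(int a + int sg) + (int a*int a - (2*int k - 1)*int a) +
    (2*int k - 1 - 2*int a - int sg)*int a = 0" by (simp add: algebra_simps)
  finally show "al a*be a*Y a^a = 1" by simp
 qed
 \<comment> \<open>The substitution of \<open>k - i\<close> for \<open>i\<close> leads from labels
   starting at 0, with decreasing exponents, to the indices of the theorem.\<close>
 also have "(\<Prod>i<k. theta (- Y i) ?ph) = (\<Prod>i = 1..k. theta (- (h^(2*i - (sg + 1)))) ?ph)"
 proof (rule prod.reindex_bij_witness[of _ "%i. k - i" "%i. k - i"])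
  fix i assume i: "i \<in> {..<k}"
  then have "2*(k - i) - (sg + 1) = 2*k - 1 - 2*i - sg" by auto
  then show "theta (- (h^(2*(k - i) - (sg + 1)))) ?ph = theta (- Y i) ?ph" by simp
 qed auto
 also have "pair_prod (%i j. theta (Y i*Y j) ?p*theta (Y i/Y j) ?p) {..<k} =
   (\<Prod>(i, j)\<in>{(i, j). 1 \<le> i \<and> i < j \<and> j \<le> k}. theta (?q^(j - i)) ?p*theta (?q^(i + j - sg - 1)) ?p)"
  unfolding pair_prod_lessThan
 proof (rule prod.reindex_bij_witness[of _ "%(i, j). (k - j, k - i)" "%(i, j). (k - j, k - i)"])
  fix x assume "x \<in> {(i, j). i < j \<and> j < k}"
  then obtain i j where x: "x = (i, j)" and ij: "i < j" "j < k" by auto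
  have "2*k - 1 - 2*i - sg = 2*(k - i - (k - j)) + (2*k - 1 - 2*j - sg)" using ij sg by auto
  then have "Y i = ?q^(k - i - (k - j))*Y j" by (metis power_add power_mult)
  then have 1: "Y i/Y j = ?q^(k - i - (k - j))" using Y0 by simp
  have "2*(k - j + (k - i) - sg - 1) = (2*k - 1 - 2*i - sg) + (2*k - 1 - 2*j - sg)" using ij sg by auto
  then have 2: "Y i*Y j = ?q^(k - j + (k - i) - sg - 1)" by (metis power_add power_mult)
  show "(case (case x of (i, j) => (k - j, k - i)) of (i, j) => theta (?q^(j - i)) ?p*theta (?q^(i + j - sg - 1)) ?p) =
    (case x of (i, j) => theta (Y i*Y j) ?p*theta (Y i/Y j) ?p)"
   unfolding x prod.case 1 2 by (rule mult.commute)
 qed auto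
 finally have "D = (2/qpoch_inf ?q ?q)^k*1*((\<Prod>i = 1..k. theta (- (h^(2*i - (sg + 1)))) ?ph) *
   (\<Prod>(i, j)\<in>{(i, j). 1 \<le> i \<and> i < j \<and> j \<le> k}. theta (?q^(j - i)) ?p*theta (?q^(i + j - sg - 1)) ?p) *
   (qpoch_inf ?ph ?ph*qpoch_inf ?p ?p^(k - 1)))" .
 then have "D/(of_nat (sg + 1)*2^k) = product_side k sg s h"
  unfolding product_side_def Let_def by (simp add: power_divide mult_ac)
 with lim show ?thesis by simp
qed

end

section \<open>Dominated convergence over partitions\<close>

text \<open>Dominated convergence for the counting measure, carried over to unordered sums.\<close>

lemma tendsto_infsum_dominated:
 fixes F :: "nat => 'a => complex" and b :: "'a => real"
 assumes le: "!!n a. a \<in> A ==> norm (F n a) \<le> b a" and b: "b summable_on A"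
  and lim: "!!a. a \<in> A ==> (%n. F n a) \<longlonglongrightarrow> G a"
 shows "(%n. \<Sum>\<^sub>\<infinity>a\<in>A. F n a) \<longlonglongrightarrow> (\<Sum>\<^sub>\<infinity>a\<in>A. G a)"
  and "!!a. a \<in> A ==> norm (G a) \<le> b a"
proof -
 have b0: "0 \<le> b a" if "a \<in> A" for a using le[OF that, of 0] norm_ge_zero order.trans by blast
 show Gle: "norm (G a) \<le> b a" if "a \<in> A" for a
  by (rule LIMSEQ_le_const2[OF tendsto_norm[OF lim[OF that]]]) (use le that in auto)
 have nb: "(%a. norm (b a)) summable_on A"
  using b by (rule summable_on_cong[THEN iffD1, rotated]) (use b0 in auto)
 have ib: "integrable (count_space A) b"
  using nb unfolding abs_summable_equivalent Infinite_Set_Sum.abs_summable_on_def .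
 have sF: "infsetsum f A = infsum f A" if "!!a. a \<in> A ==> norm (f a) \<le> b a" for f :: "'a => complex"
 proof (rule infsetsum_infsum)
  have "(%a. norm (f a)) summable_on A"
   by (rule summable_on_comparison_test[OF b]) (use that in auto)
  then show "Infinite_Set_Sum.abs_summable_on f A" unfolding abs_summable_equivalent .
 qed
 have "(%n. infsetsum (F n) A) \<longlonglongrightarrow> infsetsum G A"
  unfolding infsetsum_def
  by (rule integral_dominated_convergence[OF _ _ ib]) (use le lim in "auto simp: AE_count_space")
 then show "(%n. \<Sum>\<^sub>\<infinity>a\<in>A. F n a) \<longlonglongrightarrow> (\<Sum>\<^sub>\<infinity>a\<in>A. G a)"
  using sF[of G] sF[of "F n" for n] Gle le by simp
qed

text \<open>Indexes the terms of the expanded sum in infinitely many variables: exponent functions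
  of finite support. Those supported on the first \<open>n\<close> variables form
  \<open>below_fun n M\<close>, extended by 0 so that they lie in the same set.\<close>

definition fin_fun :: "nat => (nat => nat) set" where
 "fin_fun M = {f. finite {i. f i ~= 0} \<and> (\<forall>i. f i \<le> M)}"

definition below_fun :: "nat => nat => (nat => nat) set" where
 "below_fun n M = {f. (\<forall>i\<ge>n. f i = 0) \<and> (\<forall>i. f i \<le> M)}"

text \<open>The number of variables from which on the term of \<open>f\<close> is present.\<close>

definition fsize :: "(nat => nat) => nat" where
 "fsize f = (LEAST N. \<forall>i\<ge>N. f i = 0)"

lemma below_funD: "f \<in> below_fun n M ==> 0 < f i ==> i < n"
 by (rule ccontr) (simp add: below_fun_def)

lemma below_fin_fun: "below_fun n M \<subseteq> fin_fun M"
proof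
 fix f assume f: "f \<in> below_fun n M"
 then have "{i. f i ~= 0} \<subseteq> {..<n}" by (auto dest: below_funD)
 then show "f \<in> fin_fun M" using f by (auto simp: fin_fun_def below_fun_def intro: finite_subset)
qed

lemma fsize_zero:
 assumes "f \<in> fin_fun M" "i \<ge> fsize f" shows "f i = 0"
proof -
 obtain N where "\<forall>i\<in>{i. f i ~= 0}. i < N"
  using assms(1) finite_nat_set_iff_bounded[of "{i. f i ~= 0}"] by (auto simp: fin_fun_def)
 then have "\<forall>i\<ge>N. f i = 0" by (meson mem_Collect_eq not_le)
 then have "\<forall>i\<ge>fsize f. f i = 0" unfolding fsize_def by (rule LeastI)
 then show ?thesis using assms(2) by blast
qed

lemma fsize_le: "f \<in> below_fun n M ==> fsize f \<le> n"
 unfolding fsize_def by (rule Least_le) (auto simp: below_fun_def)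

lemma below_fun_iff:
 assumes f: "f \<in> fin_fun M" shows "f \<in> below_fun n M \<longleftrightarrow> fsize f \<le> n"
proof
 show "fsize f \<le> n" if "f \<in> below_fun n M" using fsize_le[OF that] .
 show "f \<in> below_fun n M" if "fsize f \<le> n"
  using fsize_zero[OF f] f that by (auto simp: below_fun_def fin_fun_def)
qed

lemma sum_below_fun:
 fixes g :: "(nat => nat) => 'a :: comm_monoid_add"
 assumes "!!f f'. (!!i. i < n ==> f i = f' i) ==> g f = g f'"
 shows "(\<Sum>f\<in>PiE {..<n} (%_. {..M}). g f) = (\<Sum>f\<in>below_fun n M. g f)"
proof (rule sum.reindex_bij_witness[of _ "%f. restrict f {..<n}" "%f i. if i < n then f i else 0"])
 fix f assume f: "f \<in> PiE {..<n} (%_. {..M})"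
 show "restrict (%i. if i < n then f i else 0) {..<n} = f"
  using f by (auto simp: PiE_def extensional_def fun_eq_iff restrict_def)
 show "(%i. if i < n then f i else 0) \<in> below_fun n M"
  using f by (auto simp: below_fun_def PiE_def Pi_def)
 show "g (%i. if i < n then f i else 0) = g f" by (rule assms) simp
next
 fix f assume f: "f \<in> below_fun n M"
 show "(%i. if i < n then restrict f {..<n} i else 0) = f"
  using f by (auto simp: below_fun_def fun_eq_iff restrict_def)
 show "restrict f {..<n} \<in> PiE {..<n} (%_. {..M})"
  using f by (auto simp: below_fun_def)
qed

lemma finite_below_fun: "finite (below_fun n M)"
proof -
 have "below_fun n M \<subseteq> (%g i. if i < n then g i else 0) ` PiE {..<n} (%_. {..M})"
 proof
  fix f assume "f \<in> below_fun n M"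
  then show "f \<in> (%g i. if i < n then g i else 0) ` PiE {..<n} (%_. {..M})"
   by (intro image_eqI[of _ _ "restrict f {..<n}"]) (auto simp: below_fun_def fun_eq_iff)
 qed
 then show ?thesis by (rule finite_subset) (auto intro: finite_PiE)
qed

definition type_of :: "(nat => nat) => nat list" where
 "type_of f = rev (sorted_list_of_multiset (image_mset f (mset_set {i. f i ~= 0})))"

lemma mset_type_of: "mset (type_of f) = image_mset f (mset_set {i. f i ~= 0})"
 by (simp add: type_of_def)

lemma is_partition_type_of: "f \<in> fin_fun M ==> is_partition (type_of f)"
proof -
 assume f: "f \<in> fin_fun M"
 have "set (type_of f) = f ` {i. f i ~= 0}"
  using f unfolding set_mset_mset[symmetric] mset_type_of by (simp add: fin_fun_def)
 moreover have "sorted_wrt (\<ge>) (type_of f)" by (simp add: type_of_def sorted_wrt_rev)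
 ultimately show ?thesis by (auto simp: is_partition_def)
qed

lemma set_type_of: "f \<in> fin_fun M ==> set (type_of f) = f ` {i. f i ~= 0}"
 unfolding set_mset_mset[symmetric] mset_type_of by (simp add: fin_fun_def)

lemma count_type_of:
 assumes "f \<in> fin_fun M" "r \<ge> 1"
 shows "count_list (type_of f) r = card {i. f i = r}"
proof -
 have "count_list (type_of f) r = count (image_mset f (mset_set {i. f i ~= 0})) r"
  by (simp only: count_mset[symmetric] mset_type_of)
 also have "... = (\<Sum>i | i \<in># mset_set {i. f i ~= 0} \<and> r = f i. count (mset_set {i. f i ~= 0}) i)"
  by (rule count_image_mset')
 also have "... = (\<Sum>i\<in>{i \<in> {i. f i ~= 0}. f i = r}. 1)"
  by (rule sum.cong) (use assms(1) in "auto simp: fin_fun_def")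
 also have "... = card {i \<in> {i. f i ~= 0}. f i = r}" by simp
 also have "{i \<in> {i. f i ~= 0}. f i = r} = {i. f i = r}" using assms(2) by auto
 finally show ?thesis .
qed

lemma sum_list_type_of:
 assumes "f \<in> below_fun n M" shows "sum_list (type_of f) = (\<Sum>i<n. f i)"
proof -
 have "sum_list (type_of f) = sum_mset (mset (type_of f))" by (simp add: sum_mset_sum_list)
 also have "... = (\<Sum>i\<in>{i. f i ~= 0}. f i)"
  by (simp only: mset_type_of sum_unfold_sum_mset)
 also have "... = (\<Sum>i<n. f i)"
  by (rule sum.mono_neutral_left) (use below_funD[OF assms] in auto)
 finally show ?thesis .
qed

lemma length_type_of:
 assumes "f \<in> fin_fun M" shows "length (type_of f) = card {i. f i ~= 0}"
proof -
 have "length (type_of f) = size (mset (type_of f))" by simp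
 then show ?thesis by (simp only: mset_type_of size_image_mset size_mset_set)
qed

lemma partition_eqI:
 assumes "is_partition a" "is_partition b" "!!r. r \<ge> 1 ==> count_list a r = count_list b r"
 shows "a = b"
proof -
 have "count_list a r = count_list b r" for r
 proof (cases "r = 0")
  case True
  then show ?thesis using assms(1,2) by (simp add: is_partition_def count_list_0_iff)
 qed (use assms(3) in auto)
 then have "mset a = mset b" by (intro multiset_eqI) (simp add: count_mset)
 then have "mset (rev a) = mset (rev b)" by simp
 moreover have "sorted (rev a)" "sorted (rev b)" using assms by (auto simp: is_partition_def sorted_wrt_rev)
 ultimately have "sort (rev b) = rev a" "sort (rev b) = rev b" by (auto intro!: properties_for_sort)
 then have "rev a = rev b" by metis
 then show ?thesis by simp
qed

lemma hl_weight_below_cong: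
 "(!!i. i < n ==> f i = f' i) ==> hl_weight x t {..<n} f = hl_weight x t {..<n} f'"
 unfolding hl_weight_def by (intro prod.cong arg_cong2[where f = "(*)"]) auto

lemma hl_levels_below:
 "hl_levels x t c M {..<n} =
  (\<Sum>f\<in>below_fun n M. (\<Prod>r\<le>M. c r (card {i. i < n \<and> f i = r}))*hl_weight x t {..<n} f)"
proof -
 have "hl_levels x t c M {..<n} =
  (\<Sum>f\<in>PiE {..<n} (%_. {..M}). (\<Prod>r\<le>M. c r (card {i. i < n \<and> f i = r}))*hl_weight x t {..<n} f)"
  by (subst hl_levels_eq_sum) simp_all
 also have "... = (\<Sum>f\<in>below_fun n M. (\<Prod>r\<le>M. c r (card {i. i < n \<and> f i = r}))*hl_weight x t {..<n} f)"
 proof (rule sum_below_fun)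
  fix f f' :: "nat => nat" assume e: "!!i. i < n ==> f i = f' i"
  then have "{i. i < n \<and> f i = r} = {i. i < n \<and> f' i = r}" for r by auto
  then show "(\<Prod>r\<le>M. c r (card {i. i < n \<and> f i = r}))*hl_weight x t {..<n} f =
    (\<Prod>r\<le>M. c r (card {i. i < n \<and> f' i = r}))*hl_weight x t {..<n} f'"
   using hl_weight_below_cong[of n f f' x t] e by simp
 qed
 finally show ?thesis .
qed

lemma card_below: "f \<in> below_fun n M ==> r \<ge> 1 ==> card {i. i < n \<and> f i = r} = count_list (type_of f) r"
proof -
 assume f: "f \<in> below_fun n M" and r: "r \<ge> 1"
 then have "{i. i < n \<and> f i = r} = {i. f i = r}" using below_funD[OF f] by (intro Collect_cong) auto
 moreover have "count_list (type_of f) r = card {i. f i = r}"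
  using below_fin_fun f r by (intro count_type_of) auto
 ultimately show ?thesis by simp
qed

lemma card_below_zero:
 assumes "f \<in> below_fun n M" shows "card {i. i < n \<and> f i = 0} = n - length (type_of f)"
proof -
 have "{..<n} = {i. i < n \<and> f i = 0} \<union> {i. f i ~= 0}" using below_funD[OF assms] by auto
 moreover have "finite {i. f i ~= 0}" using assms below_fin_fun by (auto simp: fin_fun_def)
 ultimately have "card {..<n} = card {i. i < n \<and> f i = 0} + card {i. f i ~= 0}"
  by (metis (mono_tags, lifting) card_Un_disjoint disjoint_iff finite_Un finite_lessThan mem_Collect_eq)
 moreover have "length (type_of f) = card {i. f i ~= 0}"
  using assms below_fin_fun by (intro length_type_of) auto
 ultimately show ?thesis by simp
qed

definition type_wt :: "complex => nat => nat list => complex" where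
 "type_wt s M lam = (\<Prod>r = 1..M - 1. qpoch (- s) s (count_list lam r))"

lemma hl_levels_bounded_below:
 "hl_levels x t (bounded_wt s M) M {..<n} = (\<Sum>f\<in>below_fun n M. type_wt s M (type_of f)*hl_weight x t {..<n} f)"
 unfolding hl_levels_below
proof (rule sum.cong)
 fix f assume f: "f \<in> below_fun n M"
 have "(\<Prod>r\<le>M. bounded_wt s M r (card {i. i < n \<and> f i = r})) = (\<Prod>r\<in>{1..M - 1}. bounded_wt s M r (card {i. i < n \<and> f i = r}))"
  by (rule prod.mono_neutral_right) (auto simp: bounded_wt_def)
 also have "... = type_wt s M (type_of f)"
  unfolding type_wt_def by (rule prod.cong) (auto simp: bounded_wt_def card_below[OF f])
 finally show "(\<Prod>r\<le>M. bounded_wt s M r (card {i. i < n \<and> f i = r}))*hl_weight x t {..<n} f =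
   type_wt s M (type_of f)*hl_weight x t {..<n} f" by simp
qed simp

text \<open>The indicator weights of \<open>hl_sym_levels\<close> select the exponent functions
  whose nonzero values rearrange to \<open>lam\<close>; the number of zeros is then forced.\<close>

lemma hl_sym_below:
 assumes lam: "is_partition lam" "!!p. p \<in> set lam ==> p \<le> M" "length lam \<le> n"
  and x: "inj_on x {..<n}" "!!i. i < n ==> x i ~= 0" and t: "norm t < 1"
 shows "hl_sym n lam t x = (\<Sum>f\<in>{f \<in> below_fun n M. type_of f = lam}. hl_weight x t {..<n} f)"
proof -
 let ?m = "%r N. of_bool (N = (if r = 0 then n - length lam else count_list lam r)) :: complex"
 have "hl_sym n lam t x = (\<Sum>f\<in>below_fun n M. (\<Prod>r\<le>M. ?m r (card {i. i < n \<and> f i = r}))*hl_weight x t {..<n} f)"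
  using hl_sym_levels[OF assms] unfolding hl_levels_below .
 also have "... = (\<Sum>f\<in>below_fun n M. if type_of f = lam then hl_weight x t {..<n} f else 0)"
 proof (rule sum.cong)
  fix f assume f: "f \<in> below_fun n M"
  then have ff: "f \<in> fin_fun M" using below_fin_fun by auto
  show "(\<Prod>r\<le>M. ?m r (card {i. i < n \<and> f i = r}))*hl_weight x t {..<n} f =
    (if type_of f = lam then hl_weight x t {..<n} f else 0)"
  proof (cases "type_of f = lam")
   case True
   have "(\<Prod>r\<le>M. ?m r (card {i. i < n \<and> f i = r})) = 1"
    by (rule prod.neutral) (use card_below[OF f] card_below_zero[OF f] True in auto)
   then show ?thesis using True by simp
  next
   case False
   then obtain r where r: "r \<ge> 1" "count_list (type_of f) r ~= count_list lam r"
    using partition_eqI[OF is_partition_type_of[OF ff] lam(1)] by blast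
   have "r \<le> M"
   proof (rule ccontr)
    assume "\<not> r \<le> M"
    then have "r \<notin> set lam" "r \<notin> set (type_of f)" using lam(2) ff by (auto simp: set_type_of[OF ff] fin_fun_def)
    then show False using r(2) by (simp add: count_list_0_iff)
   qed
   then have "(\<Prod>r\<le>M. ?m r (card {i. i < n \<and> f i = r})) = 0"
    by (intro prod_zero) (use r card_below[OF f r(1)] in "auto intro!: bexI[of _ r]")
   then show ?thesis using False by simp
  qed
 qed simp
 also have "... = (\<Sum>f\<in>{f \<in> below_fun n M. type_of f = lam}. hl_weight x t {..<n} f)"
  by (rule sum.inter_filter[OF finite_below_fun, symmetric])
 finally show ?thesis .
qed

section \<open>A summable majorant at a geometric progression\<close>

locale geom_point =
 fixes z q :: complex
 assumes q: "q ~= 0" "norm q < 1" and z: "z ~= 0" "norm z \<le> 1"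
begin

definition xx :: "nat => complex" where "xx i = z*q^i"

lemma xx_nonzero: "xx i ~= 0" using q z by (simp add: xx_def)

lemma xx_inj: "inj_on xx S"
proof (rule inj_onI)
 fix i j assume "xx i = xx j"
 then have "q^i = q^j" using z by (simp add: xx_def)
 then have "norm q^i = norm q^j" by (metis norm_power)
 then show "i = j"
  using q power_strict_decreasing[of i j "norm q"] power_strict_decreasing[of j i "norm q"]
  by (cases i j rule: linorder_cases) auto
qed

lemma one_minus_pow: "d \<ge> 1 ==> 1 - q^d ~= 0"
proof
 assume d: "d \<ge> 1" and "1 - q^d = 0"
 then have "norm q^d = 1" by (metis eq_iff_diff_eq_0 norm_one norm_power)
 then show False using power_Suc_less_one[of "norm q" "d - 1"] q d by simp
qed

lemma ratio_right:
 assumes "i < j" shows "(xx i - t*xx j)/(xx i - xx j) = (1 - t*q^(j - i))/(1 - q^(j - i))"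
proof -
 have "xx j = xx i*q^(j - i)" using assms by (simp add: xx_def flip: power_add)
 then have "(xx i - t*xx j)/(xx i - xx j) = (xx i*(1 - t*q^(j - i)))/(xx i*(1 - q^(j - i)))"
  by (simp add: algebra_simps)
 then show ?thesis using xx_nonzero[of i] by simp
qed

lemma ratio_left:
 assumes "j < i" shows "(xx i - t*xx j)/(xx i - xx j) = (t - q^(i - j))/(1 - q^(i - j))"
proof -
 have "xx i = xx j*q^(i - j)" using assms by (simp add: xx_def flip: power_add)
 then have "(xx i - t*xx j)/(xx i - xx j) = (xx j*(q^(i - j) - t))/(xx j*(q^(i - j) - 1))"
  by (simp add: algebra_simps)
 also have "... = (q^(i - j) - t)/(q^(i - j) - 1)" using xx_nonzero[of j] by simp
 also have "... = (t - q^(i - j))/(1 - q^(i - j))"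
  using minus_divide_divide[of "t - q^(i - j)" "1 - q^(i - j)"] by simp
 finally show ?thesis .
qed

text \<open>Bounds the cross factor of two variables \<open>d\<close> places apart, uniformly in
  \<open>t\<close> with \<open>norm t \<le> 1\<close>.\<close>

definition B :: "nat => real" where "B d = (1 + norm q^d)/(1 - norm q^d)"

lemma B_ge_1: "d \<ge> 1 ==> B d \<ge> 1"
proof -
 assume d: "d \<ge> 1"
 have "norm q^d < 1" using power_Suc_less_one[of "norm q" "d - 1"] q d by simp
 then show ?thesis by (simp add: B_def)
qed

lemma norm_ratio:
 assumes "i ~= j" "norm t \<le> 1"
 shows "norm ((xx i - t*xx j)/(xx i - xx j)) \<le> B (if i < j then j - i else i - j)"
proof -
 have le: "1 - norm q^d \<le> norm (1 - q^d)" for d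
  using norm_triangle_ineq2[of 1 "q^d"] by (simp add: norm_power)
 have lt: "norm q^d < 1" if "d \<ge> 1" for d using power_Suc_less_one[of "norm q" "d - 1"] q that by simp
 have f: "norm u/norm (1 - q^d) \<le> B d" if "norm u \<le> 1 + norm q^d" "d \<ge> 1" for u :: complex and d
  unfolding B_def by (rule frac_le) (use that lt[OF that(2)] le[of d] in auto)
 show ?thesis
 proof (cases "i < j")
  case True
  have "norm (1 - t*q^(j - i)) \<le> 1 + norm t*norm q^(j - i)"
   using norm_triangle_ineq4[of 1 "t*q^(j - i)"] by (simp add: norm_mult norm_power)
  also have "... \<le> 1 + 1*norm q^(j - i)" using assms by (intro add_left_mono mult_right_mono) auto
  finally show ?thesis unfolding ratio_right[OF True] norm_divide using f[of "1 - t*q^(j - i)" "j - i"] True by simp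
 next
  case False
  then have ji: "j < i" using assms by simp
  have "norm (t - q^(i - j)) \<le> norm t + norm q^(i - j)"
   using norm_triangle_ineq4[of t "q^(i - j)"] by (simp add: norm_power)
  then have "norm (t - q^(i - j)) \<le> 1 + norm q^(i - j)" using assms by simp
  then show ?thesis unfolding ratio_left[OF ji] norm_divide using f[of "t - q^(i - j)" "i - j"] False ji by simp
 qed
qed

text \<open>With \<open>r = norm q\<close> the product is the quotient of
  \<open>qpoch (- r) r N\<close> by \<open>qpoch r r N\<close>, both of which are controlled
  uniformly in \<open>N\<close>.\<close>

lemma prod_B_bounded: obtains kp where "kp \<ge> 1" "!!N. (\<Prod>d\<in>{1..N}. B d) \<le> kp"
proof -
 let ?r = "complex_of_real (norm q)"
 have r: "norm ?r < 1" using q by simp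
 obtain dl where dl: "dl > 0" "!!n. norm (1/qpoch ?r ?r n) \<le> dl" using qpoch_self_bound[OF r] by blast
 define kp where "kp = exp (norm q/(1 - norm q))*dl"
 have "(\<Prod>d\<in>{1..N}. B d) \<le> kp" for N
 proof -
  have "(\<Prod>d\<in>{1..N}. B d) = (\<Prod>i<N. B (Suc i))"
   by (rule prod.reindex_bij_witness[of _ Suc "%d. d - 1"]) auto
  also have "... = norm (qpoch (- ?r) ?r N*(1/qpoch ?r ?r N))"
  proof -
   have "norm (1 + ?r*?r^i) = 1 + norm q^Suc i" for i
   proof -
    have "1 + ?r*?r^i = complex_of_real (1 + norm q^Suc i)" by simp
    then show ?thesis by (simp only: norm_of_real) simp
   qed
   moreover have "norm (1 - ?r*?r^i) = 1 - norm q^Suc i" for i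
   proof -
    have "1 - ?r*?r^i = complex_of_real (1 - norm q^Suc i)" by simp
    moreover have "norm q^Suc i \<le> 1" using q by (intro power_le_one) auto
    ultimately show ?thesis by (simp only: norm_of_real)
   qed
   ultimately show ?thesis
    by (simp add: qpoch_def norm_mult norm_divide prod_norm[symmetric] B_def prod_dividef)
  qed
  also have "... \<le> kp"
   unfolding norm_mult kp_def using norm_qpoch_le[OF r, of "- ?r" N] dl(2)[of N] by (intro mult_mono) auto
  finally show ?thesis .
 qed
 moreover have "kp \<ge> 1" using calculation[of 0] by simp
 ultimately show ?thesis using that by blast
qed

text \<open>Bounds all cross factors of one variable together, for any number of variables. The
  choice by \<open>SOME\<close> makes it a fixed constant of the locale.\<close>

definition kp :: real where
 "kp = (SOME K. K \<ge> 1 \<and> (\<forall>n i S. i < n \<longrightarrow> S \<subseteq> {..<n} - {i} \<longrightarrow> (\<Prod>j\<in>S. B (if i < j then j - i else i - j)) \<le> K))"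

lemma kp: "kp \<ge> 1" "!!n i S. i < n ==> S \<subseteq> {..<n} - {i} ==> (\<Prod>j\<in>S. B (if i < j then j - i else i - j)) \<le> kp"
proof -
 obtain K where K: "K \<ge> 1" "!!N. (\<Prod>d\<in>{1..N}. B d) \<le> K" using prod_B_bounded by blast
 have "(\<Prod>j\<in>S. B (if i < j then j - i else i - j)) \<le> K*K" if i: "i < n" and S: "S \<subseteq> {..<n} - {i}" for n i S
 proof -
  let ?b = "%j. B (if i < j then j - i else i - j)"
  have b1: "?b j \<ge> 1" if "j ~= i" for j using that by (auto intro: B_ge_1)
  have "(\<Prod>j\<in>S. ?b j) \<le> (\<Prod>j\<in>{..<n} - {i}. ?b j)"
  proof (rule prod_mono2[OF _ S])
   show "1 \<le> ?b j" if "j \<in> ({..<n} - {i}) - S" for j using b1[of j] that by simp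
   show "0 \<le> ?b j" if "j \<in> S" for j using b1[of j] that S by fastforce
  qed simp
  \<comment> \<open>On either side of \<open>i\<close> each distance occurs at most once, so each
    side contributes one product of consecutive \<open>B d\<close>.\<close>
  also have "{..<n} - {i} = {..<i} \<union> {i<..<n}" using i by auto
  also have "(\<Prod>j\<in>{..<i} \<union> {i<..<n}. ?b j) = (\<Prod>j<i. ?b j)*(\<Prod>j\<in>{i<..<n}. ?b j)"
   by (rule prod.union_disjoint) auto
  also have "(\<Prod>j<i. ?b j) = (\<Prod>d\<in>{1..i}. B d)"
   by (rule prod.reindex_bij_witness[of _ "%d. i - d" "%j. i - j"]) auto
  also have "(\<Prod>j\<in>{i<..<n}. ?b j) = (\<Prod>d\<in>{1..n - Suc i}. B d)"
   by (rule prod.reindex_bij_witness[of _ "%d. d + i" "%j. j - i"]) (use i in auto)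
  also have "(\<Prod>d\<in>{1..i}. B d)*(\<Prod>d\<in>{1..n - Suc i}. B d) \<le> K*K"
  proof (intro mult_mono K)
   show "0 \<le> (\<Prod>d\<in>{1..n - Suc i}. B d)" by (intro prod_nonneg ballI) (use B_ge_1 in "force intro: order.trans")
  qed (use K in auto)
  finally show ?thesis .
 qed
 moreover have "K*K \<ge> 1" using K(1) mult_mono[of 1 K 1 K] by simp
 ultimately have "\<exists>K. K \<ge> 1 \<and> (\<forall>n i S. i < n \<longrightarrow> S \<subseteq> {..<n} - {i} \<longrightarrow> (\<Prod>j\<in>S. B (if i < j then j - i else i - j)) \<le> K)"
  by blast
 from someI_ex[OF this] show "kp \<ge> 1"
  "!!n i S. i < n ==> S \<subseteq> {..<n} - {i} ==> (\<Prod>j\<in>S. B (if i < j then j - i else i - j)) \<le> kp"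
  unfolding kp_def[symmetric] by blast+
qed

definition cc :: "nat => nat => real" where "cc i r = (if r = 0 then 1 else kp*norm q^i)"

lemma cc_pos: "cc i r \<ge> 0" using kp(1) by (simp add: cc_def)

text \<open>The majorant of the terms. A variable with exponent 0 costs nothing; any other one
  contributes \<open>kp*norm q^i\<close> whatever its exponent, since
  \<open>norm (xx i) \<le> norm q^i \<le> 1\<close>.\<close>

definition bb :: "(nat => nat) => real" where "bb f = (\<Prod>i<fsize f. cc i (f i))"

lemma bb_below:
 assumes "f \<in> below_fun n M" shows "bb f = (\<Prod>i<n. cc i (f i))"
 unfolding bb_def
proof (rule prod.mono_neutral_left)
 show "{..<fsize f} \<subseteq> {..<n}" using fsize_le[OF assms] by auto
 show "\<forall>i\<in>{..<n} - {..<fsize f}. cc i (f i) = 1"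
 proof -
  have "f \<in> fin_fun M" using assms below_fin_fun by auto
  then show ?thesis using fsize_zero[of f M] by (auto simp: cc_def not_less)
 qed
qed simp

lemma norm_hl_weight:
 assumes "norm t \<le> 1" "f \<in> below_fun n M"
 shows "norm (hl_weight xx t {..<n} f) \<le> bb f"
 unfolding bb_below[OF assms(2)] hl_weight_def prod_norm[symmetric]
proof (rule prod_mono, intro conjI)
 fix i assume i: "i \<in> {..<n}"
 show "norm (xx i^f i*(\<Prod>j\<in>{j \<in> {..<n}. f j < f i}. (xx i - t*xx j)/(xx i - xx j))) \<le> cc i (f i)"
 proof (cases "f i = 0")
  case True
  then show ?thesis by (simp add: cc_def)
 next
  case False
  have "norm (\<Prod>j\<in>{j \<in> {..<n}. f j < f i}. (xx i - t*xx j)/(xx i - xx j)) \<le>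
    (\<Prod>j\<in>{j \<in> {..<n}. f j < f i}. B (if i < j then j - i else i - j))"
   unfolding prod_norm[symmetric] by (intro prod_mono conjI norm_ge_zero norm_ratio assms) auto
  also have "... \<le> kp" by (rule kp(2)[of i n]) (use i in auto)
  finally have 1: "norm (\<Prod>j\<in>{j \<in> {..<n}. f j < f i}. (xx i - t*xx j)/(xx i - xx j)) \<le> kp" .
  have "norm (xx i) \<le> norm q^i" "norm (xx i) \<le> 1"
  proof -
   show a: "norm (xx i) \<le> norm q^i" unfolding xx_def norm_mult norm_power using z by (intro mult_left_le_one_le) auto
   show "norm (xx i) \<le> 1" by (rule order.trans[OF a]) (use q in "auto intro: power_le_one")
  qed
  then have "norm (xx i)^f i \<le> norm q^i"
   using power_decreasing[of 1 "f i" "norm (xx i)"] False by simp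
  then have "norm (xx i^f i)*norm (\<Prod>j\<in>{j \<in> {..<n}. f j < f i}. (xx i - t*xx j)/(xx i - xx j)) \<le> norm q^i*kp"
   unfolding norm_power by (intro mult_mono 1) auto
  then show ?thesis using False by (simp add: norm_mult cc_def mult.commute)
 qed
qed simp

lemma bb_nonneg: "bb f \<ge> 0"
 unfolding bb_def by (intro prod_nonneg) (simp add: cc_pos)

text \<open>On \<open>below_fun n M\<close> the sum factors into a product of the
  \<open>1 + M*kp*norm q^i\<close>, which the geometric series bounds independently of
  \<open>n\<close>.\<close>

lemma bb_summable: "bb summable_on fin_fun M"
proof (rule nonneg_bdd_above_summable_on)
 let ?K = "exp (real M*kp/(1 - norm q))"
 show "bdd_above (sum bb ` {F. F \<subseteq> fin_fun M \<and> finite F})"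
 proof (rule bdd_aboveI)
  fix v assume "v \<in> sum bb ` {F. F \<subseteq> fin_fun M \<and> finite F}"
  then obtain F where F: "F \<subseteq> fin_fun M" "finite F" "v = sum bb F" by auto
  define n where "n = Max (insert 0 (fsize ` F))"
  have "fsize f \<le> n" if "f \<in> F" for f unfolding n_def using F(2) that by (intro Max_ge) auto
  then have Fn: "F \<subseteq> below_fun n M" using F(1) below_fun_iff by blast
  have "v \<le> sum bb (below_fun n M)"
   unfolding F(3) by (rule sum_mono2[OF finite_below_fun Fn]) (rule bb_nonneg)
  also have "... = (\<Sum>f\<in>below_fun n M. \<Prod>i<n. cc i (f i))" by (rule sum.cong) (auto simp: bb_below)
  also have "... = (\<Sum>f\<in>PiE {..<n} (%_. {..M}). \<Prod>i<n. cc i (f i))"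
   by (rule sum_below_fun[symmetric]) (auto intro!: prod.cong)
  also have "... = (\<Prod>i<n. \<Sum>r\<le>M. cc i r)" by (rule prod_sum_PiE[symmetric]) auto
  also have "... \<le> (\<Prod>i<n. exp (real M*kp*norm q^i))"
  proof (intro prod_mono conjI sum_nonneg cc_pos)
   fix i
   have "(\<Sum>r\<le>M. cc i r) = cc i 0 + (\<Sum>r\<in>{1..M}. cc i r)"
   proof -
    have "{..M} = insert 0 {1..M}" by auto
    then show ?thesis by simp
   qed
   also have "... = 1 + real M*kp*norm q^i" by (simp add: cc_def)
   also have "... \<le> exp (real M*kp*norm q^i)" by (rule exp_ge_add_one_self)
   finally show "(\<Sum>r\<le>M. cc i r) \<le> exp (real M*kp*norm q^i)" .
  qed
  also have "... = exp (\<Sum>i<n. real M*kp*norm q^i)" by (simp add: exp_sum)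
  also have "... \<le> ?K"
  proof -
   have "(\<Sum>i<n. norm q^i) \<le> (\<Sum>i. norm q^i)"
    using q by (intro sum_le_suminf summable_geometric) auto
   also have "... = 1/(1 - norm q)" using q by (intro suminf_geometric) auto
   finally have "real M*kp*(\<Sum>i<n. norm q^i) \<le> real M*kp*(1/(1 - norm q))"
    using kp(1) by (intro mult_left_mono) auto
   then show ?thesis by (simp add: sum_distrib_left)
  qed
  finally show "v \<le> ?K" .
 qed
qed (rule bb_nonneg)

definition Wn :: "complex => nat => (nat => nat) => complex" where
 "Wn t n f = (if fsize f \<le> n then hl_weight xx t {..<n} f else 0)"

text \<open>Variables beyond \<open>fsize f\<close> have exponent 0 and interact only with the
  indices of positive exponent. Each of these collects a quotient of infinite products.\<close>

definition Winf :: "complex => (nat => nat) => complex" where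
 "Winf t f = hl_weight xx t {..<fsize f} f *
   (\<Prod>i\<in>{i. i < fsize f \<and> f i ~= 0}. qpoch_inf (t*q^(fsize f - i)) q/qpoch_inf (q^(fsize f - i)) q)"

lemma Wn_bound: "norm t \<le> 1 ==> f \<in> fin_fun M ==> norm (Wn t n f) \<le> bb f"
 using norm_hl_weight[of t f n M] below_fun_iff[of f M n] bb_nonneg[of f] by (auto simp: Wn_def)

lemma hl_weight_tail:
 assumes f: "f \<in> fin_fun M"
 shows "hl_weight xx t {..<fsize f + m} f = hl_weight xx t {..<fsize f} f *
   (\<Prod>i\<in>{i. i < fsize f \<and> f i ~= 0}. qpoch (t*q^(fsize f - i)) q m/qpoch (q^(fsize f - i)) q m)"
proof (induction m)
 case 0
 show ?case by (simp add: qpoch_def)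
next
 case (Suc m)
 let ?N = "fsize f" and ?A = "{i. i < fsize f \<and> f i ~= 0}"
 let ?n = "?N + m"
 have fn: "f i = 0" if "i \<ge> ?N" for i using fsize_zero[OF f that] .
 have "hl_weight xx t {..<Suc ?n} f = (\<Prod>i<?n. xx i^f i*(\<Prod>j\<in>{j \<in> {..<Suc ?n}. f j < f i}. (xx i - t*xx j)/(xx i - xx j)))"
  by (simp add: hl_weight_def fn)
 also have "... = (\<Prod>i<?n. (xx i^f i*(\<Prod>j\<in>{j \<in> {..<?n}. f j < f i}. (xx i - t*xx j)/(xx i - xx j))) *
   (if f i ~= 0 then (xx i - t*xx ?n)/(xx i - xx ?n) else 1))"
 proof (rule prod.cong)
  fix i assume i: "i \<in> {..<?n}"
  have "{j \<in> {..<Suc ?n}. f j < f i} = (if f i ~= 0 then insert ?n {j \<in> {..<?n}. f j < f i} else {j \<in> {..<?n}. f j < f i})"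
   using fn[of ?n] by (auto simp: less_Suc_eq)
  then show "xx i^f i*(\<Prod>j\<in>{j \<in> {..<Suc ?n}. f j < f i}. (xx i - t*xx j)/(xx i - xx j)) =
    (xx i^f i*(\<Prod>j\<in>{j \<in> {..<?n}. f j < f i}. (xx i - t*xx j)/(xx i - xx j))) *
    (if f i ~= 0 then (xx i - t*xx ?n)/(xx i - xx ?n) else 1)"
   by (simp add: mult_ac)
 qed simp
 also have "... = hl_weight xx t {..<?n} f*(\<Prod>i<?n. if f i ~= 0 then (xx i - t*xx ?n)/(xx i - xx ?n) else 1)"
  unfolding hl_weight_def by (rule prod.distrib)
 also have "(\<Prod>i<?n. if f i ~= 0 then (xx i - t*xx ?n)/(xx i - xx ?n) else 1) =
   (\<Prod>i\<in>?A. (1 - t*q^(?n - i))/(1 - q^(?n - i)))"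
 proof (rule prod.mono_neutral_cong_right)
  show "\<forall>i\<in>{..<?n} - ?A. (if f i ~= 0 then (xx i - t*xx ?n)/(xx i - xx ?n) else 1) = 1"
   using fn by (auto simp: not_less)
  show "(if f i ~= 0 then (xx i - t*xx ?n)/(xx i - xx ?n) else 1) = (1 - t*q^(?n - i))/(1 - q^(?n - i))"
   if "i \<in> ?A" for i using that ratio_right[of i ?n t] by simp
 qed auto
 also have "hl_weight xx t {..<?n} f*(\<Prod>i\<in>?A. (1 - t*q^(?n - i))/(1 - q^(?n - i))) =
   hl_weight xx t {..<?N} f*(\<Prod>i\<in>?A. (qpoch (t*q^(?N - i)) q m/qpoch (q^(?N - i)) q m) *
    ((1 - t*q^(?n - i))/(1 - q^(?n - i))))"
  unfolding Suc.IH by (simp only: prod.distrib mult.assoc)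
 also have "(\<Prod>i\<in>?A. (qpoch (t*q^(?N - i)) q m/qpoch (q^(?N - i)) q m) *
    ((1 - t*q^(?n - i))/(1 - q^(?n - i)))) =
   (\<Prod>i\<in>?A. qpoch (t*q^(?N - i)) q (Suc m)/qpoch (q^(?N - i)) q (Suc m))"
 proof (rule prod.cong)
  fix i assume "i \<in> ?A"
  then have "q^(?n - i) = q^(?N - i)*q^m" by (simp flip: power_add)
  then show "(qpoch (t*q^(?N - i)) q m/qpoch (q^(?N - i)) q m)*((1 - t*q^(?n - i))/(1 - q^(?n - i))) =
    qpoch (t*q^(?N - i)) q (Suc m)/qpoch (q^(?N - i)) q (Suc m)"
   by (simp add: qpoch_def mult.assoc)
 qed simp
 finally show ?case by simp
qed

lemma qpoch_inf_pow_nonzero: "d \<ge> 1 ==> qpoch_inf (q^d) q ~= 0"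
 by (rule qpoch_inf_nonzero[OF q(2)]) (use one_minus_pow in "auto simp flip: power_add")

lemma Wn_LIMSEQ:
 assumes f: "f \<in> fin_fun M" shows "(%n. Wn t n f) \<longlonglongrightarrow> Winf t f"
proof (rule LIMSEQ_offset[of _ "fsize f"])
 have "(%m. hl_weight xx t {..<fsize f + m} f) \<longlonglongrightarrow> Winf t f"
  unfolding hl_weight_tail[OF f] Winf_def
  by (intro tendsto_intros qpoch_LIMSEQ q qpoch_inf_pow_nonzero) auto
 then show "(%m. Wn t (m + fsize f) f) \<longlonglongrightarrow> Winf t f" by (simp add: Wn_def add.commute)
qed

lemma Winf_bound: "norm t \<le> 1 ==> f \<in> fin_fun M ==> norm (Winf t f) \<le> bb f"
 by (rule LIMSEQ_le_const2[OF tendsto_norm[OF Wn_LIMSEQ]]) (use Wn_bound in auto)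

lemma Winf_tendsto:
 assumes "(u \<longlongrightarrow> t) F" shows "((%n. Winf (u n) f) \<longlongrightarrow> Winf t f) F"
 unfolding Winf_def hl_weight_def
 by (intro tendsto_intros tendsto_qpoch_inf q qpoch_inf_pow_nonzero assms) (auto simp: inj_on_eq_iff[OF xx_inj[of UNIV]])

lemma sum_Wn:
 assumes "A \<subseteq> fin_fun M"
 shows "(\<Sum>\<^sub>\<infinity>f\<in>A. g f*Wn t n f) = (\<Sum>f\<in>{f \<in> below_fun n M. f \<in> A}. g f*hl_weight xx t {..<n} f)"
proof -
 have "(\<Sum>\<^sub>\<infinity>f\<in>A. g f*Wn t n f) = (\<Sum>\<^sub>\<infinity>f\<in>{f \<in> below_fun n M. f \<in> A}. g f*hl_weight xx t {..<n} f)"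
 proof (rule infsum_cong_neutral)
  fix f assume "f \<in> A - {f \<in> below_fun n M. f \<in> A}"
  then show "g f*Wn t n f = 0" using assms below_fun_iff[of f M n] by (auto simp: Wn_def)
 next
  fix f assume "f \<in> A \<inter> {f \<in> below_fun n M. f \<in> A}"
  then show "g f*Wn t n f = g f*hl_weight xx t {..<n} f" using fsize_le[of f n M] by (auto simp: Wn_def)
 qed auto
 then show ?thesis using finite_below_fun[of n M] by simp
qed

end

lemma geom_point_one: "q ~= 0 ==> norm q < 1 ==> geom_point 1 q"
 by unfold_locales auto

lemma norm_type_wt:
 assumes "norm s \<le> r" "r < 1" shows "norm (type_wt s M lam) \<le> exp (r/(1 - r))^(M - 1)"
proof -
 have s: "norm s < 1" using assms by simp
 have "norm (type_wt s M lam) \<le> (\<Prod>r'\<in>{1..M - 1}. exp (r/(1 - r)))"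
  unfolding type_wt_def prod_norm[symmetric]
 proof (intro prod_mono conjI norm_ge_zero)
  fix i
  have "norm (qpoch (- s) s (count_list lam i)) \<le> exp (norm (- s)/(1 - norm s))" by (rule norm_qpoch_le[OF s])
  also have "... \<le> exp (r/(1 - r))" using assms order.trans[OF norm_ge_zero assms(1)] by (auto intro!: frac_le)
  finally show "norm (qpoch (- s) s (count_list lam i)) \<le> exp (r/(1 - r))" .
 qed
 then show ?thesis by simp
qed

lemma (in geom_point) bounded_sum_limits:
 assumes s: "norm s < 1"
 shows "(%n. hl_levels xx (s^2) (bounded_wt s M) M {..<n}) \<longlonglongrightarrow> (\<Sum>\<^sub>\<infinity>f\<in>fin_fun M. type_wt s M (type_of f)*Winf (s^2) f)"
  and "(%f. type_wt s M (type_of f)*Winf (s^2) f) summable_on fin_fun M"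
proof -
 have t: "norm (s^2) \<le> 1" using s by (simp add: norm_power power_le_one)
 let ?K = "exp (norm s/(1 - norm s))^(M - 1)"
 have b: "norm (type_wt s M (type_of f)*w) \<le> ?K*bb f" if "norm w \<le> bb f" for f w
  unfolding norm_mult using norm_type_wt[OF order.refl s] that by (intro mult_mono) auto
 have sb: "(%f. ?K*bb f) summable_on fin_fun M" by (rule summable_on_cmult_right[OF bb_summable])
 have "hl_levels xx (s^2) (bounded_wt s M) M {..<n} = (\<Sum>\<^sub>\<infinity>f\<in>fin_fun M. type_wt s M (type_of f)*Wn (s^2) n f)" for n
 proof -
  have "{f \<in> below_fun n M. f \<in> fin_fun M} = below_fun n M" using below_fin_fun by auto
  then show ?thesis unfolding hl_levels_bounded_below by (subst sum_Wn[OF order.refl]) simp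
 qed
 then show "(%n. hl_levels xx (s^2) (bounded_wt s M) M {..<n}) \<longlonglongrightarrow> (\<Sum>\<^sub>\<infinity>f\<in>fin_fun M. type_wt s M (type_of f)*Winf (s^2) f)"
  by (simp only:) (rule tendsto_infsum_dominated(1)[OF b[OF Wn_bound[OF t]] sb], assumption, intro tendsto_mult tendsto_const Wn_LIMSEQ)
 show "(%f. type_wt s M (type_of f)*Winf (s^2) f) summable_on fin_fun M"
 proof (rule abs_summable_summable)
  show "(%f. norm (type_wt s M (type_of f)*Winf (s^2) f)) summable_on fin_fun M"
   by (rule summable_on_comparison_test[OF sb]) (use b[OF Winf_bound[OF t]] in auto)
 qed
qed

definition type_fiber :: "nat => nat list => (nat => nat) set" where
 "type_fiber M lam = {f \<in> fin_fun M. type_of f = lam}"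

text \<open>For \<open>z = 1\<close> this establishes the limit that
  \<open>hall_littlewood_principal\<close> refers to.\<close>

lemma (in geom_point) hall_littlewood_LIMSEQ:
 assumes lam: "is_partition lam" "!!p. p \<in> set lam ==> p \<le> M" and t: "norm t < 1"
 shows "(%n. hall_littlewood n lam t xx) \<longlonglongrightarrow> (\<Sum>\<^sub>\<infinity>f\<in>type_fiber M lam. Winf t f)"
proof -
 have t1: "norm t \<le> 1" using t by simp
 have A: "type_fiber M lam \<subseteq> fin_fun M" by (auto simp: type_fiber_def)
 have "(%n. \<Sum>\<^sub>\<infinity>f\<in>type_fiber M lam. 1*Wn t n f) \<longlonglongrightarrow> (\<Sum>\<^sub>\<infinity>f\<in>type_fiber M lam. 1*Winf t f)"
  by (rule tendsto_infsum_dominated(1)[where b = bb])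
    (use Wn_bound[OF t1] Wn_LIMSEQ A summable_on_subset_banach[OF bb_summable A] in auto)
 moreover have "\<forall>\<^sub>F n in sequentially. (\<Sum>\<^sub>\<infinity>f\<in>type_fiber M lam. 1*Wn t n f) = hall_littlewood n lam t xx"
 proof (rule eventually_sequentiallyI[of "length lam"])
  fix n assume n: "length lam \<le> n"
  have "hall_littlewood n lam t xx = hl_sym n lam t xx" by (rule hall_littlewood_eval[OF n xx_inj])
  also have "... = (\<Sum>f\<in>{f \<in> below_fun n M. type_of f = lam}. hl_weight xx t {..<n} f)"
   by (rule hl_sym_below[OF lam n xx_inj xx_nonzero t])
  also have "{f \<in> below_fun n M. type_of f = lam} = {f \<in> below_fun n M. f \<in> type_fiber M lam}"
   using below_fin_fun by (auto simp: type_fiber_def)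
  finally show "(\<Sum>\<^sub>\<infinity>f\<in>type_fiber M lam. 1*Wn t n f) = hall_littlewood n lam t xx"
   unfolding sum_Wn[OF A] by simp
 qed
 ultimately show ?thesis by (simp add: Lim_transform_eventually)
qed

text \<open>The cross factors have degree 0, so the scale \<open>z\<close> enters only through the
  sum of the exponents. With \<open>z = h^(\<sigma> + 1)\<close> and \<open>q = h^2\<close> this is
  the power of \<open>q\<close> in the theorem.\<close>

lemma (in geom_point) Winf_homogeneous:
 assumes f: "f \<in> fin_fun M"
 shows "Winf t f = z^sum_list (type_of f)*geom_point.Winf 1 q t f"
proof -
 interpret G: geom_point 1 q by (rule geom_point_one[OF q])
 have x: "xx i = z*G.xx i" for i by (simp add: xx_def G.xx_def)
 have "hl_weight xx t {..<fsize f} f = z^(\<Sum>i<fsize f. f i)*hl_weight G.xx t {..<fsize f} f"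
 proof -
  have r: "(xx i - t*xx j)/(xx i - xx j) = (G.xx i - t*G.xx j)/(G.xx i - G.xx j)" for i j
  proof -
   have "(xx i - t*xx j)/(xx i - xx j) = (z*(G.xx i - t*G.xx j))/(z*(G.xx i - G.xx j))"
    unfolding x by (simp add: algebra_simps)
   then show ?thesis using z(1) by simp
  qed
  show ?thesis unfolding hl_weight_def r unfolding x by (simp add: prod.distrib power_mult_distrib power_sum mult.assoc)
 qed
 moreover have "sum_list (type_of f) = (\<Sum>i<fsize f. f i)"
  by (rule sum_list_type_of[of _ _ M]) (use f below_fun_iff in auto)
 ultimately show ?thesis unfolding Winf_def G.Winf_def by (simp add: mult.assoc)
qed

text \<open>The absolutely convergent sum over exponent functions is grouped by the partition to
  which their nonzero values rearrange.\<close>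

theorem (in geom_point) hall_littlewood_has_sum:
 assumes s: "norm s < 1"
 shows "((%lam. z^sum_list lam*type_wt s M lam*hall_littlewood_principal lam q (s^2)) has_sum
   (\<Sum>\<^sub>\<infinity>f\<in>fin_fun M. type_wt s M (type_of f)*Winf (s^2) f))
  {lam. is_partition lam \<and> part_at lam 0 \<le> M}"
proof -
 interpret G: geom_point 1 q by (rule geom_point_one[OF q])
 have t: "norm (s^2) < 1" using s by (simp add: norm_power power_less_one_iff)
 let ?\<Lambda> = "{lam. is_partition lam \<and> part_at lam 0 \<le> M}"
 have parts: "p \<le> M" if lam: "lam \<in> ?\<Lambda>" and p: "p \<in> set lam" for lam p
 proof -
  from p obtain i where i: "i < length lam" "lam ! i = p" by (auto simp: in_set_conv_nth)
  have "lam ! i \<le> lam ! 0"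
   using lam i(1) sorted_wrt_nth_less[of "(\<ge>)" lam 0 i] by (cases "i = 0") (auto simp: is_partition_def)
  moreover have "lam ! 0 \<le> M" using lam i by (auto simp: part_at_def split: if_splits)
  ultimately show ?thesis using i by simp
 qed
 have mem: "type_of f \<in> ?\<Lambda>" if f: "f \<in> fin_fun M" for f
 proof -
  have "part_at (type_of f) 0 \<le> M"
  proof (cases "type_of f")
   case (Cons a l)
   then have "a \<in> set (type_of f)" by simp
   then obtain i where "a = f i" unfolding set_type_of[OF f] by auto
   then show ?thesis using Cons f by (simp add: part_at_def fin_fun_def)
  qed (simp add: part_at_def)
  then show ?thesis using is_partition_type_of[OF f] by simp
 qed
 have xx1: "G.xx = (%i. q^i)" by (rule ext) (simp add: G.xx_def)
 have fib: "((%f. type_wt s M (type_of f)*Winf (s^2) f) has_sum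
   z^sum_list lam*type_wt s M lam*hall_littlewood_principal lam q (s^2)) (type_fiber M lam)"
  if lam: "lam \<in> ?\<Lambda>" for lam
 proof -
  have A: "type_fiber M lam \<subseteq> fin_fun M" by (auto simp: type_fiber_def)
  have "hall_littlewood_principal lam q (s^2) = (\<Sum>\<^sub>\<infinity>f\<in>type_fiber M lam. G.Winf (s^2) f)"
   unfolding hall_littlewood_principal_def
   using G.hall_littlewood_LIMSEQ[of lam M "s^2"] lam parts[OF lam] t unfolding xx1 by (auto intro: limI)
  moreover have "G.Winf (s^2) summable_on type_fiber M lam"
  proof (rule abs_summable_summable)
   show "(%f. norm (G.Winf (s^2) f)) summable_on type_fiber M lam"
    by (rule summable_on_comparison_test[OF summable_on_subset_banach[OF G.bb_summable A]])
      (use G.Winf_bound[of "s^2"] t A in auto)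
  qed
  ultimately have "(G.Winf (s^2) has_sum hall_littlewood_principal lam q (s^2)) (type_fiber M lam)" by simp
  from has_sum_cmult_right[OF this, of "z^sum_list lam*type_wt s M lam"]
  show ?thesis
   by (rule has_sum_cong[THEN iffD1, rotated]) (auto simp: type_fiber_def Winf_homogeneous mult_ac)
 qed
 have "((%f. type_wt s M (type_of f)*Winf (s^2) f) has_sum
   (\<Sum>\<^sub>\<infinity>f\<in>fin_fun M. type_wt s M (type_of f)*Winf (s^2) f)) (fin_fun M)"
  using bounded_sum_limits(2)[OF s] by (rule has_sum_infsum)
 also have "?this \<longleftrightarrow> ((%(lam, f). type_wt s M (type_of f)*Winf (s^2) f) has_sum
   (\<Sum>\<^sub>\<infinity>f\<in>fin_fun M. type_wt s M (type_of f)*Winf (s^2) f)) (Sigma ?\<Lambda> (type_fiber M))"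
  by (rule has_sum_reindex_bij_witness[of _ snd "%f. (type_of f, f)"]) (use mem in "auto simp: type_fiber_def")
 finally show ?thesis
  by (rule has_sum_SigmaD) (use fib in simp)
qed

section \<open>Removal of the exceptional parameters\<close>

lemma (in geom_point) bounded_sum_tendsto:
 assumes u: "u \<longlonglongrightarrow> s" and s: "norm s < 1"
 shows "(%n. \<Sum>\<^sub>\<infinity>f\<in>fin_fun M. type_wt (u n) M (type_of f)*Winf ((u n)\<^sup>2) f)
  \<longlonglongrightarrow> (\<Sum>\<^sub>\<infinity>f\<in>fin_fun M. type_wt s M (type_of f)*Winf (s^2) f)"
proof -
 define r where "r = (norm s + 1)/2"
 have r: "norm s < r" "r < 1" using s by (auto simp: r_def)
 have "\<forall>\<^sub>F n in sequentially. norm (u n) < r"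
  by (rule order_tendstoD(2)[OF tendsto_norm[OF u] r(1)])
 then obtain N where N: "!!n. n \<ge> N ==> norm (u n) < r" by (auto simp: eventually_sequentially)
 let ?K = "exp (r/(1 - r))^(M - 1)"
 have "(%n. \<Sum>\<^sub>\<infinity>f\<in>fin_fun M. type_wt (u (n + N)) M (type_of f)*Winf ((u (n + N))\<^sup>2) f)
  \<longlonglongrightarrow> (\<Sum>\<^sub>\<infinity>f\<in>fin_fun M. type_wt s M (type_of f)*Winf (s^2) f)"
 proof (rule tendsto_infsum_dominated(1)[where b = "%f. ?K*bb f"])
  show "(%f. ?K*bb f) summable_on fin_fun M" by (rule summable_on_cmult_right[OF bb_summable])
  fix f assume f: "f \<in> fin_fun M"
  show "norm (type_wt (u (n + N)) M (type_of f)*Winf ((u (n + N))\<^sup>2) f) \<le> ?K*bb f" for n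
  proof -
   have un: "norm (u (n + N)) \<le> r" using N[of "n + N"] by simp
   then have "norm ((u (n + N))\<^sup>2) \<le> 1" using r by (simp add: norm_power power_le_one)
   then show ?thesis unfolding norm_mult
    using norm_type_wt[OF un r(2)] Winf_bound[OF _ f] by (intro mult_mono) auto
  qed
  have u': "(%n. u (n + N)) \<longlonglongrightarrow> s" by (rule LIMSEQ_ignore_initial_segment[OF u])
  show "(%n. type_wt (u (n + N)) M (type_of f)*Winf ((u (n + N))\<^sup>2) f) \<longlonglongrightarrow> type_wt s M (type_of f)*Winf (s^2) f"
   unfolding type_wt_def qpoch_def by (intro tendsto_mult Winf_tendsto tendsto_prod tendsto_diff tendsto_const tendsto_power tendsto_minus u')
 qed
 then show ?thesis by (rule LIMSEQ_offset)
qed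

lemma product_side_tendsto:
 assumes u: "u \<longlonglongrightarrow> s" and s: "norm s < 1" and h: "h ~= 0" "norm h < 1"
 shows "(%n. product_side k \<sigma> (u n) h) \<longlonglongrightarrow> product_side k \<sigma> s h"
proof -
 have n: "norm (s*h^(2*k)) < 1"
 proof -
  have "norm (s*h^(2*k)) \<le> norm s*1"
   unfolding norm_mult norm_power using h by (intro mult_left_mono power_le_one) auto
  then show ?thesis using s by simp
 qed
 then have n2: "norm ((s*h^(2*k))\<^sup>2) < 1" unfolding norm_power by (simp add: power_less_one_iff)
 have q: "norm (h^2) < 1" using h by (simp add: norm_power power_less_one_iff)
 have nz: "of_nat (\<sigma> + 1)*qpoch_inf (h^2) (h^2)^k ~= 0"
  using qpoch_inf_self_nonzero[OF q] by (simp del: of_nat_add of_nat_Suc)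
 show ?thesis
  unfolding product_side_def Let_def case_prod_unfold
  by (intro tendsto_mult tendsto_prod tendsto_divide tendsto_power tendsto_qpoch_inf tendsto_theta u n n2 tendsto_const nz)
    (use h q in auto)
qed

text \<open>For \<open>s\<close> different from 0 and from all variables both sides are limits of
  the same finite sums. Only countably many \<open>s\<close> are excluded, so every \<open>s\<close>
  is a limit of admissible ones, and both sides are continuous in \<open>s\<close>.\<close>

lemma bounded_sum_eq_product:
 assumes k: "k \<ge> 1" and \<sigma>: "\<sigma> \<in> {0, 1}" and s: "norm s < 1" and h: "h ~= 0" "norm h < 1"
 shows "(\<Sum>\<^sub>\<infinity>f\<in>fin_fun (2*k). type_wt s (2*k) (type_of f)*geom_point.Winf (h^(\<sigma> + 1)) (h^2) (s^2) f) =
  product_side k \<sigma> s h"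
proof -
 have q: "h^2 ~= 0" "norm (h^2) < 1" using h by (auto simp: norm_power power_less_one_iff)
 have z: "h^(\<sigma> + 1) ~= 0" "norm (h^(\<sigma> + 1)) \<le> 1"
 proof -
  show "h^(\<sigma> + 1) ~= 0" using h by simp
  show "norm (h^(\<sigma> + 1)) \<le> 1" unfolding norm_power using h by (intro power_le_one) auto
 qed
 interpret G: geom_point "h^(\<sigma> + 1)" "h^2" by unfold_locales (use q z in auto)
 have xx: "G.xx = lw_z \<sigma> h" by (rule ext) (simp only: G.xx_def lw_z_def)
 define T where "T s = (\<Sum>\<^sub>\<infinity>f\<in>fin_fun (2*k). type_wt s (2*k) (type_of f)*G.Winf (s^2) f)" for s
 have generic: "T s = product_side k \<sigma> s h" if s: "s ~= 0" "norm s < 1" "!!i. lw_z \<sigma> h i ~= s" for s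
 proof -
  interpret L: lw_point k \<sigma> s h by unfold_locales (use k \<sigma> s h in auto)
  obtain m where m: "2*k = Suc m" using k by (cases k) auto
  have "hl_levels G.xx (s^2) (bounded_wt s (2*k)) (2*k) {..<n} = bc_sum (lw_z \<sigma> h) (s^2) s (2*k) {..<n}" for n
   unfolding xx m
  proof (rule bounded_littlewood)
   show "norm (lw_z \<sigma> h i) < 1" for i using L.norm_lw_z[of i] h by simp
   show "lw_z \<sigma> h i ~= 0" for i using h by (simp add: lw_z_power)
  qed (use L.inj_lw_z s in auto)
  then show ?thesis unfolding T_def
   using LIMSEQ_unique[OF G.bounded_sum_limits(1)[OF s(2), of "2*k"]] L.bc_sum_LIMSEQ by simp
 qed
 \<comment> \<open>The bound \<open>1 - norm s\<close> keeps the approximating sequence inside the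
   open unit disc.\<close>
 have "\<exists>u. \<forall>n. norm (u n - s) < min (inverse (real (Suc n))) (1 - norm s) \<and> u n \<notin> insert 0 (range (lw_z \<sigma> h))"
 proof (rule choice, rule allI)
  fix n
  let ?r = "min (inverse (real (Suc n))) (1 - norm s)"
  have "uncountable (ball s ?r)" using s by (intro uncountable_ball) auto
  moreover have "countable (insert 0 (range (lw_z \<sigma> h)))" by auto
  ultimately have "uncountable (ball s ?r - insert 0 (range (lw_z \<sigma> h)))" by (rule uncountable_minus_countable)
  then have "ball s ?r - insert 0 (range (lw_z \<sigma> h)) ~= {}" by (metis countable_empty)
  then obtain v where "v \<in> ball s ?r - insert 0 (range (lw_z \<sigma> h))" by blast
  then show "\<exists>v. norm (v - s) < ?r \<and> v \<notin> insert 0 (range (lw_z \<sigma> h))"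
   by (intro exI[of _ v]) (auto simp: dist_norm norm_minus_commute)
 qed
 then obtain u where u: "!!n. norm (u n - s) < min (inverse (real (Suc n))) (1 - norm s)"
  "!!n. u n \<notin> insert 0 (range (lw_z \<sigma> h))" by blast
 have u_lim: "u \<longlonglongrightarrow> s"
 proof (rule LIM_zero_cancel, rule Lim_null_comparison)
  show "\<forall>\<^sub>F n in sequentially. norm (u n - s) \<le> inverse (real (Suc n))"
   using u(1) by (intro always_eventually allI) (metis less_imp_le min.strict_boundedE)
  show "(%n. inverse (real (Suc n))) \<longlonglongrightarrow> 0" by (rule LIMSEQ_inverse_real_of_nat)
 qed
 have un: "norm (u n) < 1" for n
 proof -
  have "norm (u n - s) < 1 - norm s" using u(1)[of n] by simp
  then show ?thesis using norm_triangle_sub[of "u n" s] by linarith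
 qed
 have "T (u n) = product_side k \<sigma> (u n) h" for n
 proof (rule generic)
  show "lw_z \<sigma> h i ~= u n" for i using u(2)[of n] by (metis insertCI rangeI)
 qed (use u(2)[of n] un in auto)
 moreover have "(%n. T (u n)) \<longlonglongrightarrow> T s" unfolding T_def by (rule G.bounded_sum_tendsto[OF u_lim s])
 ultimately have "T s = product_side k \<sigma> s h"
  using LIMSEQ_unique product_side_tendsto[OF u_lim s h, of k \<sigma>] by auto
 then show ?thesis by (simp add: T_def)
qed

lemma qpoch_inf_base_zero: "qpoch_inf a 0 = 1 - a"
proof -
 have "qpoch_inf 0 0 = 1" by (rule qpoch_inf_eqI) (simp_all add: qpoch_def)
 then show ?thesis using qpoch_inf_shift[of 0 a] by simp
qed

lemma theta_base_zero: "theta a 0 = 1 - a"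
 by (simp add: theta_def qpoch_inf_base_zero)

theorem theorem1p7:
  fixes k \<sigma> :: nat and q t p qh th ph :: complex
  assumes "k \<ge> 1" and "\<sigma> \<in> {0, 1}"
    and "norm q < 1" and "norm t < 1"
    and "qh ^ 2 = q" and "th ^ 2 = t"
    and "p = t * q ^ (2 * k)" and "ph = th * q ^ k"
  shows "((\<lambda>lam. qh ^ ((\<sigma> + 1) * sum_list lam) *
             (\<Prod>i = 1..2 * k - 1. qpoch (- th) th (count_list lam i)) *
             hall_littlewood_principal lam q t)
          has_sum
            (qpoch_inf ph ph * qpoch_inf p p ^ (k - 1) / (of_nat (\<sigma> + 1) * qpoch_inf q q ^ k) *
             (\<Prod>i = 1..k. theta (- (qh ^ (2 * i - (\<sigma> + 1)))) ph) *
             (\<Prod>(i, j)\<in>{(i, j). 1 \<le> i \<and> i < j \<and> j \<le> k}.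
                theta (q ^ (j - i)) p * theta (q ^ (i + j - \<sigma> - 1)) p)))
         {lam. is_partition lam \<and> part_at lam 0 \<le> 2 * k}"
proof (cases "q = 0")
 case False
 have qh: "qh ~= 0" "norm qh < 1" and th: "norm th < 1"
 proof -
  show "qh ~= 0" using False assms(5) by auto
  have "norm qh^2 < 1" "norm th^2 < 1" using assms(3-6) by (auto simp flip: norm_power)
  then show "norm qh < 1" "norm th < 1" by (simp_all add: power_less_one_iff)
 qed
 interpret G: geom_point "qh^(\<sigma> + 1)" q
  using False assms(3) qh by unfold_locales (auto simp del: power_Suc simp: norm_power intro!: power_le_one)
 have "q^(2*k) = (q^k)\<^sup>2" by (metis mult.commute power_mult)
 then have p: "p = ph^2" by (simp add: assms(7,8) power_mult_distrib assms(6))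
 have "((%lam. (qh^(\<sigma> + 1))^sum_list lam*type_wt th (2*k) lam*hall_littlewood_principal lam q (th^2)) has_sum
   product_side k \<sigma> th qh) {lam. is_partition lam \<and> part_at lam 0 \<le> 2*k}"
  using G.hall_littlewood_has_sum[OF th, of "2*k"] bounded_sum_eq_product[OF assms(1,2) th qh]
  unfolding assms(5) by simp
 then show ?thesis
  unfolding product_side_def Let_def type_wt_def power_mult assms(5,6) assms(8)[symmetric] p[symmetric] .
next
 case True
 have qh: "qh = 0" using True assms(5) by simp
 have ph: "ph = 0" and p: "p = 0" using True assms(1,7,8) by auto
 let ?f = "%lam. qh^((\<sigma> + 1) * sum_list lam)*(\<Prod>i = 1..2*k - 1. qpoch (- th) th (count_list lam i)) *
       hall_littlewood_principal lam q t"
 \<comment> \<open>A nonempty partition has positive weight and hence carries a positive power of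
   \<open>qh = 0\<close>.\<close>
 have zero: "?f lam = 0" if "is_partition lam" "lam ~= []" for lam
 proof -
  have "hd lam \<in> set lam" using that by simp
  moreover from this have "hd lam ~= 0" using that unfolding is_partition_def by metis
  ultimately have "0 < sum_list lam" using member_le_sum_list[of "hd lam" lam] by linarith
  then have "0 < (\<sigma> + 1) * sum_list lam" by (intro mult_pos_pos) auto
  then have "qh^((\<sigma> + 1) * sum_list lam) = 0" unfolding qh by (rule zero_power)
  then show ?thesis by (simp only: mult_zero_left)
 qed
 have "hall_littlewood_principal [] q t = 1"
  unfolding hall_littlewood_principal_def by (simp add: hall_littlewood_empty[OF assms(4)])
 then have one: "?f [] = 1" by (simp add: qpoch_def)
 have "(?f has_sum 1) {[]}" using has_sum_finite[of "{[]}" ?f] unfolding one[symmetric] by simp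
 then have main: "(?f has_sum 1) {lam. is_partition lam \<and> part_at lam 0 \<le> 2*k}"
  by (rule has_sum_cong_neutral[THEN iffD1, rotated -1])
    (use zero in "auto simp: is_partition_def part_at_def")
 \<comment> \<open>Since \<open>0^0 = 1\<close>, the factor \<open>i = 1\<close> is
   \<open>theta (- 1) 0 = 2\<close> for \<open>\<sigma> = 1\<close>. For
   \<open>\<sigma> = 0\<close>, and for all larger \<open>i\<close>, the exponent is positive and
   the factor is 1. The product cancels the denominator \<open>\<sigma> + 1\<close>.\<close>
 have "(\<Prod>i = 1..k. theta (- (qh^(2*i - (\<sigma> + 1)))) ph) = of_nat (\<sigma> + 1)"
 proof -
  have "(\<Prod>i = 1..k. theta (- (qh^(2*i - (\<sigma> + 1)))) ph) = (\<Prod>i = 1..k. if i = 1 then of_nat (\<sigma> + 1) else 1)"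
  proof (rule prod.cong)
   fix i assume "i \<in> {1..k}"
   then have i: "i \<ge> 1" by simp
   show "theta (- (qh^(2*i - (\<sigma> + 1)))) ph = (if i = 1 then of_nat (\<sigma> + 1) else 1)"
    unfolding ph theta_base_zero qh using assms(2) i by (auto simp: power_0_left)
  qed simp
  then show ?thesis using assms(1) by simp
 qed
 moreover have "(\<Prod>(i, j)\<in>{(i, j). 1 \<le> i \<and> i < j \<and> j \<le> k}. theta (q^(j - i)) p*theta (q^(i + j - \<sigma> - 1)) p) = 1"
  by (rule prod.neutral) (use assms(2) in "auto simp: p True theta_base_zero power_0_left")
 ultimately have e: "qpoch_inf ph ph*qpoch_inf p p^(k - 1)/(of_nat (\<sigma> + 1)*qpoch_inf q q^k) *
       (\<Prod>i = 1..k. theta (- (qh^(2*i - (\<sigma> + 1)))) ph) *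
       (\<Prod>(i, j)\<in>{(i, j). 1 \<le> i \<and> i < j \<and> j \<le> k}.
        theta (q^(j - i)) p*theta (q^(i + j - \<sigma> - 1)) p) = 1"
  by (simp add: ph p True qpoch_inf_base_zero del: of_nat_add of_nat_Suc)
 show ?thesis unfolding e by (rule main)
qed


end
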